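(* Let $\mathsf d\ge 0$ and $k_0\ge 5+\mathsf d$ be integers. Then $$\big(\mathrm{E}^{\mathrm{pure}[1]}_{\ge k_0}(\mathrm{sym}^{\mathsf d}(X),\mathbb{1})+\mathrm{M}_{\bullet,\mathsf d}\,:\,\Delta^\infty\big)=\mathrm{M}^{[1]}_\bullet(\mathrm{sym}^{\mathsf d}(X),\mathbb{1})$$ and $$\big(\mathrm{E}^{\mathrm{pure}[1]}_{\ge k_0}(\mathbb{1},\mathrm{sym}^{\mathsf d}(X))+\mathrm{M}_{\bullet}\,:\,\Delta^\infty\big)=\mathrm{M}^{[1]}_\bullet(\mathbb{1},\mathrm{sym}^{\mathsf d}(X)),$$ where the saturations are taken inside the $\mathrm{M}_\bullet$-modules $\mathrm{M}^{[1]}_\bullet(\mathrm{sym}^{\mathsf d}(X),\mathbb{1})$ and $\mathrm{M}^{[1]}_\bullet(\mathbb{1},\mathrm{sym}^{\mathsf d}(X))$, respectively.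
   Context: Notation: $\mathbb{H}$ is the upper half plane, $T=\begin{pmatrix}1&1\\0&1\end{pmatrix}$, $\Gamma_\infty=\{\pm T^n:n\in\mathbb{Z}\}$; $\mathrm{M}_k$ is the space of classical holomorphic modular forms of weight $k$ for $\mathrm{SL}_2(\mathbb{Z})$, $\mathrm{M}_\bullet=\bigoplus_k\mathrm{M}_k$ the graded ring, and $\Delta\in\mathrm{M}_{12}$ the Ramanujan discriminant form. $\mathbb{1}$ is the trivial representation. Saturation: for a commutative ring $R$, $R$-modules $N\subseteq M$ and $r\in R$, the saturation of $N$ in $M$ at $r$ is $(N:r^\infty)=\{m\in M:\exists n\in\mathbb{Z}_{\ge0},\ r^nm\in N\}$. Arithmetic types: an arithmetic type is a finite-dimensional complex representation $\rho$ of $\mathrm{SL}_2(\mathbb{Z})$ on a space $V(\rho)$. For $f:\mathbb{H}\to V(\rho)$, $(f|_{k,\rho}\gamma)(\tau)=(c\tau+d)^{-k}\rho(\gamma^{-1})f(\gamma\tau)$, where $(c,d)$ is the bottom row of $\gamma$; $f|_k\gamma=(c\tau+d)^{-k}f(\gamma\tau)$. $f$ has moderate growth if there is $a\in\mathbb{R}$ such that for all $\gamma\in\mathrm{SL}_2(\mathbb{Z})$, $\|(f|_k\gamma)(\tau)\|=O(\mathrm{Im}(\tau)^a)$ as $\mathrm{Im}(\tau)\to\infty$, uniformly for $\mathrm{Re}(\tau)$ in bounded sets. $\mathrm{M}_k(\rho)$ is the space of holomorphic $f:\mathbb{H}\to V(\rho)$ of moderate growth with $f|_{k,\rho}\gamma=f$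 for all $\gamma\in\mathrm{SL}_2(\mathbb{Z})$. $\mathrm{sym}^{\mathsf d}(X)$: the space $\mathbb{C}[X]_{\mathsf d}$ of polynomials of degree at most $\mathsf d$ with $\mathrm{sym}^{\mathsf d}(X)(\gamma^{-1})p(X)=(cX+d)^{\mathsf d}p\big(\frac{aX+b}{cX+d}\big)$ for $\gamma=\begin{pmatrix}a&b\\c&d\end{pmatrix}$; $\mathrm{sym}^{\mathsf d}(X)^\vee$ is its dual. $\mathrm{M}_{k,\mathsf d}=\mathrm{M}_k(\mathrm{sym}^{\mathsf d}(X))$, $\mathrm{M}_{\bullet,\mathsf d}=\bigoplus_{k\in\mathbb{Z}}\mathrm{M}_{k,\mathsf d}$. Cocycles: a $1$-cocycle for $\rho$ is a map $\phi:\mathrm{SL}_2(\mathbb{Z})\to V(\rho)$ with $\phi(\gamma_1\gamma_2)=\rho(\gamma_1)\phi(\gamma_2)+\phi(\gamma_1)$; it is parabolic, i.e. lies in $\mathrm{Z}^1_{\mathrm{pb}}(\mathrm{SL}_2(\mathbb{Z}),\rho)$, if it vanishes on $\Gamma_\infty$. $V(\sigma)^\vee\otimes V(\rho)$ is identified with $\mathrm{Hom}(V(\sigma),V(\rho))$. Generalized second order modular forms: for arithmetic types $\rho,\sigma$ and $k\in\mathbb{Z}$, $\mathrm{M}^{[1]}_k(\rho,\sigma)$ is the space of holomorphic $f:\mathbb{H}\to V(\rho)$ of moderate growth for which there exist a finite set $A\subseteq\mathrm{Z}^1_{\mathrm{pb}}(\mathrm{SL}_2(\mathbb{Z}),\sigma^\vee\otimes\rho)$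 and $g_\phi\in\mathrm{M}_k(\sigma)$ for $\phi\in A$ such that for every $\gamma\in\mathrm{SL}_2(\mathbb{Z})$, $(f|_{k,\rho}\gamma)(\tau)-f(\tau)=\sum_{\phi\in A}\phi(\gamma^{-1})(g_\phi(\tau))$. It contains $\mathrm{M}_k(\rho)$. Put $\mathrm{M}^{[1]}_\bullet(\rho,\sigma)=\bigoplus_{k\in\mathbb{Z}}\mathrm{M}^{[1]}_k(\rho,\sigma)$, an $\mathrm{M}_\bullet$-module by multiplication. Generalized second order Eisenstein series: for $\phi\in\mathrm{Z}^1_{\mathrm{pb}}(\mathrm{SL}_2(\mathbb{Z}),\mathrm{sym}^{\mathsf d}(X))$, $E^{[1]}_k(\tau;\phi)=\sum_{\gamma\in\Gamma_\infty\backslash\mathrm{SL}_2(\mathbb{Z})}(c\tau+d)^{-k}\phi(\gamma^{-1})$ ($k$ even); for $\phi\in\mathrm{Z}^1_{\mathrm{pb}}(\mathrm{SL}_2(\mathbb{Z}),\mathrm{sym}^{\mathsf d}(X)^\vee)$ and $0\le j\le\mathsf d$, $E^{[1]}_k(\tau;\phi,j)=\sum_{\gamma\in\Gamma_\infty\backslash\mathrm{SL}_2(\mathbb{Z})}\phi(\gamma^{-1})\big(((X-\tau)^j|_{k,\mathrm{sym}^{\mathsf d}(X)}\gamma)(\tau)\big)$ ($k\equiv\mathsf d\pmod 2$). For $k\ge5+\mathsf d$ these converge absolutely and locally uniformly and lie in $\mathrm{M}^{[1]}_k(\mathrm{sym}^{\mathsf d}(X),\mathbb{1})$ and $\mathrm{M}^{[1]}_k(\mathbb{1},\mathrm{sym}^{\mathsf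 d}(X))$, respectively. $\mathrm{E}^{\mathrm{pure}[1]}_{\ge k_0}(\mathrm{sym}^{\mathsf d}(X),\mathbb{1})$ is the $\mathrm{M}_\bullet$-span of all $E^{[1]}_k(\cdot;\phi)$ with $k\ge k_0$, $\phi\in\mathrm{Z}^1_{\mathrm{pb}}(\mathrm{SL}_2(\mathbb{Z}),\mathrm{sym}^{\mathsf d}(X))$. $\mathrm{E}^{\mathrm{pure}[1]}_{\ge k_0}(\mathbb{1},\mathrm{sym}^{\mathsf d}(X))$ is the $\mathrm{M}_\bullet$-span of all $E^{[1]}_k(\cdot;\phi,j)$ with $k\ge k_0$, $0\le j\le\mathsf d$, $\phi\in\mathrm{Z}^1_{\mathrm{pb}}(\mathrm{SL}_2(\mathbb{Z}),\mathrm{sym}^{\mathsf d}(X)^\vee)$. In both, $k$ ranges over the weights of the indicated parity. *)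

theory Defs
  imports
    "HOL-Complex_Analysis.Complex_Analysis"
    "HOL-Library.Landau_Symbols"
    "HOL-Library.Function_Algebras"
    "HOL-Computational_Algebra.Polynomial"
    "HOL-Algebra.Coset"
    "HOL-Algebra.AbelCoset"
    "HOL-Algebra.Module"
begin

no_notation fps_nth (infixl \<open>$\<close> 75)
hide_const (open) Module.smult Polynomial.order Coset.order

section \<open>The modular group and its action on the upper half plane\<close>

definition SL2Z :: "(int^2^2) monoid" where
  "SL2Z = \<lparr>carrier = {\<gamma>. det \<gamma> = 1}, monoid.mult = (**), one = mat 1\<rparr>"

lemma group_SL2Z: "Group.group SL2Z"
proof (rule groupI)
  fix \<gamma> assume "\<gamma> \<in> carrier SL2Z"
  then have det: "\<gamma>$1$1 * \<gamma>$2$2 - \<gamma>$1$2 * \<gamma>$2$1 = 1"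
    by (simp add: SL2Z_def det_2)
  define \<delta> :: "int^2^2" where
    "\<delta> = vector [vector [\<gamma>$2$2, - \<gamma>$1$2], vector [- \<gamma>$2$1, \<gamma>$1$1]]"
  have "det \<delta> = 1"
    using det by (simp add: \<delta>_def det_2 algebra_simps)
  moreover have "\<delta> ** \<gamma> = mat 1"
    using det
    by (simp add: \<delta>_def matrix_matrix_mult_def mat_def vec_eq_iff forall_2 sum_2 algebra_simps)
  ultimately show "\<exists>\<delta>\<in>carrier SL2Z. \<delta> \<otimes>\<^bsub>SL2Z\<^esub> \<gamma> = \<one>\<^bsub>SL2Z\<^esub>"
    by (auto simp: SL2Z_def)
qed (auto simp: SL2Z_def det_mul matrix_mul_assoc)

definition T_mat :: "int^2^2" where
  "T_mat = vector [vector [1, 1], vector [0, 1]]"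

definition Gamma_inf :: "(int^2^2) set" where
  "Gamma_inf = (\<Union>n::int. {T_mat [^]\<^bsub>SL2Z\<^esub> n, - (T_mat [^]\<^bsub>SL2Z\<^esub> n)})"

definition upper_half_plane :: "complex set" where
  "upper_half_plane = {\<tau>. Im \<tau> > 0}"

definition moebius_act :: "int^2^2 \<Rightarrow> complex \<Rightarrow> complex" where
  "moebius_act \<gamma> \<tau> = (of_int (\<gamma>$1$1) * \<tau> + of_int (\<gamma>$1$2)) / (of_int (\<gamma>$2$1) * \<tau> + of_int (\<gamma>$2$2))"

definition aut_factor :: "int^2^2 \<Rightarrow> complex \<Rightarrow> complex" where
  "aut_factor \<gamma> \<tau> = of_int (\<gamma>$2$1) * \<tau> + of_int (\<gamma>$2$2)"

lemma aut_factor_nonzero: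
  assumes "\<gamma> \<in> carrier SL2Z" and "\<tau> \<in> upper_half_plane"
  shows "aut_factor \<gamma> \<tau> \<noteq> 0"
proof
  assume "aut_factor \<gamma> \<tau> = 0"
  then have *: "of_int (\<gamma>$2$1) * Im \<tau> = 0" "of_int (\<gamma>$2$1) * Re \<tau> + of_int (\<gamma>$2$2) = 0"
    by (auto simp: aut_factor_def complex_eq_iff)
  then have "\<gamma>$2$1 = 0" "\<gamma>$2$2 = 0"
    using assms(2) by (auto simp: upper_half_plane_def)
  then show False
    using assms(1) by (simp add: SL2Z_def det_2)
qed

lemma Im_moebius:
  assumes "\<gamma> \<in> carrier SL2Z"
  shows "Im (moebius_act \<gamma> \<tau>) = Im \<tau> / norm (aut_factor \<gamma> \<tau>) ^ 2"
proof -
  have "real_of_int (\<gamma>$1$1 * \<gamma>$2$2 - \<gamma>$1$2 * \<gamma>$2$1) = 1"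
    using assms by (simp add: SL2Z_def det_2)
  then have det: "real_of_int (\<gamma>$1$1) * of_int (\<gamma>$2$2) - of_int (\<gamma>$1$2) * of_int (\<gamma>$2$1) = 1"
    by simp
  have "Im (moebius_act \<gamma> \<tau>) =
      (real_of_int (\<gamma>$1$1) * of_int (\<gamma>$2$2) - of_int (\<gamma>$1$2) * of_int (\<gamma>$2$1)) * Im \<tau>
        / norm (aut_factor \<gamma> \<tau>) ^ 2"
    by (simp add: moebius_act_def aut_factor_def Im_divide cmod_power2 algebra_simps)
  then show ?thesis
    by (simp add: det)
qed

lemma moebius_upper_half_plane:
  assumes "\<gamma> \<in> carrier SL2Z" and "\<tau> \<in> upper_half_plane"
  shows "moebius_act \<gamma> \<tau> \<in> upper_half_plane"
  using assms aut_factor_nonzero[OF assms] by (simp add: upper_half_plane_def Im_moebius)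

lemma aut_factor_mult:
  assumes "\<gamma> \<in> carrier SL2Z" "\<delta> \<in> carrier SL2Z" and "\<tau> \<in> upper_half_plane"
  shows "aut_factor (\<gamma> \<otimes>\<^bsub>SL2Z\<^esub> \<delta>) \<tau> = aut_factor \<gamma> (moebius_act \<delta> \<tau>) * aut_factor \<delta> \<tau>"
proof -
  have "aut_factor \<delta> \<tau> \<noteq> 0" using assms by (intro aut_factor_nonzero)
  then show ?thesis
    unfolding aut_factor_def moebius_act_def SL2Z_def
    by (simp add: matrix_matrix_mult_def sum_2 divide_simps) (simp add: algebra_simps)
qed

lemma moebius_mult:
  assumes "\<gamma> \<in> carrier SL2Z" "\<delta> \<in> carrier SL2Z" and "\<tau> \<in> upper_half_plane"
  shows "moebius_act (\<gamma> \<otimes>\<^bsub>SL2Z\<^esub> \<delta>) \<tau> = moebius_act \<gamma> (moebius_act \<delta> \<tau>)"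
proof -
  define u where "u = of_int (\<delta>$1$1) * \<tau> + (of_int (\<delta>$1$2) :: complex)"
  define w where "w = aut_factor \<delta> \<tau>"
  have w: "w \<noteq> 0" using assms by (simp add: w_def aut_factor_nonzero)
  have "moebius_act \<gamma> (moebius_act \<delta> \<tau>) = moebius_act \<gamma> (u / w)"
    by (simp add: u_def w_def moebius_act_def[of \<delta>] aut_factor_def)
  also have "\<dots> = (of_int (\<gamma>$1$1) * u + of_int (\<gamma>$1$2) * w) / (of_int (\<gamma>$2$1) * u + of_int (\<gamma>$2$2) * w)"
  proof -
    have "of_int (\<gamma>$1$1) * (u / w) + of_int (\<gamma>$1$2) = (of_int (\<gamma>$1$1) * u + of_int (\<gamma>$1$2) * w) / w"
      and "of_int (\<gamma>$2$1) * (u / w) + of_int (\<gamma>$2$2) = (of_int (\<gamma>$2$1) * u + of_int (\<gamma>$2$2) * w) / w"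
      using w by (auto simp: field_simps)
    then show ?thesis using w by (simp add: moebius_act_def)
  qed
  also have "\<dots> = moebius_act (\<gamma> \<otimes>\<^bsub>SL2Z\<^esub> \<delta>) \<tau>"
    by (simp add: moebius_act_def SL2Z_def matrix_matrix_mult_def sum_2 u_def w_def aut_factor_def algebra_simps)
  finally show ?thesis by simp
qed


section \<open>Arithmetic types\<close>

text \<open>
  The representation space is a subset of an ambient type with an explicit scalar multiplication,
  so that polynomials of degree at most \<open>d\<close> and spaces of linear maps between representation
  spaces are covered. Only the action of elements of \<^const>\<open>SL2Z\<close> on \<open>rep_space\<close> is meaningful.
\<close>

record 'v arith_type =
  rep_space :: "'v set"
  rep_scale :: "complex \<Rightarrow> 'v \<Rightarrow> 'v"
  rep_act :: "int^2^2 \<Rightarrow> 'v \<Rightarrow> 'v"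

text \<open>Linear maps are extended by zero, so that each is a unique function on the ambient type.\<close>

definition rep_lin_maps ::
    "'v::ab_group_add arith_type \<Rightarrow> 'w::ab_group_add arith_type \<Rightarrow> ('v \<Rightarrow> 'w) set" where
  "rep_lin_maps \<sigma> \<rho> = {h.
     (\<forall>v\<in>rep_space \<sigma>. h v \<in> rep_space \<rho>) \<and>
     (\<forall>v\<in>rep_space \<sigma>. \<forall>w\<in>rep_space \<sigma>. h (v + w) = h v + h w) \<and>
     (\<forall>c. \<forall>v\<in>rep_space \<sigma>. h (rep_scale \<sigma> c v) = rep_scale \<rho> c (h v)) \<and>
     (\<forall>v. v \<notin> rep_space \<sigma> \<longrightarrow> h v = 0)}"

definition arithmetic_type :: "'v::ab_group_add arith_type \<Rightarrow> bool" where
  "arithmetic_type \<rho> \<longleftrightarrow>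
     vector_space (rep_scale \<rho>) \<and>
     module.subspace (rep_scale \<rho>) (rep_space \<rho>) \<and>
     (\<exists>B. finite B \<and> rep_space \<rho> = module.span (rep_scale \<rho>) B) \<and>
     (\<forall>\<gamma>\<in>carrier SL2Z. (\<lambda>v. if v \<in> rep_space \<rho> then rep_act \<rho> \<gamma> v else 0) \<in> rep_lin_maps \<rho> \<rho>) \<and>
     (\<forall>v\<in>rep_space \<rho>. rep_act \<rho> \<one>\<^bsub>SL2Z\<^esub> v = v) \<and>
     (\<forall>\<gamma>\<in>carrier SL2Z. \<forall>\<delta>\<in>carrier SL2Z. \<forall>v\<in>rep_space \<rho>.
        rep_act \<rho> (\<gamma> \<otimes>\<^bsub>SL2Z\<^esub> \<delta>) v = rep_act \<rho> \<gamma> (rep_act \<rho> \<delta> v))"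

definition triv_rep :: "complex arith_type" where
  "triv_rep = \<lparr>rep_space = UNIV, rep_scale = (*), rep_act = (\<lambda>_ z. z)\<rparr>"

lemma arithmetic_type_triv: "arithmetic_type triv_rep"
proof -
  have "(UNIV :: complex set) = vector_space_over_itself.span {1}"
    by (simp add: vector_space_over_itself.span_singleton)
  then have "\<exists>B. finite B \<and> (UNIV :: complex set) = vector_space_over_itself.span B"
    by (intro exI[of _ "{1}"]) auto
  then show ?thesis
    by (auto simp: arithmetic_type_def triv_rep_def rep_lin_maps_def
        vector_space_over_itself.vector_space_axioms algebra_simps)
qed

text \<open>The representation \<open>\<sigma>\<^sup>\<or> \<otimes> \<rho>\<close>, realised on \<open>Hom(V(\<sigma>), V(\<rho>))\<close>.\<close>

definition hom_rep ::
    "'v::ab_group_add arith_type \<Rightarrow> 'w::ab_group_add arith_type \<Rightarrow> ('v \<Rightarrow> 'w) arith_type" where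
  "hom_rep \<sigma> \<rho> =
     \<lparr>rep_space = rep_lin_maps \<sigma> \<rho>,
      rep_scale = (\<lambda>c h v. rep_scale \<rho> c (h v)),
      rep_act = (\<lambda>\<gamma> h v. if v \<in> rep_space \<sigma>
                  then rep_act \<rho> \<gamma> (h (rep_act \<sigma> (inv\<^bsub>SL2Z\<^esub> \<gamma>) v)) else 0)\<rparr>"

definition dual_rep :: "'v::ab_group_add arith_type \<Rightarrow> ('v \<Rightarrow> complex) arith_type" where
  "dual_rep \<rho> = hom_rep \<rho> triv_rep"

text \<open>
  The polynomial \<open>(c X + e)\<^sup>d p((a X + b) / (c X + e))\<close> for a polynomial \<open>p\<close> of degree at most \<open>d\<close>
  and \<open>\<gamma> = (a, b; c, e)\<close>.
\<close>

definition homog_subst :: "nat \<Rightarrow> int^2^2 \<Rightarrow> complex poly \<Rightarrow> complex poly" where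
  "homog_subst d \<gamma> p =
     (\<Sum>i\<le>d. Polynomial.smult (coeff p i)
        ([:of_int (\<gamma>$1$2), of_int (\<gamma>$1$1):] ^ i * [:of_int (\<gamma>$2$2), of_int (\<gamma>$2$1):] ^ (d - i)))"

lemma poly_homog_subst:
  assumes "degree p \<le> d" and "aut_factor \<gamma> x \<noteq> 0"
  shows "poly (homog_subst d \<gamma> p) x = aut_factor \<gamma> x ^ d * poly p (moebius_act \<gamma> x)"
proof -
  define u where "u = of_int (\<gamma>$1$1) * x + (of_int (\<gamma>$1$2) :: complex)"
  define w where "w = aut_factor \<gamma> x"
  have w: "w \<noteq> 0" and mo: "moebius_act \<gamma> x = u / w"
    using assms by (auto simp: w_def u_def moebius_act_def aut_factor_def)
  have "poly (homog_subst d \<gamma> p) x = (\<Sum>i\<le>d. coeff p i * (u ^ i * w ^ (d - i)))"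
    by (simp add: homog_subst_def poly_sum u_def w_def aut_factor_def algebra_simps)
  also have "\<dots> = (\<Sum>i\<le>d. w ^ d * (coeff p i * (u / w) ^ i))"
    using w by (intro sum.cong refl) (auto simp: power_divide power_diff field_simps)
  also have "\<dots> = w ^ d * (\<Sum>i\<le>degree p. coeff p i * (u / w) ^ i)"
  proof -
    have "(\<Sum>i\<le>d. coeff p i * (u / w) ^ i) = (\<Sum>i\<le>degree p. coeff p i * (u / w) ^ i)"
      using assms(1) by (intro sum.mono_neutral_right) (auto simp: coeff_eq_0)
    then show ?thesis by (simp flip: sum_distrib_left)
  qed
  finally show ?thesis
    by (simp add: poly_altdef mo w_def)
qed

lemma degree_homog_subst: "degree (homog_subst d \<gamma> p) \<le> d"
  unfolding homog_subst_def
proof (rule degree_sum_le)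
  fix i assume i: "i \<in> {..d}"
  have "degree ([:of_int (\<gamma>$1$2), of_int (\<gamma>$1$1) :: complex:] ^ i) \<le> 1 * i"
    by (rule order_trans[OF degree_power_le]) simp
  moreover have "degree ([:of_int (\<gamma>$2$2), of_int (\<gamma>$2$1) :: complex:] ^ (d - i)) \<le> 1 * (d - i)"
    by (rule order_trans[OF degree_power_le]) simp
  ultimately show "degree (Polynomial.smult (coeff p i)
      ([:of_int (\<gamma>$1$2), of_int (\<gamma>$1$1):] ^ i * [:of_int (\<gamma>$2$2), of_int (\<gamma>$2$1):] ^ (d - i))) \<le> d"
    using i by (intro order_trans[OF degree_smult_le] order_trans[OF degree_mult_le]) auto
qed auto

lemma poly_eqI_upper_half_plane:
  fixes p q :: "complex poly"
  assumes "\<And>\<tau>. \<tau> \<in> upper_half_plane \<Longrightarrow> poly p \<tau> = poly q \<tau>"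
  shows "p = q"
proof (rule ccontr)
  assume "p \<noteq> q"
  then have "finite {\<tau>. poly (p - q) \<tau> = 0}"
    by (intro poly_roots_finite) auto
  moreover have "(\<lambda>n::nat. \<i> * of_nat (Suc n)) ` UNIV \<subseteq> {\<tau>. poly (p - q) \<tau> = 0}"
    using assms by (auto simp: upper_half_plane_def)
  moreover have "inj (\<lambda>n::nat. \<i> * of_nat (Suc n))"
    by (auto simp: inj_on_def)
  ultimately show False
    using finite_subset finite_imageD infinite_UNIV_nat by blast
qed

lemma homog_subst_mult:
  assumes "\<gamma> \<in> carrier SL2Z" "\<delta> \<in> carrier SL2Z" "degree p \<le> d"
  shows "homog_subst d (\<gamma> \<otimes>\<^bsub>SL2Z\<^esub> \<delta>) p = homog_subst d \<delta> (homog_subst d \<gamma> p)"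
proof (rule poly_eqI_upper_half_plane)
  fix \<tau> assume \<tau>: "\<tau> \<in> upper_half_plane"
  interpret SL: Group.group SL2Z by (rule group_SL2Z)
  show "poly (homog_subst d (\<gamma> \<otimes>\<^bsub>SL2Z\<^esub> \<delta>) p) \<tau> = poly (homog_subst d \<delta> (homog_subst d \<gamma> p)) \<tau>"
    using assms \<tau>
    by (simp add: poly_homog_subst aut_factor_nonzero moebius_upper_half_plane degree_homog_subst
        aut_factor_mult moebius_mult power_mult_distrib)
qed

definition sym_rep :: "nat \<Rightarrow> complex poly arith_type" where
  "sym_rep d =
     \<lparr>rep_space = {p. degree p \<le> d},
      rep_scale = Polynomial.smult,
      rep_act = (\<lambda>\<gamma>. homog_subst d (inv\<^bsub>SL2Z\<^esub> \<gamma>))\<rparr>"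

lemma arithmetic_type_sym: "arithmetic_type (sym_rep d)"
proof -
  interpret V: vector_space "Polynomial.smult :: complex \<Rightarrow> complex poly \<Rightarrow> complex poly"
    by unfold_locales (auto simp: smult_add_right smult_add_left)
  interpret SL: Group.group SL2Z by (rule group_SL2Z)
  let ?V = "{p :: complex poly. degree p \<le> d}"
  have sub: "V.subspace ?V"
    by (auto simp: V.subspace_def degree_add_le intro: order_trans[OF degree_smult_le])
  have "?V = V.span ((\<lambda>i. Polynomial.monom 1 i) ` {..d})" (is "_ = V.span ?B")
  proof (intro equalityI subsetI)
    fix p assume "p \<in> ?V"
    then have "p = (\<Sum>i\<le>d. Polynomial.monom (coeff p i) i)"
      by (simp add: poly_as_sum_of_monoms')
    also have "\<dots> = (\<Sum>i\<le>d. Polynomial.smult (coeff p i) (Polynomial.monom 1 i))"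
      by (simp add: smult_monom)
    also have "\<dots> \<in> V.span ?B"
      by (intro V.span_sum V.span_scale V.span_base) auto
    finally show "p \<in> V.span ?B" .
  next
    fix p assume "p \<in> V.span ?B"
    moreover have "V.span ?B \<subseteq> ?V"
      using sub by (intro V.span_minimal) (auto simp: degree_monom_eq)
    ultimately show "p \<in> ?V" by auto
  qed
  then have fin: "\<exists>B. finite B \<and> ?V = V.span B"
    by (intro exI[of _ ?B]) auto
  have add: "homog_subst d \<gamma> (p + q) = homog_subst d \<gamma> p + homog_subst d \<gamma> q" for \<gamma> p q
    by (simp add: homog_subst_def smult_add_left sum.distrib)
  have scale: "homog_subst d \<gamma> (Polynomial.smult c p) = Polynomial.smult c (homog_subst d \<gamma> p)" for \<gamma> c p
    by (rule poly_eqI) (simp add: homog_subst_def coeff_sum sum_distrib_left mult.assoc)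
  have one: "homog_subst d \<one>\<^bsub>SL2Z\<^esub> p = p" if "degree p \<le> d" for p
    by (rule poly_eqI_upper_half_plane, subst poly_homog_subst)
       (use that in \<open>auto simp: SL2Z_def aut_factor_def moebius_act_def mat_def\<close>)
  show ?thesis
    using sub fin
    by (auto simp: arithmetic_type_def sym_rep_def rep_lin_maps_def V.vector_space_axioms add scale one
        degree_homog_subst SL.inv_mult_group homog_subst_mult degree_add_le
        intro: order_trans[OF degree_smult_le])
qed


section \<open>Modular forms\<close>

text \<open>
  Functions on the upper half plane are represented by functions on \<^typ>\<open>complex\<close> that vanish
  outside of it.
\<close>

definition vv_functions :: "'v::zero arith_type \<Rightarrow> (complex \<Rightarrow> 'v) set" where
  "vv_functions \<rho> = {f. (\<forall>\<tau>\<in>upper_half_plane. f \<tau> \<in> rep_space \<rho>) \<and>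
                         (\<forall>\<tau>. \<tau> \<notin> upper_half_plane \<longrightarrow> f \<tau> = 0)}"

definition vv_holomorphic :: "'v::ab_group_add arith_type \<Rightarrow> (complex \<Rightarrow> 'v) \<Rightarrow> bool" where
  "vv_holomorphic \<rho> f \<longleftrightarrow>
     (\<forall>l\<in>rep_space (dual_rep \<rho>). (\<lambda>\<tau>. l (f \<tau>)) holomorphic_on upper_half_plane)"

definition vv_slash ::
    "int \<Rightarrow> 'v arith_type \<Rightarrow> (complex \<Rightarrow> 'v) \<Rightarrow> int^2^2 \<Rightarrow> complex \<Rightarrow> 'v" where
  "vv_slash k \<rho> f \<gamma> \<tau> =
     rep_scale \<rho> (aut_factor \<gamma> \<tau> powi (- k)) (rep_act \<rho> (inv\<^bsub>SL2Z\<^esub> \<gamma>) (f (moebius_act \<gamma> \<tau>)))"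

definition rep_norm :: "'v::ab_group_add arith_type \<Rightarrow> ('v \<Rightarrow> real) \<Rightarrow> bool" where
  "rep_norm \<rho> N \<longleftrightarrow>
     (\<forall>v\<in>rep_space \<rho>. 0 \<le> N v \<and> (N v = 0 \<longleftrightarrow> v = 0)) \<and>
     (\<forall>v\<in>rep_space \<rho>. \<forall>w\<in>rep_space \<rho>. N (v + w) \<le> N v + N w) \<and>
     (\<forall>c. \<forall>v\<in>rep_space \<rho>. N (rep_scale \<rho> c v) = norm c * N v)"

text \<open>
  All norms on a finite-dimensional space are equivalent, so the condition does not depend on \<open>N\<close>.
  The growth is measured with the slash action that does not involve \<open>\<rho>\<close>.
\<close>

definition moderate_growth ::
    "int \<Rightarrow> 'v::ab_group_add arith_type \<Rightarrow> (complex \<Rightarrow> 'v) \<Rightarrow> bool" where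
  "moderate_growth k \<rho> f \<longleftrightarrow>
     (\<exists>a::real. \<forall>N. rep_norm \<rho> N \<longrightarrow> (\<forall>\<gamma>\<in>carrier SL2Z. \<forall>B. bounded B \<longrightarrow>
        (\<lambda>\<tau>. N (rep_scale \<rho> (aut_factor \<gamma> \<tau> powi (- k)) (f (moebius_act \<gamma> \<tau>))))
          \<in> O[inf (filtercomap Im at_top) (principal (Re -` B))](\<lambda>\<tau>. Im \<tau> powr a)))"

definition vv_modular_forms :: "int \<Rightarrow> 'v::ab_group_add arith_type \<Rightarrow> (complex \<Rightarrow> 'v) set" where
  "vv_modular_forms k \<rho> =
     {f \<in> vv_functions \<rho>. vv_holomorphic \<rho> f \<and> moderate_growth k \<rho> f \<and>
        (\<forall>\<gamma>\<in>carrier SL2Z. \<forall>\<tau>\<in>upper_half_plane. vv_slash k \<rho> f \<gamma> \<tau> = f \<tau>)}"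

definition modular_forms :: "int \<Rightarrow> (complex \<Rightarrow> complex) set" where
  "modular_forms k =
     {f. (\<forall>\<tau>. \<tau> \<notin> upper_half_plane \<longrightarrow> f \<tau> = 0) \<and>
         f holomorphic_on upper_half_plane \<and>
         (\<forall>\<gamma>\<in>carrier SL2Z. \<forall>\<tau>\<in>upper_half_plane.
            aut_factor \<gamma> \<tau> powi (- k) * f (moebius_act \<gamma> \<tau>) = f \<tau>) \<and>
         f \<in> O[filtercomap Im at_top](\<lambda>_. 1)}"

definition ramanujan_delta :: "complex \<Rightarrow> complex" where
  "ramanujan_delta \<tau> =
     (if \<tau> \<in> upper_half_plane
      then exp (2 * pi * \<i> * \<tau>) * (\<Prod>n. (1 - exp (2 * pi * \<i> * \<tau>) ^ Suc n) ^ 24)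
      else 0)"


section \<open>Parabolic cocycles and second order modular forms\<close>

definition parabolic_cocycles :: "'v::ab_group_add arith_type \<Rightarrow> (int^2^2 \<Rightarrow> 'v) set" where
  "parabolic_cocycles \<rho> =
     {\<phi>. (\<forall>\<gamma>\<in>carrier SL2Z. \<phi> \<gamma> \<in> rep_space \<rho>) \<and>
         (\<forall>\<gamma>. \<gamma> \<notin> carrier SL2Z \<longrightarrow> \<phi> \<gamma> = 0) \<and>
         (\<forall>\<gamma>\<in>carrier SL2Z. \<forall>\<delta>\<in>carrier SL2Z.
            \<phi> (\<gamma> \<otimes>\<^bsub>SL2Z\<^esub> \<delta>) = rep_act \<rho> \<gamma> (\<phi> \<delta>) + \<phi> \<gamma>) \<and>
         (\<forall>\<gamma>\<in>Gamma_inf. \<phi> \<gamma> = 0)}"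

definition second_order_forms ::
    "int \<Rightarrow> 'v::ab_group_add arith_type \<Rightarrow> 'w::ab_group_add arith_type \<Rightarrow> (complex \<Rightarrow> 'v) set" where
  "second_order_forms k \<rho> \<sigma> =
     {f \<in> vv_functions \<rho>. vv_holomorphic \<rho> f \<and> moderate_growth k \<rho> f \<and>
        (\<exists>A g. finite A \<and> A \<subseteq> parabolic_cocycles (hom_rep \<sigma> \<rho>) \<and>
           (\<forall>\<phi>\<in>A. g \<phi> \<in> vv_modular_forms k \<sigma>) \<and>
           (\<forall>\<gamma>\<in>carrier SL2Z. \<forall>\<tau>\<in>upper_half_plane.
              vv_slash k \<rho> f \<gamma> \<tau> - f \<tau> = (\<Sum>\<phi>\<in>A. \<phi> (inv\<^bsub>SL2Z\<^esub> \<gamma>) (g \<phi> \<tau>))))}"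


section \<open>Second order Eisenstein series\<close>

text \<open>
  The terms of the following series depend only on the coset \<open>\<Gamma>\<^sub>\<infinity> \<gamma>\<close> (for weights of the
  appropriate parity), hence may be evaluated at an arbitrary representative.
\<close>

definition coset_rep :: "(int^2^2) set \<Rightarrow> int^2^2" where
  "coset_rep C = (SOME \<gamma>. \<gamma> \<in> C)"

text \<open>The sum of polynomials of degree at most \<open>d\<close> is taken coefficientwise.\<close>

definition eisenstein_sym ::
    "nat \<Rightarrow> int \<Rightarrow> (int^2^2 \<Rightarrow> complex poly) \<Rightarrow> complex \<Rightarrow> complex poly" where
  "eisenstein_sym d k \<phi> \<tau> =
     (if \<tau> \<in> upper_half_plane
      then \<Sum>i\<le>d. Polynomial.monom
             (\<Sum>\<^sub>\<infinity>C\<in>rcosets\<^bsub>SL2Z\<^esub> Gamma_inf.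
                coeff (Polynomial.smult (aut_factor (coset_rep C) \<tau> powi (- k))
                         (\<phi> (inv\<^bsub>SL2Z\<^esub> (coset_rep C)))) i) i
      else 0)"

definition eisenstein_sym_dual ::
    "nat \<Rightarrow> int \<Rightarrow> (int^2^2 \<Rightarrow> complex poly \<Rightarrow> complex) \<Rightarrow> nat \<Rightarrow> complex \<Rightarrow> complex" where
  "eisenstein_sym_dual d k \<phi> j \<tau> =
     (if \<tau> \<in> upper_half_plane
      then \<Sum>\<^sub>\<infinity>C\<in>rcosets\<^bsub>SL2Z\<^esub> Gamma_inf.
             \<phi> (inv\<^bsub>SL2Z\<^esub> (coset_rep C))
               (vv_slash k (sym_rep d) (\<lambda>z. [:- z, 1:] ^ j) (coset_rep C) \<tau>)
      else 0)"


section \<open>Graded modules over the ring of modular forms\<close>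

definition graded_sum :: "(int \<Rightarrow> (complex \<Rightarrow> 'v::zero) set) \<Rightarrow> (int \<Rightarrow> complex \<Rightarrow> 'v) set" where
  "graded_sum M = {F. (\<forall>k. F k \<in> M k) \<and> finite {k. F k \<noteq> 0}}"

definition homogeneous :: "int \<Rightarrow> (complex \<Rightarrow> 'v::zero) \<Rightarrow> int \<Rightarrow> complex \<Rightarrow> 'v" where
  "homogeneous k f = (\<lambda>l. if l = k then f else 0)"

definition graded_mult ::
    "(complex \<Rightarrow> 'v::comm_monoid_add \<Rightarrow> 'v) \<Rightarrow> (int \<Rightarrow> complex \<Rightarrow> complex)
      \<Rightarrow> (int \<Rightarrow> complex \<Rightarrow> 'v) \<Rightarrow> int \<Rightarrow> complex \<Rightarrow> 'v" where
  "graded_mult act r F = (\<lambda>k \<tau>. \<Sum>l | r l \<noteq> 0. act (r l \<tau>) (F (k - l) \<tau>))"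

definition modular_ring :: "(int \<Rightarrow> complex \<Rightarrow> complex) ring" where
  "modular_ring =
     \<lparr>carrier = graded_sum modular_forms,
      monoid.mult = graded_mult (*),
      one = homogeneous 0 (indicator upper_half_plane),
      ring.zero = 0,
      ring.add = (+)\<rparr>"

text \<open>The ring multiplication of the module record plays no role.\<close>

definition graded_module ::
    "'v::ab_group_add arith_type \<Rightarrow> (int \<Rightarrow> (complex \<Rightarrow> 'v) set)
      \<Rightarrow> (int \<Rightarrow> complex \<Rightarrow> complex, int \<Rightarrow> complex \<Rightarrow> 'v) module" where
  "graded_module \<rho> M =
     \<lparr>carrier = graded_sum M,
      monoid.mult = undefined,
      one = undefined,
      ring.zero = 0,
      ring.add = (+),
      module.smult = graded_mult (rep_scale \<rho>)\<rparr>"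

definition second_order_module ::
    "'v::ab_group_add arith_type \<Rightarrow> 'w::ab_group_add arith_type
      \<Rightarrow> (int \<Rightarrow> complex \<Rightarrow> complex, int \<Rightarrow> complex \<Rightarrow> 'v) module" where
  "second_order_module \<rho> \<sigma> = graded_module \<rho> (\<lambda>k. second_order_forms k \<rho> \<sigma>)"

definition module_span :: "('a, 'm) ring_scheme \<Rightarrow> ('a, 'b, 'n) module_scheme \<Rightarrow> 'b set \<Rightarrow> 'b set" where
  "module_span R M S =
     {\<Oplus>\<^bsub>M\<^esub>s\<in>A. c s \<odot>\<^bsub>M\<^esub> s | A c. finite A \<and> A \<subseteq> S \<and> c \<in> A \<rightarrow> carrier R}"

definition saturation ::
    "('a, 'm) ring_scheme \<Rightarrow> ('a, 'b, 'n) module_scheme \<Rightarrow> 'b set \<Rightarrow> 'a \<Rightarrow> 'b set" where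
  "saturation R M N r = {m \<in> carrier M. \<exists>n::nat. (r [^]\<^bsub>R\<^esub> n) \<odot>\<^bsub>M\<^esub> m \<in> N}"

definition pure_eisenstein_sym :: "nat \<Rightarrow> int \<Rightarrow> (int \<Rightarrow> complex \<Rightarrow> complex poly) set" where
  "pure_eisenstein_sym d k0 =
     module_span modular_ring (second_order_module (sym_rep d) triv_rep)
       {homogeneous k (eisenstein_sym d k \<phi>) | k \<phi>.
          k \<ge> k0 \<and> even k \<and> \<phi> \<in> parabolic_cocycles (sym_rep d)}"

definition pure_eisenstein_sym_dual :: "nat \<Rightarrow> int \<Rightarrow> (int \<Rightarrow> complex \<Rightarrow> complex) set" where
  "pure_eisenstein_sym_dual d k0 =
     module_span modular_ring (second_order_module triv_rep (sym_rep d))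
       {homogeneous k (eisenstein_sym_dual d k \<phi> j) | k \<phi> j.
          k \<ge> k0 \<and> even (k - int d) \<and> j \<le> d \<and> \<phi> \<in> parabolic_cocycles (dual_rep (sym_rep d))}"

end

theory Submission
  imports Defs "HOL-Computational_Algebra.Fundamental_Theorem_Algebra"
begin

text \<open>
  The series \<open>E = E\<^sub>k(\<phi>)\<close> of second order fails to be modular by \<open>E|\<gamma> - E = - G\<^sub>k \<phi>(\<gamma>\<^sup>-\<^sup>1)\<close>, where \<open>G\<^sub>k\<close> is the
  classical Eisenstein series; for the dual type \<open>G\<^sub>k\<close> is replaced by the vector-valued Eisenstein
  series \<open>G\<^sub>k\<^sub>,\<^sub>j = \<Sum> (X - \<tau>)\<^sup>j|\<gamma>\<close>. The cocycle \<open>\<Sum> \<phi>(\<gamma>\<^sup>-\<^sup>1)(g\<^sub>\<phi>)\<close> of \<open>\<Delta>\<^sup>N f\<close> can hence be cancelled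
  by second order Eisenstein series as soon as all \<open>\<Delta>\<^sup>N g\<^sub>\<phi>\<close> are combinations of such Eisenstein
  series of large weight, with modular forms as coefficients.

  For scalar \<open>g\<^sub>\<phi>\<close> it suffices that some \<open>\<Delta>\<^sup>N\<close> is in the ideal generated by the \<open>G\<^sub>1\<^sub>2\<^sub>n\<close> with \<open>n \<ge> n\<^sub>0\<close>. Modular
  forms of weight \<open>12n\<close> are \<open>\<Delta>\<^sup>n\<close> times polynomials in the hauptmodul \<open>G\<^sub>1\<^sub>2/\<Delta>\<close>, which takes every complex value,
  and no point is a zero of almost all \<open>G\<^sub>1\<^sub>2\<^sub>n\<close>, so the polynomials belonging to the \<open>G\<^sub>1\<^sub>2\<^sub>n\<close> generate the
  unit ideal. Forms with values in the symmetric power are filtered by the order of vanishing at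
  \<open>X = \<tau>\<close>: the leading coefficient of such a form is a modular form, that of \<open>G\<^sub>k\<^sub>,\<^sub>j\<close> is a classical
  Eisenstein series, and the scalar case applies to one step of the filtration after the other.

  Convergence rests on the fact that a parabolic cocycle is bounded by a power of the bottom row
  of its argument, which follows from the Euclidean algorithm.
\<close>

section \<open>The modular group\<close>

text \<open>Inverting \<Delta> removes the cusp. The forms of weight divisible by 12 then form a
  Laurent ring in \<Delta> over the polynomials in one variable, where a family without a common
  zero generates the unit ideal. Generating becomes a question about one point at a time. A
  saturation is contained in the ambient module by definition, so only one inclusion has content,
  and it can be proved with generators of weights as large as convenient. \<Delta> is given as an
  infinite product, so its weight has to be proved. The behaviour of Jacobi's theta function under
  inversion does this: the constant in its transformation law is found from the values at the three
  half periods, whose product is elementary by Euler's identity. The cocycle bound has exponent d +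
  1 in the bottom row, and summing over bottom rows costs 4 more, which gives the weight d + 5. For
  the dual type the polynomials (X - \<tau>)^j|\<gamma> bring up to d further powers, which gives 2
  d + 5.\<close>

interpretation SL: Group.group SL2Z by (rule group_SL2Z)

lemma SL2Z_iff: "\<gamma> \<in> carrier SL2Z \<longleftrightarrow> \<gamma>$1$1 * \<gamma>$2$2 - \<gamma>$1$2 * \<gamma>$2$1 = 1"
  by (simp add: SL2Z_def det_2)

lemma SL2Z_mult_nth:
  "(\<gamma> \<otimes>\<^bsub>SL2Z\<^esub> \<delta>)$i$j = \<gamma>$i$1 * \<delta>$1$j + \<gamma>$i$2 * \<delta>$2$j"
  by (simp add: SL2Z_def matrix_matrix_mult_def sum_2)

definition mat2 :: "int \<Rightarrow> int \<Rightarrow> int \<Rightarrow> int \<Rightarrow> int^2^2" where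
  "mat2 a b c d = vector [vector [a, b], vector [c, d]]"

lemma mat2_nth [simp]:
  "mat2 a b c d $ 1 $ 1 = a" "mat2 a b c d $ 1 $ 2 = b"
  "mat2 a b c d $ 2 $ 1 = c" "mat2 a b c d $ 2 $ 2 = d"
  by (simp_all add: mat2_def)

lemma mat2_eqI:
  fixes \<gamma> \<delta> :: "int^2^2"
  assumes "\<gamma>$1$1 = \<delta>$1$1" "\<gamma>$1$2 = \<delta>$1$2" "\<gamma>$2$1 = \<delta>$2$1" "\<gamma>$2$2 = \<delta>$2$2"
  shows "\<gamma> = \<delta>"
  using assms by (simp add: vec_eq_iff forall_2)

lemma SL2Z_one: "\<one>\<^bsub>SL2Z\<^esub> = mat2 1 0 0 1"
  by (rule mat2_eqI) (simp_all add: SL2Z_def mat_def)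

lemma SL2Z_mult_mat2:
  "mat2 a b c d \<otimes>\<^bsub>SL2Z\<^esub> mat2 a' b' c' d'
     = mat2 (a * a' + b * c') (a * b' + b * d') (c * a' + d * c') (c * b' + d * d')"
  by (rule mat2_eqI) (simp_all add: SL2Z_mult_nth)

lemma SL2Z_inv:
  assumes "\<gamma> \<in> carrier SL2Z"
  shows "inv\<^bsub>SL2Z\<^esub> \<gamma> = mat2 (\<gamma>$2$2) (- \<gamma>$1$2) (- \<gamma>$2$1) (\<gamma>$1$1)"
proof -
  have "mat2 (\<gamma>$2$2) (- \<gamma>$1$2) (- \<gamma>$2$1) (\<gamma>$1$1) \<otimes>\<^bsub>SL2Z\<^esub> \<gamma> = \<one>\<^bsub>SL2Z\<^esub>"
    using assms by (intro mat2_eqI) (simp_all add: SL2Z_mult_nth SL2Z_one SL2Z_iff algebra_simps)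
  moreover have "mat2 (\<gamma>$2$2) (- \<gamma>$1$2) (- \<gamma>$2$1) (\<gamma>$1$1) \<in> carrier SL2Z"
    using assms by (simp add: SL2Z_iff algebra_simps)
  ultimately show ?thesis
    using assms by (metis SL.inv_equality)
qed

definition T_pow :: "int \<Rightarrow> int^2^2" where
  "T_pow n = mat2 1 n 0 1"

definition S_mat :: "int^2^2" where
  "S_mat = mat2 0 (- 1) 1 0"

lemma T_pow_carrier [simp]: "T_pow n \<in> carrier SL2Z"
  and S_mat_carrier [simp]: "S_mat \<in> carrier SL2Z"
  by (simp_all add: SL2Z_iff T_pow_def S_mat_def)

lemma T_pow_add: "T_pow m \<otimes>\<^bsub>SL2Z\<^esub> T_pow n = T_pow (m + n)"
  by (simp add: T_pow_def SL2Z_mult_mat2 add.commute)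

lemma inv_T_pow: "inv\<^bsub>SL2Z\<^esub> T_pow n = T_pow (- n)"
  by (simp add: SL2Z_inv) (simp add: T_pow_def)

lemma T_mat_pow: "T_mat [^]\<^bsub>SL2Z\<^esub> (n :: int) = T_pow n"
proof -
  have T: "T_mat = T_pow 1"
    by (simp add: T_mat_def T_pow_def mat2_def)
  have nat: "T_mat [^]\<^bsub>SL2Z\<^esub> k = T_pow (int k)" for k :: nat
  proof (induction k)
    case 0
    show ?case by (simp only: nat_pow_0) (simp add: SL2Z_one T_pow_def)
  next
    case (Suc k)
    have "T_mat [^]\<^bsub>SL2Z\<^esub> Suc k = T_pow (int k) \<otimes>\<^bsub>SL2Z\<^esub> T_pow 1"
      unfolding nat_pow_Suc Suc.IH by (simp only: T)
    then show ?case by (simp only: T_pow_add of_nat_Suc add.commute)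
  qed
  show ?thesis
  proof (cases "n < 0")
    case False
    then show ?thesis
      by (simp only: int_pow_def2 nat if_False) simp
  next
    case True
    then show ?thesis
      by (simp only: int_pow_def2 nat if_True inv_T_pow) simp
  qed
qed

lemma Gamma_inf_iff:
  "\<gamma> \<in> Gamma_inf \<longleftrightarrow> (\<exists>n. \<gamma> = mat2 1 n 0 1 \<or> \<gamma> = mat2 (- 1) n 0 (- 1))"
proof -
  have "- T_pow n = mat2 (- 1) (- n) 0 (- 1)" for n
    by (rule mat2_eqI) (simp_all add: T_pow_def)
  then show ?thesis
    unfolding Gamma_inf_def T_mat_pow
    by (auto simp: T_pow_def) (metis add.inverse_inverse)
qed

text \<open>Determinant 1 with lower left entry 0 forces the diagonal to be 1, 1 or -1, -1. With
  this criterion, statements on cosets become computations with bottom rows.\<close>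

lemma Gamma_inf_iff_lower_left:
  "\<gamma> \<in> Gamma_inf \<longleftrightarrow> \<gamma> \<in> carrier SL2Z \<and> \<gamma>$2$1 = 0"
proof
  assume "\<gamma> \<in> carrier SL2Z \<and> \<gamma>$2$1 = 0"
  then have 0: "\<gamma>$2$1 = 0" and "\<gamma>$1$1 * \<gamma>$2$2 = 1"
    by (auto simp: SL2Z_iff)
  then have "\<gamma>$1$1 = 1 \<and> \<gamma>$2$2 = 1 \<or> \<gamma>$1$1 = - 1 \<and> \<gamma>$2$2 = - 1"
    using zmult_eq_1_iff by blast
  then show "\<gamma> \<in> Gamma_inf"
    using 0 by (auto simp: Gamma_inf_iff intro!: mat2_eqI exI[of _ "\<gamma>$1$2"])
qed (auto simp: Gamma_inf_iff SL2Z_iff)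

lemma subgroup_Gamma_inf: "subgroup Gamma_inf SL2Z"
proof
  show "\<gamma> \<otimes>\<^bsub>SL2Z\<^esub> \<delta> \<in> Gamma_inf" if "\<gamma> \<in> Gamma_inf" "\<delta> \<in> Gamma_inf" for \<gamma> \<delta>
    using that by (auto simp: Gamma_inf_iff_lower_left SL2Z_mult_nth)
  show "inv\<^bsub>SL2Z\<^esub> \<gamma> \<in> Gamma_inf" if "\<gamma> \<in> Gamma_inf" for \<gamma>
    using that by (auto simp: Gamma_inf_iff_lower_left) (simp add: SL2Z_inv)
qed (auto simp: Gamma_inf_iff_lower_left SL2Z_one SL2Z_iff)

lemma Gamma_inf_carrier: "\<gamma> \<in> Gamma_inf \<Longrightarrow> \<gamma> \<in> carrier SL2Z"
  by (simp add: Gamma_inf_iff_lower_left)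

text \<open>Division with least absolute remainder, applied to the bottom row (c, e): multiplication
  by the inverse of S T^n from the right turns it into (n c - e, c). Both the small remainder and
  the halving of the lower left entry enter the growth estimate for cocycles.\<close>

lemma SL2Z_euclid_step:
  assumes "\<gamma> \<in> carrier SL2Z" "\<gamma>$2$1 \<noteq> 0"
  obtains \<delta> n where "\<delta> \<in> carrier SL2Z" "\<gamma> = \<delta> \<otimes>\<^bsub>SL2Z\<^esub> (S_mat \<otimes>\<^bsub>SL2Z\<^esub> T_pow n)"
    "2 * \<bar>\<gamma>$2$2 - n * \<gamma>$2$1\<bar> \<le> \<bar>\<gamma>$2$1\<bar>" "2 * \<bar>\<delta>$2$1\<bar> \<le> \<bar>\<gamma>$2$1\<bar>"
proof -
  define c where "c = \<gamma>$2$1"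
  \<comment> \<open>The nearest integer and not the floor, so that the remainder is at most half of
    |c|.\<close>
  define n where "n = round (of_int (\<gamma>$2$2) / of_int c :: real)"
  define \<delta> where "\<delta> = \<gamma> \<otimes>\<^bsub>SL2Z\<^esub> inv\<^bsub>SL2Z\<^esub> (S_mat \<otimes>\<^bsub>SL2Z\<^esub> T_pow n)"
  have c: "c \<noteq> 0" using assms by (simp add: c_def)
  have "\<bar>of_int n - of_int (\<gamma>$2$2) / of_int c\<bar> \<le> (1 / 2 :: real)"
    unfolding n_def by (rule of_int_round_abs_le)
  then have "\<bar>of_int c :: real\<bar> * \<bar>of_int n - of_int (\<gamma>$2$2) / of_int c\<bar> \<le> \<bar>of_int c\<bar> * (1 / 2)"
    by (intro mult_left_mono) auto
  then have "\<bar>real_of_int (c * n - \<gamma>$2$2)\<bar> \<le> \<bar>of_int c\<bar> / 2"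
    using c by (simp flip: abs_mult add: right_diff_distrib)
  then have "real_of_int (2 * \<bar>c * n - \<gamma>$2$2\<bar>) \<le> of_int \<bar>c\<bar>"
    by simp
  then have *: "2 * \<bar>\<gamma>$2$2 - n * c\<bar> \<le> \<bar>c\<bar>"
    by (simp only: of_int_le_iff abs_minus_commute[of "\<gamma>$2$2"] mult.commute)
  have [simp]: "\<delta> \<in> carrier SL2Z" using assms by (simp add: \<delta>_def)
  have "\<gamma> = \<delta> \<otimes>\<^bsub>SL2Z\<^esub> (S_mat \<otimes>\<^bsub>SL2Z\<^esub> T_pow n)"
    using assms by (simp add: \<delta>_def SL.m_assoc SL.l_inv)
  moreover have "\<delta>$2$1 = n * c - \<gamma>$2$2"
    unfolding \<delta>_def SL2Z_mult_nth
    by (subst (1 2) SL2Z_inv, simp) (simp add: S_mat_def T_pow_def SL2Z_mult_mat2 c_def)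
  ultimately show ?thesis
    using * that[of \<delta> n] by (simp add: c_def abs_minus_commute)
qed

text \<open>The Euclidean algorithm terminates in \<open>Gamma_inf\<close>. This is the generation
  of the group by S and T in the shape needed to pass from the behaviour under S and T to that under
  all \<gamma>.\<close>

lemma SL2Z_induct [consumes 1, case_names Gamma_inf step]:
  assumes "\<gamma> \<in> carrier SL2Z"
    and "\<And>\<gamma>. \<gamma> \<in> Gamma_inf \<Longrightarrow> P \<gamma>"
    and "\<And>\<delta> n. \<delta> \<in> carrier SL2Z \<Longrightarrow> P \<delta> \<Longrightarrow> P (\<delta> \<otimes>\<^bsub>SL2Z\<^esub> (S_mat \<otimes>\<^bsub>SL2Z\<^esub> T_pow n))"
  shows "P \<gamma>"
  using assms(1)
proof (induction "nat \<bar>\<gamma>$2$1\<bar>" arbitrary: \<gamma> rule: less_induct)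
  case less
  show ?case
  proof (cases "\<gamma>$2$1 = 0")
    case True
    then show ?thesis using less.prems assms(2) by (simp add: Gamma_inf_iff_lower_left)
  next
    case False
    obtain \<delta> n where "\<delta> \<in> carrier SL2Z" "\<gamma> = \<delta> \<otimes>\<^bsub>SL2Z\<^esub> (S_mat \<otimes>\<^bsub>SL2Z\<^esub> T_pow n)"
      "2 * \<bar>\<delta>$2$1\<bar> \<le> \<bar>\<gamma>$2$1\<bar>"
      using SL2Z_euclid_step[OF less.prems False] by metis
    then show ?thesis
      using less.hyps[of \<delta>] assms(3)[of \<delta> n] False by auto
  qed
qed

section \<open>Automorphy factors and the action on the upper half plane\<close>

lemma aut_factor_one [simp]: "aut_factor \<one>\<^bsub>SL2Z\<^esub> \<tau> = 1"
  and moebius_one [simp]: "moebius_act \<one>\<^bsub>SL2Z\<^esub> \<tau> = \<tau>"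
  by (simp_all add: SL2Z_one aut_factor_def moebius_act_def)

lemma aut_factor_T [simp]: "aut_factor (T_pow n) \<tau> = 1"
  and moebius_T [simp]: "moebius_act (T_pow n) \<tau> = \<tau> + of_int n"
  and aut_factor_S [simp]: "aut_factor S_mat \<tau> = \<tau>"
  and moebius_S [simp]: "moebius_act S_mat \<tau> = - (1 / \<tau>)"
  by (simp_all add: T_pow_def S_mat_def aut_factor_def moebius_act_def)

lemma upper_half_plane_nonzero: "\<tau> \<in> upper_half_plane \<Longrightarrow> \<tau> \<noteq> 0"
  by (auto simp: upper_half_plane_def)

lemma open_upper_half_plane [simp]: "open upper_half_plane"
  unfolding upper_half_plane_def by (rule open_halfspace_Im_gt)

lemma aut_factor_inv:
  assumes "\<gamma> \<in> carrier SL2Z" "\<tau> \<in> upper_half_plane"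
  shows "aut_factor (inv\<^bsub>SL2Z\<^esub> \<gamma>) \<tau> * aut_factor \<gamma> (moebius_act (inv\<^bsub>SL2Z\<^esub> \<gamma>) \<tau>) = 1"
  using aut_factor_mult[of \<gamma> "inv\<^bsub>SL2Z\<^esub> \<gamma>" \<tau>] assms by (simp add: mult.commute)

lemma moebius_inv_cancel:
  assumes "\<gamma> \<in> carrier SL2Z" "\<tau> \<in> upper_half_plane"
  shows "moebius_act \<gamma> (moebius_act (inv\<^bsub>SL2Z\<^esub> \<gamma>) \<tau>) = \<tau>"
    and "moebius_act (inv\<^bsub>SL2Z\<^esub> \<gamma>) (moebius_act \<gamma> \<tau>) = \<tau>"
  using moebius_mult[of \<gamma> "inv\<^bsub>SL2Z\<^esub> \<gamma>" \<tau>] moebius_mult[of "inv\<^bsub>SL2Z\<^esub> \<gamma>" \<gamma> \<tau>] assms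
  by simp_all

text \<open>The difference of the two fractions, multiplied by both denominators, is det \<gamma>
  times x - \<tau>. This is what makes the powers of X - \<tau> transform well.\<close>

lemma moebius_diff:
  assumes "\<gamma> \<in> carrier SL2Z" "x \<in> upper_half_plane" "\<tau> \<in> upper_half_plane"
  shows "aut_factor \<gamma> x * aut_factor \<gamma> \<tau> * (moebius_act \<gamma> x - moebius_act \<gamma> \<tau>) = x - \<tau>"
proof -
  have num: "aut_factor \<gamma> z * moebius_act \<gamma> z = of_int (\<gamma>$1$1) * z + of_int (\<gamma>$1$2)"
    if "z \<in> upper_half_plane" for z
    using aut_factor_nonzero[OF assms(1) that] by (simp add: moebius_act_def aut_factor_def)
  have "(of_int (\<gamma>$1$1 * \<gamma>$2$2 - \<gamma>$1$2 * \<gamma>$2$1) :: complex) = 1"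
    using assms(1) by (simp only: SL2Z_iff of_int_1)
  then have det: "of_int (\<gamma>$1$1) * of_int (\<gamma>$2$2) - of_int (\<gamma>$1$2) * of_int (\<gamma>$2$1) = (1 :: complex)"
    by simp
  have "aut_factor \<gamma> x * aut_factor \<gamma> \<tau> * (moebius_act \<gamma> x - moebius_act \<gamma> \<tau>)
     = (aut_factor \<gamma> x * moebius_act \<gamma> x) * aut_factor \<gamma> \<tau> - (aut_factor \<gamma> \<tau> * moebius_act \<gamma> \<tau>) * aut_factor \<gamma> x"
    by (simp add: algebra_simps)
  also have "\<dots> = (of_int (\<gamma>$1$1) * of_int (\<gamma>$2$2) - of_int (\<gamma>$1$2) * of_int (\<gamma>$2$1)) * (x - \<tau>)"
    unfolding num[OF assms(2)] num[OF assms(3)] by (simp add: aut_factor_def algebra_simps)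
  finally show ?thesis by (simp add: det)
qed

lemma holomorphic_aut_factor [holomorphic_intros]: "aut_factor \<gamma> holomorphic_on A"
  unfolding aut_factor_def by (intro holomorphic_intros)


section \<open>Cosets and bottom rows\<close>

abbreviation cosets :: "(int^2^2) set set" where
  "cosets \<equiv> rcosets\<^bsub>SL2Z\<^esub> Gamma_inf"

lemma coset_rep:
  assumes "C \<in> cosets"
  shows "coset_rep C \<in> carrier SL2Z" "C = Gamma_inf #>\<^bsub>SL2Z\<^esub> coset_rep C"
proof -
  obtain g where g: "g \<in> carrier SL2Z" "C = Gamma_inf #>\<^bsub>SL2Z\<^esub> g"
    using assms by (auto simp: RCOSETS_def)
  then have "g \<in> C" using SL.rcos_self subgroup_Gamma_inf by blast
  then have "coset_rep C \<in> C" unfolding coset_rep_def by (rule someI)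
  then show "C = Gamma_inf #>\<^bsub>SL2Z\<^esub> coset_rep C"
    using SL.repr_independence g subgroup_Gamma_inf by blast
  show "coset_rep C \<in> carrier SL2Z"
    using \<open>coset_rep C \<in> C\<close> assms subgroup.rcosets_carrier[OF subgroup_Gamma_inf group_SL2Z] by blast
qed

text \<open>The chosen representative of a translated coset is the translate of the chosen
  representative only up to \<open>Gamma_inf\<close> on the left. Hence each series needs terms that
  are invariant under \<open>Gamma_inf\<close>.\<close>

lemma coset_rep_translate:
  assumes "C \<in> cosets" "\<gamma> \<in> carrier SL2Z"
  obtains t where "t \<in> Gamma_inf"
    "coset_rep (C #>\<^bsub>SL2Z\<^esub> \<gamma>) = t \<otimes>\<^bsub>SL2Z\<^esub> (coset_rep C \<otimes>\<^bsub>SL2Z\<^esub> \<gamma>)"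
proof -
  let ?g = "coset_rep C \<otimes>\<^bsub>SL2Z\<^esub> \<gamma>"
  have sub: "Gamma_inf \<subseteq> carrier SL2Z" using Gamma_inf_carrier by blast
  have eq: "C #>\<^bsub>SL2Z\<^esub> \<gamma> = Gamma_inf #>\<^bsub>SL2Z\<^esub> ?g"
    using coset_rep[OF assms(1)] assms(2) sub by (metis SL.coset_mult_assoc)
  then have mem: "C #>\<^bsub>SL2Z\<^esub> \<gamma> \<in> cosets"
    using coset_rep[OF assms(1)] assms(2) sub by (simp add: SL.rcosetsI)
  have "coset_rep (C #>\<^bsub>SL2Z\<^esub> \<gamma>) \<in> Gamma_inf #>\<^bsub>SL2Z\<^esub> ?g"
    using coset_rep[OF mem] eq SL.rcos_self[OF _ subgroup_Gamma_inf] by metis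
  then show ?thesis using that by (auto simp: r_coset_def)
qed

lemma Gamma_inf_in_cosets: "Gamma_inf \<in> cosets"
  using subgroup.subgroup_in_rcosets[OF subgroup_Gamma_inf group_SL2Z] by blast

lemma coset_rep_Gamma_inf: "coset_rep Gamma_inf \<in> Gamma_inf"
  unfolding coset_rep_def
  by (rule someI[of _ "\<one>\<^bsub>SL2Z\<^esub>"]) (rule subgroup.one_closed[OF subgroup_Gamma_inf])

lemma bij_betw_coset_translate:
  assumes "\<gamma> \<in> carrier SL2Z"
  shows "bij_betw (\<lambda>C. C #>\<^bsub>SL2Z\<^esub> \<gamma>) cosets cosets"
proof (rule bij_betw_byWitness[where f' = "\<lambda>C. C #>\<^bsub>SL2Z\<^esub> inv\<^bsub>SL2Z\<^esub> \<gamma>"])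
  have sub: "C \<subseteq> carrier SL2Z" if "C \<in> cosets" for C
    using that subgroup.rcosets_carrier[OF subgroup_Gamma_inf group_SL2Z] by blast
  have G: "Gamma_inf \<subseteq> carrier SL2Z" using Gamma_inf_carrier by blast
  have cancel: "C #>\<^bsub>SL2Z\<^esub> g #>\<^bsub>SL2Z\<^esub> h = C"
    if "C \<in> cosets" "g \<in> carrier SL2Z" "h \<in> carrier SL2Z" "g \<otimes>\<^bsub>SL2Z\<^esub> h = \<one>\<^bsub>SL2Z\<^esub>" for C g h
    using SL.coset_mult_assoc[OF sub[OF that(1)] that(2,3)] SL.coset_mult_one[OF sub[OF that(1)]]
    by (simp only: that(4))
  show "\<forall>C\<in>cosets. C #>\<^bsub>SL2Z\<^esub> \<gamma> #>\<^bsub>SL2Z\<^esub> inv\<^bsub>SL2Z\<^esub> \<gamma> = C"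
    using assms by (intro ballI cancel SL.r_inv SL.inv_closed)
  show "\<forall>C\<in>cosets. C #>\<^bsub>SL2Z\<^esub> inv\<^bsub>SL2Z\<^esub> \<gamma> #>\<^bsub>SL2Z\<^esub> \<gamma> = C"
    using assms by (intro ballI cancel SL.l_inv SL.inv_closed)
  have mem: "C #>\<^bsub>SL2Z\<^esub> \<delta> \<in> cosets" if C: "C \<in> cosets" "\<delta> \<in> carrier SL2Z" for C \<delta>
  proof -
    obtain g where g: "g \<in> carrier SL2Z" "C = Gamma_inf #>\<^bsub>SL2Z\<^esub> g"
      using coset_rep[OF C(1)] by blast
    then have "C #>\<^bsub>SL2Z\<^esub> \<delta> = Gamma_inf #>\<^bsub>SL2Z\<^esub> (g \<otimes>\<^bsub>SL2Z\<^esub> \<delta>)"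
      using SL.coset_mult_assoc[OF G g(1) C(2)] by simp
    then show ?thesis
      using SL.rcosetsI[OF G SL.m_closed[OF g(1) C(2)]] by simp
  qed
  show "(\<lambda>C. C #>\<^bsub>SL2Z\<^esub> \<gamma>) ` cosets \<subseteq> cosets"
    using mem assms by blast
  show "(\<lambda>C. C #>\<^bsub>SL2Z\<^esub> inv\<^bsub>SL2Z\<^esub> \<gamma>) ` cosets \<subseteq> cosets"
    using mem SL.inv_closed[OF assms] by blast
qed

text \<open>For equal bottom rows the quotient of two representatives has lower left entry 0 and
  lies in \<open>Gamma_inf\<close>. Sums over cosets are thereby dominated by sums over pairs of
  integers.\<close>

lemma inj_on_bottom_row:
  "inj_on (\<lambda>C. (coset_rep C $ 2 $ 1, coset_rep C $ 2 $ 2)) cosets"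
proof (rule inj_onI)
  fix C D assume C: "C \<in> cosets" and D: "D \<in> cosets"
    and eq: "(coset_rep C $ 2 $ 1, coset_rep C $ 2 $ 2) = (coset_rep D $ 2 $ 1, coset_rep D $ 2 $ 2)"
  note c = coset_rep[OF C] and d = coset_rep[OF D]
  let ?t = "coset_rep C \<otimes>\<^bsub>SL2Z\<^esub> inv\<^bsub>SL2Z\<^esub> coset_rep D"
  have "?t \<in> carrier SL2Z" using c d by simp
  moreover have "?t$2$1 = 0"
    using c d eq by (simp add: SL2Z_mult_nth SL2Z_inv)
  ultimately have "?t \<in> Gamma_inf"
    by (simp add: Gamma_inf_iff_lower_left)
  moreover have "coset_rep C = ?t \<otimes>\<^bsub>SL2Z\<^esub> coset_rep D"
    using c d by (simp add: SL.m_assoc)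
  ultimately have "coset_rep C \<in> Gamma_inf #>\<^bsub>SL2Z\<^esub> coset_rep D"
    by (auto simp: r_coset_def)
  then show "C = D"
    using c d SL.repr_independence subgroup_Gamma_inf by metis
qed

text \<open>A measure of size for a bottom row that does not involve \<tau>. It is the common scale
  for cocycles and for automorphy factors.\<close>

definition height :: "int^2^2 \<Rightarrow> real" where
  "height \<gamma> = \<bar>of_int (\<gamma>$2$1)\<bar> + \<bar>of_int (\<gamma>$2$2)\<bar>"

lemma height_ge_1:
  assumes "\<gamma> \<in> carrier SL2Z"
  shows "height \<gamma> \<ge> 1"
proof -
  have "\<gamma>$2$1 \<noteq> 0 \<or> \<gamma>$2$2 \<noteq> 0"
    using assms by (auto simp: SL2Z_iff)
  then have "\<bar>\<gamma>$2$1\<bar> + \<bar>\<gamma>$2$2\<bar> \<ge> 1" by linarith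
  then have "real_of_int (\<bar>\<gamma>$2$1\<bar> + \<bar>\<gamma>$2$2\<bar>) \<ge> 1" by linarith
  then show ?thesis by (simp add: height_def)
qed

text \<open>The exponent 4 is convenient because (1 + |c|)^2 (1 + |d|)^2 is at most 16 times the
  fourth power of the height, so the double sum is dominated by a product of two convergent single
  sums.\<close>

lemma summable_height: "(\<lambda>C. 1 / height (coset_rep C) ^ 4) summable_on cosets"
proof -
  define f :: "int \<times> int \<Rightarrow> real" where
    "f = (\<lambda>(c, d). (1 / (1 + \<bar>of_int c\<bar>)\<^sup>2) * (1 / (1 + \<bar>of_int d\<bar>)\<^sup>2))"
  have nat: "(\<lambda>n::nat. 1 / (1 + real n)\<^sup>2) summable_on UNIV"
  proof (rule norm_summable_imp_summable_on)
    have "summable (\<lambda>n. 1 / (real (n + 1))\<^sup>2)"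
      using summable_ignore_initial_segment[OF inverse_power_summable[of 2, where 'a = real], of 1]
      by (simp add: field_simps)
    then show "summable (\<lambda>n. norm (1 / (1 + real n)\<^sup>2))"
      by (simp add: add.commute)
  qed
  have "(\<lambda>c::int. 1 / (1 + \<bar>real_of_int c\<bar>)\<^sup>2) summable_on (range int \<union> range (\<lambda>n. - int n))"
  proof (rule summable_on_union)
    show "(\<lambda>c::int. 1 / (1 + \<bar>real_of_int c\<bar>)\<^sup>2) summable_on range int"
      using nat by (subst summable_on_reindex) (auto simp: o_def)
    show "(\<lambda>c::int. 1 / (1 + \<bar>real_of_int c\<bar>)\<^sup>2) summable_on range (\<lambda>n. - int n)"
      using nat by (subst summable_on_reindex) (auto simp: o_def inj_on_def)
  qed
  moreover have "range int \<union> range (\<lambda>n. - int n) = UNIV"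
  proof -
    have "z \<in> range int \<union> range (\<lambda>n. - int n)" for z :: int
      by (cases z rule: int_cases2) auto
    then show ?thesis by blast
  qed
  ultimately have 1: "(\<lambda>c::int. 1 / (1 + \<bar>real_of_int c\<bar>)\<^sup>2) summable_on UNIV" by simp
  define u :: "int \<Rightarrow> real" where "u = (\<lambda>c. 1 / (1 + \<bar>of_int c\<bar>)\<^sup>2)"
  have u: "u summable_on UNIV" "\<And>c. u c \<ge> 0" using 1 by (auto simp: u_def)
  have f_u: "f (c, d) = u c * u d" for c d by (simp add: f_def u_def)
  have "(\<lambda>x. norm (f x)) summable_on UNIV \<times> UNIV"
    unfolding Infinite_Sum.abs_summable_on_Sigma_iff
  proof (intro conjI ballI)
    show "(\<lambda>d. norm (f (c, d))) summable_on UNIV" for c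
      using u by (simp add: f_u abs_mult summable_on_cmult_right)
    have "(\<Sum>\<^sub>\<infinity>d. norm (f (c, d))) = u c * infsum u UNIV" for c
      using u by (simp add: f_u abs_mult infsum_cmult_right)
    moreover have "infsum u UNIV \<ge> 0" using u by (simp add: infsum_nonneg)
    ultimately show "(\<lambda>c. norm (\<Sum>\<^sub>\<infinity>d. norm (f (c, d)))) summable_on UNIV"
      using u by (simp add: abs_mult summable_on_cmult_left)
  qed
  then have "f summable_on UNIV \<times> UNIV"
    by (rule Infinite_Sum.abs_summable_summable)
  then have "f summable_on (\<lambda>C. (coset_rep C $ 2 $ 1, coset_rep C $ 2 $ 2)) ` cosets"
    by (rule summable_on_subset_banach) auto
  then have "(\<lambda>C. f (coset_rep C $ 2 $ 1, coset_rep C $ 2 $ 2)) summable_on cosets"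
    by (subst (asm) summable_on_reindex[OF inj_on_bottom_row]) (simp add: o_def)
  then have "(\<lambda>C. 16 * f (coset_rep C $ 2 $ 1, coset_rep C $ 2 $ 2)) summable_on cosets"
    by (rule summable_on_cmult_right)
  then show ?thesis
  proof (rule summable_on_comparison_test)
    fix C assume C: "C \<in> cosets"
    define h where "h = height (coset_rep C)"
    define c d where "c = \<bar>real_of_int (coset_rep C $ 2 $ 1)\<bar>" and "d = \<bar>real_of_int (coset_rep C $ 2 $ 2)\<bar>"
    have h: "h \<ge> 1" "h = c + d" "c \<ge> 0" "d \<ge> 0"
      using height_ge_1 coset_rep[OF C] by (auto simp: h_def height_def c_def d_def)
    have "(1 + c)\<^sup>2 * (1 + d)\<^sup>2 \<le> (2 * h)\<^sup>2 * (2 * h)\<^sup>2"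
      using h by (intro mult_mono power_mono) auto
    also have "\<dots> = 16 * h ^ 4" by (simp add: power2_eq_square power4_eq_xxxx)
    finally have "1 / h ^ 4 \<le> 16 * (1 / ((1 + c)\<^sup>2 * (1 + d)\<^sup>2))"
      using h by (simp add: field_simps)
    then show "1 / height (coset_rep C) ^ 4 \<le> 16 * f (coset_rep C $ 2 $ 1, coset_rep C $ 2 $ 2)"
      by (simp add: f_def h_def c_def d_def)
  qed auto
qed

section \<open>Series over cosets\<close>

text \<open>Locally bounded, and large both at the cusp and near the real line. Polynomial bounds in
  it survive products and turn into powers of Im \<tau> after the action of any \<gamma>, by
  \<open>growth_moebius\<close>.\<close>

definition growth :: "complex \<Rightarrow> real" where
  "growth \<tau> = (1 + norm \<tau>) * (1 + 1 / Im \<tau>)"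

lemma growth_ge_1: "\<tau> \<in> upper_half_plane \<Longrightarrow> growth \<tau> \<ge> 1"
  unfolding growth_def upper_half_plane_def
  using mult_mono[of 1 "1 + norm \<tau>" 1 "1 + 1 / Im \<tau>"] by simp

text \<open>The imaginary part of c \<tau> + d bounds |c|, and d is the difference of c \<tau> + d
  and c \<tau>. The lemma separates the dependence on \<tau> from that on \<gamma>.\<close>

lemma height_le_growth:
  assumes "\<gamma> \<in> carrier SL2Z" "\<tau> \<in> upper_half_plane"
  shows "height \<gamma> \<le> growth \<tau> * norm (aut_factor \<gamma> \<tau>)"
proof -
  define c d where "c = real_of_int (\<gamma>$2$1)" and "d = real_of_int (\<gamma>$2$2)"
  define w where "w = norm (aut_factor \<gamma> \<tau>)"
  define y where "y = Im \<tau>"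
  have y: "y > 0" using assms by (simp add: y_def upper_half_plane_def)
  have af: "aut_factor \<gamma> \<tau> = of_real c * \<tau> + of_real d"
    by (simp add: aut_factor_def c_def d_def)
  have "\<bar>Im (aut_factor \<gamma> \<tau>)\<bar> \<le> w"
    unfolding w_def by (rule abs_Im_le_cmod)
  then have c: "\<bar>c\<bar> \<le> w / y"
    using y by (simp add: af y_def abs_mult field_simps)
  have "norm (of_real d :: complex) = norm (aut_factor \<gamma> \<tau> - of_real c * \<tau>)"
    by (simp add: af)
  also have "\<dots> \<le> w + \<bar>c\<bar> * norm \<tau>"
    using norm_triangle_ineq4[of "aut_factor \<gamma> \<tau>" "of_real c * \<tau>"] by (simp add: w_def norm_mult)
  finally have "\<bar>c\<bar> + \<bar>d\<bar> \<le> w + \<bar>c\<bar> * (1 + norm \<tau>)"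
    by (simp add: algebra_simps)
  also have "\<dots> \<le> w + w / y * (1 + norm \<tau>)"
    using c by (intro add_left_mono mult_right_mono) auto
  also have "\<dots> \<le> growth \<tau> * w"
    using y by (simp add: growth_def y_def[symmetric] field_simps w_def)
  finally show ?thesis by (simp add: height_def c_def d_def w_def)
qed

definition height_bounded :: "nat \<Rightarrow> (int^2^2 \<Rightarrow> complex) \<Rightarrow> bool" where
  "height_bounded M a \<longleftrightarrow> (\<exists>K. \<forall>\<gamma>\<in>carrier SL2Z. norm (a \<gamma>) \<le> K * height \<gamma> ^ M)"

lemma height_boundedE:
  assumes "height_bounded M a"
  obtains K where "K \<ge> 0" "\<And>\<gamma>. \<gamma> \<in> carrier SL2Z \<Longrightarrow> norm (a \<gamma>) \<le> K * height \<gamma> ^ M"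
proof -
  obtain K where K: "\<And>\<gamma>. \<gamma> \<in> carrier SL2Z \<Longrightarrow> norm (a \<gamma>) \<le> K * height \<gamma> ^ M"
    using assms by (auto simp: height_bounded_def)
  have "norm (a \<gamma>) \<le> max K 0 * height \<gamma> ^ M" if "\<gamma> \<in> carrier SL2Z" for \<gamma>
    using K[OF that] height_ge_1[OF that]
    by (smt (verit) max_def mult_right_mono zero_le_power)
  then show ?thesis using that[of "max K 0"] by simp
qed

lemma height_bounded_mult:
  assumes "height_bounded M a" "height_bounded L b"
  shows "height_bounded (M + L) (\<lambda>\<gamma>. a \<gamma> * b \<gamma>)"
proof -
  obtain K where K: "K \<ge> 0" "\<And>\<gamma>. \<gamma> \<in> carrier SL2Z \<Longrightarrow> norm (a \<gamma>) \<le> K * height \<gamma> ^ M"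
    using height_boundedE[OF assms(1)] by metis
  obtain J where J: "J \<ge> 0" "\<And>\<gamma>. \<gamma> \<in> carrier SL2Z \<Longrightarrow> norm (b \<gamma>) \<le> J * height \<gamma> ^ L"
    using height_boundedE[OF assms(2)] by metis
  have "norm (a \<gamma> * b \<gamma>) \<le> (K * J) * height \<gamma> ^ (M + L)" if "\<gamma> \<in> carrier SL2Z" for \<gamma>
  proof -
    have "norm (a \<gamma>) * norm (b \<gamma>) \<le> (K * height \<gamma> ^ M) * (J * height \<gamma> ^ L)"
      using K J that height_ge_1[OF that] by (intro mult_mono) auto
    then show ?thesis by (simp add: norm_mult power_add mult_ac)
  qed
  then show ?thesis unfolding height_bounded_def by blast
qed

lemma height_bounded_mono:
  assumes "height_bounded M a" "M \<le> L"
  shows "height_bounded L a"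
proof -
  obtain K where K: "K \<ge> 0" "\<And>\<gamma>. \<gamma> \<in> carrier SL2Z \<Longrightarrow> norm (a \<gamma>) \<le> K * height \<gamma> ^ M"
    using height_boundedE[OF assms(1)] by metis
  have "norm (a \<gamma>) \<le> K * height \<gamma> ^ L" if "\<gamma> \<in> carrier SL2Z" for \<gamma>
    using K(2)[OF that] mult_left_mono[OF power_increasing[OF assms(2) height_ge_1[OF that]] K(1)]
    by linarith
  then show ?thesis unfolding height_bounded_def by blast
qed

lemma height_bounded_const: "height_bounded 0 (\<lambda>_. z)"
  unfolding height_bounded_def by auto

definition coset_series :: "nat \<Rightarrow> (int^2^2 \<Rightarrow> complex) \<Rightarrow> complex \<Rightarrow> complex" where
  "coset_series m a \<tau> =
     (\<Sum>\<^sub>\<infinity>C\<in>cosets. a (coset_rep C) * aut_factor (coset_rep C) \<tau> powi (- int m))"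

text \<open>By \<open>height_le_growth\<close> the inverse of the automorphy factor is at most
  growth divided by height. Of the m powers of the height in the denominator, M pay for the
  coefficient and at least 4 are left for summation.\<close>

lemma coset_term_bound:
  assumes "norm (a \<gamma>) \<le> K * height \<gamma> ^ M" "K \<ge> 0" "M + 4 \<le> m"
    and "\<gamma> \<in> carrier SL2Z" "\<tau> \<in> upper_half_plane"
  shows "norm (a \<gamma> * aut_factor \<gamma> \<tau> powi (- int m)) \<le> K * growth \<tau> ^ m * (1 / height \<gamma> ^ 4)"
proof -
  define w h where "w = norm (aut_factor \<gamma> \<tau>)" and "h = height \<gamma>"
  have w: "w > 0" using assms aut_factor_nonzero by (simp add: w_def)
  have h: "h \<ge> 1" using height_ge_1 assms by (simp add: h_def)
  have "h \<le> growth \<tau> * w" using height_le_growth assms by (simp add: w_def h_def)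
  then have "inverse w \<le> growth \<tau> / h"
    using w h by (simp add: field_simps)
  then have "inverse w ^ m \<le> (growth \<tau> / h) ^ m"
    using w by (intro power_mono) auto
  moreover have "norm (aut_factor \<gamma> \<tau> powi (- int m)) = inverse w ^ m"
    by (simp add: w_def norm_inverse norm_power power_int_minus power_inverse)
  ultimately have "norm (a \<gamma> * aut_factor \<gamma> \<tau> powi (- int m)) \<le> (K * h ^ M) * (growth \<tau> / h) ^ m"
    using assms(1,2) h w unfolding norm_mult h_def by (intro mult_mono) auto
  also have "\<dots> = K * growth \<tau> ^ m * (h ^ M / h ^ m)"
    by (simp add: power_divide)
  also have "h ^ M / h ^ m \<le> 1 / h ^ 4"
  proof -
    have "h ^ (M + 4) \<le> h ^ m" using h assms by (intro power_increasing) auto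
    then show ?thesis using h by (simp add: power_add field_simps)
  qed
  finally show ?thesis
    using assms growth_ge_1[OF assms(5)] by (simp add: h_def mult_left_mono)
qed

lemma
  assumes "height_bounded M a" "M + 4 \<le> m"
  shows coset_series_summable: "\<tau> \<in> upper_half_plane \<Longrightarrow>
      (\<lambda>C. norm (a (coset_rep C) * aut_factor (coset_rep C) \<tau> powi (- int m))) summable_on cosets"
    and coset_series_growth: "\<exists>K. \<forall>\<tau>\<in>upper_half_plane. norm (coset_series m a \<tau>) \<le> K * growth \<tau> ^ m"
proof -
  obtain K where K: "K \<ge> 0" "\<And>\<gamma>. \<gamma> \<in> carrier SL2Z \<Longrightarrow> norm (a \<gamma>) \<le> K * height \<gamma> ^ M"
    using height_boundedE[OF assms(1)] by metis
  define t where "t = (\<lambda>C \<tau>. a (coset_rep C) * aut_factor (coset_rep C) \<tau> powi (- int m))"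
  have bound: "norm (t C \<tau>) \<le> K * growth \<tau> ^ m * (1 / height (coset_rep C) ^ 4)"
    if "C \<in> cosets" "\<tau> \<in> upper_half_plane" for C \<tau>
    unfolding t_def using K coset_rep that assms(2) by (intro coset_term_bound) auto
  have sum: "(\<lambda>C. B * (1 / height (coset_rep C) ^ 4)) summable_on cosets" for B
    by (intro summable_on_cmult_right summable_height)
  have summ: "(\<lambda>C. norm (t C \<tau>)) summable_on cosets" if "\<tau> \<in> upper_half_plane" for \<tau>
    by (rule summable_on_comparison_test[OF sum[of "K * growth \<tau> ^ m"]]) (use bound that in auto)
  then show "\<tau> \<in> upper_half_plane \<Longrightarrow>
      (\<lambda>C. norm (a (coset_rep C) * aut_factor (coset_rep C) \<tau> powi (- int m))) summable_on cosets"
    by (simp add: t_def)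
  define Z where "Z = (\<Sum>\<^sub>\<infinity>C\<in>cosets. 1 / height (coset_rep C) ^ 4)"
  have "norm (coset_series m a \<tau>) \<le> (K * Z) * growth \<tau> ^ m" if "\<tau> \<in> upper_half_plane" for \<tau>
  proof -
    have "norm (infsum (\<lambda>C. t C \<tau>) cosets) \<le> (\<Sum>\<^sub>\<infinity>C\<in>cosets. norm (t C \<tau>))"
      by (rule norm_infsum_bound[OF summ[OF that]])
    also have "\<dots> \<le> (\<Sum>\<^sub>\<infinity>C\<in>cosets. (K * growth \<tau> ^ m) * (1 / height (coset_rep C) ^ 4))"
      using summ[OF that] sum[of "K * growth \<tau> ^ m"] bound[OF _ that]
      by (intro infsum_mono) auto
    also have "\<dots> = (K * growth \<tau> ^ m) * Z"
      unfolding Z_def by (rule infsum_cmult_right) (simp add: summable_height)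
    finally show ?thesis by (simp add: coset_series_def t_def mult_ac)
  qed
  then show "\<exists>K. \<forall>\<tau>\<in>upper_half_plane. norm (coset_series m a \<tau>) \<le> K * growth \<tau> ^ m" by blast
qed

text \<open>On a small closed disc the growth function is bounded, so the terms have a summable
  majorant there and the finite partial sums converge uniformly.\<close>

lemma coset_series_holomorphic:
  assumes "height_bounded M a" "M + 4 \<le> m"
  shows "coset_series m a holomorphic_on upper_half_plane"
proof -
  obtain K where K: "K \<ge> 0" "\<And>\<gamma>. \<gamma> \<in> carrier SL2Z \<Longrightarrow> norm (a \<gamma>) \<le> K * height \<gamma> ^ M"
    using height_boundedE[OF assms(1)] by metis
  define t where "t = (\<lambda>C \<tau>. a (coset_rep C) * aut_factor (coset_rep C) \<tau> powi (- int m))"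
  have hol: "t C holomorphic_on upper_half_plane" if "C \<in> cosets" for C
    unfolding t_def using aut_factor_nonzero coset_rep(1)[OF that]
    by (intro holomorphic_intros) auto
  have "coset_series m a field_differentiable at z" if z: "z \<in> upper_half_plane" for z
  proof -
    obtain r where r: "r > 0" "cball z r \<subseteq> upper_half_plane"
      using open_contains_cball open_upper_half_plane z by blast
    have "continuous_on (cball z r) growth"
      unfolding growth_def using r by (intro continuous_intros) (force simp: upper_half_plane_def)+
    then have "bounded (growth ` cball z r)"
      by (intro compact_imp_bounded compact_continuous_image) auto
    then obtain G where G: "\<And>\<tau>. \<tau> \<in> cball z r \<Longrightarrow> norm (growth \<tau>) \<le> G"
      unfolding bounded_iff by (metis imageI)
    have bound: "norm (t C \<tau>) \<le> K * G ^ m * (1 / height (coset_rep C) ^ 4)"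
      if "C \<in> cosets" "\<tau> \<in> cball z r" for C \<tau>
    proof -
      have \<tau>: "\<tau> \<in> upper_half_plane" using that r by blast
      have "norm (t C \<tau>) \<le> K * growth \<tau> ^ m * (1 / height (coset_rep C) ^ 4)"
        unfolding t_def using K coset_rep that assms(2) \<tau> by (intro coset_term_bound) auto
      also have "growth \<tau> ^ m \<le> G ^ m"
        using G[OF that(2)] growth_ge_1[OF \<tau>] by (intro power_mono) auto
      finally show ?thesis
        using K by (simp add: divide_right_mono mult_left_mono)
    qed
    have ulim: "uniform_limit (cball z r) (\<lambda>X \<tau>. \<Sum>C\<in>X. t C \<tau>) (\<lambda>\<tau>. \<Sum>\<^sub>\<infinity>C\<in>cosets. t C \<tau>)
        (finite_subsets_at_top cosets)"
      by (rule Weierstrass_m_test_general[OF bound];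
          (assumption | intro summable_on_cmult_right summable_height))
    have ev: "\<forall>\<^sub>F X in finite_subsets_at_top cosets.
        continuous_on (cball z r) (\<lambda>\<tau>. \<Sum>C\<in>X. t C \<tau>) \<and> (\<lambda>\<tau>. \<Sum>C\<in>X. t C \<tau>) holomorphic_on ball z r"
    proof (rule eventually_finite_subsets_at_top_weakI)
      fix X assume "finite X" "X \<subseteq> cosets"
      then have "(\<lambda>\<tau>. \<Sum>C\<in>X. t C \<tau>) holomorphic_on cball z r"
        using hol r by (intro holomorphic_on_sum) (meson holomorphic_on_subset subsetD)
      then show "continuous_on (cball z r) (\<lambda>\<tau>. \<Sum>C\<in>X. t C \<tau>) \<and> (\<lambda>\<tau>. \<Sum>C\<in>X. t C \<tau>) holomorphic_on ball z r"
        using holomorphic_on_imp_continuous_on holomorphic_on_subset ball_subset_cball by blast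
    qed
    have "(\<lambda>\<tau>. \<Sum>\<^sub>\<infinity>C\<in>cosets. t C \<tau>) holomorphic_on ball z r"
      using holomorphic_uniform_limit[OF ev ulim] by auto
    then have "coset_series m a holomorphic_on ball z r"
      by (simp add: coset_series_def[abs_def] t_def)
    then show ?thesis
      using r holomorphic_on_imp_differentiable_at[of _ "ball z r"] by simp
  qed
  then show ?thesis
    by (auto simp: holomorphic_on_def intro: field_differentiable_at_within)
qed

text \<open>Right translation permutes the cosets, and the invariance of f absorbs the change of
  representatives. Every transformation law of a series below rests on this.\<close>

lemma infsum_cosets_translate:
  assumes "\<gamma> \<in> carrier SL2Z"
    and "\<And>t \<delta>. t \<in> Gamma_inf \<Longrightarrow> \<delta> \<in> carrier SL2Z \<Longrightarrow> f (t \<otimes>\<^bsub>SL2Z\<^esub> \<delta>) = f \<delta>"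
  shows "(\<Sum>\<^sub>\<infinity>C\<in>cosets. f (coset_rep C \<otimes>\<^bsub>SL2Z\<^esub> \<gamma>)) = (\<Sum>\<^sub>\<infinity>C\<in>cosets. f (coset_rep C))"
proof -
  have "(\<Sum>\<^sub>\<infinity>C\<in>cosets. f (coset_rep C)) = (\<Sum>\<^sub>\<infinity>C\<in>cosets. f (coset_rep (C #>\<^bsub>SL2Z\<^esub> \<gamma>)))"
    using infsum_reindex_bij_betw[OF bij_betw_coset_translate[OF assms(1)], of "\<lambda>C. f (coset_rep C)"]
    by simp
  also have "\<dots> = (\<Sum>\<^sub>\<infinity>C\<in>cosets. f (coset_rep C \<otimes>\<^bsub>SL2Z\<^esub> \<gamma>))"
  proof (rule infsum_cong)
    fix C assume C: "C \<in> cosets"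
    then obtain t where "t \<in> Gamma_inf"
      "coset_rep (C #>\<^bsub>SL2Z\<^esub> \<gamma>) = t \<otimes>\<^bsub>SL2Z\<^esub> (coset_rep C \<otimes>\<^bsub>SL2Z\<^esub> \<gamma>)"
      using coset_rep_translate[OF C assms(1)] by metis
    then show "f (coset_rep (C #>\<^bsub>SL2Z\<^esub> \<gamma>)) = f (coset_rep C \<otimes>\<^bsub>SL2Z\<^esub> \<gamma>)"
      using assms C coset_rep(1)[OF C] by simp
  qed
  finally show ?thesis by simp
qed

lemma aut_factor_Gamma_inf:
  assumes "t \<in> Gamma_inf"
  obtains s :: complex where "s = 1 \<or> s = - 1" "\<And>\<tau>. aut_factor t \<tau> = s"
    "\<And>\<gamma> \<tau>. aut_factor (t \<otimes>\<^bsub>SL2Z\<^esub> \<gamma>) \<tau> = s * aut_factor \<gamma> \<tau>"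
proof -
  from assms consider n where "t = mat2 1 n 0 1" | n where "t = mat2 (- 1) n 0 (- 1)"
    by (auto simp: Gamma_inf_iff)
  then show ?thesis
  proof cases
    case 1
    then show ?thesis by (intro that[of 1]) (auto simp: aut_factor_def SL2Z_mult_nth)
  next
    case 2
    then show ?thesis by (intro that[of "- 1"]) (auto simp: aut_factor_def SL2Z_mult_nth)
  qed
qed

lemma power_int_minus_one_even:
  fixes s z :: complex
  assumes "s = 1 \<or> s = - 1" "even k"
  shows "(s * z) powi k = z powi k"
  using assms by (auto simp: power_int_mult_distrib)


section \<open>Functions of polynomial growth on the upper half plane\<close>

definition poly_growth :: "(complex \<Rightarrow> complex) \<Rightarrow> bool" where
  "poly_growth f \<longleftrightarrow> (\<exists>K n. \<forall>\<tau>\<in>upper_half_plane. norm (f \<tau>) \<le> K * growth \<tau> ^ n)"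

text \<open>As growth is at least 1, the exponent may be raised freely. The bound is given for all
  larger exponents at once so that bounds with different exponents can be combined.\<close>

lemma poly_growthE:
  assumes "poly_growth f"
  obtains K n where "K \<ge> 0" "\<And>\<tau> m. \<tau> \<in> upper_half_plane \<Longrightarrow> n \<le> m \<Longrightarrow> norm (f \<tau>) \<le> K * growth \<tau> ^ m"
proof -
  obtain K n where K: "\<And>\<tau>. \<tau> \<in> upper_half_plane \<Longrightarrow> norm (f \<tau>) \<le> K * growth \<tau> ^ n"
    using assms by (auto simp: poly_growth_def)
  have "norm (f \<tau>) \<le> \<bar>K\<bar> * growth \<tau> ^ m" if "\<tau> \<in> upper_half_plane" "n \<le> m" for \<tau> m
  proof -
    have "K * growth \<tau> ^ n \<le> \<bar>K\<bar> * growth \<tau> ^ m"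
      using growth_ge_1[OF that(1)] that(2) by (intro mult_mono power_increasing) auto
    then show ?thesis using K[OF that(1)] by linarith
  qed
  then show ?thesis using that[of "\<bar>K\<bar>" n] by simp
qed

lemma poly_growth_const: "poly_growth (\<lambda>_. c)"
  unfolding poly_growth_def by (intro exI[of _ "norm c"] exI[of _ 0]) auto

lemma poly_growth_ident: "poly_growth (\<lambda>\<tau>. \<tau>)"
proof -
  have "norm \<tau> \<le> 1 * growth \<tau> ^ 1" if "\<tau> \<in> upper_half_plane" for \<tau>
  proof -
    have "(1 + norm \<tau>) * 1 \<le> growth \<tau>"
      unfolding growth_def using that by (intro mult_left_mono) (auto simp: upper_half_plane_def)
    then show ?thesis by simp
  qed
  then show ?thesis unfolding poly_growth_def by blast
qed

lemma poly_growth_add: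
  assumes "poly_growth f" "poly_growth g"
  shows "poly_growth (\<lambda>\<tau>. f \<tau> + g \<tau>)"
proof -
  obtain K n where K: "K \<ge> 0" "\<And>\<tau> m. \<tau> \<in> upper_half_plane \<Longrightarrow> n \<le> m \<Longrightarrow> norm (f \<tau>) \<le> K * growth \<tau> ^ m"
    using poly_growthE[OF assms(1)] by metis
  obtain K' n' where K': "K' \<ge> 0" "\<And>\<tau> m. \<tau> \<in> upper_half_plane \<Longrightarrow> n' \<le> m \<Longrightarrow> norm (g \<tau>) \<le> K' * growth \<tau> ^ m"
    using poly_growthE[OF assms(2)] by metis
  have "norm (f \<tau> + g \<tau>) \<le> (K + K') * growth \<tau> ^ (n + n')" if "\<tau> \<in> upper_half_plane" for \<tau>
    using K(2)[OF that, of "n + n'"] K'(2)[OF that, of "n + n'"] norm_triangle_ineq[of "f \<tau>" "g \<tau>"]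
    by (simp add: algebra_simps)
  then show ?thesis unfolding poly_growth_def by blast
qed

lemma poly_growth_mult:
  assumes "poly_growth f" "poly_growth g"
  shows "poly_growth (\<lambda>\<tau>. f \<tau> * g \<tau>)"
proof -
  obtain K n where K: "K \<ge> 0" "\<And>\<tau> m. \<tau> \<in> upper_half_plane \<Longrightarrow> n \<le> m \<Longrightarrow> norm (f \<tau>) \<le> K * growth \<tau> ^ m"
    using poly_growthE[OF assms(1)] by metis
  obtain K' n' where K': "K' \<ge> 0" "\<And>\<tau> m. \<tau> \<in> upper_half_plane \<Longrightarrow> n' \<le> m \<Longrightarrow> norm (g \<tau>) \<le> K' * growth \<tau> ^ m"
    using poly_growthE[OF assms(2)] by metis
  have "norm (f \<tau> * g \<tau>) \<le> (K * K') * growth \<tau> ^ (n + n')" if "\<tau> \<in> upper_half_plane" for \<tau>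
  proof -
    have "norm (f \<tau>) * norm (g \<tau>) \<le> (K * growth \<tau> ^ n) * (K' * growth \<tau> ^ n')"
      using K K' that growth_ge_1[OF that] by (intro mult_mono) auto
    then show ?thesis by (simp add: norm_mult power_add mult_ac)
  qed
  then show ?thesis unfolding poly_growth_def by blast
qed

lemma poly_growth_sum:
  "(\<And>i. i \<in> I \<Longrightarrow> poly_growth (f i)) \<Longrightarrow> poly_growth (\<lambda>\<tau>. \<Sum>i\<in>I. f i \<tau>)"
  by (induction I rule: infinite_finite_induct) (auto intro: poly_growth_const poly_growth_add)

lemma poly_growth_coset_series:
  assumes "height_bounded M a" "M + 4 \<le> m"
  shows "poly_growth (coset_series m a)"
  using coset_series_growth[OF assms] unfolding poly_growth_def by blast

text \<open>The constant K may depend on \<gamma> and on the strip, but the powers of Im \<tau> do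
  not. This matches moderate growth, which asks for a single exponent for all \<gamma>.\<close>

lemma growth_moebius:
  assumes "\<gamma> \<in> carrier SL2Z" "bounded B"
  obtains K where "K \<ge> 1" "\<And>\<tau>. Im \<tau> \<ge> 1 \<Longrightarrow> Re \<tau> \<in> B \<Longrightarrow>
      growth (moebius_act \<gamma> \<tau>) \<le> K * Im \<tau> ^ 2 \<and> norm (aut_factor \<gamma> \<tau>) \<ge> 1 \<and> norm (aut_factor \<gamma> \<tau>) \<le> K * Im \<tau>"
proof -
  obtain R where R: "\<And>x. x \<in> B \<Longrightarrow> norm x \<le> R"
    using assms(2) unfolding bounded_iff by blast
  define R' where "R' = \<bar>R\<bar> + 1"
  define a b c d where "a = real_of_int (\<gamma>$1$1)" and "b = real_of_int (\<gamma>$1$2)"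
    and "c = real_of_int (\<gamma>$2$1)" and "d = real_of_int (\<gamma>$2$2)"
  define C1 C2 where "C1 = (\<bar>a\<bar> + \<bar>b\<bar>) * R'" and "C2 = (\<bar>c\<bar> + \<bar>d\<bar>) * R'"
  have C: "C1 \<ge> 0" "C2 \<ge> 0" by (auto simp: C1_def C2_def R'_def)
  have main: "growth (moebius_act \<gamma> \<tau>) \<le> (1 + C1) * (1 + C2\<^sup>2) * Im \<tau> ^ 2
      \<and> norm (aut_factor \<gamma> \<tau>) \<ge> 1 \<and> norm (aut_factor \<gamma> \<tau>) \<le> C2 * Im \<tau>"
    if \<tau>: "Im \<tau> \<ge> 1" "Re \<tau> \<in> B" for \<tau>
  proof -
    define y where "y = Im \<tau>"
    define w where "w = norm (aut_factor \<gamma> \<tau>)"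
    have y: "y \<ge> 1" using \<tau> by (simp add: y_def)
    have H: "\<tau> \<in> upper_half_plane" using \<tau> by (simp add: upper_half_plane_def)
    have "norm \<tau> \<le> \<bar>Re \<tau>\<bar> + \<bar>Im \<tau>\<bar>" by (rule cmod_le)
    also have "\<dots> \<le> \<bar>R\<bar> * 1 + y" using R[OF \<tau>(2)] y by (simp add: y_def)
    also have "\<dots> \<le> \<bar>R\<bar> * y + y" using y by (intro add_right_mono mult_left_mono) auto
    finally have n\<tau>: "norm \<tau> \<le> R' * y" by (simp add: R'_def algebra_simps)
    have R'y: "1 \<le> R' * y"
      using mult_mono[of 1 R' 1 y] y by (simp add: R'_def)
    have lin: "norm (of_real u * \<tau> + of_real v) \<le> (\<bar>u\<bar> + \<bar>v\<bar>) * R' * y" for u v :: real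
    proof -
      have "norm (of_real u * \<tau> + of_real v) \<le> \<bar>u\<bar> * norm \<tau> + \<bar>v\<bar> * 1"
        using norm_triangle_ineq[of "of_real u * \<tau>" "of_real v"] by (simp add: norm_mult)
      also have "\<dots> \<le> \<bar>u\<bar> * (R' * y) + \<bar>v\<bar> * (R' * y)"
        using n\<tau> R'y by (intro add_mono mult_left_mono) auto
      finally show ?thesis by (simp add: algebra_simps)
    qed
    have w_le: "w \<le> C2 * y"
      using lin[of c d] by (simp add: w_def C2_def aut_factor_def c_def d_def)
    \<comment> \<open>Either c = 0 and then |d| = 1, or |c| is at least 1 and the imaginary part
      alone exceeds 1.\<close>
    have w1: "w \<ge> 1"
    proof (cases "\<gamma>$2$1 = 0")
      case True
      then have "\<bar>\<gamma>$2$2\<bar> = 1"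
        using assms(1) unfolding SL2Z_iff by (auto simp: zmult_eq_1_iff)
      then have "\<bar>real_of_int (\<gamma>$2$2)\<bar> = 1" by linarith
      then show ?thesis using True by (simp add: w_def aut_factor_def)
    next
      case False
      then have "\<bar>\<gamma>$2$1\<bar> \<ge> 1" by linarith
      then have "\<bar>c\<bar> \<ge> 1" unfolding c_def by linarith
      then have "1 \<le> \<bar>c\<bar> * y" using mult_mono[of 1 "\<bar>c\<bar>" 1 y] y by simp
      also have "\<dots> = \<bar>Im (aut_factor \<gamma> \<tau>)\<bar>"
        using y by (simp add: aut_factor_def c_def y_def abs_mult)
      also have "\<dots> \<le> w" unfolding w_def by (rule abs_Im_le_cmod)
      finally show ?thesis .
    qed
    have "norm (moebius_act \<gamma> \<tau>) = norm (of_real a * \<tau> + of_real b) / w"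
      by (simp add: moebius_act_def w_def aut_factor_def a_def b_def norm_divide)
    also have "\<dots> \<le> norm (of_real a * \<tau> + of_real b)"
      using w1 by (simp add: divide_le_eq mult_le_cancel_left1)
    also have "\<dots> \<le> C1 * y" using lin[of a b] by (simp add: C1_def)
    finally have 1: "1 + norm (moebius_act \<gamma> \<tau>) \<le> (1 + C1) * y"
      using y by (simp add: algebra_simps)
    have "1 / Im (moebius_act \<gamma> \<tau>) = w ^ 2 / y"
      using Im_moebius[OF assms(1)] by (simp add: w_def y_def)
    also have "\<dots> \<le> (C2 * y) ^ 2 / y"
      using w_le w1 y by (intro divide_right_mono power_mono) auto
    also have "\<dots> = C2\<^sup>2 * y" using y by (simp add: power2_eq_square)
    finally have 2: "1 + 1 / Im (moebius_act \<gamma> \<tau>) \<le> (1 + C2\<^sup>2) * y"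
      using y by (simp add: algebra_simps)
    have "growth (moebius_act \<gamma> \<tau>) \<le> ((1 + C1) * y) * ((1 + C2\<^sup>2) * y)"
      unfolding growth_def using 1 2 C y moebius_upper_half_plane[OF assms(1) H]
      by (intro mult_mono) (auto simp: upper_half_plane_def)
    then show ?thesis using w1 w_le by (simp add: w_def y_def power2_eq_square mult_ac)
  qed
  define K where "K = (1 + C1) * (1 + C2\<^sup>2) + C2"
  have "K \<ge> 1"
    using mult_mono[of 1 "1 + C1" 1 "1 + C2\<^sup>2"] C by (simp add: K_def)
  moreover have "growth (moebius_act \<gamma> \<tau>) \<le> K * Im \<tau> ^ 2 \<and> norm (aut_factor \<gamma> \<tau>) \<ge> 1
      \<and> norm (aut_factor \<gamma> \<tau>) \<le> K * Im \<tau>" if \<tau>: "Im \<tau> \<ge> 1" "Re \<tau> \<in> B" for \<tau>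
  proof -
    have "(1 + C1) * (1 + C2\<^sup>2) * Im \<tau> ^ 2 \<le> K * Im \<tau> ^ 2" "C2 * Im \<tau> \<le> K * Im \<tau>"
      using C \<tau> by (auto simp: K_def intro!: mult_right_mono)
    then show ?thesis using main[OF \<tau>] by linarith
  qed
  ultimately show ?thesis using that by blast
qed

text \<open>The exponent 2 n comes from \<open>growth_moebius\<close>. The summand |k| covers both
  signs of k: the automorphy factor has modulus between 1 and a multiple of Im \<tau>, so a negative
  power of it is at most 1.\<close>

lemma slash_bound:
  fixes F :: "complex \<Rightarrow> real"
  assumes "K \<ge> 0" "\<And>\<tau>. \<tau> \<in> upper_half_plane \<Longrightarrow> F \<tau> \<le> K * growth \<tau> ^ n"
    and "\<gamma> \<in> carrier SL2Z" "bounded B"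
  obtains J where "\<And>\<tau>. Im \<tau> \<ge> 1 \<Longrightarrow> Re \<tau> \<in> B \<Longrightarrow>
    norm (aut_factor \<gamma> \<tau> powi (- k)) * F (moebius_act \<gamma> \<tau>) \<le> J * Im \<tau> ^ (2 * n + nat \<bar>k\<bar>)"
proof -
  obtain L where L: "L \<ge> 1" "\<And>\<tau>. Im \<tau> \<ge> 1 \<Longrightarrow> Re \<tau> \<in> B \<Longrightarrow>
      growth (moebius_act \<gamma> \<tau>) \<le> L * Im \<tau> ^ 2 \<and> norm (aut_factor \<gamma> \<tau>) \<ge> 1 \<and> norm (aut_factor \<gamma> \<tau>) \<le> L * Im \<tau>"
    using growth_moebius[OF assms(3,4)] by metis
  show ?thesis
  proof (rule that)
    fix \<tau> assume \<tau>: "Im \<tau> \<ge> 1" "Re \<tau> \<in> B"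
    have H: "moebius_act \<gamma> \<tau> \<in> upper_half_plane"
      using \<tau> by (intro moebius_upper_half_plane assms) (simp add: upper_half_plane_def)
    define w where "w = norm (aut_factor \<gamma> \<tau>)"
    have w: "1 \<le> w" "w \<le> L * Im \<tau>" using L(2)[OF \<tau>] by (auto simp: w_def)
    have 1: "norm (aut_factor \<gamma> \<tau> powi (- k)) \<le> (L * Im \<tau>) ^ nat \<bar>k\<bar>"
    proof -
      have "norm (aut_factor \<gamma> \<tau> powi (- k)) = w powi (- k)"
        by (simp add: w_def norm_power_int)
      also have "\<dots> \<le> w powi (int (nat \<bar>k\<bar>))"
        using w by (intro power_int_increasing) auto
      also have "\<dots> \<le> (L * Im \<tau>) ^ nat \<bar>k\<bar>"
        using w by (simp only: power_int_of_nat) (intro power_mono, auto)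
      finally show ?thesis .
    qed
    have "F (moebius_act \<gamma> \<tau>) \<le> K * growth (moebius_act \<gamma> \<tau>) ^ n"
      by (rule assms(2)[OF H])
    also have "\<dots> \<le> K * (L * Im \<tau> ^ 2) ^ n"
      using L(2)[OF \<tau>] growth_ge_1[OF H] assms(1) by (intro mult_left_mono power_mono) auto
    finally have 2: "F (moebius_act \<gamma> \<tau>) \<le> K * (L * Im \<tau> ^ 2) ^ n" .
    have "norm (aut_factor \<gamma> \<tau> powi (- k)) * F (moebius_act \<gamma> \<tau>)
        \<le> norm (aut_factor \<gamma> \<tau> powi (- k)) * (K * (L * Im \<tau> ^ 2) ^ n)"
      by (rule mult_left_mono[OF 2]) simp
    also have "\<dots> \<le> (L * Im \<tau>) ^ nat \<bar>k\<bar> * (K * (L * Im \<tau> ^ 2) ^ n)"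
      using 1 assms(1) L(1) \<tau> by (intro mult_right_mono) auto
    also have "(L * Im \<tau> ^ 2) ^ n = L ^ n * Im \<tau> ^ (2 * n)"
      by (simp only: power_mult_distrib power_mult)
    also have "(L * Im \<tau>) ^ nat \<bar>k\<bar> * (K * (L ^ n * Im \<tau> ^ (2 * n)))
        = (L ^ nat \<bar>k\<bar> * K * L ^ n) * Im \<tau> ^ (2 * n + nat \<bar>k\<bar>)"
      by (simp add: power_mult_distrib power_add mult_ac)
    finally show "norm (aut_factor \<gamma> \<tau> powi (- k)) * F (moebius_act \<gamma> \<tau>)
        \<le> (L ^ nat \<bar>k\<bar> * K * L ^ n) * Im \<tau> ^ (2 * n + nat \<bar>k\<bar>)" .
  qed
qed

section \<open>Infinite products and the discriminant\<close>

text \<open>Majorants on compact sets give locally uniform convergence of the partial products. The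
  lemma serves both for the product as a function of w, as in theta, and as a function of q, as in
  \<Delta>.\<close>

lemma holomorphic_prodinf:
  fixes f :: "nat \<Rightarrow> complex \<Rightarrow> complex"
  assumes "open A" "\<And>n. f n holomorphic_on A"
    and "\<And>K. compact K \<Longrightarrow> K \<subseteq> A \<Longrightarrow> \<exists>M. summable M \<and> (\<forall>n. \<forall>x\<in>K. norm (f n x) \<le> M n)"
  shows "(\<lambda>x. \<Prod>n. 1 + f n x) holomorphic_on A"
proof -
  have lim: "(\<lambda>N. \<Prod>n<N. 1 + f n x) \<longlonglongrightarrow> (\<Prod>n. 1 + f n x)" if "x \<in> A" for x
  proof -
    have "\<exists>M. summable M \<and> (\<forall>n. \<forall>x\<in>{x}. norm (f n x) \<le> M n)"
      by (rule assms(3)) (use that in auto)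
    then obtain M where M: "summable M" "\<And>n. norm (f n x) \<le> M n"
      by blast
    have "summable (\<lambda>n. norm (1 + f n x - 1))"
      using M by (intro summable_comparison_test'[OF M(1)]) auto
    then have "convergent_prod (\<lambda>n. 1 + f n x)"
      by (intro abs_convergent_prod_imp_convergent_prod summable_imp_abs_convergent_prod)
    then show ?thesis
      using convergent_prod_LIMSEQ LIMSEQ_lessThan_iff_atMost by blast
  qed
  have "(\<lambda>x. \<Prod>n. 1 + f n x) field_differentiable at z" if z: "z \<in> A" for z
  proof -
    obtain r where r: "r > 0" "cball z r \<subseteq> A"
      using open_contains_cball assms(1) z by blast
    have "\<exists>M. summable M \<and> (\<forall>n. \<forall>x\<in>cball z r. norm (f n x) \<le> M n)"
      by (rule assms(3)) (use r in auto)
    then obtain M where M: "summable M" "\<And>n x. x \<in> cball z r \<Longrightarrow> norm (f n x) \<le> M n"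
      by blast
    have cont: "continuous_on (cball z r) (f n)" for n
      using assms(2) r by (meson holomorphic_on_imp_continuous_on continuous_on_subset)
    have "uniformly_convergent_on (cball z r) (\<lambda>N x. \<Sum>n<N. norm (f n x))"
      by (rule Weierstrass_m_test'[OF _ M(1)]) (use M(2) in auto)
    then have "uniformly_convergent_on (cball z r) (\<lambda>N x. \<Prod>n<N. 1 + f n x)"
      by (intro uniformly_convergent_on_prod cont) auto
    then obtain g where g: "uniform_limit (cball z r) (\<lambda>N x. \<Prod>n<N. 1 + f n x) g sequentially"
      by (auto simp: uniformly_convergent_on_def)
    have hol: "f n holomorphic_on ball z r" for n
      using assms(2)[of n] r by (meson holomorphic_on_subset subset_trans ball_subset_cball)
    have "\<forall>\<^sub>F N in sequentially. continuous_on (cball z r) (\<lambda>x. \<Prod>n<N. 1 + f n x)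
        \<and> (\<lambda>x. \<Prod>n<N. 1 + f n x) holomorphic_on ball z r"
      by (intro always_eventually allI conjI continuous_intros cont holomorphic_intros hol)
    then have "g holomorphic_on ball z r"
      using holomorphic_uniform_limit[OF _ g] by auto
    moreover have "g x = (\<Prod>n. 1 + f n x)" if "x \<in> ball z r" for x
    proof -
      have "(\<lambda>N. \<Prod>n<N. 1 + f n x) \<longlonglongrightarrow> g x"
        by (rule tendsto_uniform_limitI[OF g]) (use that in auto)
      then show ?thesis
        using lim[of x] that r by (metis LIMSEQ_unique ball_subset_cball subsetD)
    qed
    ultimately have "(\<lambda>x. \<Prod>n. 1 + f n x) holomorphic_on ball z r"
      by (rule holomorphic_transform) simp
    then show ?thesis
      using r holomorphic_on_imp_differentiable_at[of _ "ball z r"] by simp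
  qed
  then show ?thesis
    by (auto simp: holomorphic_on_def intro: field_differentiable_at_within)
qed

section \<open>The q-Pochhammer product of q w to the base q, and Euler's identity\<close>

definition qprod :: "complex \<Rightarrow> complex \<Rightarrow> complex" where
  "qprod q w = (\<Prod>n. 1 - q ^ Suc n * w)"

context
  fixes q :: complex
  assumes q: "norm q < 1"
begin

lemma qprod_convergent: "convergent_prod (\<lambda>n. 1 - q ^ Suc n * w)"
proof -
  have "summable (\<lambda>n. norm q ^ n * (norm q * norm w))"
    using q by (intro summable_mult2 summable_geometric) simp
  then have "summable (\<lambda>n. norm (1 - q ^ Suc n * w - 1))"
    by (simp add: norm_mult norm_power mult_ac)
  then show ?thesis
    by (intro abs_convergent_prod_imp_convergent_prod summable_imp_abs_convergent_prod)
qed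

lemma qprod_LIMSEQ: "(\<lambda>N. \<Prod>n<N. 1 - q ^ Suc n * w) \<longlonglongrightarrow> qprod q w"
  unfolding qprod_def using convergent_prod_LIMSEQ[OF qprod_convergent] LIMSEQ_lessThan_iff_atMost by blast

lemma qprod_nonzero: "(\<And>n. q ^ Suc n * w \<noteq> 1) \<Longrightarrow> qprod q w \<noteq> 0"
  unfolding qprod_def by (rule prodinf_nonzero[OF qprod_convergent]) (metis diff_eq_diff_eq diff_self)

lemma qprod_1_nonzero: "qprod q 1 \<noteq> 0"
proof (rule qprod_nonzero)
  fix n
  have "norm (q ^ Suc n) < 1"
    using q by (simp add: norm_power power_less_one_iff del: power_Suc)
  then show "q ^ Suc n * 1 \<noteq> 1" by (metis mult.right_neutral norm_one order_less_irrefl)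
qed

text \<open>Splitting off the first factor leaves the same product with w replaced by q w. This is
  the origin of the second quasi-period of theta.\<close>

lemma qprod_shift: "qprod q w = (1 - q * w) * qprod q (q * w)"
proof -
  have "(\<lambda>N. (1 - q * w) * (\<Prod>n<N. 1 - q ^ Suc n * (q * w))) \<longlonglongrightarrow> (1 - q * w) * qprod q (q * w)"
    by (intro tendsto_mult tendsto_const qprod_LIMSEQ)
  moreover have "(1 - q * w) * (\<Prod>n<N. 1 - q ^ Suc n * (q * w)) = (\<Prod>n<Suc N. 1 - q ^ Suc n * w)" for N
    by (subst prod.lessThan_Suc_shift) (simp add: mult_ac)
  ultimately have "(\<lambda>N. \<Prod>n<Suc N. 1 - q ^ Suc n * w) \<longlonglongrightarrow> (1 - q * w) * qprod q (q * w)"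
    by simp
  moreover have "(\<lambda>N. \<Prod>n<Suc N. 1 - q ^ Suc n * w) \<longlonglongrightarrow> qprod q w"
    by (rule LIMSEQ_Suc[OF qprod_LIMSEQ])
  ultimately show ?thesis by (rule LIMSEQ_unique[symmetric])
qed

lemma qprod_holomorphic: "qprod q holomorphic_on UNIV"
proof -
  have "(\<lambda>w. \<Prod>n. 1 + (- (q ^ Suc n * w))) holomorphic_on UNIV"
  proof (rule holomorphic_prodinf)
    fix K :: "complex set" assume "compact K"
    then obtain B where B: "\<And>w. w \<in> K \<Longrightarrow> norm w \<le> B"
      using compact_imp_bounded bounded_iff by metis
    have "summable (\<lambda>n. norm q ^ n * (norm q * B))"
      using q by (intro summable_mult2 summable_geometric) simp
    moreover have "norm (- (q ^ Suc n * w)) \<le> norm q ^ n * (norm q * B)" if "w \<in> K" for n w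
    proof -
      have "norm (- (q ^ Suc n * w)) = norm q ^ Suc n * norm w"
        by (simp add: norm_mult norm_power)
      also have "\<dots> \<le> norm q ^ Suc n * B"
        using B[OF that] by (intro mult_left_mono) auto
      finally show ?thesis by (simp add: mult_ac)
    qed
    ultimately show "\<exists>M. summable M \<and> (\<forall>n. \<forall>w\<in>K. norm (- (q ^ Suc n * w)) \<le> M n)" by blast
  qed (auto intro!: holomorphic_intros)
  then show ?thesis by (simp add: qprod_def[abs_def])
qed

text \<open>Euler: the product of \<open>(1 + q\<^sup>n)\<close> over \<open>n \<ge> 1\<close> is inverse to the product of \<open>1 - q\<^bsup>2n+1\<^esup>\<close> over \<open>n \<ge> 0\<close>.\<close>

lemma qprod_euler:
  assumes "q = p ^ 2"
  shows "qprod q (- 1) * ((1 - p) * qprod q p) * ((1 + p) * qprod q (- p)) = 1"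
proof -
  let ?A = "\<lambda>N w. \<Prod>n<N. 1 - q ^ Suc n * w"
  \<comment> \<open>The even factors 1 - q^(2n) come from w = 1 and w = -1, the odd ones 1 -
    q^(2n+1) from w = p and w = -p. The leading (1 - p)(1 + p) = 1 - q is the odd factor with n = 0,
    whence the length 2 N + 1.\<close>
  have fin: "?A N 1 * (?A N (- 1) * ((1 - p) * ?A N p) * ((1 + p) * ?A N (- p))) = ?A (2 * N + 1) 1" for N
  proof (induction N)
    case 0
    show ?case using assms by (simp add: algebra_simps power2_eq_square)
  next
    case (Suc N)
    define x where "x = q ^ Suc N"
    have "Suc (2 * N + 1) = Suc N * 2" by simp
    then have x2: "q ^ Suc (2 * N + 1) = x ^ 2"
      unfolding x_def by (simp only: power_mult)
    then have x3: "q ^ Suc (Suc (2 * N + 1)) = x ^ 2 * p ^ 2"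
      by (simp only: power_Suc[of _ "Suc (2 * N + 1)"]) (simp add: assms)
    have "?A (Suc N) 1 * (?A (Suc N) (- 1) * ((1 - p) * ?A (Suc N) p) * ((1 + p) * ?A (Suc N) (- p)))
      = (?A N 1 * (?A N (- 1) * ((1 - p) * ?A N p) * ((1 + p) * ?A N (- p))))
        * ((1 - x) * (1 + x) * (1 - x * p) * (1 + x * p))"
      by (simp add: x_def mult_ac)
    also have "\<dots> = ?A (2 * N + 1) 1 * ((1 - x ^ 2) * (1 - x ^ 2 * p ^ 2))"
      unfolding Suc.IH by (simp add: algebra_simps power2_eq_square)
    also have "\<dots> = ?A (2 * Suc N + 1) 1"
    proof -
      have "2 * Suc N + 1 = Suc (Suc (2 * N + 1))" by simp
      then show ?thesis by (simp only: prod.lessThan_Suc x2 x3 mult_1_right mult.assoc)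
    qed
    finally show ?case .
  qed
  have "(\<lambda>N. ?A N 1 * (?A N (- 1) * ((1 - p) * ?A N p) * ((1 + p) * ?A N (- p))))
      \<longlonglongrightarrow> qprod q 1 * (qprod q (- 1) * ((1 - p) * qprod q p) * ((1 + p) * qprod q (- p)))"
    by (intro tendsto_mult tendsto_const qprod_LIMSEQ)
  moreover have "(\<lambda>N. ?A (2 * N + 1) 1) \<longlonglongrightarrow> qprod q 1"
    by (rule filterlim_compose[OF qprod_LIMSEQ]) (auto intro!: filterlim_subseq simp: strict_mono_def)
  ultimately have "qprod q 1 * (qprod q (- 1) * ((1 - p) * qprod q p) * ((1 + p) * qprod q (- p))) = qprod q 1"
    unfolding fin by (rule LIMSEQ_unique)
  then show ?thesis using qprod_1_nonzero by simp
qed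

end

section \<open>Jacobi's theta function in product form\<close>

definition nome :: "complex \<Rightarrow> complex" where
  "nome \<tau> = exp (2 * pi * \<i> * \<tau>)"

lemma norm_nome: "norm (nome \<tau>) = exp (- 2 * pi * Im \<tau>)"
  by (simp add: nome_def)

lemma norm_nome_less_1: "\<tau> \<in> upper_half_plane \<Longrightarrow> norm (nome \<tau>) < 1"
  by (simp add: norm_nome upper_half_plane_def)

text \<open>Jacobi's odd theta function, up to a factor that depends on \<tau> only. The difference
  of exponentials carries the zeros at the integers, the two products those at the other lattice
  points.\<close>

definition theta :: "complex \<Rightarrow> complex \<Rightarrow> complex" where
  "theta \<tau> z = (exp (pi * \<i> * z) - exp (- (pi * \<i> * z)))
     * (qprod (nome \<tau>) (nome z) * qprod (nome \<tau>) (nome (- z)))"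

lemma nome_add: "nome (y + z) = nome y * nome z"
  by (simp add: nome_def algebra_simps exp_add)

lemma nome_minus: "nome (- z) = inverse (nome z)"
  by (simp add: nome_def exp_minus)

lemma nome_nonzero [simp]: "nome z \<noteq> 0"
  by (simp add: nome_def)

lemma nome_eq_1_iff: "nome z = 1 \<longleftrightarrow> z \<in> \<int>"
proof
  assume "nome z = 1"
  then obtain n :: int where "Re (2 * pi * \<i> * z) = 0" "Im (2 * pi * \<i> * z) = of_int (2 * n) * pi"
    by (auto simp: nome_def exp_eq_1)
  then have "z = of_int n" by (auto simp: complex_eq_iff)
  then show "z \<in> \<int>" by simp
next
  assume "z \<in> \<int>"
  then obtain n where "z = of_int n" by (auto elim: Ints_cases)
  then show "nome z = 1"
    by (auto simp: nome_def exp_eq_1)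
qed

lemma exp_pi_sq: "exp (pi * \<i> * z) * exp (pi * \<i> * z) = nome z"
  by (simp add: nome_def mult_exp_exp mult_ac)

lemma theta_minus: "theta \<tau> (- z) = - theta \<tau> z"
  by (simp add: theta_def algebra_simps)

lemma theta_add_1: "theta \<tau> (z + 1) = - theta \<tau> z"
proof -
  have 1: "nome 1 = 1" "nome (- 1) = 1" using nome_eq_1_iff[of 1] nome_eq_1_iff[of "-1"] by auto
  have 2: "exp (pi * \<i> * (z + 1)) = - exp (pi * \<i> * z)"
    by (simp add: distrib_left exp_add)
  have 3: "exp (- (pi * \<i> * (z + 1))) = - exp (- (pi * \<i> * z))"
    unfolding exp_minus[of "_ * (z + 1)"] 2 by (simp add: exp_minus)
  have "nome (- (z + 1)) = nome (- z)"
    using nome_add[of "- z" "- 1"] 1 by simp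
  then show ?thesis
    unfolding theta_def 2 3 using nome_add[of z 1] 1 by (simp add: algebra_simps)
qed


text \<open>Adding \<tau> to z removes the first factor from one of the two products and puts a new
  one in front of the other. Together with the exponentials this leaves an elementary
  multiplier.\<close>

lemma theta_add_tau:
  assumes "\<tau> \<in> upper_half_plane"
  shows "theta \<tau> (z + \<tau>) = - exp (- (pi * \<i> * (2 * z + \<tau>))) * theta \<tau> z"
proof -
  note q = norm_nome_less_1[OF assms]
  define e where "e = exp (pi * \<i> * z)"
  define f where "f = exp (pi * \<i> * \<tau>)"
  have nz: "e \<noteq> 0" "f \<noteq> 0" by (simp_all add: e_def f_def)
  have z: "nome z = e * e" and t: "nome \<tau> = f * f" by (simp_all add: e_def f_def exp_pi_sq)
  define A where "A = qprod (nome \<tau>) (nome \<tau> * nome z)"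
  define B where "B = qprod (nome \<tau>) (nome (- z))"
  have 1: "qprod (nome \<tau>) (nome z) = (1 - nome \<tau> * nome z) * A"
    unfolding A_def by (rule qprod_shift[OF q])
  have "nome \<tau> * nome (- (z + \<tau>)) = nome (- z)"
    by (simp flip: nome_add)
  then have 2: "qprod (nome \<tau>) (nome (- (z + \<tau>))) = (1 - nome (- z)) * B"
    using qprod_shift[OF q, of "nome (- (z + \<tau>))"] by (simp add: B_def)
  have 3: "exp (pi * \<i> * (z + \<tau>)) = e * f"
    by (simp add: e_def f_def distrib_left exp_add)
  have 4: "exp (- (pi * \<i> * (2 * z + \<tau>))) = inverse (e * e * f)"
    by (simp add: e_def f_def mult_exp_exp algebra_simps flip: exp_minus)
  have "theta \<tau> (z + \<tau>) = (e * f - inverse (e * f)) * (A * ((1 - inverse (e * e)) * B))"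
    unfolding theta_def 2 3 exp_minus[of "_ * (z + \<tau>)"]
    by (simp add: A_def nome_add nome_minus z mult.commute)
  also have "\<dots> = - inverse (e * e * f) * ((e - inverse e) * ((1 - (f * f) * (e * e)) * A * B))"
    using nz by (simp add: field_simps)
  also have "\<dots> = - exp (- (pi * \<i> * (2 * z + \<tau>))) * theta \<tau> z"
  proof -
    have "theta \<tau> z = (e - inverse e) * ((1 - (f * f) * (e * e)) * A * B)"
      unfolding theta_def 1 exp_minus by (simp add: B_def e_def[symmetric] z t)
    then show ?thesis by (simp only: 4)
  qed
  finally show ?thesis .
qed

lemma theta_holomorphic:
  assumes "\<tau> \<in> upper_half_plane"
  shows "theta \<tau> holomorphic_on UNIV"
proof -
  have "qprod (nome \<tau>) \<circ> (\<lambda>z. nome (s * z)) holomorphic_on UNIV" for s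
    by (rule holomorphic_on_compose_gen[OF _ qprod_holomorphic[OF norm_nome_less_1[OF assms]]])
      (auto simp: nome_def[abs_def] intro!: holomorphic_intros)
  from this[of 1] this[of "- 1"] show ?thesis
    unfolding theta_def[abs_def] by (intro holomorphic_intros) (auto simp: o_def)
qed

text \<open>A convergent product vanishes only if one of its factors does, and a factor vanishes
  only where \<open>nome\<close> takes the value 1, that is at an integer argument.\<close>

lemma theta_zero:
  assumes "\<tau> \<in> upper_half_plane" "theta \<tau> z = 0"
  obtains m n :: int where "z = of_int m + of_int n * \<tau>"
proof -
  note q = norm_nome_less_1[OF assms(1)]
  have pow: "nome \<tau> ^ k = nome (of_nat k * \<tau>)" for k
    by (induction k) (simp_all add: nome_def algebra_simps exp_add)
  consider "exp (pi * \<i> * z) = exp (- (pi * \<i> * z))" | "qprod (nome \<tau>) (nome z) = 0"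
    | "qprod (nome \<tau>) (nome (- z)) = 0"
    using assms(2) by (auto simp: theta_def)
  then show ?thesis
  proof cases
    case 1
    then have "nome z = exp (pi * \<i> * z) * exp (- (pi * \<i> * z))"
      unfolding exp_pi_sq[symmetric] by simp
    then have "nome z = 1" by (simp add: mult_exp_exp)
    then show ?thesis
      unfolding nome_eq_1_iff using that[of _ 0] by (auto elim: Ints_cases)
  next
    case 2
    then obtain k where "nome \<tau> ^ Suc k * nome z = 1"
      using qprod_nonzero[OF q] by blast
    then have "of_nat (Suc k) * \<tau> + z \<in> \<int>"
      unfolding pow nome_add[symmetric] nome_eq_1_iff .
    then obtain m where "of_nat (Suc k) * \<tau> + z = of_int m" by (auto elim: Ints_cases)
    then have "z = of_int m + of_int (- int (Suc k)) * \<tau>" by (simp add: algebra_simps)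
    then show ?thesis using that by blast
  next
    case 3
    then obtain k where "nome \<tau> ^ Suc k * nome (- z) = 1"
      using qprod_nonzero[OF q] by blast
    then have "of_nat (Suc k) * \<tau> + - z \<in> \<int>"
      unfolding pow nome_add[symmetric] nome_eq_1_iff .
    then obtain m where "of_nat (Suc k) * \<tau> + - z = of_int m" by (auto elim: Ints_cases)
    then have "z = of_int (- m) + of_int (int (Suc k)) * \<tau>" by (simp add: algebra_simps)
    then show ?thesis using that by blast
  qed
qed

text \<open>The infinite products that occur at the three half periods together form the square of
  the product in Euler's identity, so they disappear. The constant in the transformation law becomes
  computable from these three values.\<close>

lemma theta_half_periods:
  assumes "\<tau> \<in> upper_half_plane"
  shows "theta \<tau> (1 / 2) * theta \<tau> (\<tau> / 2) * theta \<tau> ((1 + \<tau>) / 2) = 2 * exp (- (pi * \<i> * \<tau>))"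
proof -
  note q = norm_nome_less_1[OF assms]
  define r where "r = exp (pi * \<i> * \<tau> / 2)"
  define p where "p = exp (pi * \<i> * \<tau>)"
  have rp: "p = r * r" "r \<noteq> 0" by (simp_all add: r_def p_def mult_exp_exp field_simps)
  have qp: "nome \<tau> = p ^ 2" by (simp add: p_def power2_eq_square exp_pi_sq)
  let ?A = "qprod (nome \<tau>)"
  have half: "nome (1 / 2) = - 1" "nome (- 1 / 2) = - 1"
    by (simp_all add: nome_def exp_minus)
  have t2: "nome (\<tau> / 2) = p" "nome (- \<tau> / 2) = inverse p"
    by (simp_all add: nome_def p_def exp_minus mult_ac)
  have t3: "nome ((1 + \<tau>) / 2) = - p" "nome (- (1 + \<tau>) / 2) = - inverse p"
    using nome_add[of "1 / 2" "\<tau> / 2"] nome_add[of "- 1 / 2" "- \<tau> / 2"] half t2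
    by (simp_all add: add_divide_distrib diff_divide_distrib)
  have e1: "exp (pi * \<i> * (1 / 2)) = \<i>" "exp (- (pi * \<i> * (1 / 2))) = - \<i>"
  proof -
    have "exp (pi * \<i> * (1 / 2)) = cis (pi / 2)" by (simp add: cis_conv_exp mult_ac)
    then show "exp (pi * \<i> * (1 / 2)) = \<i>" by simp
    then show "exp (- (pi * \<i> * (1 / 2))) = - \<i>" unfolding exp_minus by simp
  qed
  have e2: "exp (pi * \<i> * (\<tau> / 2)) = r" "exp (- (pi * \<i> * (\<tau> / 2))) = inverse r"
    by (simp_all add: r_def exp_minus)
  have "exp (pi * \<i> * ((1 + \<tau>) / 2)) = exp (pi * \<i> * (1 / 2)) * exp (pi * \<i> * (\<tau> / 2))"
    unfolding mult_exp_exp by (simp add: add_divide_distrib distrib_left)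
  then have e3: "exp (pi * \<i> * ((1 + \<tau>) / 2)) = \<i> * r" "exp (- (pi * \<i> * ((1 + \<tau>) / 2))) = - \<i> * inverse r"
    unfolding exp_minus e1(1) e2(1) by (simp_all)
  have pp: "p ^ 2 * inverse p = p" by (simp add: p_def power2_eq_square)
  \<comment> \<open>As q = p^2, one shift carries the inverse of p to p, at the cost of the factor 1
    - p. The same holds with opposite signs.\<close>
  have s2: "?A (inverse p) = (1 - p) * ?A p"
    using qprod_shift[OF q, of "inverse p"] pp by (simp add: qp)
  have s3: "?A (- inverse p) = (1 + p) * ?A (- p)"
    using qprod_shift[OF q, of "- inverse p"] pp by (simp add: qp)
  have 1: "theta \<tau> (1 / 2) = 2 * \<i> * ?A (- 1) ^ 2"
    unfolding theta_def e1 using half by (simp add: power2_eq_square)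
  have 2: "theta \<tau> (\<tau> / 2) = - inverse r * ((1 - p) * ?A p) ^ 2"
  proof -
    have "theta \<tau> (\<tau> / 2) = (r - inverse r) * (?A p * ((1 - p) * ?A p))"
      unfolding theta_def e2 using t2 s2 by simp
    also have "r - inverse r = - inverse r * (1 - p)" using rp by (simp add: field_simps)
    finally show ?thesis by (simp add: power2_eq_square mult_ac)
  qed
  have 3: "theta \<tau> ((1 + \<tau>) / 2) = \<i> * inverse r * ((1 + p) * ?A (- p)) ^ 2"
  proof -
    have "theta \<tau> ((1 + \<tau>) / 2) = (\<i> * r + \<i> * inverse r) * (?A (- p) * ((1 + p) * ?A (- p)))"
      unfolding theta_def e3 using t3 s3 by (simp add: minus_divide_left)
    also have "\<i> * r + \<i> * inverse r = \<i> * inverse r * (1 + p)" using rp by (simp add: field_simps)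
    finally show ?thesis by (simp add: power2_eq_square mult_ac)
  qed
  have "theta \<tau> (1 / 2) * theta \<tau> (\<tau> / 2) * theta \<tau> ((1 + \<tau>) / 2)
     = 2 * inverse p * (?A (- 1) * ((1 - p) * ?A p) * ((1 + p) * ?A (- p))) ^ 2"
    unfolding 1 2 3 rp(1) by (simp add: power_mult_distrib mult_ac)
  then show ?thesis
    unfolding qprod_euler[OF q qp] by (simp add: p_def exp_minus)
qed


section \<open>Transformation of theta and of Euler's product under inversion\<close>

lemma lattice_reduction:
  fixes \<tau> z :: complex
  assumes "Im \<tau> > 0"
  obtains m n :: int and s t :: real where "z = of_real s + of_real t * \<tau> + of_int m + of_int n * \<tau>"
    "s \<in> {0..1}" "t \<in> {0..1}"
proof -
  define u where "u = Im z / Im \<tau>"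
  define v where "v = Re z - u * Re \<tau>"
  have "z = of_real v + of_real u * \<tau>"
    using assms by (simp add: complex_eq_iff u_def v_def)
  then have "z = of_real (frac v) + of_real (frac u) * \<tau> + of_int \<lfloor>v\<rfloor> + of_int \<lfloor>u\<rfloor> * \<tau>"
    by (simp add: complex_eq_iff frac_def algebra_simps)
  then show ?thesis
    using that frac_ge_0 frac_lt_1 by (metis atLeastAtMost_iff less_imp_le)
qed

lemma doubly_periodic_int:
  fixes H :: "complex \<Rightarrow> 'a"
  assumes "\<And>z. H (z + w) = H z"
  shows "H (z + of_int n * w) = H z"
proof -
  have nat: "H (z + of_nat k * w) = H z" for z k
  proof (induction k)
    case (Suc k)
    have "H (z + of_nat (Suc k) * w) = H ((z + of_nat k * w) + w)" by (simp add: algebra_simps)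
    then show ?case using assms Suc by simp
  qed simp
  show ?thesis
  proof (cases "n \<ge> 0")
    case True
    then show ?thesis using nat[of z "nat n"] by simp
  next
    case False
    then show ?thesis using nat[of "z + of_int n * w" "nat (- n)"] by simp
  qed
qed

text \<open>
  The function \<open>\<theta>(z/\<tau>, -1/\<tau>) exp(-\<pi>\<i> z\<^sup>2/\<tau>)\<close> has the same quasi-periods and the same (simple) zeros
  as \<open>\<theta>(z, \<tau>)\<close>, so that the quotient of the two is constant by Liouville's theorem.
\<close>

lemma theta_transform:
  assumes "\<tau> \<in> upper_half_plane" and \<tau>': "\<tau>' = - (1 / \<tau>)"
  defines "L \<equiv> qprod (nome \<tau>') 1 ^ 2 / (\<tau> * qprod (nome \<tau>) 1 ^ 2)"
  assumes "theta \<tau> z \<noteq> 0"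
  shows "theta \<tau>' (z / \<tau>) * exp (- (pi * \<i> * z ^ 2 / \<tau>)) = L * theta \<tau> z"
proof -
  have \<tau>0: "\<tau> \<noteq> 0" using assms upper_half_plane_nonzero by blast
  have H': "\<tau>' \<in> upper_half_plane"
    using moebius_upper_half_plane[OF S_mat_carrier assms(1)] by (simp add: \<tau>')
  have Im: "Im \<tau> > 0" using assms by (simp add: upper_half_plane_def)
  define R where "R = (\<lambda>z. theta \<tau>' (z / \<tau>) * exp (- (pi * \<i> * z ^ 2 / \<tau>)))"
  \<comment> \<open>A step by 1 in z is a step by -\<tau>' in z / \<tau>. The multiplier of theta
    for \<tau>' is cancelled by the change of the Gaussian factor, up to the sign.\<close>
  have R1: "R (z + 1) = - R z" for z
  proof -
    have "theta \<tau>' (z / \<tau> - \<tau>') = - exp (pi * \<i> * (2 * (z / \<tau>) - \<tau>')) * theta \<tau>' (z / \<tau>)"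
    proof -
      have "exp (pi * \<i> * (2 * (z / \<tau>) - \<tau>')) * exp (- (pi * \<i> * (2 * (z / \<tau> - \<tau>') + \<tau>'))) = exp 0"
        unfolding mult_exp_exp by (rule arg_cong[of _ _ exp]) (simp add: algebra_simps)
      then have "theta \<tau>' (z / \<tau> - \<tau>') = exp (pi * \<i> * (2 * (z / \<tau>) - \<tau>'))
          * (exp (- (pi * \<i> * (2 * (z / \<tau> - \<tau>') + \<tau>'))) * theta \<tau>' (z / \<tau> - \<tau>'))"
        by (simp flip: mult.assoc)
      then show ?thesis
        using theta_add_tau[OF H', of "z / \<tau> - \<tau>'"] by simp
    qed
    moreover have "(z + 1) / \<tau> = z / \<tau> - \<tau>'" by (simp add: \<tau>' add_divide_distrib)
    ultimately have "R (z + 1) = - (theta \<tau>' (z / \<tau>) * (exp (pi * \<i> * (2 * (z / \<tau>) - \<tau>'))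
        * exp (- (pi * \<i> * (z + 1) ^ 2 / \<tau>))))"
      by (simp add: R_def)
    also have "exp (pi * \<i> * (2 * (z / \<tau>) - \<tau>')) * exp (- (pi * \<i> * (z + 1) ^ 2 / \<tau>))
       = exp (- (pi * \<i> * z ^ 2 / \<tau>))"
      unfolding mult_exp_exp
      by (rule arg_cong[of _ _ exp]) (use \<tau>0 in \<open>simp add: \<tau>' field_simps power2_eq_square\<close>)
    finally show ?thesis by (simp add: R_def)
  qed
  \<comment> \<open>A step by \<tau> in z is a step by 1 in z / \<tau>, which only changes the sign
    of theta for \<tau>'. Here the Gaussian factor supplies the multiplier.\<close>
  have R\<tau>: "R (z + \<tau>) = - exp (- (pi * \<i> * (2 * z + \<tau>))) * R z" for z
  proof -
    have "theta \<tau>' ((z + \<tau>) / \<tau>) = - theta \<tau>' (z / \<tau>)"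
      using theta_add_1[of \<tau>' "z / \<tau>"] \<tau>0 by (simp add: add_divide_distrib)
    moreover have "exp (- (pi * \<i> * (z + \<tau>) ^ 2 / \<tau>))
        = exp (- (pi * \<i> * (2 * z + \<tau>))) * exp (- (pi * \<i> * z ^ 2 / \<tau>))"
      unfolding mult_exp_exp
      by (rule arg_cong[of _ _ exp]) (use \<tau>0 in \<open>simp add: field_simps power2_eq_square\<close>)
    ultimately show ?thesis by (simp add: R_def)
  qed
  \<comment> \<open>The factor s carries the simple zero at 0, while E and E' have nonzero limits
    there. The two zeros have slopes in the ratio 1 / \<tau>, which is the factor 1 / \<tau> in
    L.\<close>
  define E where "E = (\<lambda>z. qprod (nome \<tau>) (nome z) * qprod (nome \<tau>) (nome (- z)))"
  define E' where "E' = (\<lambda>z. qprod (nome \<tau>') (nome (z / \<tau>)) * qprod (nome \<tau>') (nome (- z / \<tau>))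
      * exp (- (pi * \<i> * z ^ 2 / \<tau>)))"
  define s where "s = (\<lambda>z. exp (pi * \<i> * z) - exp (- (pi * \<i> * z)))"
  have th: "theta \<tau> z = s z * E z" and R: "R z = s (z / \<tau>) * E' z" for z
    by (simp_all add: theta_def R_def E_def E'_def s_def)
  have comp: "isCont (\<lambda>z. qprod (nome t) (nome (u * z))) 0" if "t \<in> upper_half_plane" for t u
  proof -
    have "qprod (nome t) \<circ> (\<lambda>z. nome (u * z)) holomorphic_on UNIV"
      by (rule holomorphic_on_compose_gen[OF _ qprod_holomorphic[OF norm_nome_less_1[OF that]]])
        (auto simp: nome_def[abs_def] intro!: holomorphic_intros)
    then show ?thesis
      using holomorphic_on_imp_continuous_on continuous_on_eq_continuous_at[of UNIV]
      by (fastforce simp: o_def)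
  qed
  have nome0: "nome 0 = 1" by (simp add: nome_def)
  have E0: "E \<midarrow>0\<rightarrow> qprod (nome \<tau>) 1 ^ 2"
  proof -
    have "isCont E 0"
      using comp[OF assms(1), of 1] comp[OF assms(1), of "-1"]
      unfolding E_def by (intro continuous_intros) auto
    then show ?thesis by (simp add: isCont_def E_def nome0 power2_eq_square)
  qed
  have E'0: "E' \<midarrow>0\<rightarrow> qprod (nome \<tau>') 1 ^ 2"
  proof -
    have "isCont E' 0"
      using comp[OF H', of "1 / \<tau>"] comp[OF H', of "- 1 / \<tau>"] \<tau>0
      unfolding E'_def by (intro continuous_intros) auto
    then show ?thesis by (simp add: isCont_def E'_def nome0 power2_eq_square)
  qed
  have ds: "(s has_field_derivative 2 * pi * \<i>) (at 0)"
    unfolding s_def by (auto intro!: derivative_eq_intros)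
  have s0: "(\<lambda>z. s z / z) \<midarrow>0\<rightarrow> 2 * pi * \<i>"
    using ds by (simp add: has_field_derivative_iff s_def)
  have ds': "((\<lambda>z. s (z / \<tau>)) has_field_derivative 2 * pi * \<i> / \<tau>) (at 0)"
    unfolding s_def using \<tau>0 by (auto intro!: derivative_eq_intros)
  have s0': "(\<lambda>z. s (z / \<tau>) / z) \<midarrow>0\<rightarrow> 2 * pi * \<i> / \<tau>"
    using ds' by (simp add: has_field_derivative_iff s_def)
  have A0: "qprod (nome \<tau>) 1 \<noteq> 0"
    by (rule qprod_1_nonzero[OF norm_nome_less_1[OF assms(1)]])
  have lim: "(\<lambda>z. R z / theta \<tau> z) \<midarrow>0\<rightarrow> L"
  proof -
    have "(\<lambda>z. (s (z / \<tau>) / z) * E' z / ((s z / z) * E z))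
        \<midarrow>0\<rightarrow> (2 * pi * \<i> / \<tau>) * qprod (nome \<tau>') 1 ^ 2 / ((2 * pi * \<i>) * qprod (nome \<tau>) 1 ^ 2)"
      using A0 by (intro tendsto_intros s0 s0' E0 E'0) auto
    also have "(2 * pi * \<i> / \<tau>) * qprod (nome \<tau>') 1 ^ 2 / ((2 * pi * \<i>) * qprod (nome \<tau>) 1 ^ 2) = L"
      using A0 \<tau>0 by (simp add: L_def field_simps)
    finally show ?thesis
      by (rule Lim_transform_within[OF _ zero_less_one]) (simp add: R th)
  qed
  have nz: "\<forall>\<^sub>F z in at 0. theta \<tau> z \<noteq> 0"
  proof -
    have "(\<lambda>z. (s z / z) * E z) \<midarrow>0\<rightarrow> (2 * pi * \<i>) * qprod (nome \<tau>) 1 ^ 2"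
      by (intro tendsto_intros s0 E0)
    then have "\<forall>\<^sub>F z in at 0. (s z / z) * E z \<noteq> 0"
      by (rule tendsto_imp_eventually_ne) (use A0 in auto)
    then show ?thesis by eventually_elim (auto simp: th)
  qed
  \<comment> \<open>The value L at the zeros is the limit of the quotient at 0, so H is holomorphic
    at 0. Being constant on the zeros keeps H doubly periodic, and the periods carry holomorphy from
    0 to every other zero.\<close>
  define H where "H = (\<lambda>z. if theta \<tau> z = 0 then L else R z / theta \<tau> z)"
  have per1: "H (z + 1) = H z" for z
    using theta_add_1[of \<tau> z] R1[of z] by (simp add: H_def)
  have per\<tau>: "H (z + \<tau>) = H z" for z
    using theta_add_tau[OF assms(1), of z] R\<tau>[of z] by (simp add: H_def)
  have per: "H (z + (of_int m + of_int n * \<tau>)) = H z" for z m n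
    using doubly_periodic_int[of H 1 "z + of_int n * \<tau>" m] doubly_periodic_int[of H \<tau> z n] per1 per\<tau>
    by (simp add: algebra_simps)
  have th_hol: "theta \<tau> holomorphic_on UNIV" by (rule theta_holomorphic[OF assms(1)])
  have R_hol: "R holomorphic_on UNIV"
  proof -
    have "theta \<tau>' \<circ> (\<lambda>z. z / \<tau>) holomorphic_on UNIV"
      by (rule holomorphic_on_compose_gen[OF _ theta_holomorphic[OF H']]) (use \<tau>0 in \<open>auto intro!: holomorphic_intros\<close>)
    then show ?thesis
      unfolding R_def using \<tau>0 by (intro holomorphic_intros) (auto simp: o_def)
  qed
  have away: "H field_differentiable at z" if "theta \<tau> z \<noteq> 0" for z
  proof -
    have "open {z. theta \<tau> z \<noteq> 0}"
      using holomorphic_on_imp_continuous_on[OF th_hol] by (intro open_Collect_neq continuous_intros) auto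
    moreover have "H holomorphic_on {z. theta \<tau> z \<noteq> 0}"
    proof -
      have "(\<lambda>z. R z / theta \<tau> z) holomorphic_on {z. theta \<tau> z \<noteq> 0}"
        using R_hol th_hol by (intro holomorphic_intros) (auto intro: holomorphic_on_subset)
      then show ?thesis by (rule holomorphic_transform) (simp add: H_def)
    qed
    ultimately show ?thesis
      using holomorphic_on_imp_differentiable_at that by blast
  qed
  have H0: "H field_differentiable at 0"
  proof -
    obtain r where r: "r > 0" "\<And>z. z \<noteq> 0 \<Longrightarrow> norm z < r \<Longrightarrow> theta \<tau> z \<noteq> 0"
      using nz unfolding eventually_at by auto
    have "H holomorphic_on ball 0 r"
    proof (rule no_isolated_singularity'[where K = "{0}"])
      have "H \<midarrow>0\<rightarrow> L"
        by (rule Lim_transform_within[OF lim r(1)]) (use r(2) in \<open>auto simp: H_def\<close>)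
      moreover have "H 0 = L" by (simp add: H_def th s_def)
      ultimately show "(H \<longlongrightarrow> H z) (at z within ball 0 r)" if "z \<in> {0}" for z
        using that by (auto intro: tendsto_within_subset)
      show "H holomorphic_on ball 0 r - {0}"
        unfolding holomorphic_on_def
      proof
        fix z :: complex assume "z \<in> ball 0 r - {0}"
        then have "theta \<tau> z \<noteq> 0" by (intro r(2)) auto
        then show "H field_differentiable at z within ball 0 r - {0}"
          by (rule field_differentiable_at_within[OF away])
      qed
    qed auto
    then show ?thesis
      using r holomorphic_on_imp_differentiable_at[of H "ball 0 r" 0] by simp
  qed
  have "H field_differentiable at z" for z
  proof (cases "theta \<tau> z = 0")
    case True
    then obtain m n where z: "z = of_int m + of_int n * \<tau>"
      using theta_zero[OF assms(1)] by blast
    have "(\<lambda>w. H (w - z)) field_differentiable at z"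
      using field_differentiable_compose[of "\<lambda>w. w - z" z H] H0
      by (simp add: o_def field_differentiable_diff field_differentiable_ident field_differentiable_const)
    moreover have "H (w - z) = H w" for w
      using per[of "w - z" m n] by (simp add: z)
    ultimately show ?thesis by simp
  qed (rule away)
  then have H_hol: "H holomorphic_on UNIV"
    by (auto simp: holomorphic_on_def intro: field_differentiable_at_within)
  have "bounded (range H)"
  proof -
    define P where "P = (\<lambda>(s, t). complex_of_real s + of_real t * \<tau>) ` ({0..1} \<times> {0..1})"
    have "compact P"
      unfolding P_def by (intro compact_continuous_image compact_Times)
        (auto simp: case_prod_unfold intro!: continuous_intros)
    then have "bounded (H ` P)"
      by (intro compact_imp_bounded compact_continuous_image
          continuous_on_subset[OF holomorphic_on_imp_continuous_on[OF H_hol]] subset_UNIV)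
    moreover have "range H \<subseteq> H ` P"
    proof
      fix y assume "y \<in> range H"
      then obtain z where z: "y = H z" by blast
      obtain m n s t where "z = of_real s + of_real t * \<tau> + of_int m + of_int n * \<tau>"
        "s \<in> {0..1}" "t \<in> {0..1}"
        by (rule lattice_reduction[OF Im, of z])
      then have st: "z = (of_real s + of_real t * \<tau>) + (of_int m + of_int n * \<tau>)"
        "(s, t) \<in> {0..1} \<times> {0..1}"
        by (simp_all only: add.assoc mem_Times_iff fst_conv snd_conv)
      have "of_real s + of_real t * \<tau> \<in> P"
        unfolding P_def by (rule image_eqI[OF _ st(2)]) simp
      moreover have "H z = H (of_real s + of_real t * \<tau>)"
        unfolding st(1) by (rule per)
      ultimately show "y \<in> H ` P" using z by blast
    qed
    ultimately show ?thesis by (rule bounded_subset)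
  qed
  then obtain c where "\<And>z. H z = c"
    using Liouville_theorem[OF H_hol] by (auto simp: constant_on_def)
  then have "H z = H 0" by simp
  also have "H 0 = L" by (simp add: H_def th s_def)
  finally have "H z = L" .
  then show ?thesis
    using assms(4) by (simp add: H_def R_def field_simps)
qed

text \<open>Inversion permutes the half periods up to sign and lattice. Multiplying the three
  instances of the transformation law eliminates the theta values and gives L^3, hence L^12, in
  closed form, and L^12 contains the quotient of the 24th powers.\<close>

lemma qprod_transform:
  assumes "\<tau> \<in> upper_half_plane" and \<tau>': "\<tau>' = - (1 / \<tau>)"
  shows "nome \<tau>' * qprod (nome \<tau>') 1 ^ 24 = \<tau> ^ 12 * (nome \<tau> * qprod (nome \<tau>) 1 ^ 24)"
proof -
  define L where "L = qprod (nome \<tau>') 1 ^ 2 / (\<tau> * qprod (nome \<tau>) 1 ^ 2)"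
  have \<tau>0: "\<tau> \<noteq> 0" using assms upper_half_plane_nonzero by blast
  have H': "\<tau>' \<in> upper_half_plane"
    using moebius_upper_half_plane[OF S_mat_carrier assms(1)] by (simp add: \<tau>')
  define a b c a' b' c' where defs: "a = theta \<tau> (1 / 2)" "b = theta \<tau> (\<tau> / 2)" "c = theta \<tau> ((1 + \<tau>) / 2)"
    "a' = theta \<tau>' (1 / 2)" "b' = theta \<tau>' (\<tau>' / 2)" "c' = theta \<tau>' ((1 + \<tau>') / 2)"
  have abc: "a * b * c = 2 * exp (- (pi * \<i> * \<tau>))" and abc': "a' * b' * c' = 2 * exp (- (pi * \<i> * \<tau>'))"
    using theta_half_periods[OF assms(1)] theta_half_periods[OF H'] by (simp_all add: defs)
  have "a * b * c \<noteq> 0" unfolding abc by simp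
  then have nz: "a \<noteq> 0" "b \<noteq> 0" "c \<noteq> 0" by auto
  note tr = theta_transform[OF assms(1) \<tau>', folded L_def]
  \<comment> \<open>Division by \<tau> sends 1/2 to -\<tau>'/2, \<tau>/2 to 1/2 and (1 + \<tau>)/2
    to (1 - \<tau>')/2. The third needs oddness and a step by 1 to become (1 + \<tau>')/2.\<close>
  have 1: "- b' * exp (- (pi * \<i> / (4 * \<tau>))) = L * a"
  proof -
    have "(1 / 2) / \<tau> = - (\<tau>' / 2)" by (simp add: \<tau>')
    then show ?thesis
      using tr[of "1 / 2"] nz theta_minus[of \<tau>' "\<tau>' / 2"] by (simp add: defs power2_eq_square mult_ac)
  qed
  have 2: "a' * exp (- (pi * \<i> * \<tau> / 4)) = L * b"
  proof -
    have "pi * \<i> * (\<tau> / 2) ^ 2 / \<tau> = pi * \<i> * \<tau> / 4"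
      using \<tau>0 by (simp add: power2_eq_square)
    moreover have "\<tau> / 2 / \<tau> = 1 / 2" using \<tau>0 by simp
    ultimately show ?thesis
      using tr[of "\<tau> / 2"] nz by (simp only: defs) metis
  qed
  have 3: "c' * exp (- (pi * \<i> * (1 + \<tau>) ^ 2 / (4 * \<tau>))) = L * c"
  proof -
    have "theta \<tau>' (((1 + \<tau>) / 2) / \<tau>) = c'"
    proof -
      have "((1 + \<tau>) / 2) / \<tau> = - ((1 + \<tau>') / 2 - 1)"
        using \<tau>0 by (simp add: \<tau>' field_simps)
      then have "theta \<tau>' (((1 + \<tau>) / 2) / \<tau>) = - theta \<tau>' ((1 + \<tau>') / 2 - 1)"
        by (simp only: theta_minus)
      also have "\<dots> = theta \<tau>' ((1 + \<tau>') / 2 - 1 + 1)"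
        by (simp only: theta_add_1)
      finally show ?thesis by (simp add: defs)
    qed
    moreover have "pi * \<i> * ((1 + \<tau>) / 2) ^ 2 / \<tau> = pi * \<i> * (1 + \<tau>) ^ 2 / (4 * \<tau>)"
      by (simp add: power_divide)
    ultimately show ?thesis
      using tr[of "(1 + \<tau>) / 2"] nz by (simp only: defs) metis
  qed
  have "L ^ 3 * (a * b * c) = (L * a) * (L * b) * (L * c)"
    by (simp add: power3_eq_cube mult_ac)
  also have "\<dots> = - (a' * b' * c') * (exp (- (pi * \<i> / (4 * \<tau>))) * exp (- (pi * \<i> * \<tau> / 4))
      * exp (- (pi * \<i> * (1 + \<tau>) ^ 2 / (4 * \<tau>))))"
    unfolding 1[symmetric] 2[symmetric] 3[symmetric] by (simp add: mult_ac)
  finally have "L ^ 3 = - (exp (- (pi * \<i> * \<tau>')) * (exp (- (pi * \<i> / (4 * \<tau>))) * exp (- (pi * \<i> * \<tau> / 4))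
      * exp (- (pi * \<i> * (1 + \<tau>) ^ 2 / (4 * \<tau>)))) * exp (pi * \<i> * \<tau>))"
    unfolding abc abc' by (simp add: exp_minus field_simps)
  also have "\<dots> = - exp (pi * \<i> / (2 * \<tau>) + pi * \<i> * \<tau> / 2 - pi * \<i> / 2)"
    unfolding mult_exp_exp using \<tau>0
    by (intro arg_cong[of _ _ "\<lambda>x. - exp x"]) (simp add: \<tau>' field_simps power2_eq_square)
  \<comment> \<open>The fourth power removes the sign and makes pi \<i> / 2 a full period, so that
    no root of unity remains.\<close>
  finally have "(L ^ 3) ^ 4 = exp (pi * \<i> / (2 * \<tau>) + pi * \<i> * \<tau> / 2 - pi * \<i> / 2) ^ 4"
    by simp
  also have "\<dots> = exp (4 * (pi * \<i> / (2 * \<tau>) + pi * \<i> * \<tau> / 2 - pi * \<i> / 2))"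
    by (simp flip: exp_of_nat_mult)
  also have "4 * (pi * \<i> / (2 * \<tau>) + pi * \<i> * \<tau> / 2 - pi * \<i> / 2)
      = 2 * pi * \<i> * - \<tau>' + 2 * pi * \<i> * \<tau> - 2 * pi * \<i>"
    using \<tau>0 by (simp add: \<tau>' field_simps)
  also have "exp \<dots> = inverse (nome \<tau>') * nome \<tau>"
    by (simp add: exp_diff exp_add nome_def exp_minus divide_inverse)
  finally have L12: "L ^ 12 = inverse (nome \<tau>') * nome \<tau>"
    by (simp flip: power_mult)
  have A0: "qprod (nome \<tau>) 1 \<noteq> 0"
    by (rule qprod_1_nonzero[OF norm_nome_less_1[OF assms(1)]])
  have "qprod (nome \<tau>') 1 ^ 24 = (L * (\<tau> * qprod (nome \<tau>) 1 ^ 2)) ^ 12"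
    using A0 \<tau>0 by (simp add: L_def flip: power_mult)
  also have "\<dots> = inverse (nome \<tau>') * nome \<tau> * \<tau> ^ 12 * qprod (nome \<tau>) 1 ^ 24"
    by (simp add: power_mult_distrib L12 flip: power_mult)
  finally show ?thesis by (simp add: field_simps)
qed

section \<open>Expansions at the cusp\<close>

text \<open>The disc includes 0: this is the holomorphy at the cusp, and \<open>F 0\<close> is the
  constant term of the expansion.\<close>

definition has_qexp :: "(complex \<Rightarrow> complex) \<Rightarrow> (complex \<Rightarrow> complex) \<Rightarrow> bool" where
  "has_qexp f F \<longleftrightarrow> F holomorphic_on ball 0 1 \<and> (\<forall>\<tau>\<in>upper_half_plane. f \<tau> = F (nome \<tau>))"

lemma nome_in_ball: "\<tau> \<in> upper_half_plane \<Longrightarrow> nome \<tau> \<in> ball 0 1"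
  by (simp add: norm_nome_less_1)

text \<open>The principal logarithm keeps the real part within [-1, 1], the strip in which growth is
  controlled. It jumps along the negative axis, so holomorphy needs other local branches.\<close>

definition nome_inv :: "complex \<Rightarrow> complex" where
  "nome_inv q = Ln q / (2 * pi * \<i>)"

lemma nome_nome_inv: "q \<noteq> 0 \<Longrightarrow> nome (nome_inv q) = q"
  by (simp add: nome_def nome_inv_def)

lemma Im_nome_inv: "q \<noteq> 0 \<Longrightarrow> Im (nome_inv q) = - ln (norm q) / (2 * pi)"
  by (simp add: nome_inv_def Im_divide power2_eq_square)

lemma nome_inv_in_H: "q \<in> ball 0 1 - {0} \<Longrightarrow> nome_inv q \<in> upper_half_plane"
  by (simp add: upper_half_plane_def Im_nome_inv divide_neg_pos)

lemma Re_nome_inv: "q \<noteq> 0 \<Longrightarrow> \<bar>Re (nome_inv q)\<bar> \<le> 1"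
  using mpi_less_Im_Ln[of q] Im_Ln_le_pi[of q]
  by (simp add: nome_inv_def Re_divide power2_eq_square abs_le_iff field_simps)

lemma nome_holomorphic: "nome holomorphic_on A"
  unfolding nome_def[abs_def] by (intro holomorphic_intros)

text \<open>Im \<tau> is a multiple of -log |q|, so a polynomial bound in Im \<tau> is a bound by
  powers of log |q|. It is beaten by a single factor q, and the singularity at q = 0 is
  removable.\<close>

lemma periodic_qexp:
  assumes hol: "f holomorphic_on upper_half_plane"
    and per: "\<And>\<tau>. \<tau> \<in> upper_half_plane \<Longrightarrow> f (\<tau> + 1) = f \<tau>"
    and bound: "\<And>\<tau>. Im \<tau> \<ge> Y \<Longrightarrow> \<bar>Re \<tau>\<bar> \<le> 1 \<Longrightarrow> norm (f \<tau>) \<le> K * Im \<tau> ^ n"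
  obtains F where "has_qexp f F"
proof -
  have per_nat: "f (\<tau> + of_nat m) = f \<tau>" if "\<tau> \<in> upper_half_plane" for \<tau> m
  proof (induction m)
    case (Suc m)
    have "f ((\<tau> + of_nat m) + 1) = f (\<tau> + of_nat m)"
      using that by (intro per) (simp add: upper_half_plane_def)
    then show ?case using Suc by (simp add: add_ac)
  qed simp
  have per_int: "f a = f b"
    if ab: "a \<in> upper_half_plane" "b \<in> upper_half_plane" "nome a = nome b" for a b
  proof -
    have "nome (a - b) = 1"
      using nome_add[of a "- b"] ab(3) by (simp add: nome_minus)
    then obtain m :: int where m: "a = b + of_int m"
      unfolding nome_eq_1_iff by (auto elim!: Ints_cases simp: algebra_simps)
    show ?thesis
    proof (cases "m \<ge> 0")
      case True
      then show ?thesis using per_nat[OF ab(2), of "nat m"] m by simp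
    next
      case False
      then show ?thesis using per_nat[OF ab(1), of "nat (- m)"] m by simp
    qed
  qed
  define F0 where "F0 = (\<lambda>q. f (nome_inv q))"
  have F0: "F0 (nome \<tau>) = f \<tau>" if "\<tau> \<in> upper_half_plane" for \<tau>
    unfolding F0_def using that nome_in_ball[OF that]
    by (intro per_int nome_inv_in_H) (auto simp: nome_nome_inv)
  have F0_hol: "F0 holomorphic_on ball 0 1 - {0}"
    unfolding holomorphic_on_def
  proof
    fix q0 :: complex assume q0: "q0 \<in> ball 0 1 - {0}"
    define r where "r = min (norm q0) (1 - norm q0)"
    have r: "r > 0" using q0 by (simp add: r_def)
    \<comment> \<open>A branch of the logarithm near q0: the ratio q / q0 has positive real part on
      the ball, so no cut is met. By periodicity f takes the same value there as on the principal
      branch.\<close>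
    define h where "h = (\<lambda>q. nome_inv q0 + Ln (q / q0) / (2 * pi * \<i>))"
    have ball: "q \<in> ball 0 1 - {0} \<and> Re (q / q0) > 0" if "q \<in> ball q0 r" for q
    proof -
      have d: "norm (q - q0) < norm q0" "norm (q - q0) < 1 - norm q0"
        using that by (auto simp: r_def dist_norm norm_minus_commute)
      have "norm q < 1" using d(2) norm_triangle_ineq[of "q - q0" q0] by simp
      moreover have "q \<noteq> 0" using d(1) by auto
      moreover have "Re (q / q0) > 0"
      proof -
        have "norm (q / q0 - 1) = norm (q - q0) / norm q0"
          using q0 by (simp add: diff_divide_distrib flip: norm_divide)
        then have "norm (q / q0 - 1) < 1" using d(1) q0 by simp
        then show ?thesis
          using abs_Re_le_cmod[of "q / q0 - 1"] by (simp add: abs_le_iff)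
      qed
      ultimately show ?thesis by simp
    qed
    have nh: "nome (h q) = q" if "q \<in> ball q0 r" for q
    proof -
      have "nome (h q) = nome (nome_inv q0) * nome (Ln (q / q0) / (2 * pi * \<i>))"
        unfolding h_def by (rule nome_add)
      moreover have "nome (Ln (q / q0) / (2 * pi * \<i>)) = q / q0"
        using ball[OF that] q0 by (auto simp: nome_def)
      ultimately show ?thesis using q0 by (simp add: nome_nome_inv)
    qed
    have hH: "h q \<in> upper_half_plane" if "q \<in> ball q0 r" for q
    proof -
      have "exp (- 2 * pi * Im (h q)) < 1"
        using nh[OF that] ball[OF that] norm_nome[of "h q"] by simp
      then show ?thesis by (simp add: upper_half_plane_def zero_less_mult_iff)
    qed
    have "h holomorphic_on ball q0 r"
      unfolding h_def using ball q0
      by (intro holomorphic_intros) (auto simp: complex_nonpos_Reals_iff not_le dest!: ball)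
    then have "f \<circ> h holomorphic_on ball q0 r"
      using hol hH by (intro holomorphic_on_compose_gen[of h _ f upper_half_plane]) auto
    then have "F0 holomorphic_on ball q0 r"
    proof (rule holomorphic_transform)
      fix q assume q: "q \<in> ball q0 r"
      then show "(f \<circ> h) q = F0 q"
        using F0[OF hH[OF q]] nh[OF q] by simp
    qed
    then have "F0 field_differentiable at q0"
      using r holomorphic_on_imp_differentiable_at[of F0 "ball q0 r" q0] by simp
    then show "F0 field_differentiable at q0 within ball 0 1 - {0}"
      by (rule field_differentiable_at_within)
  qed
  have "((\<lambda>q. (q - 0) * F0 q) \<longlongrightarrow> 0) (at 0)"
  proof (rule Lim_null_comparison)
    define C where "C = \<bar>K\<bar> * fact n"
    \<comment> \<open>With y = Im \<tau>, the estimate y^n \<le> n! e^y comes from one term of the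
      exponential series. As |q| = e^(-2 pi y), there remains e^((1 - 2 pi) y), which is at most
      e^(-y), the power of |q| with exponent 1 / (2 pi).\<close>
    show "((\<lambda>q :: complex. C * norm q powr (1 / (2 * pi))) \<longlongrightarrow> 0) (at 0)"
      by (intro tendsto_mult_right_zero tendsto_zero_powrI[where b = "1 / (2 * pi)"] tendsto_norm_zero)
        (auto intro!: tendsto_intros)
    define d where "d = exp (- 2 * pi * max Y 1)"
    have "\<forall>\<^sub>F q :: complex in at 0. q \<noteq> 0 \<and> norm q < d"
      unfolding eventually_at by (intro exI[of _ d]) (auto simp: d_def dist_norm)
    then show "\<forall>\<^sub>F q in at 0. norm ((q - 0) * F0 q) \<le> C * norm q powr (1 / (2 * pi))"
    proof eventually_elim
      case (elim q)
      define y where "y = Im (nome_inv q)"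
      have "norm q > 0" using elim by simp
      have ny: "norm q = exp (- 2 * pi * y)"
        using norm_nome[of "nome_inv q"] elim by (simp add: nome_nome_inv y_def)
      have "norm q < exp (- 2 * pi * max Y 1)"
        using elim unfolding d_def by blast
      then have y: "y \<ge> Y" "y \<ge> 1"
        unfolding ny by simp_all
      have "norm (F0 q) \<le> K * y ^ n"
        unfolding F0_def y_def using y elim by (intro bound Re_nome_inv) (auto simp: y_def)
      also have "\<dots> \<le> \<bar>K\<bar> * (fact n * exp y)"
      proof (intro mult_mono)
        have "(\<Sum>i\<in>{n}. y ^ i /\<^sub>R fact i) \<le> (\<Sum>i. y ^ i /\<^sub>R fact i)"
          using exp_converges[of y] y by (intro sum_le_suminf) (auto simp: sums_iff)
        then have "y ^ n / fact n \<le> exp y"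
          using exp_converges[of y] by (simp add: sums_iff divide_inverse mult.commute)
        then show "y ^ n \<le> fact n * exp y" by (simp add: field_simps)
      qed (use y in auto)
      finally have "norm (q * F0 q) \<le> exp (- 2 * pi * y) * (C * exp y)"
        unfolding norm_mult ny by (intro mult_left_mono) (auto simp: C_def mult_ac)
      also have "\<dots> = C * exp (- 2 * pi * y + y)" by (simp only: exp_add mult_ac)
      also have "\<dots> \<le> C * exp (- y)"
      proof -
        have "- 2 * pi * y + y \<le> - y" using y pi_gt3 by (simp add: algebra_simps)
        then show ?thesis by (intro mult_left_mono) (auto simp: C_def)
      qed
      also have "exp (- y) = norm q powr (1 / (2 * pi))"
        by (simp add: ny powr_def)
      finally show ?case by simp
    qed
  qed
  then obtain F where F: "F holomorphic_on ball 0 1" "\<And>q. q \<in> ball 0 1 - {0} \<Longrightarrow> F q = F0 q"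
    using holomorphic_on_extend_lim[OF F0_hol] by (auto simp: interior_open)
  have "f \<tau> = F (nome \<tau>)" if "\<tau> \<in> upper_half_plane" for \<tau>
    using F(2)[of "nome \<tau>"] F0[OF that] nome_in_ball[OF that] by simp
  then show ?thesis using F(1) that by (auto simp: has_qexp_def)
qed

lemma has_qexp_limit:
  assumes "has_qexp f F"
  shows "(f \<longlongrightarrow> F 0) (filtercomap Im at_top)"
proof -
  have "isCont F 0"
    using assms holomorphic_on_imp_continuous_on continuous_on_eq_continuous_at[of "ball 0 1" F]
    by (auto simp: has_qexp_def)
  have "filterlim nome (nhds 0) (filtercomap Im at_top)"
  proof (rule tendsto_norm_zero_cancel)
    have "((\<lambda>y. exp (- 2 * pi * y)) \<longlongrightarrow> 0) at_top"
      by real_asymp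
    then have "((\<lambda>\<tau>. exp (- 2 * pi * Im \<tau>)) \<longlongrightarrow> 0) (filtercomap Im at_top)"
      by (rule filterlim_compose) (rule filterlim_filtercomap)
    then show "((\<lambda>\<tau>. norm (nome \<tau>)) \<longlongrightarrow> 0) (filtercomap Im at_top)"
      by (simp add: norm_nome)
  qed
  then have "((\<lambda>\<tau>. F (nome \<tau>)) \<longlongrightarrow> F 0) (filtercomap Im at_top)"
    using \<open>isCont F 0\<close> isCont_tendsto_compose by blast
  moreover have "\<forall>\<^sub>F \<tau> in filtercomap Im at_top. F (nome \<tau>) = f \<tau>"
    unfolding eventually_filtercomap_at_top_linorder
    using assms by (intro exI[of _ 1]) (auto simp: has_qexp_def upper_half_plane_def)
  ultimately show ?thesis by (rule Lim_transform_eventually)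
qed

definition invariant :: "int \<Rightarrow> (complex \<Rightarrow> complex) \<Rightarrow> bool" where
  "invariant k f \<longleftrightarrow> (\<forall>\<gamma>\<in>carrier SL2Z. \<forall>\<tau>\<in>upper_half_plane.
     f (moebius_act \<gamma> \<tau>) = aut_factor \<gamma> \<tau> powi k * f \<tau>)"

lemma powi_cancel:
  fixes a :: complex
  assumes "a \<noteq> 0"
  shows "a powi (- k) * x = y \<longleftrightarrow> x = a powi k * y"
  using assms by (auto simp: power_int_minus field_simps)

text \<open>For an invariant function, holomorphy and boundedness at the cusp together mean an
  expansion in q on the whole disc. In this form sums, products and quotients reduce to operations
  on holomorphic functions of q.\<close>

lemma modular_forms_iff:
  "f \<in> modular_forms k \<longleftrightarrow>
     (\<forall>\<tau>. \<tau> \<notin> upper_half_plane \<longrightarrow> f \<tau> = 0) \<and> invariant k f \<and> (\<exists>F. has_qexp f F)"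
proof -
  have inv: "(\<forall>\<gamma>\<in>carrier SL2Z. \<forall>\<tau>\<in>upper_half_plane.
        aut_factor \<gamma> \<tau> powi (- k) * f (moebius_act \<gamma> \<tau>) = f \<tau>) \<longleftrightarrow> invariant k f"
    unfolding invariant_def by (intro ball_cong refl powi_cancel aut_factor_nonzero)
  have "f holomorphic_on upper_half_plane \<and> f \<in> O[filtercomap Im at_top](\<lambda>_. 1) \<longleftrightarrow> (\<exists>F. has_qexp f F)"
    if inv: "invariant k f"
  proof (intro iffI; elim conjE exE)
    assume hol: "f holomorphic_on upper_half_plane" and O: "f \<in> O[filtercomap Im at_top](\<lambda>_. 1)"
    obtain c where "\<forall>\<^sub>F \<tau> in filtercomap Im at_top. norm (f \<tau>) \<le> c * norm (1 :: complex)"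
      using O by (auto elim!: landau_o.bigE)
    then obtain Y where Y: "\<And>\<tau>. Im \<tau> \<ge> Y \<Longrightarrow> norm (f \<tau>) \<le> c"
      by (auto simp: eventually_filtercomap_at_top_linorder)
    have per: "f (\<tau> + 1) = f \<tau>" if "\<tau> \<in> upper_half_plane" for \<tau>
      using inv that unfolding invariant_def by (metis T_pow_carrier aut_factor_T moebius_T mult_1 of_int_1 power_int_1_left)
    show "\<exists>F. has_qexp f F"
      using periodic_qexp[OF hol per, of Y c 0] Y by auto
  next
    fix F assume F: "has_qexp f F"
    have "F \<circ> nome holomorphic_on upper_half_plane"
      using F nome_in_ball
      by (intro holomorphic_on_compose_gen[of nome _ F "ball 0 1"] nome_holomorphic) (auto simp: has_qexp_def)
    then have "f holomorphic_on upper_half_plane"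
      by (rule holomorphic_transform) (use F in \<open>auto simp: has_qexp_def\<close>)
    moreover have "f \<in> O[filtercomap Im at_top](\<lambda>_. 1)"
      using has_qexp_limit[OF F] by (intro bigoI_tendsto[where c = "F 0"]) auto
    ultimately show "f holomorphic_on upper_half_plane \<and> f \<in> O[filtercomap Im at_top](\<lambda>_. 1)" ..
  qed
  then show ?thesis unfolding modular_forms_def inv[symmetric] by (auto simp: inv)
qed

lemma modular_form_outside: "f \<in> modular_forms k \<Longrightarrow> \<tau> \<notin> upper_half_plane \<Longrightarrow> f \<tau> = 0"
  by (simp add: modular_forms_iff)

lemma modular_form_invariant:
  "f \<in> modular_forms k \<Longrightarrow> \<gamma> \<in> carrier SL2Z \<Longrightarrow> \<tau> \<in> upper_half_plane \<Longrightarrow>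
     f (moebius_act \<gamma> \<tau>) = aut_factor \<gamma> \<tau> powi k * f \<tau>"
  by (simp add: modular_forms_iff invariant_def)

lemma modular_form_holomorphic: "f \<in> modular_forms k \<Longrightarrow> f holomorphic_on upper_half_plane"
  by (simp add: modular_forms_def)

text \<open>A polynomial bound in one strip replaces boundedness. It is what series bounded by a
  power of growth and forms of moderate growth provide.\<close>

lemma modular_formI:
  assumes "\<And>\<tau>. \<tau> \<notin> upper_half_plane \<Longrightarrow> f \<tau> = 0" "f holomorphic_on upper_half_plane" "invariant k f"
    and bound: "\<And>\<tau>. Im \<tau> \<ge> Y \<Longrightarrow> \<bar>Re \<tau>\<bar> \<le> 1 \<Longrightarrow> norm (f \<tau>) \<le> K * Im \<tau> ^ n"
  shows "f \<in> modular_forms k"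
proof -
  have per: "f (\<tau> + 1) = f \<tau>" if "\<tau> \<in> upper_half_plane" for \<tau>
    using assms(3) that unfolding invariant_def by (metis T_pow_carrier aut_factor_T moebius_T mult_1 of_int_1 power_int_1_left)
  obtain F where "has_qexp f F"
    using periodic_qexp[OF assms(2) per bound] by blast
  then show ?thesis using assms by (auto simp: modular_forms_iff)
qed

lemma modular_forms_0: "(\<lambda>_. 0) \<in> modular_forms k"
  by (auto simp: modular_forms_iff invariant_def has_qexp_def intro!: exI[of _ "\<lambda>_. 0"])

lemma modular_forms_add:
  assumes "f \<in> modular_forms k" "g \<in> modular_forms k"
  shows "(\<lambda>\<tau>. f \<tau> + g \<tau>) \<in> modular_forms k"
proof -
  obtain F G where "has_qexp f F" "has_qexp g G" using assms by (auto simp: modular_forms_iff)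
  then have "has_qexp (\<lambda>\<tau>. f \<tau> + g \<tau>) (\<lambda>q. F q + G q)"
    by (auto simp: has_qexp_def intro!: holomorphic_intros)
  then show ?thesis using assms by (auto simp: modular_forms_iff invariant_def distrib_left)
qed

lemma modular_forms_mult:
  assumes "f \<in> modular_forms k" "g \<in> modular_forms l"
  shows "(\<lambda>\<tau>. f \<tau> * g \<tau>) \<in> modular_forms (k + l)"
proof -
  obtain F G where "has_qexp f F" "has_qexp g G" using assms by (auto simp: modular_forms_iff)
  then have "has_qexp (\<lambda>\<tau>. f \<tau> * g \<tau>) (\<lambda>q. F q * G q)"
    by (auto simp: has_qexp_def intro!: holomorphic_intros)
  then show ?thesis using assms aut_factor_nonzero
    by (auto simp: modular_forms_iff invariant_def power_int_add)
qed

lemma modular_forms_scale: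
  assumes "f \<in> modular_forms k"
  shows "(\<lambda>\<tau>. c * f \<tau>) \<in> modular_forms k"
proof -
  obtain F where "has_qexp f F" using assms by (auto simp: modular_forms_iff)
  then have "has_qexp (\<lambda>\<tau>. c * f \<tau>) (\<lambda>q. c * F q)"
    by (auto simp: has_qexp_def intro!: holomorphic_intros)
  then show ?thesis using assms by (auto simp: modular_forms_iff invariant_def)
qed

lemma modular_forms_sum:
  "(\<And>i. i \<in> I \<Longrightarrow> f i \<in> modular_forms k) \<Longrightarrow> (\<lambda>\<tau>. \<Sum>i\<in>I. f i \<tau>) \<in> modular_forms k"
  by (induction I rule: infinite_finite_induct) (auto intro: modular_forms_0 modular_forms_add)

lemma modular_forms_one: "indicator upper_half_plane \<in> modular_forms 0"
proof -
  have "has_qexp (indicator upper_half_plane) (\<lambda>_. 1)" by (auto simp: has_qexp_def)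
  then show ?thesis
    using moebius_upper_half_plane by (auto simp: modular_forms_iff invariant_def)
qed

text \<open>The plain pointwise power would have the value 1 outside of the upper half plane for n =
  0.\<close>

definition mf_pow :: "(complex \<Rightarrow> complex) \<Rightarrow> nat \<Rightarrow> complex \<Rightarrow> complex" where
  "mf_pow f n = (\<lambda>\<tau>. if \<tau> \<in> upper_half_plane then f \<tau> ^ n else 0)"

lemma modular_forms_pow:
  assumes "f \<in> modular_forms k"
  shows "mf_pow f n \<in> modular_forms (int n * k)"
proof (induction n)
  case 0
  have "mf_pow f 0 = indicator upper_half_plane" by (auto simp: mf_pow_def fun_eq_iff)
  then show ?case using modular_forms_one by simp
next
  case (Suc n)
  have "mf_pow f (Suc n) = (\<lambda>\<tau>. f \<tau> * mf_pow f n \<tau>)" by (auto simp: mf_pow_def fun_eq_iff)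
  then show ?case using modular_forms_mult[OF assms Suc] by (simp add: algebra_simps)
qed

section \<open>The discriminant as a modular form of weight 12\<close>

lemma ramanujan_delta_eq:
  assumes "\<tau> \<in> upper_half_plane"
  shows "ramanujan_delta \<tau> = nome \<tau> * qprod (nome \<tau>) 1 ^ 24"
proof -
  note q = norm_nome_less_1[OF assms]
  have "(\<lambda>N. (\<Prod>n<N. 1 - nome \<tau> ^ Suc n * 1) ^ 24) \<longlonglongrightarrow> qprod (nome \<tau>) 1 ^ 24"
    by (intro tendsto_power qprod_LIMSEQ[OF q])
  then have "(\<Prod>n. (1 - nome \<tau> ^ Suc n) ^ 24) = qprod (nome \<tau>) 1 ^ 24"
    by (intro prodinf_eq_prod_lim') (use qprod_1_nonzero[OF q] in \<open>simp_all add: prod_power_distrib\<close>)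
  then show ?thesis using assms by (simp add: ramanujan_delta_def nome_def)
qed

lemma ramanujan_delta_nonzero: "\<tau> \<in> upper_half_plane \<Longrightarrow> ramanujan_delta \<tau> \<noteq> 0"
  using qprod_1_nonzero[OF norm_nome_less_1] by (simp add: ramanujan_delta_eq)

lemma ramanujan_delta_outside: "\<tau> \<notin> upper_half_plane \<Longrightarrow> ramanujan_delta \<tau> = 0"
  by (simp add: ramanujan_delta_def)

lemma qprod_holomorphic_nome: "(\<lambda>q. qprod q 1) holomorphic_on ball 0 1"
proof -
  have "(\<lambda>q. \<Prod>n. 1 + (- (q ^ Suc n * 1))) holomorphic_on ball 0 (1 :: real)"
  proof (rule holomorphic_prodinf)
    fix K :: "complex set" assume K: "compact K" "K \<subseteq> ball 0 1"
    show "\<exists>M. summable M \<and> (\<forall>n. \<forall>q\<in>K. norm (- (q ^ Suc n * 1)) \<le> M n)"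
    proof (cases "K = {}")
      case True
      then show ?thesis by (intro exI[of _ "\<lambda>_. 0"]) auto
    next
      case False
      then obtain x where x: "x \<in> K" "\<And>q. q \<in> K \<Longrightarrow> norm q \<le> norm x"
        using continuous_attains_sup[OF K(1) False, of norm] continuous_on_norm_id by blast
      have "summable (\<lambda>n. norm x ^ Suc n)"
        using x(1) K by (subst summable_Suc_iff) (auto intro!: summable_geometric)
      moreover have "norm (- (q ^ Suc n * 1)) \<le> norm x ^ Suc n" if "q \<in> K" for q n
        using power_mono[OF x(2)[OF that], of "Suc n"] by (simp add: norm_power norm_mult)
      ultimately show ?thesis by blast
    qed
  qed (auto intro!: holomorphic_intros)
  then show ?thesis by (simp add: qprod_def[abs_def])
qed

lemma ramanujan_delta_qexp: "has_qexp ramanujan_delta (\<lambda>q. q * qprod q 1 ^ 24)"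
  unfolding has_qexp_def
  by (auto intro!: holomorphic_intros qprod_holomorphic_nome simp: ramanujan_delta_eq)

text \<open>Invariance under T is the periodicity of q, and \<open>qprod_transform\<close> is the
  law under S. The Euclidean induction combines them by the cocycle property of the automorphy
  factor.\<close>

lemma ramanujan_delta_modular: "ramanujan_delta \<in> modular_forms 12"
proof -
  let ?D = ramanujan_delta
  have T: "?D (\<tau> + of_int n) = ?D \<tau>" if "\<tau> \<in> upper_half_plane" for \<tau> n
  proof -
    have "nome (\<tau> + of_int n) = nome \<tau>"
      using nome_eq_1_iff[of "of_int n"] by (simp add: nome_add)
    moreover have "\<tau> + of_int n \<in> upper_half_plane" using that by (simp add: upper_half_plane_def)
    ultimately show ?thesis using that by (simp add: ramanujan_delta_eq)
  qed
  have S: "?D (- (1 / \<tau>)) = \<tau> ^ 12 * ?D \<tau>" if "\<tau> \<in> upper_half_plane" for \<tau>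
  proof -
    have "- (1 / \<tau>) \<in> upper_half_plane"
      using moebius_upper_half_plane[OF S_mat_carrier that] by simp
    then show ?thesis using qprod_transform[OF that refl] that by (simp add: ramanujan_delta_eq)
  qed
  have "\<forall>\<tau>\<in>upper_half_plane. ?D (moebius_act \<gamma> \<tau>) = aut_factor \<gamma> \<tau> ^ 12 * ?D \<tau>"
    if "\<gamma> \<in> carrier SL2Z" for \<gamma>
    using that
  proof (induction rule: SL2Z_induct)
    case (Gamma_inf \<gamma>)
    then obtain n where "\<gamma> = mat2 1 n 0 1 \<or> \<gamma> = mat2 (- 1) n 0 (- 1)"
      unfolding Gamma_inf_iff by blast
    then show ?case
    proof (elim disjE)
      assume "\<gamma> = mat2 1 n 0 1"
      then have "moebius_act \<gamma> \<tau> = \<tau> + of_int n" "aut_factor \<gamma> \<tau> = 1" for \<tau>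
        by (simp_all add: moebius_act_def aut_factor_def)
      then show ?thesis using T by simp
    next
      assume "\<gamma> = mat2 (- 1) n 0 (- 1)"
      then have "moebius_act \<gamma> \<tau> = \<tau> + of_int (- n)" "aut_factor \<gamma> \<tau> = - 1" for \<tau>
        by (simp_all add: moebius_act_def aut_factor_def)
      then show ?thesis using T[of _ "- n"] by simp
    qed
  next
    case (step \<delta> n)
    show ?case
    proof
      fix \<tau> assume \<tau>: "\<tau> \<in> upper_half_plane"
      let ?ST = "S_mat \<otimes>\<^bsub>SL2Z\<^esub> T_pow n"
      have \<tau>n: "\<tau> + of_int n \<in> upper_half_plane" using \<tau> by (simp add: upper_half_plane_def)
      have ST: "moebius_act ?ST \<tau> = - (1 / (\<tau> + of_int n))" "aut_factor ?ST \<tau> = \<tau> + of_int n"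
        using \<tau> by (simp_all add: moebius_mult aut_factor_mult)
      have H: "moebius_act ?ST \<tau> \<in> upper_half_plane"
        using \<tau> by (intro moebius_upper_half_plane) auto
      have "?D (moebius_act (\<delta> \<otimes>\<^bsub>SL2Z\<^esub> ?ST) \<tau>) = ?D (moebius_act \<delta> (moebius_act ?ST \<tau>))"
        using step(1) \<tau> by (subst moebius_mult) auto
      also have "\<dots> = aut_factor \<delta> (moebius_act ?ST \<tau>) ^ 12 * ?D (moebius_act ?ST \<tau>)"
        using step(2) H by blast
      also have "?D (moebius_act ?ST \<tau>) = aut_factor ?ST \<tau> ^ 12 * ?D \<tau>"
        unfolding ST S[OF \<tau>n] T[OF \<tau>] ..
      also have "aut_factor \<delta> (moebius_act ?ST \<tau>) ^ 12 * (aut_factor ?ST \<tau> ^ 12 * ?D \<tau>)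
          = (aut_factor \<delta> (moebius_act ?ST \<tau>) * aut_factor ?ST \<tau>) ^ 12 * ?D \<tau>"
        by (simp only: power_mult_distrib mult.assoc)
      also have "aut_factor \<delta> (moebius_act ?ST \<tau>) * aut_factor ?ST \<tau> = aut_factor (\<delta> \<otimes>\<^bsub>SL2Z\<^esub> ?ST) \<tau>"
        using step(1) \<tau> by (subst aut_factor_mult) auto
      finally show "?D (moebius_act (\<delta> \<otimes>\<^bsub>SL2Z\<^esub> ?ST) \<tau>) = aut_factor (\<delta> \<otimes>\<^bsub>SL2Z\<^esub> ?ST) \<tau> ^ 12 * ?D \<tau>" .
    qed
  qed
  then have "invariant 12 ?D"
    unfolding invariant_def by (simp only: power_int_numeral) blast
  then show ?thesis
    using ramanujan_delta_qexp ramanujan_delta_outside by (auto simp: modular_forms_iff)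
qed


section \<open>Minimal automorphy factors\<close>

text \<open>A bound on c \<tau> + d bounds the height of the bottom row, and there are finitely many
  integer pairs of bounded height. Hence minima of |c \<tau> + d| exist and are attained by finitely
  many cosets.\<close>

lemma finite_small_aut_factor:
  assumes "\<tau> \<in> upper_half_plane"
  shows "finite {C \<in> cosets. norm (aut_factor (coset_rep C) \<tau>) \<le> R}"
proof (rule finite_imageD)
  define N where "N = \<lceil>growth \<tau> * R\<rceil>"
  show "finite ((\<lambda>C. (coset_rep C $ 2 $ 1, coset_rep C $ 2 $ 2)) ` {C \<in> cosets. norm (aut_factor (coset_rep C) \<tau>) \<le> R})"
  proof (rule finite_subset)
    show "(\<lambda>C. (coset_rep C $ 2 $ 1, coset_rep C $ 2 $ 2)) ` {C \<in> cosets. norm (aut_factor (coset_rep C) \<tau>) \<le> R}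
      \<subseteq> {- N..N} \<times> {- N..N}"
    proof (clarify)
      fix C assume C: "C \<in> cosets" "norm (aut_factor (coset_rep C) \<tau>) \<le> R"
      have "height (coset_rep C) \<le> growth \<tau> * R"
        using height_le_growth[OF coset_rep(1)[OF C(1)] assms] mult_left_mono[OF C(2), of "growth \<tau>"]
          growth_ge_1[OF assms] by linarith
      then have "height (coset_rep C) \<le> of_int N" unfolding N_def by linarith
      then have "\<bar>coset_rep C $ 2 $ 1\<bar> + \<bar>coset_rep C $ 2 $ 2\<bar> \<le> N"
        unfolding height_def by linarith
      then show "coset_rep C $ 2 $ 1 \<in> {- N..N} \<and> coset_rep C $ 2 $ 2 \<in> {- N..N}"
        by auto
    qed
  qed simp
  show "inj_on (\<lambda>C. (coset_rep C $ 2 $ 1, coset_rep C $ 2 $ 2)) {C \<in> cosets. norm (aut_factor (coset_rep C) \<tau>) \<le> R}"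
    by (rule inj_on_subset[OF inj_on_bottom_row]) auto
qed

lemma minimal_aut_factor:
  assumes "\<tau> \<in> upper_half_plane"
  obtains C0 where "C0 \<in> cosets"
    "\<And>C. C \<in> cosets \<Longrightarrow> norm (aut_factor (coset_rep C0) \<tau>) \<le> norm (aut_factor (coset_rep C) \<tau>)"
proof -
  define f where "f = (\<lambda>C. norm (aut_factor (coset_rep C) \<tau>))"
  define S where "S = {C \<in> cosets. f C \<le> f Gamma_inf}"
  have S: "finite S" "Gamma_inf \<in> S"
    using finite_small_aut_factor[OF assms] Gamma_inf_in_cosets by (auto simp: S_def f_def)
  then have "Min (f ` S) \<in> f ` S" by (intro Min_in) auto
  then obtain C0 where C0: "C0 \<in> S" "f C0 = Min (f ` S)" by auto
  have C0_min: "f C0 \<le> f C" if "C \<in> S" for C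
    unfolding C0(2) using S(1) that by (intro Min_le) auto
  have "f C0 \<le> f C" if "C \<in> cosets" for C
    using C0(1) C0_min[of C] that by (cases "f C \<le> f Gamma_inf") (auto simp: S_def)
  then show ?thesis using that C0 by (auto simp: S_def f_def)
qed

lemma norm_aut_factor_coset:
  assumes "\<gamma> \<in> carrier SL2Z"
  obtains C where "C \<in> cosets" "\<And>\<tau>. norm (aut_factor \<gamma> \<tau>) = norm (aut_factor (coset_rep C) \<tau>)"
proof -
  let ?C = "Gamma_inf #>\<^bsub>SL2Z\<^esub> \<gamma>"
  have C: "?C \<in> cosets"
    using Gamma_inf_carrier by (intro SL.rcosetsI assms) auto
  have "\<gamma> \<in> Gamma_inf #>\<^bsub>SL2Z\<^esub> coset_rep ?C"
    unfolding coset_rep(2)[OF C, symmetric] by (rule SL.rcos_self[OF assms subgroup_Gamma_inf])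
  then obtain t where t: "t \<in> Gamma_inf" "\<gamma> = t \<otimes>\<^bsub>SL2Z\<^esub> coset_rep ?C"
    by (auto simp: r_coset_def)
  obtain s :: complex where s: "s = 1 \<or> s = - 1" "\<And>\<gamma> \<tau>. aut_factor (t \<otimes>\<^bsub>SL2Z\<^esub> \<gamma>) \<tau> = s * aut_factor \<gamma> \<tau>"
    using aut_factor_Gamma_inf[OF t(1)] by metis
  have "norm (aut_factor \<gamma> \<tau>) = norm (aut_factor (coset_rep ?C) \<tau>)" for \<tau>
  proof -
    have "aut_factor \<gamma> \<tau> = s * aut_factor (coset_rep ?C) \<tau>" by (subst t(2)) (rule s(2))
    then show ?thesis using s(1) by (auto simp: norm_mult)
  qed
  then show ?thesis using that C by blast
qed

text \<open>Moving \<tau> by a matrix with minimal |c \<tau> + d| gives a point \<sigma> at which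
  every automorphy factor has modulus at least 1. Applied to S T^n with \<sigma> + n close to the
  imaginary axis, this bounds the imaginary part from below.\<close>

lemma reduction:
  assumes "\<tau> \<in> upper_half_plane"
  obtains \<gamma> where "\<gamma> \<in> carrier SL2Z" "Im (moebius_act \<gamma> \<tau>) \<ge> 1 / 2"
proof -
  obtain C0 where C0: "C0 \<in> cosets"
    "\<And>C. C \<in> cosets \<Longrightarrow> norm (aut_factor (coset_rep C0) \<tau>) \<le> norm (aut_factor (coset_rep C) \<tau>)"
    using minimal_aut_factor[OF assms] by blast
  define g where "g = coset_rep C0"
  define \<sigma> where "\<sigma> = moebius_act g \<tau>"
  have g: "g \<in> carrier SL2Z" using C0 coset_rep by (simp add: g_def)
  have \<sigma>: "\<sigma> \<in> upper_half_plane" using g assms by (simp add: \<sigma>_def moebius_upper_half_plane)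
  have ge1: "norm (aut_factor \<gamma> \<sigma>) \<ge> 1" if \<gamma>: "\<gamma> \<in> carrier SL2Z" for \<gamma>
  proof -
    have "\<gamma> \<otimes>\<^bsub>SL2Z\<^esub> g \<in> carrier SL2Z" using \<gamma> g by simp
    then obtain C where "C \<in> cosets"
      "norm (aut_factor (\<gamma> \<otimes>\<^bsub>SL2Z\<^esub> g) \<tau>) = norm (aut_factor (coset_rep C) \<tau>)"
      using norm_aut_factor_coset by metis
    then have "norm (aut_factor g \<tau>) \<le> norm (aut_factor \<gamma> \<sigma>) * norm (aut_factor g \<tau>)"
      using C0(2) \<gamma> g assms by (simp add: aut_factor_mult norm_mult \<sigma>_def g_def)
    moreover have "norm (aut_factor g \<tau>) > 0" using aut_factor_nonzero g assms by simp
    ultimately show ?thesis by (simp add: mult_le_cancel_right1)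
  qed
  \<comment> \<open>With |Re \<sigma> + n| \<le> 1/2 and |\<sigma> + n| \<ge> 1 the square of Im
    \<sigma> is at least 3/4. The weaker bound 1/4 is enough below.\<close>
  define n where "n = - round (Re \<sigma>)"
  have "\<bar>Re \<sigma> + of_int n\<bar> \<le> 1 / 2"
    using of_int_round_abs_le[of "Re \<sigma>"] by (simp add: n_def abs_minus_commute)
  then have "\<bar>Re \<sigma> + of_int n\<bar> ^ 2 \<le> (1 / 2) ^ 2" by (intro power_mono) auto
  then have re: "(Re \<sigma> + of_int n) ^ 2 \<le> (1 / 2) ^ 2" by (simp only: power2_abs)
  have "norm (\<sigma> + of_int n) \<ge> 1"
    using ge1[of "S_mat \<otimes>\<^bsub>SL2Z\<^esub> T_pow n"] \<sigma> by (simp add: aut_factor_mult)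
  then have "1 ^ 2 \<le> norm (\<sigma> + of_int n) ^ 2" by (intro power_mono) auto
  also have "norm (\<sigma> + of_int n) ^ 2 = (Re \<sigma> + of_int n) ^ 2 + Im \<sigma> ^ 2"
    by (simp add: cmod_power2)
  finally have "1 ^ 2 \<le> (Re \<sigma> + of_int n) ^ 2 + Im \<sigma> ^ 2" .
  then have "1 \<le> (Re \<sigma> + of_int n) ^ 2 + Im \<sigma> ^ 2" by (simp only: power_one)
  moreover have quarter: "(1 / 2) ^ 2 = (1 / 4 :: real)" by (simp add: power2_eq_square)
  moreover define a b where "a = (Re \<sigma> + of_int n) ^ 2" and "b = Im \<sigma> ^ 2"
  ultimately have "1 / 4 \<le> b" using re by linarith
  then have "(1 / 2) ^ 2 \<le> Im \<sigma> ^ 2" unfolding quarter b_def .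
  then have "1 / 2 \<le> Im \<sigma>"
    by (rule power2_le_imp_le) (use \<sigma> in \<open>simp add: upper_half_plane_def\<close>)
  then show ?thesis using that g by (simp add: \<sigma>_def)
qed

text \<open>In weight 0 every value on the upper half plane is already taken in a fixed compact disc
  in the variable q, which includes the cusp. So |F| has an interior maximum and F is
  constant.\<close>

lemma modular_forms_weight_0:
  assumes "f \<in> modular_forms 0"
  obtains c where "\<And>\<tau>. \<tau> \<in> upper_half_plane \<Longrightarrow> f \<tau> = c"
proof -
  obtain F where F: "has_qexp f F" using assms by (auto simp: modular_forms_iff)
  \<comment> \<open>The image of the region Im \<tau> \<ge> 1/2 from
    \<open>reduction\<close>.\<close>
  define r where "r = exp (- pi)"
  have r: "0 < r" "r < 1" by (simp_all add: r_def)
  have cont: "continuous_on (cball 0 r) (\<lambda>q. norm (F q))"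
    using F r by (intro continuous_intros continuous_on_subset[OF holomorphic_on_imp_continuous_on])
      (auto simp: has_qexp_def)
  have "cball (0 :: complex) r \<noteq> {}" using r by simp
  then obtain q0 where q0: "q0 \<in> cball 0 r" "\<And>q. q \<in> cball 0 r \<Longrightarrow> norm (F q) \<le> norm (F q0)"
    using continuous_attains_sup[OF compact_cball _ cont] by blast
  have "norm (F q) \<le> norm (F q0)" if q: "q \<in> ball 0 1" for q
  proof (cases "q = 0")
    case True
    then show ?thesis using q0 r by simp
  next
    case False
    define \<tau> where "\<tau> = nome_inv q"
    have \<tau>: "\<tau> \<in> upper_half_plane" using q False by (simp add: \<tau>_def nome_inv_in_H)
    obtain \<gamma> where \<gamma>: "\<gamma> \<in> carrier SL2Z" "Im (moebius_act \<gamma> \<tau>) \<ge> 1 / 2"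
      using reduction[OF \<tau>] by blast
    have H: "moebius_act \<gamma> \<tau> \<in> upper_half_plane" using \<gamma> \<tau> moebius_upper_half_plane by blast
    have "F q = f \<tau>" using F \<tau> False by (simp add: has_qexp_def \<tau>_def nome_nome_inv)
    also have "\<dots> = f (moebius_act \<gamma> \<tau>)"
      using modular_form_invariant[OF assms \<gamma>(1) \<tau>] by simp
    also have "\<dots> = F (nome (moebius_act \<gamma> \<tau>))" using F H by (simp add: has_qexp_def)
    finally show ?thesis using q0(2) \<gamma>(2) by (simp add: norm_nome r_def)
  qed
  then have "F constant_on ball 0 1"
    using F q0 r by (intro maximum_modulus_principle[where \<xi> = q0 and U = "ball 0 1"]) (auto simp: has_qexp_def)
  then obtain c where "\<And>q. q \<in> ball 0 1 \<Longrightarrow> F q = c" by (auto simp: constant_on_def)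
  then show ?thesis using that[of c] F nome_in_ball by (simp add: has_qexp_def)
qed


section \<open>Eisenstein series\<close>

text \<open>Summing over cosets instead of pairs (c, d) normalises the constant term to 1. The
  choice of representatives is immaterial for even m.\<close>

definition eisenstein :: "nat \<Rightarrow> complex \<Rightarrow> complex" where
  "eisenstein m \<tau> = (if \<tau> \<in> upper_half_plane then coset_series m (\<lambda>_. 1) \<tau> else 0)"

lemma eisenstein_summable:
  assumes "m \<ge> 4" "\<tau> \<in> upper_half_plane"
  shows "(\<lambda>C. norm (aut_factor (coset_rep C) \<tau> powi (- int m))) summable_on cosets"
  using coset_series_summable[OF height_bounded_const[of 1], of m \<tau>] assms by simp

lemma eisenstein_modular:
  assumes "m \<ge> 4" "even m"
  shows "eisenstein m \<in> modular_forms (int m)"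
proof -
  have b: "height_bounded 0 (\<lambda>_. 1)" by (rule height_bounded_const)
  have "coset_series m (\<lambda>_. 1) holomorphic_on upper_half_plane"
    using assms by (intro coset_series_holomorphic[OF b]) auto
  then have hol: "eisenstein m holomorphic_on upper_half_plane"
    by (rule holomorphic_transform) (simp add: eisenstein_def)
  obtain K where K: "\<And>\<tau>. \<tau> \<in> upper_half_plane \<Longrightarrow> norm (coset_series m (\<lambda>_. 1) \<tau>) \<le> K * growth \<tau> ^ m"
    using coset_series_growth[OF b, of m] assms by auto
  have K': "\<tau> \<in> upper_half_plane \<Longrightarrow> norm (eisenstein m \<tau>) \<le> \<bar>K\<bar> * growth \<tau> ^ m" for \<tau>
  proof -
    assume \<tau>: "\<tau> \<in> upper_half_plane"
    then have "K * growth \<tau> ^ m \<le> \<bar>K\<bar> * growth \<tau> ^ m"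
      using growth_ge_1[OF \<tau>] by (intro mult_right_mono) auto
    then show ?thesis using K[OF \<tau>] \<tau> by (simp add: eisenstein_def)
  qed
  obtain J where J: "\<And>\<tau>. Im \<tau> \<ge> 1 \<Longrightarrow> Re \<tau> \<in> {-1..1} \<Longrightarrow>
    norm (aut_factor \<one>\<^bsub>SL2Z\<^esub> \<tau> powi (- 0)) * norm (eisenstein m (moebius_act \<one>\<^bsub>SL2Z\<^esub> \<tau>)) \<le> J * Im \<tau> ^ (2 * m + nat \<bar>0\<bar>)"
    using slash_bound[OF abs_ge_zero K' SL.one_closed bounded_closed_interval[of "-1" 1], where k = 0] by metis
  have bound: "norm (eisenstein m \<tau>) \<le> J * Im \<tau> ^ (2 * m)" if "Im \<tau> \<ge> 1" "\<bar>Re \<tau>\<bar> \<le> 1" for \<tau>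
    using J[of \<tau>] that by (simp add: abs_le_iff)
  have inv: "invariant (int m) (eisenstein m)"
    unfolding invariant_def
  proof (intro ballI)
    fix \<gamma> \<tau> assume \<gamma>: "\<gamma> \<in> carrier SL2Z" and \<tau>: "\<tau> \<in> upper_half_plane"
    have H: "moebius_act \<gamma> \<tau> \<in> upper_half_plane" using \<gamma> \<tau> by (rule moebius_upper_half_plane)
    define w where "w = aut_factor \<gamma> \<tau>"
    have w: "w \<noteq> 0" using aut_factor_nonzero \<gamma> \<tau> by (simp add: w_def)
    have "(\<Sum>\<^sub>\<infinity>C\<in>cosets. aut_factor (coset_rep C) (moebius_act \<gamma> \<tau>) powi (- int m))
      = (\<Sum>\<^sub>\<infinity>C\<in>cosets. w powi int m * aut_factor (coset_rep C \<otimes>\<^bsub>SL2Z\<^esub> \<gamma>) \<tau> powi (- int m))"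
    proof (rule infsum_cong)
      fix C assume "C \<in> cosets"
      then have "aut_factor (coset_rep C \<otimes>\<^bsub>SL2Z\<^esub> \<gamma>) \<tau> = aut_factor (coset_rep C) (moebius_act \<gamma> \<tau>) * w"
        unfolding w_def using coset_rep(1) \<gamma> \<tau> by (intro aut_factor_mult) auto
      then show "aut_factor (coset_rep C) (moebius_act \<gamma> \<tau>) powi (- int m)
         = w powi int m * aut_factor (coset_rep C \<otimes>\<^bsub>SL2Z\<^esub> \<gamma>) \<tau> powi (- int m)"
        using w by (simp add: power_int_minus power_mult_distrib)
    qed
    also have "\<dots> = w powi int m * (\<Sum>\<^sub>\<infinity>C\<in>cosets. aut_factor (coset_rep C \<otimes>\<^bsub>SL2Z\<^esub> \<gamma>) \<tau> powi (- int m))"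
      by (rule infsum_cmult_right')
    also have "(\<Sum>\<^sub>\<infinity>C\<in>cosets. aut_factor (coset_rep C \<otimes>\<^bsub>SL2Z\<^esub> \<gamma>) \<tau> powi (- int m))
      = (\<Sum>\<^sub>\<infinity>C\<in>cosets. aut_factor (coset_rep C) \<tau> powi (- int m))"
    proof (rule infsum_cosets_translate[OF \<gamma>, of "\<lambda>\<delta>. aut_factor \<delta> \<tau> powi (- int m)"])
      fix t \<delta> assume "t \<in> Gamma_inf"
      then obtain s :: complex where s: "s = 1 \<or> s = - 1"
        "\<And>\<gamma> \<tau>. aut_factor (t \<otimes>\<^bsub>SL2Z\<^esub> \<gamma>) \<tau> = s * aut_factor \<gamma> \<tau>"
        using aut_factor_Gamma_inf by metis
      show "aut_factor (t \<otimes>\<^bsub>SL2Z\<^esub> \<delta>) \<tau> powi (- int m) = aut_factor \<delta> \<tau> powi (- int m)"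
        unfolding s(2) by (rule power_int_minus_one_even[OF s(1)]) (use assms in simp)
    qed
    finally show "eisenstein m (moebius_act \<gamma> \<tau>) = aut_factor \<gamma> \<tau> powi int m * eisenstein m \<tau>"
      using H \<tau> by (simp add: eisenstein_def coset_series_def w_def)
  qed
  show ?thesis
    by (rule modular_formI[OF _ hol inv bound]) (simp_all add: eisenstein_def)
qed

text \<open>On \<tau> = \<i> y the coset \<open>Gamma_inf\<close> contributes 1. All other terms
  have c \<noteq> 0 and |c \<tau> + d| \<ge> y: one such factor yields the decay 1 / y, and four
  more make the sum converge, which explains m \<ge> 5.\<close>

lemma eisenstein_constant_term:
  assumes "m \<ge> 5" "even m" "has_qexp (eisenstein m) F"
  shows "F 0 = 1"
proof -
  define Z where "Z = (\<Sum>\<^sub>\<infinity>C\<in>cosets. 1 / height (coset_rep C) ^ 4)"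
  have bound: "norm (eisenstein m (\<i> * of_real y) - 1) \<le> 16 * Z / y" if y: "y \<ge> 1" for y :: real
  proof -
    let ?\<tau> = "\<i> * of_real y"
    define t where "t = (\<lambda>C. aut_factor (coset_rep C) ?\<tau> powi (- int m))"
    have H: "?\<tau> \<in> upper_half_plane" using y by (simp add: upper_half_plane_def)
    have summ: "(\<lambda>C. norm (t C)) summable_on cosets"
      unfolding t_def using assms H by (intro eisenstein_summable) auto
    have t0: "t Gamma_inf = 1"
    proof -
      obtain s :: complex where s: "s = 1 \<or> s = - 1" "\<And>\<tau>. aut_factor (coset_rep Gamma_inf) \<tau> = s"
        using aut_factor_Gamma_inf[OF coset_rep_Gamma_inf] by metis
      then show ?thesis using assms(2) by (auto simp: t_def)
    qed
    let ?R = "cosets - {Gamma_inf}"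
    have summR: "(\<lambda>C. norm (t C)) summable_on ?R"
      by (rule summable_on_subset_banach[OF summ]) auto
    have "infsum t cosets = infsum t (insert Gamma_inf ?R)"
      using Gamma_inf_in_cosets by (simp add: insert_absorb)
    also have "\<dots> = t Gamma_inf + infsum t ?R"
      using Infinite_Sum.abs_summable_summable[OF summR] by (subst infsum_insert) auto
    finally have "eisenstein m ?\<tau> - 1 = infsum t ?R"
      using H t0 by (simp add: eisenstein_def coset_series_def t_def)
    moreover have "norm (infsum t ?R) \<le> (\<Sum>\<^sub>\<infinity>C\<in>?R. norm (t C))"
      by (rule norm_infsum_bound[OF summR])
    moreover have "(\<Sum>\<^sub>\<infinity>C\<in>?R. norm (t C)) \<le> (\<Sum>\<^sub>\<infinity>C\<in>cosets. (16 / y) * (1 / height (coset_rep C) ^ 4))"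
    proof (rule infsum_mono_neutral[OF summR])
      show "(\<lambda>C. (16 / y) * (1 / height (coset_rep C) ^ 4)) summable_on cosets"
        by (intro summable_on_cmult_right summable_height)
      show "norm (t C) \<le> 0" if "C \<in> ?R - cosets" for C using that by blast
      show "0 \<le> (16 / y) * (1 / height (coset_rep C) ^ 4)" for C
        using y by (simp add: height_def)
      fix C assume "C \<in> ?R \<inter> cosets"
      then have C: "C \<in> ?R" by blast
      define c d where "c = coset_rep C $ 2 $ 1" and "d = coset_rep C $ 2 $ 2"
      define w where "w = norm (aut_factor (coset_rep C) ?\<tau>)"
      have rep: "coset_rep C \<in> carrier SL2Z" using coset_rep C by blast
      have "c \<noteq> 0"
      proof
        assume "c = 0"
        then have "coset_rep C \<in> Gamma_inf" using rep by (simp add: Gamma_inf_iff_lower_left c_def)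
        then have "Gamma_inf #>\<^bsub>SL2Z\<^esub> coset_rep C = Gamma_inf"
          by (intro SL.coset_join2[OF rep subgroup_Gamma_inf])
        then have "C = Gamma_inf"
          using coset_rep(2)[of C] C by blast
        then show False using C by simp
      qed
      then have c1: "\<bar>real_of_int c\<bar> \<ge> 1" by linarith
      have w_eq: "aut_factor (coset_rep C) ?\<tau> = Complex (of_int d) (of_int c * y)"
        by (simp add: aut_factor_def c_def d_def complex_eq_iff)
      have w1: "\<bar>real_of_int c\<bar> * y \<le> w"
        using abs_Im_le_cmod[of "Complex (of_int d) (of_int c * y)"] y by (simp add: w_def w_eq abs_mult)
      have wd: "\<bar>real_of_int d\<bar> \<le> w"
        using abs_Re_le_cmod[of "Complex (of_int d) (of_int c * y)"] by (simp add: w_def w_eq)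
      have "1 * y \<le> \<bar>real_of_int c\<bar> * y" using c1 y by (intro mult_right_mono) auto
      then have wy: "w \<ge> y" using w1 by linarith
      have "\<bar>real_of_int c\<bar> * 1 \<le> \<bar>real_of_int c\<bar> * y" using y by (intro mult_left_mono) auto
      then have wc: "\<bar>real_of_int c\<bar> \<le> w" using w1 by linarith
      define h where "h = height (coset_rep C)"
      have h: "h \<ge> 1" "h \<le> 2 * w" using height_ge_1[OF rep] wc wd by (auto simp: h_def height_def c_def d_def)
      \<comment> \<open>One factor w bounds y, the other four bound h / 2 each; 16 is 2^4.\<close>
      have "y * h ^ 4 \<le> w * (2 * w) ^ 4" using wy h y by (intro mult_mono power_mono) auto
      also have "\<dots> = 16 * w ^ 5" by (simp add: power_mult_distrib eval_nat_numeral)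
      also have "\<dots> \<le> 16 * w ^ m" using wy y assms by (intro mult_left_mono power_increasing) auto
      finally have "inverse (w ^ m) \<le> (16 / y) * (1 / h ^ 4)"
        using y h wy by (simp add: field_simps)
      then show "norm (t C) \<le> (16 / y) * (1 / height (coset_rep C) ^ 4)"
        by (simp add: t_def norm_inverse norm_power power_int_minus w_def h_def)
    qed
    moreover have "(\<Sum>\<^sub>\<infinity>C\<in>cosets. (16 / y) * (1 / height (coset_rep C) ^ 4)) = (16 / y) * Z"
      unfolding Z_def by (rule infsum_cmult_right) (simp add: summable_height)
    ultimately show ?thesis by (simp add: field_simps)
  qed
  have "((\<lambda>y. eisenstein m (\<i> * of_real y) - 1) \<longlongrightarrow> 0) at_top"
  proof (rule Lim_null_comparison)
    show "\<forall>\<^sub>F y in at_top. norm (eisenstein m (\<i> * of_real y) - 1) \<le> 16 * Z / y"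
      using eventually_ge_at_top[of 1] by eventually_elim (rule bound)
    show "((\<lambda>y. 16 * Z / y) \<longlongrightarrow> 0) at_top" by real_asymp
  qed
  then have 1: "((\<lambda>y. eisenstein m (\<i> * of_real y)) \<longlongrightarrow> 1) at_top"
    by (simp add: LIM_zero_iff)
  have "filterlim (\<lambda>y. \<i> * complex_of_real y) (filtercomap Im at_top) at_top"
    by (simp add: filterlim_filtercomap_iff o_def filterlim_ident)
  then have "((\<lambda>y. eisenstein m (\<i> * of_real y)) \<longlongrightarrow> F 0) at_top"
    by (rule filterlim_compose[OF has_qexp_limit[OF assms(3)]])
  then show ?thesis using 1 tendsto_unique trivial_limit_at_top_linorder by blast
qed

text \<open>Dirichlet's theorem makes all angles small multiples of a full turn. An error below 1/8,
  hence at most 1/6 of a turn, leaves angles of at most pi / 3, whose cosine is at least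
  1/2.\<close>

lemma unimodular_simultaneous:
  fixes u :: "nat \<Rightarrow> complex"
  assumes "\<And>i. i < k \<Longrightarrow> norm (u i) = 1"
  obtains q :: nat where "q > 0" "\<And>i. i < k \<Longrightarrow> Re (u i ^ q) \<ge> 1 / 2"
proof -
  define \<theta> where "\<theta> = (\<lambda>i. Arg (u i) / (2 * pi))"
  obtain q p where q: "0 < q" "\<And>i. i < k \<Longrightarrow> \<bar>of_int q * \<theta> i - of_int (p i)\<bar> < 1 / real 8"
    using Dirichlet_approx_simult[of 8 k \<theta>, OF zero_less_numeral] by metis
  have "Re (u i ^ nat q) \<ge> 1 / 2" if i: "i < k" for i
  proof -
    define \<delta> where "\<delta> = of_int q * \<theta> i - of_int (p i)"
    have "u i = cis (2 * pi * \<theta> i)"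
      using rcis_cmod_Arg[of "u i"] assms[OF i] by (simp add: rcis_def \<theta>_def)
    then have "u i ^ nat q = cis (real (nat q) * (2 * pi * \<theta> i))" by (simp only: Complex.DeMoivre)
    also have "real (nat q) * (2 * pi * \<theta> i) = 2 * pi * \<delta> + 2 * pi * of_int (p i)"
      using q(1) by (simp add: \<delta>_def algebra_simps)
    also have "cis \<dots> = cis (2 * pi * \<delta>)"
      by (simp add: cis_mult [symmetric] cis_multiple_2pi)
    finally have "Re (u i ^ nat q) = cos \<bar>2 * pi * \<delta>\<bar>" by simp
    also have "\<dots> \<ge> cos (pi / 3)"
    proof (rule cos_monotone_0_pi_le)
      have "\<bar>\<delta>\<bar> \<le> 1 / 6" using q(2)[OF i] by (simp add: \<delta>_def)
      then have "2 * pi * \<bar>\<delta>\<bar> \<le> 2 * pi * (1 / 6)" by (intro mult_left_mono) auto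
      then show "\<bar>2 * pi * \<delta>\<bar> \<le> pi / 3" by (simp add: abs_mult)
    qed auto
    finally show ?thesis by (simp add: cos_60)
  qed
  then show ?thesis using that[of "nat q"] q(1) by simp
qed

text \<open>
  The terms of minimal \<open>\<bar>c \<tau> + d\<bar>\<close> dominate in large weight, and by simultaneous approximation
  their phases almost align in infinitely many weights.
\<close>

lemma eisenstein_nonzero:
  assumes "\<tau> \<in> upper_half_plane"
  obtains n where "n \<ge> n0" "eisenstein (12 * n) \<tau> \<noteq> 0"
proof -
  obtain C0 where C0: "C0 \<in> cosets"
    "\<And>C. C \<in> cosets \<Longrightarrow> norm (aut_factor (coset_rep C0) \<tau>) \<le> norm (aut_factor (coset_rep C) \<tau>)"
    using minimal_aut_factor[OF assms] by blast
  define w where "w = (\<lambda>C. aut_factor (coset_rep C) \<tau>)"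
  define r where "r = norm (w C0)"
  have wnz: "w C \<noteq> 0" if "C \<in> cosets" for C
    using aut_factor_nonzero coset_rep(1)[OF that] assms by (simp add: w_def)
  have r: "r > 0" using wnz[OF C0(1)] by (simp add: r_def)
  have min: "r \<le> norm (w C)" if "C \<in> cosets" for C using C0(2)[OF that] by (simp add: r_def w_def)
  \<comment> \<open>The terms rescaled by the minimum r: their modulus is at most 1, with equality
    exactly on the finite set S.\<close>
  define u where "u = (\<lambda>C. of_real r / w C)"
  define S where "S = {C \<in> cosets. norm (w C) = r}"
  have fin2: "finite {C \<in> cosets. norm (w C) \<le> R}" for R
    using finite_small_aut_factor[OF assms] by (simp add: w_def)
  have finS: "finite S" by (rule finite_subset[OF _ fin2[of r]]) (auto simp: S_def)
  have C0S: "C0 \<in> S" using C0 by (simp add: S_def r_def)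
  have uS: "norm (u C) = 1" if "C \<in> S" for C
    using that r by (simp add: S_def u_def norm_divide)
  have "\<exists>\<rho><1. \<forall>C\<in>cosets - S. norm (u C) \<le> \<rho>"
  proof -
    \<comment> \<open>Apart from S only finitely many cosets have |w| \<le> 2 r, so their moduli
      stay below some number less than 1. The remaining cosets have |u| \<le> 1/2, a value that also
      keeps the maximum meaningful for empty Q.\<close>
    define Q where "Q = {C \<in> cosets. norm (w C) \<le> 2 * r} - S"
    have finQ: "finite Q" using fin2 by (simp add: Q_def)
    define \<rho> where "\<rho> = Max (insert (1 / 2) ((\<lambda>C. norm (u C)) ` Q))"
    have "\<rho> < 1"
      unfolding \<rho>_def
    proof (subst Max_less_iff)
      show "\<forall>x\<in>insert (1 / 2) ((\<lambda>C. norm (u C)) ` Q). x < 1"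
      proof (clarsimp)
        fix C assume C: "C \<in> Q"
        then have "norm (w C) \<noteq> r" "C \<in> cosets" by (auto simp: Q_def S_def)
        then have "r < norm (w C)"
          using min[of C] by linarith
        moreover from this have "0 < norm (w C)" using r by linarith
        ultimately show "norm (u C) < 1"
          using r by (simp add: u_def norm_divide pos_divide_less_eq del: zero_less_norm_iff)
      qed
    qed (use finQ in auto)
    moreover have "norm (u C) \<le> \<rho>" if C: "C \<in> cosets - S" for C
    proof (cases "C \<in> Q")
      case True
      then show ?thesis unfolding \<rho>_def using finQ by (intro Max_ge) auto
    next
      case False
      then have "norm (w C) > 2 * r" using C by (auto simp: Q_def)
      moreover from this have "0 < norm (w C)" using r by linarith
      ultimately have "norm (u C) \<le> 1 / 2"
        using r by (simp add: u_def norm_divide pos_divide_le_eq del: zero_less_norm_iff)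
      also have "\<dots> \<le> \<rho>" unfolding \<rho>_def using finQ by (intro Max_ge) auto
      finally show ?thesis .
    qed
    ultimately show ?thesis by blast
  qed
  then obtain \<rho> where \<rho>: "\<rho> < 1" "\<And>C. C \<in> cosets - S \<Longrightarrow> norm (u C) \<le> \<rho>" by blast
  define \<rho>' where "\<rho>' = max \<rho> 0"
  have \<rho>': "0 \<le> \<rho>'" "\<rho>' < 1" "\<And>C. C \<in> cosets - S \<Longrightarrow> norm (u C) \<le> \<rho>'"
    using \<rho> by (force simp: \<rho>'_def)+
  have summ: "(\<lambda>C. norm (u C ^ m)) summable_on cosets" if "m \<ge> 4" for m
  proof -
    have "(\<lambda>C. r ^ m * norm (w C powi (- int m))) summable_on cosets"
      using eisenstein_summable[OF that assms] unfolding w_def by (rule summable_on_cmult_right)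
    moreover have "norm (u C ^ m) = r ^ m * norm (w C powi (- int m))" for C
      using r by (simp add: u_def norm_divide norm_power power_int_minus norm_inverse divide_inverse
          norm_mult power_mult_distrib power_inverse)
    ultimately show ?thesis by (simp only:)
  qed
  define B where "B = (\<Sum>\<^sub>\<infinity>C\<in>cosets. norm (u C ^ 4))"
  \<comment> \<open>Four powers are kept for the summable majorant, the other m - 4 are estimated by
    the gap \<rho>'.\<close>
  have tail: "norm (\<Sum>\<^sub>\<infinity>C\<in>cosets - S. u C ^ m) \<le> \<rho>' ^ (m - 4) * B" if "m \<ge> 4" for m
  proof -
    have s: "(\<lambda>C. norm (u C ^ m)) summable_on cosets - S"
      by (rule summable_on_subset_banach[OF summ[OF that]]) auto
    have "norm (\<Sum>\<^sub>\<infinity>C\<in>cosets - S. u C ^ m) \<le> (\<Sum>\<^sub>\<infinity>C\<in>cosets - S. norm (u C ^ m))"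
      by (rule norm_infsum_bound[OF s])
    also have "\<dots> \<le> (\<Sum>\<^sub>\<infinity>C\<in>cosets. \<rho>' ^ (m - 4) * norm (u C ^ 4))"
    proof (rule infsum_mono_neutral[OF s])
      show "(\<lambda>C. \<rho>' ^ (m - 4) * norm (u C ^ 4)) summable_on cosets"
        using summ[of 4] by (intro summable_on_cmult_right) auto
      fix C assume "C \<in> (cosets - S) \<inter> cosets"
      then have "norm (u C) ^ (m - 4) \<le> \<rho>' ^ (m - 4)"
        using \<rho>'(3) by (intro power_mono) auto
      then have "norm (u C) ^ (m - 4) * norm (u C) ^ 4 \<le> \<rho>' ^ (m - 4) * norm (u C) ^ 4"
        by (intro mult_right_mono) auto
      then show "norm (u C ^ m) \<le> \<rho>' ^ (m - 4) * norm (u C ^ 4)"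
        using that by (simp add: norm_power flip: power_add)
    qed (use \<rho>' in auto)
    also have "\<dots> = \<rho>' ^ (m - 4) * B"
      unfolding B_def using summ[of 4] by (intro infsum_cmult_right) auto
    finally show ?thesis .
  qed
  have "(\<lambda>m. \<rho>' ^ m * B) \<longlonglongrightarrow> 0"
    using \<rho>' by (intro tendsto_mult_left_zero LIMSEQ_power_zero) auto
  then have "\<forall>\<^sub>F m in sequentially. \<rho>' ^ m * B < 1 / 2"
    by (rule order_tendstoD) auto
  then obtain M where M: "\<And>m. m \<ge> M \<Longrightarrow> \<rho>' ^ m * B < 1 / 2"
    by (auto simp: eventually_sequentially)
  \<comment> \<open>Simultaneous approximation gives some q > 0 without a lower bound of choice. It
    is applied to the powers with exponent 12 n1, so that n = n1 q is large enough in any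
    case.\<close>
  define n1 where "n1 = max n0 (M + 4)"
  obtain f where f: "bij_betw f {..<card S} S"
    using ex_bij_betw_nat_finite[OF finS] by (metis atLeast0LessThan)
  have unit: "norm (u (f i) ^ (12 * n1)) = 1" if "i < card S" for i
  proof -
    have "f i \<in> S" using f that by (auto simp: bij_betw_def)
    then show ?thesis by (simp add: norm_power uS)
  qed
  obtain q where q: "q > 0" "\<And>i. i < card S \<Longrightarrow> Re ((u (f i) ^ (12 * n1)) ^ q) \<ge> 1 / 2"
    using unimodular_simultaneous[of "card S" "\<lambda>i. u (f i) ^ (12 * n1)", OF unit] by metis
  define n where "n = n1 * q"
  have "n1 \<le> n" using q by (simp add: n_def)
  then have n: "n \<ge> n0" "12 * n \<ge> M + 4" "12 * n \<ge> 4" by (auto simp: n1_def)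
  have reS: "Re (u C ^ (12 * n)) \<ge> 1 / 2" if "C \<in> S" for C
  proof -
    have "C \<in> f ` {..<card S}" using f that by (simp add: bij_betw_def)
    then obtain i where "i < card S" "C = f i" by auto
    then show ?thesis using q(2) by (simp add: n_def mult.assoc flip: power_mult)
  qed
  have "infsum (\<lambda>C. u C ^ (12 * n)) (S \<union> (cosets - S))
      = infsum (\<lambda>C. u C ^ (12 * n)) S + infsum (\<lambda>C. u C ^ (12 * n)) (cosets - S)"
  proof (rule infsum_Un_disjoint)
    show "(\<lambda>C. u C ^ (12 * n)) summable_on S" using finS by simp
    show "(\<lambda>C. u C ^ (12 * n)) summable_on cosets - S"
      by (rule Infinite_Sum.abs_summable_summable, rule summable_on_subset_banach[OF summ[OF n(3)]]) auto
  qed auto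
  moreover have "S \<union> (cosets - S) = cosets" by (auto simp: S_def)
  ultimately have split: "infsum (\<lambda>C. u C ^ (12 * n)) cosets
      = (\<Sum>C\<in>S. u C ^ (12 * n)) + (\<Sum>\<^sub>\<infinity>C\<in>cosets - S. u C ^ (12 * n))"
    using finS by simp
  have "norm (\<Sum>\<^sub>\<infinity>C\<in>cosets - S. u C ^ (12 * n)) < 1 / 2"
    using tail[OF n(3)] M[of "12 * n - 4"] n(2) by linarith
  then have "Re (\<Sum>\<^sub>\<infinity>C\<in>cosets - S. u C ^ (12 * n)) > - (1 / 2)"
    using abs_Re_le_cmod[of "\<Sum>\<^sub>\<infinity>C\<in>cosets - S. u C ^ (12 * n)"] by linarith
  moreover have "Re (\<Sum>C\<in>S. u C ^ (12 * n)) \<ge> 1 / 2"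
  proof -
    have "Re (u C0 ^ (12 * n)) \<le> (\<Sum>C\<in>S. Re (u C ^ (12 * n)))"
      using finS C0S reS by (intro member_le_sum) (auto intro: order_trans[of 0 "1/2"])
    then show ?thesis using reS[OF C0S] by simp
  qed
  ultimately have "Re (infsum (\<lambda>C. u C ^ (12 * n)) cosets) > 0"
    unfolding split plus_complex.simps by linarith
  then have "infsum (\<lambda>C. u C ^ (12 * n)) cosets \<noteq> 0" by auto
  moreover have "infsum (\<lambda>C. u C ^ (12 * n)) cosets = of_real r ^ (12 * n) * eisenstein (12 * n) \<tau>"
  proof -
    have "u C ^ (12 * n) = of_real r ^ (12 * n) * w C powi (- int (12 * n))" for C
      unfolding u_def power_int_minus power_int_of_nat
      by (simp only: divide_inverse power_mult_distrib power_inverse)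
    then have "infsum (\<lambda>C. u C ^ (12 * n)) cosets
        = (\<Sum>\<^sub>\<infinity>C\<in>cosets. of_real r ^ (12 * n) * w C powi (- int (12 * n)))" by simp
    also have "\<dots> = of_real r ^ (12 * n) * (\<Sum>\<^sub>\<infinity>C\<in>cosets. w C powi (- int (12 * n)))"
      by (rule infsum_cmult_right')
    finally show ?thesis
      using assms by (simp add: eisenstein_def coset_series_def w_def)
  qed
  ultimately show ?thesis using that n(1) by auto
qed


section \<open>Powers of the discriminant in the ideal of Eisenstein series\<close>

text \<open>The j-invariant up to an additive constant. Any form of weight 12 with constant term 1
  could be the numerator.\<close>

definition hauptmodul :: "complex \<Rightarrow> complex" where
  "hauptmodul \<tau> = eisenstein 12 \<tau> / ramanujan_delta \<tau>"

lemma eisenstein_12: "eisenstein 12 \<in> modular_forms 12"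
  using eisenstein_modular[of 12] by simp

lemma eisenstein_12_pow: "mf_pow (eisenstein 12) n \<in> modular_forms (12 * int n)"
  and delta_pow: "mf_pow ramanujan_delta n \<in> modular_forms (12 * int n)"
  using modular_forms_pow[OF eisenstein_12, of n] modular_forms_pow[OF ramanujan_delta_modular, of n]
  by (simp_all add: mult.commute)

text \<open>In q the discriminant is q times a function without zeros in the disc. A form with
  vanishing constant term is therefore divisible by it, also at the cusp.\<close>

lemma cusp_form_div_delta:
  assumes "f \<in> modular_forms k" "has_qexp f F" "F 0 = 0"
  shows "(\<lambda>\<tau>. f \<tau> / ramanujan_delta \<tau>) \<in> modular_forms (k - 12)"
proof -
  define G where "G = (\<lambda>q. if q = 0 then deriv F 0 else (F q - F 0) / (q - 0))"
  have "G holomorphic_on ball 0 1"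
    unfolding G_def using assms(2) by (intro pole_lemma) (auto simp: has_qexp_def interior_open)
  then have "(\<lambda>q. G q / qprod q 1 ^ 24) holomorphic_on ball 0 1"
    using qprod_1_nonzero by (intro holomorphic_intros qprod_holomorphic_nome) auto
  then have "has_qexp (\<lambda>\<tau>. f \<tau> / ramanujan_delta \<tau>) (\<lambda>q. G q / qprod q 1 ^ 24)"
    using assms by (auto simp: has_qexp_def G_def ramanujan_delta_eq)
  moreover have "invariant (k - 12) (\<lambda>\<tau>. f \<tau> / ramanujan_delta \<tau>)"
    unfolding invariant_def
  proof (intro ballI)
    fix \<gamma> \<tau> assume "\<gamma> \<in> carrier SL2Z" "\<tau> \<in> upper_half_plane"
    then show "f (moebius_act \<gamma> \<tau>) / ramanujan_delta (moebius_act \<gamma> \<tau>)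
        = aut_factor \<gamma> \<tau> powi (k - 12) * (f \<tau> / ramanujan_delta \<tau>)"
      using modular_form_invariant[OF assms(1)] modular_form_invariant[OF ramanujan_delta_modular]
        aut_factor_nonzero ramanujan_delta_nonzero
      by (simp add: power_int_diff divide_simps)
  qed
  ultimately show ?thesis
    using modular_form_outside[OF assms(1)] by (auto simp: modular_forms_iff)
qed

text \<open>Subtracting the constant term times a power of the Eisenstein series of weight 12 leaves
  a cusp form. Division by \<Delta> lowers the weight by 12, down to weight 0 where only constants
  exist; each step contributes one monomial.\<close>

lemma modular_form_poly:
  assumes "f \<in> modular_forms (12 * int n)"
  shows "\<exists>p. degree p \<le> n \<and>
    (\<forall>\<tau>\<in>upper_half_plane. f \<tau> = ramanujan_delta \<tau> ^ n * poly p (hauptmodul \<tau>))"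
  using assms
proof (induction n arbitrary: f)
  case 0
  obtain c where "\<And>\<tau>. \<tau> \<in> upper_half_plane \<Longrightarrow> f \<tau> = c"
    using modular_forms_weight_0[of f] 0 by auto
  then show ?case by (intro exI[of _ "[:c:]"]) simp
next
  case (Suc n)
  obtain F where F: "has_qexp f F" using Suc.prems by (auto simp: modular_forms_iff)
  obtain G where G: "has_qexp (eisenstein 12) G" using eisenstein_12 by (auto simp: modular_forms_iff)
  have G0: "G 0 = 1" using eisenstein_constant_term[OF _ _ G] by simp
  define g where "g = (\<lambda>\<tau>. f \<tau> + (- F 0) * mf_pow (eisenstein 12) (Suc n) \<tau>)"
  have g: "g \<in> modular_forms (12 * int (Suc n))"
    unfolding g_def by (intro modular_forms_add modular_forms_scale Suc.prems eisenstein_12_pow)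
  have "has_qexp g (\<lambda>q. F q + (- F 0) * G q ^ Suc n)"
    using F G by (auto simp: has_qexp_def g_def mf_pow_def intro!: holomorphic_intros)
  then have "(\<lambda>\<tau>. g \<tau> / ramanujan_delta \<tau>) \<in> modular_forms (12 * int (Suc n) - 12)"
    using cusp_form_div_delta[OF g] G0 by auto
  moreover have "12 * int (Suc n) - 12 = 12 * int n" by simp
  ultimately have "(\<lambda>\<tau>. g \<tau> / ramanujan_delta \<tau>) \<in> modular_forms (12 * int n)"
    by (simp only:)
  from Suc.IH[OF this] obtain p where p: "degree p \<le> n" "\<And>\<tau>. \<tau> \<in> upper_half_plane \<Longrightarrow>
      g \<tau> / ramanujan_delta \<tau> = ramanujan_delta \<tau> ^ n * poly p (hauptmodul \<tau>)"
    by blast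
  show ?case
  proof (intro exI[of _ "p + Polynomial.monom (F 0) (Suc n)"] conjI ballI)
    show "degree (p + Polynomial.monom (F 0) (Suc n)) \<le> Suc n"
      using p(1) by (intro degree_add_le) (auto intro: order_trans[OF degree_monom_le])
    fix \<tau> assume \<tau>: "\<tau> \<in> upper_half_plane"
    have D: "ramanujan_delta \<tau> \<noteq> 0" using ramanujan_delta_nonzero[OF \<tau>] .
    have "f \<tau> = g \<tau> + F 0 * eisenstein 12 \<tau> ^ Suc n" using \<tau> by (simp add: g_def mf_pow_def)
    also have "g \<tau> = ramanujan_delta \<tau> ^ Suc n * poly p (hauptmodul \<tau>)"
      using p(2)[OF \<tau>] D by (simp add: field_simps)
    also have "F 0 * eisenstein 12 \<tau> ^ Suc n
        = ramanujan_delta \<tau> ^ Suc n * poly (Polynomial.monom (F 0) (Suc n)) (hauptmodul \<tau>)"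
      using D by (simp add: hauptmodul_def poly_monom power_divide)
    finally show "f \<tau> = ramanujan_delta \<tau> ^ Suc n * poly (p + Polynomial.monom (F 0) (Suc n)) (hauptmodul \<tau>)"
      by (simp only: poly_add distrib_left)
  qed
qed

text \<open>The monomial of degree i times \<Delta>^n is the i-th power of the Eisenstein series
  times \<Delta>^(n - i). So the degree bound is what prevents poles at the cusp.\<close>

lemma poly_modular_form:
  assumes "degree p \<le> n"
  shows "(\<lambda>\<tau>. mf_pow ramanujan_delta n \<tau> * poly p (hauptmodul \<tau>)) \<in> modular_forms (12 * int n)"
proof -
  have "(\<lambda>\<tau>. mf_pow ramanujan_delta n \<tau> * poly p (hauptmodul \<tau>))
     = (\<lambda>\<tau>. \<Sum>i\<le>n. coeff p i * (mf_pow (eisenstein 12) i \<tau> * mf_pow ramanujan_delta (n - i) \<tau>))"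
  proof
    fix \<tau>
    show "mf_pow ramanujan_delta n \<tau> * poly p (hauptmodul \<tau>)
      = (\<Sum>i\<le>n. coeff p i * (mf_pow (eisenstein 12) i \<tau> * mf_pow ramanujan_delta (n - i) \<tau>))"
    proof (cases "\<tau> \<in> upper_half_plane")
      case True
      have D: "ramanujan_delta \<tau> \<noteq> 0" using ramanujan_delta_nonzero[OF True] .
      have "poly p (hauptmodul \<tau>) = (\<Sum>i\<le>n. coeff p i * hauptmodul \<tau> ^ i)"
        unfolding poly_altdef using assms by (intro sum.mono_neutral_left) (auto simp: coeff_eq_0)
      then show ?thesis
        using True D
        by (auto simp: mf_pow_def sum_distrib_left hauptmodul_def power_divide power_diff intro!: sum.cong)
    qed (simp add: mf_pow_def)
  qed
  also have "\<dots> \<in> modular_forms (12 * int n)"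
  proof (rule modular_forms_sum)
    fix i assume "i \<in> {..n}"
    then have "12 * int i + 12 * int (n - i) = 12 * int n" by (simp add: of_nat_diff algebra_simps)
    then show "(\<lambda>\<tau>. coeff p i * (mf_pow (eisenstein 12) i \<tau> * mf_pow ramanujan_delta (n - i) \<tau>)) \<in> modular_forms (12 * int n)"
      using modular_forms_scale[OF modular_forms_mult[OF eisenstein_12_pow[of i] delta_pow[of "n - i"]]] by simp
  qed
  finally show ?thesis .
qed

text \<open>Otherwise \<open>\<Delta> / (E\<^sub>1\<^sub>2 - x \<Delta>)\<close> would be a nonzero cusp form of weight 0.\<close>

lemma hauptmodul_surj:
  obtains \<tau> where "\<tau> \<in> upper_half_plane" "hauptmodul \<tau> = x"
proof -
  define h where "h = (\<lambda>\<tau>. eisenstein 12 \<tau> + (- x) * ramanujan_delta \<tau>)"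
  have h: "h \<in> modular_forms 12"
    unfolding h_def by (intro modular_forms_add modular_forms_scale eisenstein_12 ramanujan_delta_modular)
  have "\<exists>\<tau>\<in>upper_half_plane. h \<tau> = 0"
  proof (rule ccontr)
    assume "\<not> (\<exists>\<tau>\<in>upper_half_plane. h \<tau> = 0)"
    then have hnz: "h \<tau> \<noteq> 0" if "\<tau> \<in> upper_half_plane" for \<tau> using that by blast
    define f where "f = (\<lambda>\<tau>. ramanujan_delta \<tau> / h \<tau>)"
    obtain G where G: "has_qexp (eisenstein 12) G" using eisenstein_12 by (auto simp: modular_forms_iff)
    have G0: "G 0 = 1" using eisenstein_constant_term[OF _ _ G] by simp
    define Hq where "Hq = (\<lambda>q. G q + (- x) * (q * qprod q 1 ^ 24))"
    have hq: "has_qexp h Hq"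
      using G ramanujan_delta_qexp by (auto simp: has_qexp_def h_def Hq_def intro!: holomorphic_intros)
    have Hnz: "Hq q \<noteq> 0" if "q \<in> ball 0 1" for q
    proof (cases "q = 0")
      case False
      then have "nome_inv q \<in> upper_half_plane" "nome (nome_inv q) = q"
        using that by (auto simp: nome_inv_in_H nome_nome_inv)
      then show ?thesis using hnz hq by (metis has_qexp_def)
    qed (simp add: Hq_def G0)
    have fq: "has_qexp f (\<lambda>q. q * qprod q 1 ^ 24 / Hq q)"
      using hq ramanujan_delta_qexp Hnz by (auto simp: has_qexp_def f_def intro!: holomorphic_intros)
    moreover have "invariant 0 f"
      unfolding invariant_def
    proof (intro ballI)
      fix \<gamma> \<tau> assume "\<gamma> \<in> carrier SL2Z" "\<tau> \<in> upper_half_plane"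
      then show "f (moebius_act \<gamma> \<tau>) = aut_factor \<gamma> \<tau> powi 0 * f \<tau>"
        using modular_form_invariant[OF h] modular_form_invariant[OF ramanujan_delta_modular] aut_factor_nonzero
        by (simp add: f_def)
    qed
    ultimately have "f \<in> modular_forms 0"
      by (auto simp: modular_forms_iff f_def ramanujan_delta_outside)
    then obtain c where c: "\<And>\<tau>. \<tau> \<in> upper_half_plane \<Longrightarrow> f \<tau> = c"
      using modular_forms_weight_0 by blast
    have "((\<lambda>_. c) \<longlongrightarrow> 0) (filtercomap Im at_top)"
    proof (rule Lim_transform_eventually)
      show "(f \<longlongrightarrow> 0) (filtercomap Im at_top)" using has_qexp_limit[OF fq] by simp
      show "\<forall>\<^sub>F \<tau> in filtercomap Im at_top. f \<tau> = c"
        unfolding eventually_filtercomap_at_top_linorder using c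
        by (intro exI[of _ 1]) (auto simp: upper_half_plane_def)
    qed
    moreover have "filtercomap Im at_top \<noteq> (bot :: complex filter)"
      by (rule filtercomap_neq_bot_surj) (auto simp: surj_def intro: exI[of _ "Complex 0 _"])
    ultimately have "c = 0" by (simp add: tendsto_const_iff)
    moreover have "\<i> \<in> upper_half_plane" by (simp add: upper_half_plane_def)
    ultimately show False
      using c[of \<i>] hnz[of \<i>] ramanujan_delta_nonzero[of \<i>] by (simp add: f_def)
  qed
  then obtain \<tau> where "\<tau> \<in> upper_half_plane" "h \<tau> = 0" by blast
  then show ?thesis using that ramanujan_delta_nonzero[of \<tau>] by (simp add: h_def hauptmodul_def)
qed

text \<open>The finite combinations form an ideal. An element of least degree divides all the others
  by division with remainder; if it were not constant, any of its roots would be a zero of the whole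
  family.\<close>

lemma poly_family_bezout:
  fixes P :: "nat \<Rightarrow> complex poly"
  assumes "\<And>x. \<exists>n. poly (P n) x \<noteq> 0"
  obtains m Q where "(\<Sum>n<m. Q n * P n) = 1"
proof -
  define I where "I = {p. \<exists>m Q. p = (\<Sum>n<m. Q n * P n)}"
  have PI: "P n \<in> I" for n
  proof -
    have "P n = (\<Sum>i<Suc n. (if i = n then 1 else 0) * P i)" by simp
    then show ?thesis
      unfolding I_def by (intro CollectI exI[of _ "Suc n"] exI[of _ "\<lambda>i. if i = n then 1 else 0"])
  qed
  have mult: "a * p \<in> I" if p: "p \<in> I" for a p
  proof -
    obtain m Q where "p = (\<Sum>n<m. Q n * P n)" using p by (auto simp: I_def)
    then have "a * p = (\<Sum>n<m. (a * Q n) * P n)" by (simp add: sum_distrib_left mult.assoc)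
    then show ?thesis
      unfolding I_def by (intro CollectI exI[of _ m] exI[of _ "\<lambda>n. a * Q n"])
  qed
  have ext: "\<exists>Q'. (\<Sum>n<m. Q n * P n) = (\<Sum>n<l. Q' n * P n)" if "m \<le> l" for m l Q
  proof -
    have "(\<Sum>n<m. Q n * P n) = (\<Sum>n<l. (if n < m then Q n else 0) * P n)"
      using that by (intro sum.mono_neutral_cong_left) auto
    then show ?thesis by (intro exI[of _ "\<lambda>n. if n < m then Q n else 0"])
  qed
  have add: "p + r \<in> I" if pr: "p \<in> I" "r \<in> I" for p r
  proof -
    obtain m Q where p: "p = (\<Sum>n<m. Q n * P n)" using pr by (auto simp: I_def)
    obtain l R where r: "r = (\<Sum>n<l. R n * P n)" using pr by (auto simp: I_def)
    obtain Q' R' where "p = (\<Sum>n<max m l. Q' n * P n)" "r = (\<Sum>n<max m l. R' n * P n)"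
      using ext[of m "max m l" Q] ext[of l "max m l" R] p r by auto
    then have "p + r = (\<Sum>n<max m l. (Q' n + R' n) * P n)"
      by (simp add: distrib_right sum.distrib)
    then show ?thesis
      unfolding I_def by (intro CollectI exI[of _ "max m l"] exI[of _ "\<lambda>n. Q' n + R' n"])
  qed
  obtain n0 where n0: "P n0 \<noteq> 0" using assms[of 0] by (metis poly_0)
  define D where "D = (\<lambda>p. p \<in> I \<and> p \<noteq> 0)"
  obtain p where p: "p \<in> I" "p \<noteq> 0" "\<And>r. r \<in> I \<Longrightarrow> r \<noteq> 0 \<Longrightarrow> degree p \<le> degree r"
    using ex_has_least_nat[where P = D and k = "P n0" and m = degree] PI n0 unfolding D_def by blast
  have dvd: "p dvd r" if "r \<in> I" for r
  proof -
    have eq: "r mod p = r + (- (r div p)) * p" by (simp add: minus_div_mult_eq_mod [symmetric])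
    have "r mod p \<in> I" unfolding eq by (rule add[OF that mult[OF p(1)]])
    then show ?thesis
      using p(3)[of "r mod p"] degree_mod_less[OF p(2)] by (auto simp: mod_eq_0_iff_dvd not_less[symmetric])
  qed
  have "degree p = 0"
  proof (rule ccontr)
    assume "degree p \<noteq> 0"
    then obtain x where "poly p x = 0" using alg_closed_imp_poly_has_root[of p] by blast
    then have "poly (P n) x = 0" for n using dvd[OF PI[of n]] by (auto elim!: dvdE)
    then show False using assms by blast
  qed
  then obtain c where "p = [:c:]" by (auto elim: degree_eq_zeroE)
  then have "[:inverse c:] * p = 1" using p(2) by (simp add: one_pCons)
  then have "1 \<in> I" using mult[OF p(1), of "[:inverse c:]"] by simp
  then show ?thesis using that by (auto simp: I_def)
qed

text \<open>The relation between the polynomials in the hauptmodul is turned into one between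
  modular forms by multiplication with a power of \<Delta>, with N large enough to clear the poles
  of all coefficients.\<close>

lemma delta_power_eisenstein:
  obtains N m H where
    "\<And>n. n < m \<Longrightarrow> H n \<in> modular_forms (12 * int N - 12 * int (n0 + n))"
    "\<And>\<tau>. \<tau> \<in> upper_half_plane \<Longrightarrow>
       ramanujan_delta \<tau> ^ N = (\<Sum>n<m. H n \<tau> * eisenstein (12 * (n0 + n)) \<tau>)"
proof -
  \<comment> \<open>The family starts at n0 + 1, so that the weight is at least 12 even for n0 =
    0.\<close>
  have "\<exists>p. \<forall>\<tau>\<in>upper_half_plane. eisenstein (12 * (n0 + n + 1)) \<tau>
      = ramanujan_delta \<tau> ^ (n0 + n + 1) * poly p (hauptmodul \<tau>)" for n
  proof -
    have "eisenstein (12 * (n0 + n + 1)) \<in> modular_forms (12 * int (n0 + n + 1))"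
      using eisenstein_modular[of "12 * (n0 + n + 1)"] by simp
    from modular_form_poly[OF this] show ?thesis by blast
  qed
  then obtain P where P: "\<And>n \<tau>. \<tau> \<in> upper_half_plane \<Longrightarrow> eisenstein (12 * (n0 + n + 1)) \<tau>
      = ramanujan_delta \<tau> ^ (n0 + n + 1) * poly (P n) (hauptmodul \<tau>)"
    by metis
  have "\<exists>n. poly (P n) x \<noteq> 0" for x
  proof -
    obtain \<tau> where \<tau>: "\<tau> \<in> upper_half_plane" "hauptmodul \<tau> = x" using hauptmodul_surj by blast
    obtain n where n: "n \<ge> n0 + 1" "eisenstein (12 * n) \<tau> \<noteq> 0" using eisenstein_nonzero[OF \<tau>(1)] by blast
    then have "n = n0 + (n - n0 - 1) + 1" by simp
    then have "eisenstein (12 * (n0 + (n - n0 - 1) + 1)) \<tau> \<noteq> 0" using n(2) by simp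
    then show ?thesis using P[OF \<tau>(1), of "n - n0 - 1"] \<tau>(2) by auto
  qed
  then obtain m Q where Q: "(\<Sum>n<m. Q n * P n) = 1" using poly_family_bezout by blast
  \<comment> \<open>Each \<open>Q n\<close> needs N - (n0 + n + 1) to be at least its degree. The
    sum of all degrees and m + 1 give room for every n < m at once.\<close>
  define N where "N = n0 + m + 1 + (\<Sum>n<m. degree (Q n))"
  have N: "degree (Q n) \<le> N - (n0 + n + 1)" "n0 + n + 1 \<le> N" if "n < m" for n
    using member_le_sum[of n "{..<m}" "\<lambda>n. degree (Q n)"] that by (auto simp: N_def)
  \<comment> \<open>Undoes the shift of the index: the series of index n0 enters with coefficient
    0.\<close>
  define H where "H = (\<lambda>n. if n = 0 then (\<lambda>_. 0) else
      (\<lambda>\<tau>. mf_pow ramanujan_delta (N - (n0 + n)) \<tau> * poly (Q (n - 1)) (hauptmodul \<tau>)))"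
  show ?thesis
  proof (rule that[of "Suc m" H N])
    fix n assume n: "n < Suc m"
    show "H n \<in> modular_forms (12 * int N - 12 * int (n0 + n))"
    proof (cases n)
      case (Suc l)
      have "degree (Q l) \<le> N - (n0 + n)" "12 * int (N - (n0 + n)) = 12 * int N - 12 * int (n0 + n)"
        using N[of l] n Suc by auto
      then show ?thesis using poly_modular_form[of "Q l" "N - (n0 + n)"] Suc by (simp add: H_def)
    qed (simp add: H_def modular_forms_0)
  next
    fix \<tau> assume \<tau>: "\<tau> \<in> upper_half_plane"
    have "(\<Sum>n<Suc m. H n \<tau> * eisenstein (12 * (n0 + n)) \<tau>)
        = (\<Sum>n<m. H (Suc n) \<tau> * eisenstein (12 * (n0 + n + 1)) \<tau>)"
      by (subst sum.lessThan_Suc_shift) (simp add: H_def)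
    also have "\<dots> = (\<Sum>n<m. ramanujan_delta \<tau> ^ N * (poly (Q n) (hauptmodul \<tau>) * poly (P n) (hauptmodul \<tau>)))"
    proof (rule sum.cong[OF refl])
      fix n assume "n \<in> {..<m}"
      then have "ramanujan_delta \<tau> ^ N = ramanujan_delta \<tau> ^ (N - (n0 + n + 1)) * ramanujan_delta \<tau> ^ (n0 + n + 1)"
        using N(2)[of n] by (simp only: power_add[symmetric]) simp
      then show "H (Suc n) \<tau> * eisenstein (12 * (n0 + n + 1)) \<tau>
          = ramanujan_delta \<tau> ^ N * (poly (Q n) (hauptmodul \<tau>) * poly (P n) (hauptmodul \<tau>))"
        using \<tau> P[OF \<tau>, of n] by (simp add: H_def mf_pow_def)
    qed
    also have "\<dots> = ramanujan_delta \<tau> ^ N * poly (\<Sum>n<m. Q n * P n) (hauptmodul \<tau>)"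
      by (simp add: poly_sum sum_distrib_left)
    finally show "ramanujan_delta \<tau> ^ N = (\<Sum>n<Suc m. H n \<tau> * eisenstein (12 * (n0 + n)) \<tau>)"
      by (simp add: Q)
  qed
qed

section \<open>Representations\<close>

lemma
  assumes "h \<in> rep_lin_maps \<sigma> \<rho>" "v \<in> rep_space \<sigma>"
  shows lin_maps_mem: "h v \<in> rep_space \<rho>"
    and lin_maps_scale: "h (rep_scale \<sigma> c v) = rep_scale \<rho> c (h v)"
    and lin_maps_add: "w \<in> rep_space \<sigma> \<Longrightarrow> h (v + w) = h v + h w"
  using assms by (simp_all add: rep_lin_maps_def)

locale arith_rep =
  fixes \<rho> :: "'v::ab_group_add arith_type"
  assumes arith: "arithmetic_type \<rho>"
begin

sublocale V: vector_space "rep_scale \<rho>"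
  using arith by (simp add: arithmetic_type_def)

lemma subspace: "V.subspace (rep_space \<rho>)"
  using arith by (simp add: arithmetic_type_def)

lemma zero_mem [simp]: "0 \<in> rep_space \<rho>"
  using V.subspace_0[OF subspace] .

lemma add_mem: "v \<in> rep_space \<rho> \<Longrightarrow> w \<in> rep_space \<rho> \<Longrightarrow> v + w \<in> rep_space \<rho>"
  using V.subspace_add[OF subspace] .

lemma scale_mem: "v \<in> rep_space \<rho> \<Longrightarrow> rep_scale \<rho> c v \<in> rep_space \<rho>"
  using V.subspace_scale[OF subspace] .

lemma act_lin: "\<gamma> \<in> carrier SL2Z \<Longrightarrow>
    (\<lambda>v. if v \<in> rep_space \<rho> then rep_act \<rho> \<gamma> v else 0) \<in> rep_lin_maps \<rho> \<rho>"
  using arith by (simp add: arithmetic_type_def)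

lemma act_add: "\<gamma> \<in> carrier SL2Z \<Longrightarrow> v \<in> rep_space \<rho> \<Longrightarrow> w \<in> rep_space \<rho> \<Longrightarrow>
    rep_act \<rho> \<gamma> (v + w) = rep_act \<rho> \<gamma> v + rep_act \<rho> \<gamma> w"
  using lin_maps_add[OF act_lin, of \<gamma> v w] add_mem[of v w] by simp

lemma act_scale: "\<gamma> \<in> carrier SL2Z \<Longrightarrow> v \<in> rep_space \<rho> \<Longrightarrow>
    rep_act \<rho> \<gamma> (rep_scale \<rho> c v) = rep_scale \<rho> c (rep_act \<rho> \<gamma> v)"
  using lin_maps_scale[OF act_lin, of \<gamma> v c] scale_mem[of v c] by simp

lemma vv_slash_add:
  assumes "\<gamma> \<in> carrier SL2Z" "\<tau> \<in> upper_half_plane" "f \<in> vv_functions \<rho>" "g \<in> vv_functions \<rho>"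
  shows "vv_slash k \<rho> (\<lambda>\<tau>. f \<tau> + g \<tau>) \<gamma> \<tau> = vv_slash k \<rho> f \<gamma> \<tau> + vv_slash k \<rho> g \<gamma> \<tau>"
  using assms moebius_upper_half_plane[OF assms(1,2)]
  by (simp add: vv_slash_def vv_functions_def act_add V.scale_right_distrib)

lemma vv_slash_mult:
  assumes "\<gamma> \<in> carrier SL2Z" "\<tau> \<in> upper_half_plane" "f \<in> vv_functions \<rho>"
    and "h (moebius_act \<gamma> \<tau>) = aut_factor \<gamma> \<tau> powi l * h \<tau>"
  shows "vv_slash (l + k) \<rho> (\<lambda>\<tau>. rep_scale \<rho> (h \<tau>) (f \<tau>)) \<gamma> \<tau> = rep_scale \<rho> (h \<tau>) (vv_slash k \<rho> f \<gamma> \<tau>)"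
proof -
  define w where "w = aut_factor \<gamma> \<tau>"
  have w: "w \<noteq> 0" using assms aut_factor_nonzero by (simp add: w_def)
  have "w powi (- (l + k)) * (w powi l * h \<tau>) = h \<tau> * w powi (- k)"
  proof -
    have "w powi (- (l + k)) * w powi l = w powi (- k)"
      by (subst power_int_add[symmetric]) (use w in auto)
    then show ?thesis by (simp flip: mult.assoc)
  qed
  then show ?thesis
    using assms moebius_upper_half_plane[OF assms(1,2)]
    by (simp add: vv_slash_def vv_functions_def act_scale w_def[symmetric])
qed

lemma vv_functions_add:
  "f \<in> vv_functions \<rho> \<Longrightarrow> g \<in> vv_functions \<rho> \<Longrightarrow> (\<lambda>\<tau>. f \<tau> + g \<tau>) \<in> vv_functions \<rho>"
  by (simp add: vv_functions_def add_mem)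

lemma vv_functions_mult:
  "f \<in> vv_functions \<rho> \<Longrightarrow> (\<lambda>\<tau>. rep_scale \<rho> (h \<tau>) (f \<tau>)) \<in> vv_functions \<rho>"
  by (simp add: vv_functions_def scale_mem)

lemma dual_rep_space: "rep_space (dual_rep \<rho>) = rep_lin_maps \<rho> triv_rep"
  by (simp add: dual_rep_def hom_rep_def)

lemma vv_holomorphic_add:
  assumes "f \<in> vv_functions \<rho>" "g \<in> vv_functions \<rho>" "vv_holomorphic \<rho> f" "vv_holomorphic \<rho> g"
  shows "vv_holomorphic \<rho> (\<lambda>\<tau>. f \<tau> + g \<tau>)"
  unfolding vv_holomorphic_def
proof
  fix l assume l: "l \<in> rep_space (dual_rep \<rho>)"
  have "(\<lambda>\<tau>. l (f \<tau>) + l (g \<tau>)) holomorphic_on upper_half_plane"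
    using assms l by (intro holomorphic_intros) (auto simp: vv_holomorphic_def)
  then show "(\<lambda>\<tau>. l (f \<tau> + g \<tau>)) holomorphic_on upper_half_plane"
    by (rule holomorphic_transform)
      (use l assms in \<open>auto simp: dual_rep_space rep_lin_maps_def vv_functions_def\<close>)
qed

lemma vv_holomorphic_mult:
  assumes "f \<in> vv_functions \<rho>" "h holomorphic_on upper_half_plane" "vv_holomorphic \<rho> f"
  shows "vv_holomorphic \<rho> (\<lambda>\<tau>. rep_scale \<rho> (h \<tau>) (f \<tau>))"
  unfolding vv_holomorphic_def
proof
  fix l assume l: "l \<in> rep_space (dual_rep \<rho>)"
  have "(\<lambda>\<tau>. h \<tau> * l (f \<tau>)) holomorphic_on upper_half_plane"
    using assms l by (intro holomorphic_intros) (auto simp: vv_holomorphic_def)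
  then show "(\<lambda>\<tau>. l (rep_scale \<rho> (h \<tau>) (f \<tau>))) holomorphic_on upper_half_plane"
    by (rule holomorphic_transform)
      (use l assms in \<open>auto simp: dual_rep_space rep_lin_maps_def vv_functions_def triv_rep_def\<close>)
qed

abbreviation cusp_filter :: "real set \<Rightarrow> complex filter" where
  "cusp_filter B \<equiv> inf (filtercomap Im at_top) (principal (Re -` B))"

lemma eventually_cusp_filter:
  "(\<And>\<tau>. Im \<tau> \<ge> Y \<Longrightarrow> Re \<tau> \<in> B \<Longrightarrow> P \<tau>) \<Longrightarrow> eventually P (cusp_filter B)"
  unfolding eventually_inf_principal eventually_filtercomap_at_top_linorder by blast

lemma rep_norm_zero: "rep_norm \<rho> N \<Longrightarrow> N 0 = 0"
  by (simp add: rep_norm_def)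

lemma rep_norm_scale: "rep_norm \<rho> N \<Longrightarrow> v \<in> rep_space \<rho> \<Longrightarrow> N (rep_scale \<rho> c v) = norm c * N v"
  by (simp add: rep_norm_def)

lemma moderate_growth_add:
  assumes "f \<in> vv_functions \<rho>" "g \<in> vv_functions \<rho>" "moderate_growth k \<rho> f" "moderate_growth k \<rho> g"
  shows "moderate_growth k \<rho> (\<lambda>\<tau>. f \<tau> + g \<tau>)"
proof -
  let ?t = "\<lambda>N f \<gamma> \<tau>. N (rep_scale \<rho> (aut_factor \<gamma> \<tau> powi (- k)) (f (moebius_act \<gamma> \<tau>))) :: real"
  obtain a where a: "\<And>N \<gamma> B. rep_norm \<rho> N \<Longrightarrow> \<gamma> \<in> carrier SL2Z \<Longrightarrow> bounded B \<Longrightarrow>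
      ?t N f \<gamma> \<in> O[cusp_filter B](\<lambda>\<tau>. Im \<tau> powr a)"
    using assms(3) unfolding moderate_growth_def by blast
  obtain b where b: "\<And>N \<gamma> B. rep_norm \<rho> N \<Longrightarrow> \<gamma> \<in> carrier SL2Z \<Longrightarrow> bounded B \<Longrightarrow>
      ?t N g \<gamma> \<in> O[cusp_filter B](\<lambda>\<tau>. Im \<tau> powr b)"
    using assms(4) unfolding moderate_growth_def by blast
  have mono: "(\<lambda>\<tau>. Im \<tau> powr c) \<in> O[cusp_filter B](\<lambda>\<tau>. Im \<tau> powr max a b)" if "c \<le> max a b" for c B
    using that by (intro landau_o.bigI[of 1] eventually_cusp_filter[of 1]) (auto intro: powr_mono)
  show ?thesis
    unfolding moderate_growth_def
  proof (intro exI[of _ "max a b"] allI impI ballI)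
    fix N \<gamma> and B :: "real set"
    assume N: "rep_norm \<rho> N" and \<gamma>: "\<gamma> \<in> carrier SL2Z" and B: "bounded B"
    have "(\<lambda>\<tau>. ?t N f \<gamma> \<tau> + ?t N g \<gamma> \<tau>) \<in> O[cusp_filter B](\<lambda>\<tau>. Im \<tau> powr max a b)"
      using landau_o.big_trans[OF a[OF N \<gamma> B] mono] landau_o.big_trans[OF b[OF N \<gamma> B] mono]
      by (intro sum_in_bigo) auto
    moreover have "?t N (\<lambda>\<tau>. f \<tau> + g \<tau>) \<gamma> \<in> O[cusp_filter B](\<lambda>\<tau>. ?t N f \<gamma> \<tau> + ?t N g \<gamma> \<tau>)"
    proof (intro landau_o.bigI[of 1] eventually_cusp_filter[of 1])
      fix \<tau> assume "Im \<tau> \<ge> 1" "Re \<tau> \<in> B"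
      then have H: "moebius_act \<gamma> \<tau> \<in> upper_half_plane"
        by (intro moebius_upper_half_plane[OF \<gamma>]) (simp add: upper_half_plane_def)
      define x y where "x = rep_scale \<rho> (aut_factor \<gamma> \<tau> powi (- k)) (f (moebius_act \<gamma> \<tau>))"
        and "y = rep_scale \<rho> (aut_factor \<gamma> \<tau> powi (- k)) (g (moebius_act \<gamma> \<tau>))"
      have "x \<in> rep_space \<rho>" "y \<in> rep_space \<rho>"
        using H assms by (auto simp: x_def y_def vv_functions_def intro: scale_mem)
      then have "N (x + y) \<le> N x + N y" "0 \<le> N (x + y)" "0 \<le> N x" "0 \<le> N y"
        using N add_mem[of x y] by (auto simp: rep_norm_def)
      then show "norm (?t N (\<lambda>\<tau>. f \<tau> + g \<tau>) \<gamma> \<tau>) \<le> 1 * norm (?t N f \<gamma> \<tau> + ?t N g \<gamma> \<tau>)"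
        by (simp add: V.scale_right_distrib x_def y_def)
    qed simp
    ultimately show "?t N (\<lambda>\<tau>. f \<tau> + g \<tau>) \<gamma> \<in> O[cusp_filter B](\<lambda>\<tau>. Im \<tau> powr max a b)"
      using landau_o.big_trans by blast
  qed
qed

text \<open>The slash action in weight l returns h itself, which is bounded at the cusp.
  Multiplication thus does not change the exponent of the growth condition.\<close>

lemma moderate_growth_mult:
  assumes f: "f \<in> vv_functions \<rho>" "moderate_growth k \<rho> f" and h: "h \<in> modular_forms l"
  shows "moderate_growth (l + k) \<rho> (\<lambda>\<tau>. rep_scale \<rho> (h \<tau>) (f \<tau>))"
proof -
  let ?t = "\<lambda>N f k \<gamma> \<tau>. N (rep_scale \<rho> (aut_factor \<gamma> \<tau> powi (- k)) (f (moebius_act \<gamma> \<tau>))) :: real"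
  obtain a where a: "\<And>N \<gamma> B. rep_norm \<rho> N \<Longrightarrow> \<gamma> \<in> carrier SL2Z \<Longrightarrow> bounded B \<Longrightarrow>
      ?t N f k \<gamma> \<in> O[cusp_filter B](\<lambda>\<tau>. Im \<tau> powr a)"
    using assms(2) unfolding moderate_growth_def by blast
  have hO: "h \<in> O[filtercomap Im at_top](\<lambda>_. 1)" using h by (simp add: modular_forms_def)
  obtain c where c: "\<forall>\<^sub>F \<tau> in filtercomap Im at_top. norm (h \<tau>) \<le> c * norm (1 :: complex)"
    using hO by (elim landau_o.bigE)
  show ?thesis
    unfolding moderate_growth_def
  proof (intro exI[of _ a] allI impI ballI)
    fix N \<gamma> and B :: "real set"
    assume N: "rep_norm \<rho> N" and \<gamma>: "\<gamma> \<in> carrier SL2Z" and B: "bounded B"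
    have ev0: "\<forall>\<^sub>F \<tau> in cusp_filter B. norm (h \<tau>) \<le> c * norm (1 :: complex)"
      by (rule filter_leD[OF inf_le1 c])
    have "(\<lambda>\<tau>. norm (h \<tau>)) \<in> O[cusp_filter B](\<lambda>_. 1)"
      by (rule bigoI[of _ c], rule eventually_mono[OF ev0]) simp
    then have O: "(\<lambda>\<tau>. norm (h \<tau>) * ?t N f k \<gamma> \<tau>) \<in> O[cusp_filter B](\<lambda>\<tau>. 1 * Im \<tau> powr a)"
      by (rule landau_o.big_mult[OF _ a[OF N \<gamma> B]])
    have ev: "\<forall>\<^sub>F \<tau> in cusp_filter B. norm (h \<tau>) * ?t N f k \<gamma> \<tau> = ?t N (\<lambda>\<tau>. rep_scale \<rho> (h \<tau>) (f \<tau>)) (l + k) \<gamma> \<tau>"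
    proof (rule eventually_cusp_filter[of 1])
      fix \<tau> assume "Im \<tau> \<ge> 1"
      then have \<tau>: "\<tau> \<in> upper_half_plane" by (simp add: upper_half_plane_def)
      define w where "w = aut_factor \<gamma> \<tau>"
      define v where "v = f (moebius_act \<gamma> \<tau>)"
      have w: "w \<noteq> 0" using aut_factor_nonzero[OF \<gamma> \<tau>] by (simp add: w_def)
      have v: "v \<in> rep_space \<rho>" using f moebius_upper_half_plane[OF \<gamma> \<tau>] by (simp add: v_def vv_functions_def)
      have 1: "w powi (- l) * h (moebius_act \<gamma> \<tau>) = h \<tau>"
      proof -
        have "\<forall>\<gamma>\<in>carrier SL2Z. \<forall>\<tau>\<in>upper_half_plane. aut_factor \<gamma> \<tau> powi (- l) * h (moebius_act \<gamma> \<tau>) = h \<tau>"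
          using h unfolding modular_forms_def by blast
        then show ?thesis using \<gamma> \<tau> unfolding w_def by blast
      qed
      have "w powi (- (l + k)) = w powi (- k + - l)" by (rule arg_cong[of _ _ "power_int w"]) simp
      also have "\<dots> = w powi (- k) * w powi (- l)" by (rule power_int_add) (use w in simp)
      finally have "w powi (- (l + k)) * h (moebius_act \<gamma> \<tau>)
          = w powi (- k) * (w powi (- l) * h (moebius_act \<gamma> \<tau>))" by (simp only: mult.assoc)
      also have "\<dots> = h \<tau> * w powi (- k)" unfolding 1 by (rule mult.commute)
      finally have "w powi (- (l + k)) * h (moebius_act \<gamma> \<tau>) = h \<tau> * w powi (- k)" .
      then have eq: "rep_scale \<rho> (w powi (- (l + k))) (rep_scale \<rho> (h (moebius_act \<gamma> \<tau>)) v)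
          = rep_scale \<rho> (h \<tau>) (rep_scale \<rho> (w powi (- k)) v)"
        by (simp only: V.scale_scale)
      have "N (rep_scale \<rho> (h \<tau>) (rep_scale \<rho> (w powi (- k)) v))
          = norm (h \<tau>) * N (rep_scale \<rho> (w powi (- k)) v)"
        by (rule rep_norm_scale[OF N scale_mem[OF v]])
      then have "norm (h \<tau>) * N (rep_scale \<rho> (w powi (- k)) v)
          = N (rep_scale \<rho> (w powi (- (l + k))) (rep_scale \<rho> (h (moebius_act \<gamma> \<tau>)) v))"
        by (simp only: eq)
      then show "norm (h \<tau>) * ?t N f k \<gamma> \<tau> = ?t N (\<lambda>\<tau>. rep_scale \<rho> (h \<tau>) (f \<tau>)) (l + k) \<gamma> \<tau>"
        by (simp only: w_def v_def)
    qed
    show "?t N (\<lambda>\<tau>. rep_scale \<rho> (h \<tau>) (f \<tau>)) (l + k) \<gamma> \<in> O[cusp_filter B](\<lambda>\<tau>. Im \<tau> powr a)"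
    proof -
      have "(\<lambda>\<tau>. norm (h \<tau>) * ?t N f k \<gamma> \<tau>) \<in> O[cusp_filter B](\<lambda>\<tau>. Im \<tau> powr a)"
        using O by (simp only: mult_1)
      then show ?thesis by (rule landau_o.big.in_cong[OF ev, THEN iffD1])
    qed
  qed
qed

lemma moderate_growth_zero: "moderate_growth k \<rho> (\<lambda>_. 0)"
  unfolding moderate_growth_def using rep_norm_zero by (auto intro!: exI[of _ 0])

text \<open>The exponent n is fixed before the norm, and only K may depend on the norm. This is the
  order of quantifiers in moderate growth.\<close>

lemma moderate_growthI:
  assumes f: "f \<in> vv_functions \<rho>"
    and "\<And>N. rep_norm \<rho> N \<Longrightarrow> \<exists>K. \<forall>\<tau>\<in>upper_half_plane. N (f \<tau>) \<le> K * growth \<tau> ^ n"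
  shows "moderate_growth k \<rho> f"
  unfolding moderate_growth_def
proof (intro exI[of _ "real (2 * n + nat \<bar>k\<bar>)"] allI impI ballI)
  fix N \<gamma> and B :: "real set"
  assume N: "rep_norm \<rho> N" and \<gamma>: "\<gamma> \<in> carrier SL2Z" and B: "bounded B"
  obtain K where K: "\<And>\<tau>. \<tau> \<in> upper_half_plane \<Longrightarrow> N (f \<tau>) \<le> K * growth \<tau> ^ n"
    using assms(2)[OF N] by blast
  have K': "N (f \<tau>) \<le> \<bar>K\<bar> * growth \<tau> ^ n" if "\<tau> \<in> upper_half_plane" for \<tau>
  proof -
    have "K * growth \<tau> ^ n \<le> \<bar>K\<bar> * growth \<tau> ^ n"
      using growth_ge_1[OF that] by (intro mult_right_mono) auto
    then show ?thesis using K[OF that] by linarith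
  qed
  obtain J where J: "\<And>\<tau>. Im \<tau> \<ge> 1 \<Longrightarrow> Re \<tau> \<in> B \<Longrightarrow>
      norm (aut_factor \<gamma> \<tau> powi (- k)) * N (f (moebius_act \<gamma> \<tau>)) \<le> J * Im \<tau> ^ (2 * n + nat \<bar>k\<bar>)"
    using slash_bound[OF abs_ge_zero K' \<gamma> B, where k = k] by metis
  show "(\<lambda>\<tau>. N (rep_scale \<rho> (aut_factor \<gamma> \<tau> powi (- k)) (f (moebius_act \<gamma> \<tau>))))
      \<in> O[cusp_filter B](\<lambda>\<tau>. Im \<tau> powr real (2 * n + nat \<bar>k\<bar>))"
  proof (intro bigoI[of _ J] eventually_cusp_filter[of 1])
    fix \<tau> assume \<tau>: "Im \<tau> \<ge> 1" "Re \<tau> \<in> B"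
    then have "moebius_act \<gamma> \<tau> \<in> upper_half_plane"
      by (intro moebius_upper_half_plane[OF \<gamma>]) (simp add: upper_half_plane_def)
    then have v: "f (moebius_act \<gamma> \<tau>) \<in> rep_space \<rho>" using f by (simp add: vv_functions_def)
    then have "N (rep_scale \<rho> (aut_factor \<gamma> \<tau> powi (- k)) (f (moebius_act \<gamma> \<tau>)))
        = norm (aut_factor \<gamma> \<tau> powi (- k)) * N (f (moebius_act \<gamma> \<tau>))"
      and "0 \<le> N (f (moebius_act \<gamma> \<tau>))"
      using N by (auto simp: rep_norm_def)
    then show "norm (N (rep_scale \<rho> (aut_factor \<gamma> \<tau> powi (- k)) (f (moebius_act \<gamma> \<tau>))))
        \<le> J * norm (Im \<tau> powr real (2 * n + nat \<bar>k\<bar>))"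
      using J[OF \<tau>] \<tau> by (simp add: powr_realpow flip: of_nat_add of_nat_mult)
  qed
qed

text \<open>Extracts the case of the identity matrix and of one strip, with an integral exponent.
  This is the bound that the expansion in q requires.\<close>

lemma moderate_growthD:
  assumes "moderate_growth k \<rho> f" "rep_norm \<rho> N"
  obtains K Y n where "Y \<ge> 1" "\<And>\<tau>. Im \<tau> \<ge> Y \<Longrightarrow> \<bar>Re \<tau>\<bar> \<le> 1 \<Longrightarrow> N (f \<tau>) \<le> K * Im \<tau> ^ n"
proof -
  obtain a where "(\<lambda>\<tau>. N (rep_scale \<rho> (aut_factor \<one>\<^bsub>SL2Z\<^esub> \<tau> powi (- k)) (f (moebius_act \<one>\<^bsub>SL2Z\<^esub> \<tau>))))
      \<in> O[cusp_filter {-1..1}](\<lambda>\<tau>. Im \<tau> powr a)"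
    using assms SL.one_closed bounded_closed_interval[of "-1" "1::real"]
    unfolding moderate_growth_def by blast
  then have "(\<lambda>\<tau>. N (f \<tau>)) \<in> O[cusp_filter {-1..1}](\<lambda>\<tau>. Im \<tau> powr a)" by simp
  then obtain c where c: "c > 0" "\<forall>\<^sub>F \<tau> in cusp_filter {-1..1}. norm (N (f \<tau>)) \<le> c * norm (Im \<tau> powr a)"
    by (elim landau_o.bigE)
  then obtain Y where Y: "\<And>\<tau>. Im \<tau> \<ge> Y \<Longrightarrow> Re \<tau> \<in> {-1..1} \<Longrightarrow> norm (N (f \<tau>)) \<le> c * norm (Im \<tau> powr a)"
    unfolding eventually_inf_principal eventually_filtercomap_at_top_linorder by auto
  show ?thesis
  proof (rule that[of "max Y 1"])
    fix \<tau> assume \<tau>: "Im \<tau> \<ge> max Y 1" "\<bar>Re \<tau>\<bar> \<le> 1"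
    have "N (f \<tau>) \<le> c * norm (Im \<tau> powr a)" using Y[of \<tau>] \<tau> by (auto simp: abs_le_iff)
    also have "norm (Im \<tau> powr a) \<le> Im \<tau> powr real (nat \<lceil>a\<rceil>)"
      using \<tau> by (simp, intro powr_mono) (auto simp: le_nat_iff, linarith)
    also have "Im \<tau> powr real (nat \<lceil>a\<rceil>) = Im \<tau> ^ nat \<lceil>a\<rceil>" using \<tau> by (simp add: powr_realpow)
    finally show "N (f \<tau>) \<le> c * Im \<tau> ^ nat \<lceil>a\<rceil>" using c(1) by simp
  qed simp
qed

lemma vv_modular_forms_zero: "(\<lambda>_. 0) \<in> vv_modular_forms k \<rho>"
proof -
  have "vv_slash k \<rho> (\<lambda>_. 0) \<gamma> \<tau> = 0" if "\<gamma> \<in> carrier SL2Z" for \<gamma> \<tau>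
  proof -
    have "rep_act \<rho> (inv\<^bsub>SL2Z\<^esub> \<gamma>) (0 + 0) = rep_act \<rho> (inv\<^bsub>SL2Z\<^esub> \<gamma>) 0 + rep_act \<rho> (inv\<^bsub>SL2Z\<^esub> \<gamma>) 0"
      using that by (intro act_add) auto
    then show ?thesis by (simp add: vv_slash_def)
  qed
  moreover have "vv_holomorphic \<rho> (\<lambda>_. 0)" by (simp add: vv_holomorphic_def)
  ultimately show ?thesis
    using moderate_growth_zero by (simp add: vv_modular_forms_def vv_functions_def)
qed

lemma vv_modular_forms_add:
  assumes "f \<in> vv_modular_forms k \<rho>" "g \<in> vv_modular_forms k \<rho>"
  shows "(\<lambda>\<tau>. f \<tau> + g \<tau>) \<in> vv_modular_forms k \<rho>"
  using assms
  by (simp add: vv_modular_forms_def vv_functions_add vv_holomorphic_add moderate_growth_add vv_slash_add)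

lemma vv_modular_forms_mult:
  assumes "h \<in> modular_forms l" "f \<in> vv_modular_forms k \<rho>"
  shows "(\<lambda>\<tau>. rep_scale \<rho> (h \<tau>) (f \<tau>)) \<in> vv_modular_forms (l + k) \<rho>"
proof -
  have "h (moebius_act \<gamma> \<tau>) = aut_factor \<gamma> \<tau> powi l * h \<tau>"
    if "\<gamma> \<in> carrier SL2Z" "\<tau> \<in> upper_half_plane" for \<gamma> \<tau>
  proof -
    have "aut_factor \<gamma> \<tau> powi (- l) * h (moebius_act \<gamma> \<tau>) = h \<tau>"
      using assms(1) that by (simp add: modular_forms_def)
    then show ?thesis
      using aut_factor_nonzero[OF that] by (auto simp: power_int_minus field_simps)
  qed
  then show ?thesis
    using assms
    by (simp add: vv_modular_forms_def vv_functions_mult moderate_growth_mult vv_slash_mult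
        vv_holomorphic_mult modular_forms_def)
qed

lemma vv_modular_forms_sum:
  "(\<And>i. i \<in> I \<Longrightarrow> f i \<in> vv_modular_forms k \<rho>) \<Longrightarrow> (\<lambda>\<tau>. \<Sum>i\<in>I. f i \<tau>) \<in> vv_modular_forms k \<rho>"
  by (induction I rule: infinite_finite_induct) (auto intro: vv_modular_forms_zero vv_modular_forms_add)

end


section \<open>The module of second order forms\<close>

locale arith_rep_pair = \<rho>: arith_rep \<rho> + \<sigma>: arith_rep \<sigma>
  for \<rho> :: "'v::ab_group_add arith_type" and \<sigma> :: "'w::ab_group_add arith_type"
begin

lemma hom_zero: "h \<in> rep_lin_maps \<sigma> \<rho> \<Longrightarrow> h 0 = 0"
proof -
  assume "h \<in> rep_lin_maps \<sigma> \<rho>"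
  then have "h (0 + 0) = h 0 + h 0" by (rule lin_maps_add) simp_all
  then show ?thesis by simp
qed

lemma cocycle_lin: "\<phi> \<in> parabolic_cocycles (hom_rep \<sigma> \<rho>) \<Longrightarrow> \<gamma> \<in> carrier SL2Z \<Longrightarrow> \<phi> \<gamma> \<in> rep_lin_maps \<sigma> \<rho>"
  by (simp add: parabolic_cocycles_def hom_rep_def)

lemma vv_modular_subset_second_order: "vv_modular_forms k \<rho> \<subseteq> second_order_forms k \<rho> \<sigma>"
  by (auto simp: vv_modular_forms_def second_order_forms_def intro!: exI[of _ "{}"])

lemma second_order_zero: "(\<lambda>_. 0) \<in> second_order_forms k \<rho> \<sigma>"
  using \<rho>.vv_modular_forms_zero vv_modular_subset_second_order by blast

lemma second_orderE:
  assumes "f \<in> second_order_forms k \<rho> \<sigma>"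
  obtains A g where "f \<in> vv_functions \<rho>" "vv_holomorphic \<rho> f" "moderate_growth k \<rho> f"
    "finite A" "A \<subseteq> parabolic_cocycles (hom_rep \<sigma> \<rho>)"
    "\<forall>\<phi>\<in>A. g \<phi> \<in> vv_modular_forms k \<sigma>"
    "\<forall>\<gamma>\<in>carrier SL2Z. \<forall>\<tau>\<in>upper_half_plane.
        vv_slash k \<rho> f \<gamma> \<tau> - f \<tau> = (\<Sum>\<phi>\<in>A. \<phi> (inv\<^bsub>SL2Z\<^esub> \<gamma>) (g \<phi> \<tau>))"
  using assms unfolding second_order_forms_def mem_Collect_eq by (elim conjE exE) (rule that)

lemma second_orderI:
  assumes "f \<in> vv_functions \<rho>" "vv_holomorphic \<rho> f" "moderate_growth k \<rho> f"
    "finite A" "A \<subseteq> parabolic_cocycles (hom_rep \<sigma> \<rho>)"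
    "\<And>\<phi>. \<phi> \<in> A \<Longrightarrow> g \<phi> \<in> vv_modular_forms k \<sigma>"
    "\<And>\<gamma> \<tau>. \<gamma> \<in> carrier SL2Z \<Longrightarrow> \<tau> \<in> upper_half_plane \<Longrightarrow>
        vv_slash k \<rho> f \<gamma> \<tau> - f \<tau> = (\<Sum>\<phi>\<in>A. \<phi> (inv\<^bsub>SL2Z\<^esub> \<gamma>) (g \<phi> \<tau>))"
  shows "f \<in> second_order_forms k \<rho> \<sigma>"
  unfolding second_order_forms_def
  by (intro CollectI conjI exI[of _ A] exI[of _ g] ballI; rule assms; assumption?)

lemma second_order_add:
  assumes "f \<in> second_order_forms k \<rho> \<sigma>" "f' \<in> second_order_forms k \<rho> \<sigma>"
  shows "(\<lambda>\<tau>. f \<tau> + f' \<tau>) \<in> second_order_forms k \<rho> \<sigma>"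
proof -
  obtain A g where f: "f \<in> vv_functions \<rho>" "vv_holomorphic \<rho> f" "moderate_growth k \<rho> f"
    "finite A" "A \<subseteq> parabolic_cocycles (hom_rep \<sigma> \<rho>)" "\<forall>\<phi>\<in>A. g \<phi> \<in> vv_modular_forms k \<sigma>"
    "\<forall>\<gamma>\<in>carrier SL2Z. \<forall>\<tau>\<in>upper_half_plane.
        vv_slash k \<rho> f \<gamma> \<tau> - f \<tau> = (\<Sum>\<phi>\<in>A. \<phi> (inv\<^bsub>SL2Z\<^esub> \<gamma>) (g \<phi> \<tau>))"
    by (rule second_orderE[OF assms(1)])
  obtain A' g' where f': "f' \<in> vv_functions \<rho>" "vv_holomorphic \<rho> f'" "moderate_growth k \<rho> f'"
    "finite A'" "A' \<subseteq> parabolic_cocycles (hom_rep \<sigma> \<rho>)" "\<forall>\<phi>\<in>A'. g' \<phi> \<in> vv_modular_forms k \<sigma>"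
    "\<forall>\<gamma>\<in>carrier SL2Z. \<forall>\<tau>\<in>upper_half_plane.
        vv_slash k \<rho> f' \<gamma> \<tau> - f' \<tau> = (\<Sum>\<phi>\<in>A'. \<phi> (inv\<^bsub>SL2Z\<^esub> \<gamma>) (g' \<phi> \<tau>))"
    by (rule second_orderE[OF assms(2)])
  note f67 = f(6,7)[rule_format] and f67' = f'(6,7)[rule_format]
  \<comment> \<open>The two sets of cocycles may overlap. With both families of forms extended by
    zero, a shared cocycle is paired with the sum of its two forms, by linearity of its
    values.\<close>
  define e where "e = (\<lambda>\<phi>. if \<phi> \<in> A then g \<phi> else (\<lambda>_. 0))"
  define e' where "e' = (\<lambda>\<phi>. if \<phi> \<in> A' then g' \<phi> else (\<lambda>_. 0))"
  have e: "e \<phi> \<in> vv_modular_forms k \<sigma>" "e' \<phi> \<in> vv_modular_forms k \<sigma>" for \<phi>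
    using f67(1) f67'(1) \<sigma>.vv_modular_forms_zero by (simp_all add: e_def e'_def)
  show ?thesis
  proof (rule second_orderI[where A = "A \<union> A'" and g = "\<lambda>\<phi> \<tau>. e \<phi> \<tau> + e' \<phi> \<tau>"])
    fix \<gamma> \<tau> assume \<gamma>: "\<gamma> \<in> carrier SL2Z" and \<tau>: "\<tau> \<in> upper_half_plane"
    let ?i = "inv\<^bsub>SL2Z\<^esub> \<gamma>"
    have lin: "\<phi> ?i \<in> rep_lin_maps \<sigma> \<rho>" if "\<phi> \<in> A \<union> A'" for \<phi>
      using that f(5) f'(5) \<gamma> by (intro cocycle_lin) auto
    have "(\<Sum>\<phi>\<in>A \<union> A'. \<phi> ?i (e \<phi> \<tau> + e' \<phi> \<tau>)) = (\<Sum>\<phi>\<in>A \<union> A'. \<phi> ?i (e \<phi> \<tau>) + \<phi> ?i (e' \<phi> \<tau>))"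
    proof (rule sum.cong[OF refl])
      fix \<phi> assume "\<phi> \<in> A \<union> A'"
      moreover have "e \<phi> \<tau> \<in> rep_space \<sigma>" "e' \<phi> \<tau> \<in> rep_space \<sigma>"
        using e[of \<phi>] \<tau> by (auto simp: vv_modular_forms_def vv_functions_def)
      ultimately show "\<phi> ?i (e \<phi> \<tau> + e' \<phi> \<tau>) = \<phi> ?i (e \<phi> \<tau>) + \<phi> ?i (e' \<phi> \<tau>)"
        using lin[of \<phi>] by (simp add: rep_lin_maps_def)
    qed
    also have "\<dots> = (\<Sum>\<phi>\<in>A \<union> A'. \<phi> ?i (e \<phi> \<tau>)) + (\<Sum>\<phi>\<in>A \<union> A'. \<phi> ?i (e' \<phi> \<tau>))"
      by (rule sum.distrib)
    also have "(\<Sum>\<phi>\<in>A \<union> A'. \<phi> ?i (e \<phi> \<tau>)) = (\<Sum>\<phi>\<in>A. \<phi> ?i (g \<phi> \<tau>))"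
      using f(4) f'(4) lin by (intro sum.mono_neutral_cong_right) (auto simp: e_def hom_zero)
    also have "(\<Sum>\<phi>\<in>A \<union> A'. \<phi> ?i (e' \<phi> \<tau>)) = (\<Sum>\<phi>\<in>A'. \<phi> ?i (g' \<phi> \<tau>))"
      using f(4) f'(4) lin by (intro sum.mono_neutral_cong_right) (auto simp: e'_def hom_zero)
    finally show "vv_slash k \<rho> (\<lambda>\<tau>. f \<tau> + f' \<tau>) \<gamma> \<tau> - (f \<tau> + f' \<tau>) = (\<Sum>\<phi>\<in>A \<union> A'. \<phi> ?i (e \<phi> \<tau> + e' \<phi> \<tau>))"
      using f(1) f'(1) \<gamma> \<tau> by (simp add: \<rho>.vv_slash_add flip: f67(2) f67'(2))
  next
    show "(\<lambda>\<tau>. e \<phi> \<tau> + e' \<phi> \<tau>) \<in> vv_modular_forms k \<sigma>" for \<phi>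
      by (rule \<sigma>.vv_modular_forms_add[OF e])
    show "A \<union> A' \<subseteq> parabolic_cocycles (hom_rep \<sigma> \<rho>)"
      using f(5) f'(5) by (rule Un_least)
  qed (simp_all add: f(1-4) f'(1-4) \<rho>.vv_functions_add \<rho>.vv_holomorphic_add \<rho>.moderate_growth_add)
qed

lemma second_order_mult:
  assumes h: "h \<in> modular_forms l" and "f \<in> second_order_forms k \<rho> \<sigma>"
  shows "(\<lambda>\<tau>. rep_scale \<rho> (h \<tau>) (f \<tau>)) \<in> second_order_forms (l + k) \<rho> \<sigma>"
proof -
  obtain A g where f: "f \<in> vv_functions \<rho>" "vv_holomorphic \<rho> f" "moderate_growth k \<rho> f"
    "finite A" "A \<subseteq> parabolic_cocycles (hom_rep \<sigma> \<rho>)" "\<forall>\<phi>\<in>A. g \<phi> \<in> vv_modular_forms k \<sigma>"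
    "\<forall>\<gamma>\<in>carrier SL2Z. \<forall>\<tau>\<in>upper_half_plane.
        vv_slash k \<rho> f \<gamma> \<tau> - f \<tau> = (\<Sum>\<phi>\<in>A. \<phi> (inv\<^bsub>SL2Z\<^esub> \<gamma>) (g \<phi> \<tau>))"
    by (rule second_orderE[OF assms(2)])
  note f67 = f(6,7)[rule_format]
  show ?thesis
  proof (rule second_orderI[where A = A and g = "\<lambda>\<phi> \<tau>. rep_scale \<sigma> (h \<tau>) (g \<phi> \<tau>)"])
    show "(\<lambda>\<tau>. rep_scale \<rho> (h \<tau>) (f \<tau>)) \<in> vv_functions \<rho>" by (rule \<rho>.vv_functions_mult[OF f(1)])
    show "vv_holomorphic \<rho> (\<lambda>\<tau>. rep_scale \<rho> (h \<tau>) (f \<tau>))"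
      using h by (intro \<rho>.vv_holomorphic_mult f) (simp add: modular_forms_def)
    show "moderate_growth (l + k) \<rho> (\<lambda>\<tau>. rep_scale \<rho> (h \<tau>) (f \<tau>))"
      by (intro \<rho>.moderate_growth_mult f h)
    show "(\<lambda>\<tau>. rep_scale \<sigma> (h \<tau>) (g \<phi> \<tau>)) \<in> vv_modular_forms (l + k) \<sigma>" if "\<phi> \<in> A" for \<phi>
      using that by (intro \<sigma>.vv_modular_forms_mult h f67)
    fix \<gamma> \<tau> assume \<gamma>: "\<gamma> \<in> carrier SL2Z" and \<tau>: "\<tau> \<in> upper_half_plane"
    let ?i = "inv\<^bsub>SL2Z\<^esub> \<gamma>"
    have "aut_factor \<gamma> \<tau> powi (- l) * h (moebius_act \<gamma> \<tau>) = h \<tau>"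
      using h \<gamma> \<tau> by (simp add: modular_forms_def)
    then have hinv: "h (moebius_act \<gamma> \<tau>) = aut_factor \<gamma> \<tau> powi l * h \<tau>"
      using aut_factor_nonzero[OF \<gamma> \<tau>] by (auto simp: power_int_minus field_simps)
    have "(\<Sum>\<phi>\<in>A. \<phi> ?i (rep_scale \<sigma> (h \<tau>) (g \<phi> \<tau>))) = (\<Sum>\<phi>\<in>A. rep_scale \<rho> (h \<tau>) (\<phi> ?i (g \<phi> \<tau>)))"
    proof (rule sum.cong[OF refl])
      fix \<phi> assume \<phi>: "\<phi> \<in> A"
      have "\<phi> ?i \<in> rep_lin_maps \<sigma> \<rho>" using \<phi> f(5) \<gamma> by (intro cocycle_lin) auto
      moreover have "g \<phi> \<tau> \<in> rep_space \<sigma>"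
        using f67(1)[OF \<phi>] \<tau> by (simp add: vv_modular_forms_def vv_functions_def)
      ultimately show "\<phi> ?i (rep_scale \<sigma> (h \<tau>) (g \<phi> \<tau>)) = rep_scale \<rho> (h \<tau>) (\<phi> ?i (g \<phi> \<tau>))"
        by (simp add: rep_lin_maps_def)
    qed
    also have "\<dots> = rep_scale \<rho> (h \<tau>) (vv_slash k \<rho> f \<gamma> \<tau> - f \<tau>)"
      by (simp add: f67(2)[OF \<gamma> \<tau>] \<rho>.V.scale_sum_right)
    finally show "vv_slash (l + k) \<rho> (\<lambda>\<tau>. rep_scale \<rho> (h \<tau>) (f \<tau>)) \<gamma> \<tau> - rep_scale \<rho> (h \<tau>) (f \<tau>)
        = (\<Sum>\<phi>\<in>A. \<phi> ?i (rep_scale \<sigma> (h \<tau>) (g \<phi> \<tau>)))"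
      by (simp add: \<rho>.vv_slash_mult[OF \<gamma> \<tau> f(1) hinv] \<rho>.V.scale_right_diff_distrib)
  qed (rule f)+
qed

lemma second_order_sum:
  "(\<And>i. i \<in> I \<Longrightarrow> f i \<in> second_order_forms k \<rho> \<sigma>) \<Longrightarrow> (\<lambda>\<tau>. \<Sum>i\<in>I. f i \<tau>) \<in> second_order_forms k \<rho> \<sigma>"
  by (induction I rule: infinite_finite_induct) (auto intro: second_order_zero second_order_add)

end

section \<open>Graded multiplication and spans of homogeneous generators\<close>

lemma graded_mult_eq:
  assumes "\<And>x. act 0 x = 0" "finite L" "{l. r l \<noteq> 0} \<subseteq> L"
  shows "graded_mult act r F k \<tau> = (\<Sum>l\<in>L. act (r l \<tau>) (F (k - l) \<tau>))"
  unfolding graded_mult_def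
proof (rule sum.mono_neutral_left[OF assms(2,3)])
  show "\<forall>l\<in>L - {l. r l \<noteq> 0}. act (r l \<tau>) (F (k - l) \<tau>) = 0"
    using assms(1) by simp
qed

lemma homogeneous_support: "{l. homogeneous m u l \<noteq> 0} \<subseteq> {m}"
  by (auto simp: homogeneous_def)

lemma graded_mult_homogeneous:
  assumes "\<And>x. act 0 x = 0" "\<And>c. act c 0 = 0"
  shows "graded_mult act (homogeneous m u) (homogeneous l e) = homogeneous (m + l) (\<lambda>\<tau>. act (u \<tau>) (e \<tau>))"
proof (intro ext)
  fix k \<tau>
  have "graded_mult act (homogeneous m u) (homogeneous l e) k \<tau>
      = (\<Sum>j\<in>{m}. act (homogeneous m u j \<tau>) (homogeneous l e (k - j) \<tau>))"
    by (rule graded_mult_eq) (use assms(1) homogeneous_support in auto)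
  then show "graded_mult act (homogeneous m u) (homogeneous l e) k \<tau>
      = homogeneous (m + l) (\<lambda>\<tau>. act (u \<tau>) (e \<tau>)) k \<tau>"
    using assms(2) by (auto simp: homogeneous_def)
qed

lemma delta_pow_homogeneous:
  "homogeneous 12 ramanujan_delta [^]\<^bsub>modular_ring\<^esub> (n :: nat) = homogeneous (12 * int n) (mf_pow ramanujan_delta n)"
proof (induction n)
  case 0
  have "mf_pow ramanujan_delta 0 = indicator upper_half_plane"
    by (auto simp: mf_pow_def fun_eq_iff)
  then show ?case by (simp add: nat_pow_def modular_ring_def)
next
  case (Suc n)
  have "homogeneous 12 ramanujan_delta [^]\<^bsub>modular_ring\<^esub> Suc n
      = graded_mult (*) (homogeneous (12 * int n) (mf_pow ramanujan_delta n)) (homogeneous 12 ramanujan_delta)"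
    unfolding nat_pow_Suc Suc.IH by (simp add: modular_ring_def)
  also have "\<dots> = homogeneous (12 * int n + 12) (\<lambda>\<tau>. mf_pow ramanujan_delta n \<tau> * ramanujan_delta \<tau>)"
    by (rule graded_mult_homogeneous) simp_all
  also have "(\<lambda>\<tau>. mf_pow ramanujan_delta n \<tau> * ramanujan_delta \<tau>) = mf_pow ramanujan_delta (Suc n)"
    by (auto simp: mf_pow_def fun_eq_iff)
  finally show ?case by (simp add: algebra_simps)
qed

lemma graded_sum_modular_add:
  assumes "r \<in> graded_sum modular_forms" "r' \<in> graded_sum modular_forms"
  shows "r + r' \<in> graded_sum modular_forms"
proof -
  have "{k. (r + r') k \<noteq> 0} \<subseteq> {k. r k \<noteq> 0} \<union> {k. r' k \<noteq> 0}" by auto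
  moreover have "(r + r') k \<in> modular_forms k" for k
    using modular_forms_add[of "r k" k "r' k"] assms by (simp add: graded_sum_def plus_fun_def)
  ultimately show ?thesis
    using assms finite_subset by (auto simp: graded_sum_def)
qed

lemma graded_sum_modular_zero: "0 \<in> graded_sum modular_forms"
  using modular_forms_0 by (simp add: graded_sum_def zero_fun_def)

context arith_rep_pair
begin

definition M where "M = second_order_module \<rho> \<sigma>"

lemma carrier_M: "carrier M = graded_sum (\<lambda>k. second_order_forms k \<rho> \<sigma>)"
  and add_M: "(\<oplus>\<^bsub>M\<^esub>) = (+)"
  and zero_M: "\<zero>\<^bsub>M\<^esub> = 0"
  and smult_M: "(\<odot>\<^bsub>M\<^esub>) = graded_mult (rep_scale \<rho>)"
  by (simp_all add: M_def second_order_module_def graded_module_def)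

lemma graded_sum_add_closed:
  assumes "\<And>k f g. f \<in> Y k \<Longrightarrow> g \<in> Y k \<Longrightarrow> (\<lambda>\<tau>. f \<tau> + g \<tau> :: 'v) \<in> Y k"
    and "F \<in> graded_sum Y" "G \<in> graded_sum Y"
  shows "F + G \<in> graded_sum Y"
proof -
  have "{k. (F + G) k \<noteq> 0} \<subseteq> {k. F k \<noteq> 0} \<union> {k. G k \<noteq> 0}" by auto
  then have "finite {k. (F + G) k \<noteq> 0}"
    by (rule finite_subset) (use assms in \<open>simp add: graded_sum_def\<close>)
  moreover have "(F + G) k \<in> Y k" for k
    using assms(1)[of "F k" k "G k"] assms(2,3) by (simp add: graded_sum_def plus_fun_def)
  ultimately show ?thesis by (simp add: graded_sum_def)
qed

lemma carrier_add: "F \<in> carrier M \<Longrightarrow> G \<in> carrier M \<Longrightarrow> F + G \<in> carrier M"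
  unfolding carrier_M by (rule graded_sum_add_closed[OF second_order_add])

lemma carrier_zero: "0 \<in> carrier M"
  using second_order_zero by (simp add: carrier_M graded_sum_def zero_fun_def)

lemma abelian_monoid_M: "abelian_monoid M"
  by (rule abelian_monoidI) (simp_all add: add_M zero_M carrier_add carrier_zero add_ac)

lemma finsum_M:
  assumes "finite A" "\<And>s. s \<in> A \<Longrightarrow> f s \<in> carrier M"
  shows "finsum M f A = sum f A"
  using assms
proof (induction A rule: finite_induct)
  case empty
  show ?case by (simp only: abelian_monoid.finsum_empty[OF abelian_monoid_M] zero_M sum.empty)
next
  case (insert x A)
  have "finsum M f (insert x A) = f x \<oplus>\<^bsub>M\<^esub> finsum M f A"
    using insert by (intro abelian_monoid.finsum_insert[OF abelian_monoid_M]) auto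
  then show ?case using insert by (simp add: add_M)
qed

lemma graded_mult_support:
  "graded_mult (rep_scale \<rho>) r F k = (\<lambda>\<tau>. \<Sum>l | r l \<noteq> 0. rep_scale \<rho> (r l \<tau>) (F (k - l) \<tau>))"
  by (simp add: graded_mult_def)

lemma graded_mult_closed:
  assumes r: "r \<in> graded_sum modular_forms" and F: "F \<in> carrier M"
  shows "graded_mult (rep_scale \<rho>) r F \<in> carrier M"
proof -
  have "graded_mult (rep_scale \<rho>) r F k \<in> second_order_forms k \<rho> \<sigma>" for k
    unfolding graded_mult_support
  proof (rule second_order_sum)
    fix l
    have "r l \<in> modular_forms l" "F (k - l) \<in> second_order_forms (k - l) \<rho> \<sigma>"
      using r F by (simp_all add: graded_sum_def carrier_M)
    from second_order_mult[OF this]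
    show "(\<lambda>\<tau>. rep_scale \<rho> (r l \<tau>) (F (k - l) \<tau>)) \<in> second_order_forms k \<rho> \<sigma>" by simp
  qed
  moreover have "finite {k. graded_mult (rep_scale \<rho>) r F k \<noteq> 0}"
  proof (rule finite_subset)
    show "{k. graded_mult (rep_scale \<rho>) r F k \<noteq> 0}
        \<subseteq> (\<lambda>(l, m). l + m) ` ({l. r l \<noteq> 0} \<times> {m. F m \<noteq> 0})"
    proof
      fix k assume k: "k \<in> {k. graded_mult (rep_scale \<rho>) r F k \<noteq> 0}"
      have "\<exists>l. r l \<noteq> 0 \<and> F (k - l) \<noteq> 0"
      proof (rule ccontr)
        assume "\<not> (\<exists>l. r l \<noteq> 0 \<and> F (k - l) \<noteq> 0)"
        then have "graded_mult (rep_scale \<rho>) r F k = 0"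
          by (auto simp: graded_mult_support fun_eq_iff intro!: sum.neutral)
        then show False using k by simp
      qed
      then obtain l where "r l \<noteq> 0" "F (k - l) \<noteq> 0" by blast
      then show "k \<in> (\<lambda>(l, m). l + m) ` ({l. r l \<noteq> 0} \<times> {m. F m \<noteq> 0})"
        by (intro image_eqI[of _ _ "(l, k - l)"]) auto
    qed
    show "finite ((\<lambda>(l, m). l + m) ` ({l. r l \<noteq> 0} \<times> {m. F m \<noteq> 0}))"
      using r F by (simp add: graded_sum_def carrier_M)
  qed
  ultimately show ?thesis by (simp add: carrier_M graded_sum_def)
qed

lemma module_span_iff:
  assumes "S \<subseteq> carrier M"
  shows "F \<in> module_span modular_ring M S \<longleftrightarrow>
    (\<exists>A c. finite A \<and> A \<subseteq> S \<and> c \<in> A \<rightarrow> graded_sum modular_forms \<and>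
       F = (\<Sum>s\<in>A. graded_mult (rep_scale \<rho>) (c s) s))"
proof -
  have eq: "finsum M (\<lambda>s. c s \<odot>\<^bsub>M\<^esub> s) A = (\<Sum>s\<in>A. graded_mult (rep_scale \<rho>) (c s) s)"
    if "finite A" "A \<subseteq> S" "c \<in> A \<rightarrow> graded_sum modular_forms" for A c
    unfolding smult_M
  proof (rule finsum_M[OF that(1)])
    fix s assume "s \<in> A"
    then have "c s \<in> graded_sum modular_forms" "s \<in> carrier M"
      using that assms by (auto dest: funcset_mem)
    then show "graded_mult (rep_scale \<rho>) (c s) s \<in> carrier M" by (rule graded_mult_closed)
  qed
  have R: "carrier modular_ring = graded_sum modular_forms"
    by (simp add: modular_ring_def)
  show ?thesis
    unfolding module_span_def R
  proof
    assume "F \<in> {\<Oplus>\<^bsub>M\<^esub>s\<in>A. c s \<odot>\<^bsub>M\<^esub> s | A c. finite A \<and> A \<subseteq> S \<and> c \<in> A \<rightarrow> graded_sum modular_forms}"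
    then obtain A c where A: "F = finsum M (\<lambda>s. c s \<odot>\<^bsub>M\<^esub> s) A" "finite A" "A \<subseteq> S"
      "c \<in> A \<rightarrow> graded_sum modular_forms" by blast
    then show "\<exists>A c. finite A \<and> A \<subseteq> S \<and> c \<in> A \<rightarrow> graded_sum modular_forms \<and>
        F = (\<Sum>s\<in>A. graded_mult (rep_scale \<rho>) (c s) s)"
      by (intro exI[of _ A] exI[of _ c] conjI) (simp_all only: eq)
  next
    assume "\<exists>A c. finite A \<and> A \<subseteq> S \<and> c \<in> A \<rightarrow> graded_sum modular_forms \<and>
        F = (\<Sum>s\<in>A. graded_mult (rep_scale \<rho>) (c s) s)"
    then obtain A c where A: "finite A" "A \<subseteq> S" "c \<in> A \<rightarrow> graded_sum modular_forms"
      "F = (\<Sum>s\<in>A. graded_mult (rep_scale \<rho>) (c s) s)" by blast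
    then have "F = finsum M (\<lambda>s. c s \<odot>\<^bsub>M\<^esub> s) A" by (simp only: eq)
    then show "F \<in> {\<Oplus>\<^bsub>M\<^esub>s\<in>A. c s \<odot>\<^bsub>M\<^esub> s | A c. finite A \<and> A \<subseteq> S \<and> c \<in> A \<rightarrow> graded_sum modular_forms}"
      using A(1-3) by blast
  qed
qed

lemma graded_mult_add:
  assumes "r \<in> graded_sum modular_forms" "r' \<in> graded_sum modular_forms"
  shows "graded_mult (rep_scale \<rho>) (r + r') F = graded_mult (rep_scale \<rho>) r F + graded_mult (rep_scale \<rho>) r' F"
proof (intro ext)
  fix k \<tau>
  define L where "L = {l. r l \<noteq> 0} \<union> {l. r' l \<noteq> 0}"
  have L: "finite L" "{l. r l \<noteq> 0} \<subseteq> L" "{l. r' l \<noteq> 0} \<subseteq> L" "{l. (r + r') l \<noteq> 0} \<subseteq> L"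
    using assms by (auto simp: L_def graded_sum_def)
  show "graded_mult (rep_scale \<rho>) (r + r') F k \<tau>
      = (graded_mult (rep_scale \<rho>) r F + graded_mult (rep_scale \<rho>) r' F) k \<tau>"
    unfolding plus_fun_apply
      graded_mult_eq[where act = "rep_scale \<rho>" and L = L and r = r, OF \<rho>.V.scale_zero_left L(1,2)]
      graded_mult_eq[where act = "rep_scale \<rho>" and L = L and r = r', OF \<rho>.V.scale_zero_left L(1,3)]
      graded_mult_eq[where act = "rep_scale \<rho>" and L = L and r = "r + r'", OF \<rho>.V.scale_zero_left L(1,4)]
    by (simp add: \<rho>.V.scale_left_distrib sum.distrib)
qed

lemma graded_mult_zero: "graded_mult (rep_scale \<rho>) 0 F = 0"
  by (simp add: graded_mult_def fun_eq_iff)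

lemma module_span_add:
  assumes S: "S \<subseteq> carrier M" and "F \<in> module_span modular_ring M S" "G \<in> module_span modular_ring M S"
  shows "F + G \<in> module_span modular_ring M S"
proof -
  obtain A c where A: "finite A" "A \<subseteq> S" "c \<in> A \<rightarrow> graded_sum modular_forms"
    "F = (\<Sum>s\<in>A. graded_mult (rep_scale \<rho>) (c s) s)"
    using assms(2) unfolding module_span_iff[OF S] by blast
  obtain B b where B: "finite B" "B \<subseteq> S" "b \<in> B \<rightarrow> graded_sum modular_forms"
    "G = (\<Sum>s\<in>B. graded_mult (rep_scale \<rho>) (b s) s)"
    using assms(3) unfolding module_span_iff[OF S] by blast
  define c' where "c' = (\<lambda>s. if s \<in> A then c s else 0)"
  define b' where "b' = (\<lambda>s. if s \<in> B then b s else 0)"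
  have mem: "c' s \<in> graded_sum modular_forms" "b' s \<in> graded_sum modular_forms" for s
    using A(3) B(3) graded_sum_modular_zero by (auto simp: c'_def b'_def)
  have F: "F = (\<Sum>s\<in>A \<union> B. graded_mult (rep_scale \<rho>) (c' s) s)"
    unfolding A(4) using A(1) B(1)
    by (intro sum.mono_neutral_cong_left) (auto simp: c'_def graded_mult_zero)
  have G: "G = (\<Sum>s\<in>A \<union> B. graded_mult (rep_scale \<rho>) (b' s) s)"
    unfolding B(4) using A(1) B(1)
    by (intro sum.mono_neutral_cong_left) (auto simp: b'_def graded_mult_zero)
  have "F + G = (\<Sum>s\<in>A \<union> B. graded_mult (rep_scale \<rho>) (c' s + b' s) s)"
    unfolding F G by (simp add: graded_mult_add[OF mem] sum.distrib)
  moreover have "(\<lambda>s. c' s + b' s) \<in> A \<union> B \<rightarrow> graded_sum modular_forms"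
    using graded_sum_modular_add[OF mem] by blast
  ultimately show ?thesis
    unfolding module_span_iff[OF S] using A(1,2) B(1,2)
    by (intro exI[of _ "A \<union> B"] exI[of _ "\<lambda>s. c' s + b' s"]) auto
qed

lemma module_span_zero:
  assumes "S \<subseteq> carrier M"
  shows "0 \<in> module_span modular_ring M S"
  unfolding module_span_iff[OF assms] by (intro exI[of _ "{}"]) auto

lemma homogeneous_mem:
  assumes "u \<in> modular_forms m"
  shows "homogeneous m u \<in> graded_sum modular_forms"
proof -
  have "finite {k. homogeneous m u k \<noteq> 0}"
    by (rule finite_subset[OF homogeneous_support]) simp
  then show ?thesis
    using assms modular_forms_0 by (simp add: graded_sum_def homogeneous_def zero_fun_def)
qed

lemma module_span_generator:
  assumes S: "S \<subseteq> carrier M" and "homogeneous l e \<in> S" "u \<in> modular_forms m"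
  shows "homogeneous (m + l) (\<lambda>\<tau>. rep_scale \<rho> (u \<tau>) (e \<tau>)) \<in> module_span modular_ring M S"
proof -
  have "graded_mult (rep_scale \<rho>) (homogeneous m u) (homogeneous l e)
      = homogeneous (m + l) (\<lambda>\<tau>. rep_scale \<rho> (u \<tau>) (e \<tau>))"
    by (rule graded_mult_homogeneous) simp_all
  then show ?thesis
    unfolding module_span_iff[OF S] using assms(2) homogeneous_mem[OF assms(3)]
    by (intro exI[of _ "{homogeneous l e}"] exI[of _ "\<lambda>_. homogeneous m u"]) simp
qed

lemma module_span_mono: "S \<subseteq> S' \<Longrightarrow> module_span R N S \<subseteq> module_span R N S'"
  unfolding module_span_def by blast

lemma set_add_mono: "A \<subseteq> A' \<Longrightarrow> A <+>\<^bsub>N\<^esub> B \<subseteq> A' <+>\<^bsub>N\<^esub> B"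
  unfolding set_add_def set_mult_def by blast

lemma set_add_M: "F \<in> A <+>\<^bsub>M\<^esub> B \<longleftrightarrow> (\<exists>G\<in>A. \<exists>H\<in>B. F = G + H)"
  unfolding set_add_def set_mult_def by (simp add: add_M)

text \<open>A homogeneous scalar acts on each component separately. The product is written as a sum
  so that a set closed under addition can be reached one component at a time.\<close>

lemma sum_homogeneous:
  fixes F :: "int \<Rightarrow> complex \<Rightarrow> 'v"
  assumes "finite J" "{j. F j \<noteq> 0} \<subseteq> J"
  shows "graded_mult (rep_scale \<rho>) (homogeneous m u) F
    = (\<Sum>j\<in>J. homogeneous (j + m) (\<lambda>\<tau>. rep_scale \<rho> (u \<tau>) (F j \<tau>)))"
proof (intro ext)
  fix k \<tau>
  have sum_apply: "sum f J k \<tau> = (\<Sum>j\<in>J. f j k \<tau>)" for f :: "int \<Rightarrow> int \<Rightarrow> complex \<Rightarrow> 'v"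
    using assms(1) by (induction J rule: finite_induct) simp_all
  have "graded_mult (rep_scale \<rho>) (homogeneous m u) F k \<tau>
      = (\<Sum>j\<in>{m}. rep_scale \<rho> (homogeneous m u j \<tau>) (F (k - j) \<tau>))"
    by (rule graded_mult_eq[OF _ _ homogeneous_support]) simp_all
  also have "\<dots> = rep_scale \<rho> (u \<tau>) (F (k - m) \<tau>)"
    by (simp add: homogeneous_def)
  also have "\<dots> = (\<Sum>j\<in>J. if j = k - m then rep_scale \<rho> (u \<tau>) (F j \<tau>) else 0)"
  proof (cases "k - m \<in> J")
    case False
    then have "F (k - m) = 0" using assms(2) by blast
    then show ?thesis using False assms(1) by (simp add: sum.delta)
  qed (use assms(1) in \<open>simp add: sum.delta\<close>)
  also have "\<dots> = (\<Sum>j\<in>J. homogeneous (j + m) (\<lambda>\<tau>. rep_scale \<rho> (u \<tau>) (F j \<tau>)) k \<tau>)"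
    by (intro sum.cong refl) (auto simp: homogeneous_def)
  finally show "graded_mult (rep_scale \<rho>) (homogeneous m u) F k \<tau>
      = (\<Sum>j\<in>J. homogeneous (j + m) (\<lambda>\<tau>. rep_scale \<rho> (u \<tau>) (F j \<tau>))) k \<tau>"
    by (simp only: sum_apply)
qed

text \<open>Only the inclusion of the carrier has content. As N is the same for all k and f, one
  power of \<Delta> moves all components of an element into the sum at once.\<close>

lemma saturation_eq_carrier:
  fixes Y :: "int \<Rightarrow> (complex \<Rightarrow> 'v) set"
  assumes S: "S \<subseteq> carrier M" "S \<subseteq> S'"
    and Y: "\<And>k f g. f \<in> Y k \<Longrightarrow> g \<in> Y k \<Longrightarrow> (\<lambda>\<tau>. f \<tau> + g \<tau>) \<in> Y k" "\<And>k. (\<lambda>_. 0) \<in> Y k"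
    and main: "\<And>k f. f \<in> second_order_forms k \<rho> \<sigma> \<Longrightarrow>
      \<exists>G\<in>module_span modular_ring M S. \<exists>h\<in>Y (k + 12 * int N).
        homogeneous (k + 12 * int N) (\<lambda>\<tau>. rep_scale \<rho> (mf_pow ramanujan_delta N \<tau>) (f \<tau>))
          = G + homogeneous (k + 12 * int N) h"
  shows "saturation modular_ring M (module_span modular_ring M S' <+>\<^bsub>M\<^esub> graded_sum Y)
      (homogeneous 12 ramanujan_delta) = carrier M"
proof -
  \<comment> \<open>Sums are formed with the generators in S, which are known to lie in the module.
    The passage to S' is mere monotonicity of the span.\<close>
  define T where "T = module_span modular_ring M S <+>\<^bsub>M\<^esub> graded_sum Y"
  have T_sub: "T \<subseteq> module_span modular_ring M S' <+>\<^bsub>M\<^esub> graded_sum Y"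
    unfolding T_def by (intro set_add_mono module_span_mono S)
  have Y0: "0 \<in> graded_sum Y" using Y(2) by (simp add: graded_sum_def zero_fun_def)
  have T0: "0 \<in> T"
    unfolding T_def set_add_M
    by (rule bexI[OF bexI[OF _ Y0] module_span_zero[OF S(1)]]) (rule add_0_left[symmetric])
  have T_add: "F + G \<in> T" if FG: "F \<in> T" "G \<in> T" for F G
  proof -
    obtain a b where F: "a \<in> module_span modular_ring M S" "b \<in> graded_sum Y" "F = a + b"
      using FG(1) unfolding T_def set_add_M by blast
    obtain a' b' where G: "a' \<in> module_span modular_ring M S" "b' \<in> graded_sum Y" "G = a' + b'"
      using FG(2) unfolding T_def set_add_M by blast
    have "F + G = (a + a') + (b + b')" by (simp add: F G add_ac)
    then show ?thesis
      unfolding T_def set_add_M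
      using module_span_add[OF S(1) F(1) G(1)] graded_sum_add_closed[OF Y(1) F(2) G(2)] by blast
  qed
  have T_sum: "sum f J \<in> T" if "finite J" "\<And>j. j \<in> J \<Longrightarrow> f j \<in> T" for f and J :: "int set"
    using that by (induction J rule: finite_induct) (simp_all add: T0 T_add)
  have Yhom: "homogeneous k h \<in> graded_sum Y" if "h \<in> Y k" for k h
  proof -
    have "finite {l. homogeneous k h l \<noteq> 0}"
      by (rule finite_subset[OF homogeneous_support]) simp
    then show ?thesis using that Y(2) by (simp add: graded_sum_def homogeneous_def zero_fun_def)
  qed
  have "F \<in> saturation modular_ring M (module_span modular_ring M S' <+>\<^bsub>M\<^esub> graded_sum Y)
      (homogeneous 12 ramanujan_delta)" if F: "F \<in> carrier M" for F
  proof -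
    have finF: "finite {j. F j \<noteq> 0}" and Fj: "F j \<in> second_order_forms j \<rho> \<sigma>" for j
      using F by (simp_all add: carrier_M graded_sum_def)
    have "homogeneous (j + 12 * int N) (\<lambda>\<tau>. rep_scale \<rho> (mf_pow ramanujan_delta N \<tau>) (F j \<tau>)) \<in> T" for j
      using main[OF Fj[of j]] Yhom unfolding T_def set_add_M by blast
    then have "(homogeneous 12 ramanujan_delta [^]\<^bsub>modular_ring\<^esub> N) \<odot>\<^bsub>M\<^esub> F \<in> T"
      unfolding delta_pow_homogeneous smult_M sum_homogeneous[OF finF subset_refl]
      by (intro T_sum finF)
    then show ?thesis using F T_sub unfolding saturation_def by blast
  qed
  then show ?thesis by (auto simp: saturation_def)
qed

end

section \<open>Growth of parabolic cocycles\<close>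

text \<open>Interpolation at d + 1 points with an explicit bound: p is p(x 0) plus X - x 0 times r,
  and the values of r at the other points are difference quotients of p. The constant B depends on
  the points and on d only.\<close>

lemma coeff_bound_of_values:
  fixes x :: "nat \<Rightarrow> complex"
  assumes "inj x"
  shows "\<exists>B\<ge>0. \<forall>p K. degree p \<le> d \<longrightarrow> (\<forall>m\<le>d. norm (poly p (x m)) \<le> K) \<longrightarrow> (\<forall>i. norm (coeff p i) \<le> B * K)"
  using assms
proof (induction d arbitrary: x)
  case 0
  have "norm (coeff p i) \<le> 1 * K" if "degree p \<le> 0" "norm (poly p (x 0)) \<le> K" for p K i
  proof -
    obtain c where "p = [:c:]" using \<open>degree p \<le> 0\<close> by (auto elim: degree_eq_zeroE)
    then show ?thesis using that(2) order_trans[OF norm_ge_zero that(2)] by (cases i) auto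
  qed
  then show ?case by (intro exI[of _ 1]) auto
next
  case (Suc d)
  have "inj (x \<circ> Suc)" using Suc.prems by (rule inj_compose) simp
  from Suc.IH[OF this] obtain B where B: "B \<ge> 0" "\<forall>p K. degree p \<le> d \<longrightarrow>
      (\<forall>m\<le>d. norm (poly p (x (Suc m))) \<le> K) \<longrightarrow> (\<forall>i. norm (coeff p i) \<le> B * K)"
    unfolding o_def by blast
  \<comment> \<open>The sum dominates each of the reciprocal distances from \<open>x 0\<close> at
    once.\<close>
  define e where "e = (\<Sum>m\<le>d. 1 / norm (x (Suc m) - x 0))"
  have e: "e \<ge> 0" by (simp add: e_def sum_nonneg)
  define B' where "B' = (norm (x 0) + 1) * (B * (2 * e)) + 1"
  have "norm (coeff p i) \<le> B' * K"
    if deg: "degree p \<le> Suc d" and val: "\<And>m. m \<le> Suc d \<Longrightarrow> norm (poly p (x m)) \<le> K" for p K i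
  proof -
    define r where "r = synthetic_div p (x 0)"
    have p: "p = [:- x 0, 1:] * r + [:poly p (x 0):]"
      unfolding r_def by (rule synthetic_div_correct'[symmetric])
    have K: "K \<ge> 0" using order_trans[OF norm_ge_zero val[of 0]] by simp
    have "norm (poly r (x (Suc m))) \<le> 2 * e * K" if m: "m \<le> d" for m
    proof -
      have ne: "x (Suc m) - x 0 \<noteq> 0" using Suc.prems by (auto dest: injD)
      have "poly p (x (Suc m)) = (x (Suc m) - x 0) * poly r (x (Suc m)) + poly p (x 0)"
        by (subst p) (simp add: algebra_simps)
      then have "poly r (x (Suc m)) = (poly p (x (Suc m)) - poly p (x 0)) / (x (Suc m) - x 0)"
        using ne by (simp add: field_simps)
      then have "norm (poly r (x (Suc m))) = norm (poly p (x (Suc m)) - poly p (x 0)) * (1 / norm (x (Suc m) - x 0))"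
        by (simp add: norm_divide)
      also have "\<dots> \<le> (2 * K) * e"
      proof (rule mult_mono)
        show "norm (poly p (x (Suc m)) - poly p (x 0)) \<le> 2 * K"
          using norm_triangle_ineq4[of "poly p (x (Suc m))" "poly p (x 0)"] val[of "Suc m"] val[of 0] m by simp
        show "1 / norm (x (Suc m) - x 0) \<le> e"
          unfolding e_def using m by (intro member_le_sum) auto
      qed (use K in auto)
      finally show ?thesis by (simp add: mult_ac)
    qed
    moreover have "degree r \<le> d" using deg by (simp add: r_def degree_synthetic_div)
    ultimately have r: "norm (coeff r j) \<le> B * (2 * e * K)" for j using B(2) by blast
    have "norm (coeff p i) \<le> norm (x 0) * (B * (2 * e * K)) + B * (2 * e * K) + K"
    proof (cases i)
      case 0
      have "coeff p 0 = - x 0 * coeff r 0 + poly p (x 0)"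
        by (subst p) simp
      then have "norm (coeff p 0) \<le> norm (x 0) * norm (coeff r 0) + norm (poly p (x 0))"
        using norm_triangle_ineq[of "- x 0 * coeff r 0" "poly p (x 0)"] by (simp add: norm_mult)
      also have "\<dots> \<le> norm (x 0) * (B * (2 * e * K)) + K"
        using r val by (intro add_mono mult_left_mono) auto
      also have "\<dots> \<le> norm (x 0) * (B * (2 * e * K)) + B * (2 * e * K) + K"
        using B(1) e K by simp
      finally show ?thesis using 0 by simp
    next
      case (Suc j)
      have "coeff p i = - x 0 * coeff r i + coeff r j"
        by (subst p) (simp add: Suc)
      then have "norm (coeff p i) \<le> norm (x 0) * norm (coeff r i) + norm (coeff r j)"
        using norm_triangle_ineq[of "- x 0 * coeff r i" "coeff r j"] by (simp add: norm_mult)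
      also have "\<dots> \<le> norm (x 0) * (B * (2 * e * K)) + B * (2 * e * K)"
        using r by (intro add_mono mult_left_mono) auto
      finally show ?thesis using K by simp
    qed
    then show ?thesis by (simp add: B'_def algebra_simps)
  qed
  moreover have "B' \<ge> 0" using B(1) e by (simp add: B'_def)
  ultimately show ?case by blast
qed

lemma sym_cocycle:
  assumes "\<phi> \<in> parabolic_cocycles (sym_rep d)"
  shows sym_cocycle_degree: "\<gamma> \<in> carrier SL2Z \<Longrightarrow> degree (\<phi> \<gamma>) \<le> d"
    and sym_cocycle_mult: "\<gamma> \<in> carrier SL2Z \<Longrightarrow> \<delta> \<in> carrier SL2Z \<Longrightarrow>
      \<phi> (inv\<^bsub>SL2Z\<^esub> (\<gamma> \<otimes>\<^bsub>SL2Z\<^esub> \<delta>)) = homog_subst d \<delta> (\<phi> (inv\<^bsub>SL2Z\<^esub> \<gamma>)) + \<phi> (inv\<^bsub>SL2Z\<^esub> \<delta>)"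
    and sym_cocycle_Gamma_inf: "t \<in> Gamma_inf \<Longrightarrow> \<phi> (inv\<^bsub>SL2Z\<^esub> t) = 0"
proof -
  show "degree (\<phi> \<gamma>) \<le> d" if "\<gamma> \<in> carrier SL2Z"
    using assms that by (simp add: parabolic_cocycles_def sym_rep_def)
  show "\<phi> (inv\<^bsub>SL2Z\<^esub> (\<gamma> \<otimes>\<^bsub>SL2Z\<^esub> \<delta>)) = homog_subst d \<delta> (\<phi> (inv\<^bsub>SL2Z\<^esub> \<gamma>)) + \<phi> (inv\<^bsub>SL2Z\<^esub> \<delta>)"
    if "\<gamma> \<in> carrier SL2Z" "\<delta> \<in> carrier SL2Z"
    using assms that by (simp add: parabolic_cocycles_def sym_rep_def SL.inv_mult_group)
  show "\<phi> (inv\<^bsub>SL2Z\<^esub> t) = 0" if "t \<in> Gamma_inf"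
    using assms subgroup.m_inv_closed[OF subgroup_Gamma_inf that] by (simp add: parabolic_cocycles_def)
qed

lemma homog_subst_zero [simp]: "homog_subst d \<gamma> 0 = 0"
  by (simp add: homog_subst_def)

text \<open>A parabolic cocycle vanishes on \<open>Gamma_inf\<close>, so the relation loses its
  other summand. The terms of the Eisenstein series depend on the coset only for this
  reason.\<close>

lemma sym_cocycle_coset:
  assumes "\<phi> \<in> parabolic_cocycles (sym_rep d)" "t \<in> Gamma_inf" "\<gamma> \<in> carrier SL2Z"
  shows "\<phi> (inv\<^bsub>SL2Z\<^esub> (t \<otimes>\<^bsub>SL2Z\<^esub> \<gamma>)) = \<phi> (inv\<^bsub>SL2Z\<^esub> \<gamma>)"
  using sym_cocycle_mult[OF assms(1) Gamma_inf_carrier[OF assms(2)] assms(3)]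
    sym_cocycle_Gamma_inf[OF assms(1,2)] by simp

text \<open>
  With \<open>v = s (x, 1)\<close>, the bound below is a bound for the homogeneous form of \<open>\<phi>(\<gamma>\<^sup>-\<^sup>1)\<close> at \<open>v\<close>. In
  every step of the Euclidean algorithm the second coordinate of \<open>\<gamma> v\<close> is preserved, and this keeps
  the coordinates of the vector bounded by \<open>2A\<close>.
\<close>

lemma sym_cocycle_bound:
  assumes \<phi>: "\<phi> \<in> parabolic_cocycles (sym_rep d)"
  obtains C where "C \<ge> 0" "\<And>\<gamma> x s A. \<gamma> \<in> carrier SL2Z \<Longrightarrow> x \<in> upper_half_plane \<Longrightarrow> s > 0 \<Longrightarrow>
      s * norm (aut_factor \<gamma> x) \<le> A \<Longrightarrow> s \<le> 2 * A \<Longrightarrow>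
      s ^ d * norm (poly (\<phi> (inv\<^bsub>SL2Z\<^esub> \<gamma>)) x) \<le> C * of_int \<bar>\<gamma>$2$1\<bar> * (2 * A) ^ d"
proof -
  define q where "q = \<phi> (inv\<^bsub>SL2Z\<^esub> S_mat)"
  define C where "C = (\<Sum>i\<le>d. norm (coeff q i))"
  have C0: "C \<ge> 0" by (simp add: C_def sum_nonneg)
  have degq: "degree q \<le> d" using sym_cocycle_degree[OF \<phi>] by (simp add: q_def)
  \<comment> \<open>The homogeneous form of q at the vector s (u, 1): if both coordinates are at
    most R in modulus, the value is at most R^d times the sum of the coefficients.\<close>
  have q: "s ^ d * norm (poly q u) \<le> C * R ^ d" if s: "s > 0" "s \<le> R" "s * norm u \<le> R" for s R u
  proof -
    have "poly q u = (\<Sum>i\<le>d. coeff q i * u ^ i)"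
      unfolding poly_altdef using degq by (intro sum.mono_neutral_left) (auto simp: coeff_eq_0)
    then have "s ^ d * norm (poly q u) \<le> s ^ d * (\<Sum>i\<le>d. norm (coeff q i * u ^ i))"
      using s norm_sum[of "\<lambda>i. coeff q i * u ^ i" "{..d}"] by (intro mult_left_mono) auto
    also have "\<dots> = (\<Sum>i\<le>d. norm (coeff q i) * (s ^ (d - i) * (s * norm u) ^ i))"
      unfolding sum_distrib_left
    proof (rule sum.cong[OF refl])
      fix i assume "i \<in> {..d}"
      then have "s ^ d = s ^ (d - i) * s ^ i" by (simp flip: power_add)
      then show "s ^ d * norm (coeff q i * u ^ i) = norm (coeff q i) * (s ^ (d - i) * (s * norm u) ^ i)"
        by (simp add: norm_mult norm_power power_mult_distrib)
    qed
    also have "\<dots> \<le> (\<Sum>i\<le>d. norm (coeff q i) * R ^ d)"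
    proof (intro sum_mono mult_left_mono)
      fix i assume i: "i \<in> {..d}"
      have "s ^ (d - i) * (s * norm u) ^ i \<le> R ^ (d - i) * R ^ i"
        using s by (intro mult_mono power_mono) auto
      also have "\<dots> = R ^ d" using i by (simp flip: power_add)
      finally show "s ^ (d - i) * (s * norm u) ^ i \<le> R ^ d" .
    qed simp
    finally show ?thesis by (simp add: C_def sum_distrib_right)
  qed
  have main: "s ^ d * norm (poly (\<phi> (inv\<^bsub>SL2Z\<^esub> \<gamma>)) x) \<le> C * of_int \<bar>\<gamma>$2$1\<bar> * (2 * A) ^ d"
    if "\<gamma> \<in> carrier SL2Z" "x \<in> upper_half_plane" "s > 0" "s * norm (aut_factor \<gamma> x) \<le> A" "s \<le> 2 * A"
    for \<gamma> x s A
    using that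
  proof (induction "nat \<bar>\<gamma>$2$1\<bar>" arbitrary: \<gamma> x s rule: less_induct)
    case less
    note \<gamma> = less.prems(1) and x = less.prems(2) and s = less.prems(3) and sA = less.prems(4,5)
    show ?case
    proof (cases "\<gamma>$2$1 = 0")
      case True
      then have "\<gamma> \<in> Gamma_inf" using \<gamma> by (simp add: Gamma_inf_iff_lower_left)
      then show ?thesis using sym_cocycle_Gamma_inf[OF \<phi>] True by simp
    next
      case False
      obtain \<delta> n where \<delta>: "\<delta> \<in> carrier SL2Z" "\<gamma> = \<delta> \<otimes>\<^bsub>SL2Z\<^esub> (S_mat \<otimes>\<^bsub>SL2Z\<^esub> T_pow n)"
        "2 * \<bar>\<gamma>$2$2 - n * \<gamma>$2$1\<bar> \<le> \<bar>\<gamma>$2$1\<bar>" "2 * \<bar>\<delta>$2$1\<bar> \<le> \<bar>\<gamma>$2$1\<bar>"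
        by (rule SL2Z_euclid_step[OF \<gamma> False])
      define ST where "ST = S_mat \<otimes>\<^bsub>SL2Z\<^esub> T_pow n"
      define u where "u = x + of_int n"
      define c where "c = \<gamma>$2$1"
      have ST: "ST \<in> carrier SL2Z" by (simp add: ST_def)
      have u: "u \<in> upper_half_plane" using x by (simp add: u_def upper_half_plane_def)
      have afST: "aut_factor ST x = u" "moebius_act ST x = - (1 / u)"
        using x by (simp_all add: ST_def u_def aut_factor_mult moebius_mult)
      have x': "- (1 / u) \<in> upper_half_plane"
        using moebius_upper_half_plane[OF ST x] afST by simp
      have af: "aut_factor \<gamma> x = aut_factor \<delta> (- (1 / u)) * u"
        unfolding \<delta>(2) ST_def[symmetric] using aut_factor_mult[OF \<delta>(1) ST x] afST by simp
      \<comment> \<open>The number c u is the automorphy factor minus the remainder of the division,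
        which is at most |c| / 2. After multiplication by s each part contributes at most |c| A, so
        s |u| is at most 2 A.\<close>
      have "of_int c * u = aut_factor \<gamma> x - of_int (\<gamma>$2$2 - n * c)"
        by (simp add: aut_factor_def u_def c_def algebra_simps)
      then have "norm (of_int c * u) \<le> norm (aut_factor \<gamma> x) + norm (of_int (\<gamma>$2$2 - n * c) :: complex)"
        by (metis norm_triangle_ineq4)
      then have 1: "\<bar>real_of_int c\<bar> * norm u \<le> norm (aut_factor \<gamma> x) + \<bar>real_of_int (\<gamma>$2$2 - n * c)\<bar>"
        by (simp only: norm_mult norm_of_int)
      have c1: "\<bar>real_of_int c\<bar> \<ge> 1" using False unfolding c_def by linarith
      have A0: "A \<ge> 0" using s sA(2) by linarith
      have 2: "\<bar>real_of_int (\<gamma>$2$2 - n * c)\<bar> \<le> \<bar>real_of_int c\<bar> / 2"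
      proof -
        have "real_of_int (2 * \<bar>\<gamma>$2$2 - n * c\<bar>) \<le> real_of_int \<bar>c\<bar>"
          using \<delta>(3) unfolding c_def by (simp only: of_int_le_iff)
        then show ?thesis by simp
      qed
      have "s * (\<bar>real_of_int c\<bar> * norm u) \<le> s * (norm (aut_factor \<gamma> x) + \<bar>real_of_int c\<bar> / 2)"
        using 1 2 s by (intro mult_left_mono) auto
      also have "\<dots> = s * norm (aut_factor \<gamma> x) + \<bar>real_of_int c\<bar> * (s / 2)" by (simp add: algebra_simps)
      also have "\<dots> \<le> \<bar>real_of_int c\<bar> * A + \<bar>real_of_int c\<bar> * A"
      proof (rule add_mono)
        have "1 * A \<le> \<bar>real_of_int c\<bar> * A" using c1 A0 by (rule mult_right_mono)
        then show "s * norm (aut_factor \<gamma> x) \<le> \<bar>real_of_int c\<bar> * A" using sA(1) by linarith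
        show "\<bar>real_of_int c\<bar> * (s / 2) \<le> \<bar>real_of_int c\<bar> * A" using sA(2) by (intro mult_left_mono) auto
      qed
      finally have "\<bar>real_of_int c\<bar> * (s * norm u) \<le> \<bar>real_of_int c\<bar> * (2 * A)" by (simp add: algebra_simps)
      then have su: "s * norm u \<le> 2 * A"
        using c1 by (subst (asm) mult_le_cancel_left_pos) auto
      have u0: "norm u > 0" using upper_half_plane_nonzero[OF u] by simp
      have smaller: "nat \<bar>\<delta>$2$1\<bar> < nat \<bar>\<gamma>$2$1\<bar>" using \<delta>(4) False by linarith
      \<comment> \<open>The vector s (x, 1) is moved by S T^n, so s becomes s |u|. The bound A is
        kept, since the automorphy factors of \<delta> and \<gamma> differ exactly by the factor
        u.\<close>
      have IH: "(s * norm u) ^ d * norm (poly (\<phi> (inv\<^bsub>SL2Z\<^esub> \<delta>)) (- (1 / u))) \<le> C * of_int \<bar>\<delta>$2$1\<bar> * (2 * A) ^ d"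
      proof (rule less.hyps[OF smaller \<delta>(1) x'])
        show "0 < s * norm u" using s u0 by simp
        show "s * norm u * norm (aut_factor \<delta> (- (1 / u))) \<le> A"
          using sA(1) unfolding af norm_mult by (simp only: mult_ac)
        show "s * norm u \<le> 2 * A" by (rule su)
      qed
      have psiST: "poly (\<phi> (inv\<^bsub>SL2Z\<^esub> ST)) x = poly q u"
      proof -
        have "\<phi> (inv\<^bsub>SL2Z\<^esub> ST) = homog_subst d (T_pow n) q + \<phi> (inv\<^bsub>SL2Z\<^esub> (T_pow n))"
          unfolding ST_def q_def by (rule sym_cocycle_mult[OF \<phi>]) simp_all
        moreover have "\<phi> (inv\<^bsub>SL2Z\<^esub> (T_pow n)) = 0"
          by (rule sym_cocycle_Gamma_inf[OF \<phi>]) (simp add: Gamma_inf_iff_lower_left, simp add: T_pow_def)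
        ultimately show ?thesis
          using poly_homog_subst[OF degq, of "T_pow n" x] by (simp add: u_def)
      qed
      have "poly (\<phi> (inv\<^bsub>SL2Z\<^esub> \<gamma>)) x = u ^ d * poly (\<phi> (inv\<^bsub>SL2Z\<^esub> \<delta>)) (- (1 / u)) + poly q u"
      proof -
        have "\<phi> (inv\<^bsub>SL2Z\<^esub> \<gamma>) = homog_subst d ST (\<phi> (inv\<^bsub>SL2Z\<^esub> \<delta>)) + \<phi> (inv\<^bsub>SL2Z\<^esub> ST)"
          unfolding \<delta>(2) ST_def[symmetric] by (rule sym_cocycle_mult[OF \<phi> \<delta>(1) ST])
        moreover have "poly (homog_subst d ST (\<phi> (inv\<^bsub>SL2Z\<^esub> \<delta>))) x
            = u ^ d * poly (\<phi> (inv\<^bsub>SL2Z\<^esub> \<delta>)) (- (1 / u))"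
        proof -
          have "poly (homog_subst d ST (\<phi> (inv\<^bsub>SL2Z\<^esub> \<delta>))) x
              = aut_factor ST x ^ d * poly (\<phi> (inv\<^bsub>SL2Z\<^esub> \<delta>)) (moebius_act ST x)"
            by (rule poly_homog_subst) (use sym_cocycle_degree[OF \<phi>] \<delta>(1) aut_factor_nonzero[OF ST x] in auto)
          then show ?thesis by (simp only: afST)
        qed
        ultimately show ?thesis using psiST by simp
      qed
      then have "s ^ d * norm (poly (\<phi> (inv\<^bsub>SL2Z\<^esub> \<gamma>)) x)
          \<le> s ^ d * (norm u ^ d * norm (poly (\<phi> (inv\<^bsub>SL2Z\<^esub> \<delta>)) (- (1 / u))) + norm (poly q u))"
        using s norm_triangle_ineq[of "u ^ d * poly (\<phi> (inv\<^bsub>SL2Z\<^esub> \<delta>)) (- (1 / u))" "poly q u"]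
        by (intro mult_left_mono) (auto simp: norm_mult norm_power)
      also have "\<dots> = (s * norm u) ^ d * norm (poly (\<phi> (inv\<^bsub>SL2Z\<^esub> \<delta>)) (- (1 / u))) + s ^ d * norm (poly q u)"
        by (simp add: algebra_simps power_mult_distrib)
      also have "\<dots> \<le> C * of_int \<bar>\<delta>$2$1\<bar> * (2 * A) ^ d + C * (2 * A) ^ d"
        by (intro add_mono IH q s sA su)
      also have "\<dots> = C * (2 * A) ^ d * of_int (\<bar>\<delta>$2$1\<bar> + 1)" by (simp add: algebra_simps)
      \<comment> \<open>The lower left entry at least halves, so it drops by at least 1 in absolute
        value. Hence the number of steps, each costing one summand, is at most this entry.\<close>
      also have "\<dots> \<le> C * (2 * A) ^ d * of_int \<bar>\<gamma>$2$1\<bar>"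
        using \<delta>(4) False C0 A0 by (intro mult_left_mono) (simp_all only: of_int_le_iff, auto)
      finally show ?thesis by (simp add: mult_ac)
    qed
  qed
  show ?thesis by (rule that[OF C0 main])
qed

text \<open>Take s = 1 and d + 1 points on the imaginary axis, where the automorphy factors are at
  most d + 2 times the height. The polynomial accounts for d powers of the height and the lower left
  entry for one more.\<close>

lemma sym_cocycle_height_bounded:
  assumes \<phi>: "\<phi> \<in> parabolic_cocycles (sym_rep d)"
  shows "height_bounded (d + 1) (\<lambda>\<gamma>. coeff (\<phi> (inv\<^bsub>SL2Z\<^esub> \<gamma>)) i)"
proof -
  define x :: "nat \<Rightarrow> complex" where "x = (\<lambda>m. \<i> * of_nat (Suc m))"
  have "inj x" by (auto simp: x_def inj_on_def)
  then obtain B where B: "B \<ge> 0" "\<And>p K i. degree p \<le> d \<Longrightarrow> (\<And>m. m \<le> d \<Longrightarrow> norm (poly p (x m)) \<le> K) \<Longrightarrow>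
      norm (coeff p i) \<le> B * K"
    using coeff_bound_of_values[of x d] by blast
  obtain C where C: "C \<ge> 0" "\<And>\<gamma> x s A. \<gamma> \<in> carrier SL2Z \<Longrightarrow> x \<in> upper_half_plane \<Longrightarrow> s > 0 \<Longrightarrow>
      s * norm (aut_factor \<gamma> x) \<le> A \<Longrightarrow> s \<le> 2 * A \<Longrightarrow>
      s ^ d * norm (poly (\<phi> (inv\<^bsub>SL2Z\<^esub> \<gamma>)) x) \<le> C * of_int \<bar>\<gamma>$2$1\<bar> * (2 * A) ^ d"
    using sym_cocycle_bound[OF \<phi>] by metis
  define L where "L = (2 * real (d + 2)) ^ d"
  have val: "norm (poly (\<phi> (inv\<^bsub>SL2Z\<^esub> \<gamma>)) (x m)) \<le> C * L * height \<gamma> ^ (d + 1)"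
    if \<gamma>: "\<gamma> \<in> carrier SL2Z" and m: "m \<le> d" for \<gamma> m
  proof -
    define h where "h = height \<gamma>"
    have h: "h \<ge> 1" using height_ge_1[OF \<gamma>] by (simp add: h_def)
    have xH: "x m \<in> upper_half_plane" by (simp add: x_def upper_half_plane_def)
    have nx: "norm (x m) = real (Suc m)" unfolding x_def norm_mult norm_of_nat by simp
    have "norm (aut_factor \<gamma> (x m)) \<le> \<bar>real_of_int (\<gamma>$2$1)\<bar> * real (Suc m) + \<bar>real_of_int (\<gamma>$2$2)\<bar> * 1"
      unfolding aut_factor_def nx[symmetric]
      using norm_triangle_ineq[of "of_int (\<gamma>$2$1) * x m" "of_int (\<gamma>$2$2)"] by (simp add: norm_mult)
    also have "\<dots> \<le> \<bar>real_of_int (\<gamma>$2$1)\<bar> * real (d + 2) + \<bar>real_of_int (\<gamma>$2$2)\<bar> * real (d + 2)"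
      using m by (intro add_mono mult_left_mono) auto
    also have "\<dots> = h * real (d + 2)" by (simp add: h_def height_def algebra_simps)
    finally have af: "norm (aut_factor \<gamma> (x m)) \<le> h * real (d + 2)" .
    have "1 * 1 \<le> h * real (d + 2)" using h by (intro mult_mono) auto
    then have "1 ^ d * norm (poly (\<phi> (inv\<^bsub>SL2Z\<^esub> \<gamma>)) (x m)) \<le> C * of_int \<bar>\<gamma>$2$1\<bar> * (2 * (h * real (d + 2))) ^ d"
      using af by (intro C(2) \<gamma> xH) auto
    also have "\<dots> = (C * L * h ^ d) * of_int \<bar>\<gamma>$2$1\<bar>" by (simp add: L_def power_mult_distrib mult_ac)
    also have "\<dots> \<le> (C * L * h ^ d) * h"
      using C(1) h by (intro mult_left_mono) (auto simp: L_def h_def height_def)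
    finally show ?thesis by (simp add: h_def mult_ac)
  qed
  have "norm (coeff (\<phi> (inv\<^bsub>SL2Z\<^esub> \<gamma>)) i) \<le> (B * (C * L)) * height \<gamma> ^ (d + 1)"
    if \<gamma>: "\<gamma> \<in> carrier SL2Z" for \<gamma>
  proof -
    have "norm (coeff (\<phi> (inv\<^bsub>SL2Z\<^esub> \<gamma>)) i) \<le> B * (C * L * height \<gamma> ^ (d + 1))"
      by (rule B(2)) (use sym_cocycle_degree[OF \<phi>] val \<gamma> in auto)
    then show ?thesis by (simp only: mult.assoc)
  qed
  then show ?thesis unfolding height_bounded_def by blast
qed


section \<open>Dual cocycles\<close>

text \<open>By \<open>moebius_diff\<close> each factor X - \<gamma>y becomes X - y divided by both
  automorphy factors. Of the d factors c X + e that the substitution provides, j are used up and d -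
  j remain.\<close>

lemma homog_subst_linear_power:
  assumes "\<gamma> \<in> carrier SL2Z" "y \<in> upper_half_plane" "j \<le> d"
  shows "Polynomial.smult (aut_factor \<gamma> y ^ j) (homog_subst d \<gamma> ([:- moebius_act \<gamma> y, 1:] ^ j))
    = [:- y, 1:] ^ j * [:of_int (\<gamma>$2$2), of_int (\<gamma>$2$1):] ^ (d - j)"
proof (rule poly_eqI_upper_half_plane)
  fix x assume x: "x \<in> upper_half_plane"
  have "degree ([:- moebius_act \<gamma> y, 1:] ^ j) \<le> d"
    using assms(3) by (simp add: degree_linear_power)
  then have "poly (homog_subst d \<gamma> ([:- moebius_act \<gamma> y, 1:] ^ j)) x
      = aut_factor \<gamma> x ^ d * (moebius_act \<gamma> x - moebius_act \<gamma> y) ^ j"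
    using aut_factor_nonzero[OF assms(1) x] by (simp add: poly_homog_subst poly_power)
  moreover have "aut_factor \<gamma> x ^ d = aut_factor \<gamma> x ^ (d - j) * aut_factor \<gamma> x ^ j"
    using assms(3) by (simp flip: power_add)
  ultimately have "poly (Polynomial.smult (aut_factor \<gamma> y ^ j) (homog_subst d \<gamma> ([:- moebius_act \<gamma> y, 1:] ^ j))) x
      = (aut_factor \<gamma> x * aut_factor \<gamma> y * (moebius_act \<gamma> x - moebius_act \<gamma> y)) ^ j * aut_factor \<gamma> x ^ (d - j)"
    by (simp add: power_mult_distrib mult_ac)
  also have "\<dots> = (x - y) ^ j * aut_factor \<gamma> x ^ (d - j)"
    by (simp only: moebius_diff[OF assms(1) x assms(2)])
  finally show "poly (Polynomial.smult (aut_factor \<gamma> y ^ j) (homog_subst d \<gamma> ([:- moebius_act \<gamma> y, 1:] ^ j))) x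
      = poly ([:- y, 1:] ^ j * [:of_int (\<gamma>$2$2), of_int (\<gamma>$2$1):] ^ (d - j)) x"
    by (simp add: poly_power aut_factor_def algebra_simps)
qed

text \<open>The equivariant isomorphism from the dual of the symmetric power to the symmetric power.\<close>

definition dual_poly :: "nat \<Rightarrow> (complex poly \<Rightarrow> complex) \<Rightarrow> complex poly" where
  "dual_poly d h = (\<Sum>i\<le>d. Polynomial.monom (of_nat (d choose i) * (- 1) ^ (d - i) * h (Polynomial.monom 1 i)) (d - i))"

lemma coeff_dual_poly: "i \<le> d \<Longrightarrow>
    coeff (dual_poly d h) (d - i) = of_nat (d choose i) * (- 1) ^ (d - i) * h (Polynomial.monom 1 i)"
proof -
  assume i: "i \<le> d"
  have "coeff (dual_poly d h) (d - i)
      = (\<Sum>i'\<le>d. if i' = i then of_nat (d choose i') * (- 1) ^ (d - i') * h (Polynomial.monom 1 i') else 0)"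
    unfolding dual_poly_def coeff_sum using i by (intro sum.cong refl) auto
  then show ?thesis using i by simp
qed

lemma degree_dual_poly: "degree (dual_poly d h) \<le> d"
  unfolding dual_poly_def by (rule degree_sum_le) (auto intro: order_trans[OF degree_monom_le])

lemma dual_lin:
  assumes "h \<in> rep_lin_maps (sym_rep d) triv_rep"
  shows dual_lin_add: "degree p \<le> d \<Longrightarrow> degree q \<le> d \<Longrightarrow> h (p + q) = h p + h q"
    and dual_lin_smult: "degree p \<le> d \<Longrightarrow> h (Polynomial.smult c p) = c * h p"
    and dual_lin_coeffs: "degree p \<le> d \<Longrightarrow> h p = (\<Sum>i\<le>d. coeff p i * h (Polynomial.monom 1 i))"
proof -
  show add: "h (p + q) = h p + h q" if "degree p \<le> d" "degree q \<le> d" for p q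
    using assms that by (simp add: rep_lin_maps_def sym_rep_def)
  show smult: "h (Polynomial.smult c p) = c * h p" if "degree p \<le> d" for c p
    using assms that by (simp add: rep_lin_maps_def sym_rep_def triv_rep_def)
  show "h p = (\<Sum>i\<le>d. coeff p i * h (Polynomial.monom 1 i))" if "degree p \<le> d"
  proof -
    have h0: "h 0 = 0" using smult[of 0 0] by simp
    have "h (\<Sum>i\<in>I. Polynomial.monom (coeff p i) i) = (\<Sum>i\<in>I. coeff p i * h (Polynomial.monom 1 i))"
      if "I \<subseteq> {..d}" "finite I" for I
      using that(2,1)
    proof (induction I rule: finite_induct)
      case (insert i I)
      have "h (Polynomial.monom (coeff p i) i + (\<Sum>i\<in>I. Polynomial.monom (coeff p i) i))
          = h (Polynomial.monom (coeff p i) i) + h (\<Sum>i\<in>I. Polynomial.monom (coeff p i) i)"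
        using insert by (intro add degree_sum_le) (auto intro!: order_trans[OF degree_monom_le])
      also have "h (Polynomial.monom (coeff p i) i) = coeff p i * h (Polynomial.monom 1 i)"
        using smult[of "Polynomial.monom 1 i" "coeff p i"] insert by (simp add: smult_monom degree_monom_eq)
      finally show ?case using insert by simp
    qed (simp add: h0)
    from this[of "{..d}"] show ?thesis using that by (simp add: poly_as_sum_of_monoms')
  qed
qed

text \<open>The binomial coefficients and signs in \<open>dual_poly\<close> are those of (X - y)^d.
  A functional is thus encoded by its values on these powers, which the group permutes up to
  scalars.\<close>

lemma poly_dual_poly:
  assumes "h \<in> rep_lin_maps (sym_rep d) triv_rep"
  shows "poly (dual_poly d h) y = h ([:- y, 1:] ^ d)"
proof -
  have "coeff ([:- y, 1:] ^ d) i = of_nat (d choose i) * (- y) ^ (d - i)" if "i \<le> d" for i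
    using coeff_linear_poly_power[OF that, of "- y" 1] by simp
  then have "h ([:- y, 1:] ^ d) = (\<Sum>i\<le>d. (of_nat (d choose i) * (- y) ^ (d - i)) * h (Polynomial.monom 1 i))"
    by (subst dual_lin_coeffs[OF assms]) (simp_all add: degree_linear_power)
  also have "\<dots> = poly (dual_poly d h) y"
    unfolding dual_poly_def poly_sum
    by (intro sum.cong refl) (simp add: poly_monom power_minus[of y])
  finally show ?thesis by simp
qed

lemma dual_cocycle:
  assumes "\<phi> \<in> parabolic_cocycles (dual_rep (sym_rep d))"
  shows dual_cocycle_lin: "\<gamma> \<in> carrier SL2Z \<Longrightarrow> \<phi> \<gamma> \<in> rep_lin_maps (sym_rep d) triv_rep"
    and dual_cocycle_mult: "\<gamma> \<in> carrier SL2Z \<Longrightarrow> \<delta> \<in> carrier SL2Z \<Longrightarrow> degree p \<le> d \<Longrightarrow>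
      \<phi> (\<gamma> \<otimes>\<^bsub>SL2Z\<^esub> \<delta>) p = \<phi> \<delta> (homog_subst d \<gamma> p) + \<phi> \<gamma> p"
    and dual_cocycle_Gamma_inf: "t \<in> Gamma_inf \<Longrightarrow> \<phi> t = 0"
    and dual_cocycle_outside: "\<gamma> \<notin> carrier SL2Z \<Longrightarrow> \<phi> \<gamma> = 0"
proof -
  show "\<phi> \<gamma> \<in> rep_lin_maps (sym_rep d) triv_rep" if "\<gamma> \<in> carrier SL2Z"
    using assms that by (simp add: parabolic_cocycles_def dual_rep_def hom_rep_def)
  show "\<phi> (\<gamma> \<otimes>\<^bsub>SL2Z\<^esub> \<delta>) p = \<phi> \<delta> (homog_subst d \<gamma> p) + \<phi> \<gamma> p"
    if "\<gamma> \<in> carrier SL2Z" "\<delta> \<in> carrier SL2Z" "degree p \<le> d"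
    using assms that by (simp add: parabolic_cocycles_def dual_rep_def hom_rep_def sym_rep_def triv_rep_def)
  show "\<phi> t = 0" if "t \<in> Gamma_inf"
    using assms that by (simp add: parabolic_cocycles_def)
  show "\<phi> \<gamma> = 0" if "\<gamma> \<notin> carrier SL2Z"
    using assms that by (simp add: parabolic_cocycles_def)
qed

text \<open>Equivariance is checked on values at y: with j = d,
  \<open>homog_subst_linear_power\<close> turns (X - y)^d into a multiple of (X - y')^d for the
  inverse image y' of y, and the multiple is the automorphy factor of the symmetric power.\<close>

lemma dual_poly_cocycle:
  assumes \<phi>: "\<phi> \<in> parabolic_cocycles (dual_rep (sym_rep d))"
  shows "(\<lambda>\<gamma>. dual_poly d (\<phi> \<gamma>)) \<in> parabolic_cocycles (sym_rep d)"
proof -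
  have zero: "dual_poly d 0 = 0" by (simp add: dual_poly_def)
  have mult: "dual_poly d (\<phi> (\<gamma> \<otimes>\<^bsub>SL2Z\<^esub> \<delta>)) = homog_subst d (inv\<^bsub>SL2Z\<^esub> \<gamma>) (dual_poly d (\<phi> \<delta>)) + dual_poly d (\<phi> \<gamma>)"
    if \<gamma>: "\<gamma> \<in> carrier SL2Z" and \<delta>: "\<delta> \<in> carrier SL2Z" for \<gamma> \<delta>
  proof (rule poly_eqI_upper_half_plane)
    fix y assume y: "y \<in> upper_half_plane"
    define y' where "y' = moebius_act (inv\<^bsub>SL2Z\<^esub> \<gamma>) y"
    have y': "y' \<in> upper_half_plane" "moebius_act \<gamma> y' = y"
      using \<gamma> y by (simp_all add: y'_def moebius_upper_half_plane moebius_inv_cancel)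
    have afi: "aut_factor (inv\<^bsub>SL2Z\<^esub> \<gamma>) y * aut_factor \<gamma> y' = 1"
      using aut_factor_inv[OF \<gamma> y] by (simp add: y'_def)
    note lin = dual_cocycle_lin[OF \<phi>]
    have deg: "degree ([:- z, 1:] ^ d) \<le> d" for z :: complex by (simp add: degree_linear_power)
    have hs: "Polynomial.smult (aut_factor \<gamma> y' ^ d) (homog_subst d \<gamma> ([:- y, 1:] ^ d)) = [:- y', 1:] ^ d"
      using homog_subst_linear_power[OF \<gamma> y'(1), of d d] by (simp add: y'(2))
    have "poly (dual_poly d (\<phi> \<delta>)) y' = aut_factor \<gamma> y' ^ d * \<phi> \<delta> (homog_subst d \<gamma> ([:- y, 1:] ^ d))"
      unfolding poly_dual_poly[OF lin[OF \<delta>]] hs[symmetric]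
      by (rule dual_lin_smult[OF lin[OF \<delta>] degree_homog_subst])
    then have "aut_factor (inv\<^bsub>SL2Z\<^esub> \<gamma>) y ^ d * poly (dual_poly d (\<phi> \<delta>)) y'
        = (aut_factor (inv\<^bsub>SL2Z\<^esub> \<gamma>) y * aut_factor \<gamma> y') ^ d * \<phi> \<delta> (homog_subst d \<gamma> ([:- y, 1:] ^ d))"
      by (simp only: power_mult_distrib mult.assoc)
    then have "\<phi> \<delta> (homog_subst d \<gamma> ([:- y, 1:] ^ d)) = aut_factor (inv\<^bsub>SL2Z\<^esub> \<gamma>) y ^ d * poly (dual_poly d (\<phi> \<delta>)) y'"
      by (simp only: afi power_one mult_1)
    also have "\<dots> = poly (homog_subst d (inv\<^bsub>SL2Z\<^esub> \<gamma>) (dual_poly d (\<phi> \<delta>))) y"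
      unfolding y'_def
      by (rule poly_homog_subst[OF degree_dual_poly, symmetric]) (use aut_factor_nonzero \<gamma> y in auto)
    finally show "poly (dual_poly d (\<phi> (\<gamma> \<otimes>\<^bsub>SL2Z\<^esub> \<delta>))) y
        = poly (homog_subst d (inv\<^bsub>SL2Z\<^esub> \<gamma>) (dual_poly d (\<phi> \<delta>)) + dual_poly d (\<phi> \<gamma>)) y"
      unfolding poly_add poly_dual_poly[OF lin[OF SL.m_closed[OF \<gamma> \<delta>]]] poly_dual_poly[OF lin[OF \<gamma>]]
      using dual_cocycle_mult[OF \<phi> \<gamma> \<delta> deg] by simp
  qed
  show ?thesis
    unfolding parabolic_cocycles_def
    using mult zero degree_dual_poly dual_cocycle_Gamma_inf[OF \<phi>] dual_cocycle_outside[OF \<phi>]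
    by (simp add: sym_rep_def)
qed

text \<open>The bound for the symmetric power is transported through \<open>dual_poly\<close>. The
  binomial coefficients and signs are nonzero and can be divided out.\<close>

lemma dual_cocycle_height_bounded:
  assumes \<phi>: "\<phi> \<in> parabolic_cocycles (dual_rep (sym_rep d))" and "i \<le> d"
  shows "height_bounded (d + 1) (\<lambda>\<gamma>. \<phi> (inv\<^bsub>SL2Z\<^esub> \<gamma>) (Polynomial.monom 1 i))"
proof -
  define b :: complex where "b = of_nat (d choose i) * (- 1) ^ (d - i)"
  have b: "b \<noteq> 0" using assms(2) by (simp add: b_def)
  have "height_bounded (0 + (d + 1)) (\<lambda>\<gamma>. (1 / b) * coeff (dual_poly d (\<phi> (inv\<^bsub>SL2Z\<^esub> \<gamma>))) (d - i))"
    by (intro height_bounded_mult height_bounded_const sym_cocycle_height_bounded[OF dual_poly_cocycle[OF \<phi>]])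
  then show ?thesis
    using b by (simp add: coeff_dual_poly[OF assms(2)] b_def)
qed

section \<open>Second order Eisenstein series\<close>

lemma
  fixes f :: "'i \<Rightarrow> 'a \<Rightarrow> complex"
  assumes "\<And>i. i \<in> I \<Longrightarrow> f i summable_on A"
  shows summable_on_finite_sum: "(\<lambda>x. \<Sum>i\<in>I. f i x) summable_on A"
    and infsum_finite_sum: "infsum (\<lambda>x. \<Sum>i\<in>I. f i x) A = (\<Sum>i\<in>I. infsum (f i) A)"
proof -
  have "(\<lambda>x. \<Sum>i\<in>I. f i x) summable_on A \<and> infsum (\<lambda>x. \<Sum>i\<in>I. f i x) A = (\<Sum>i\<in>I. infsum (f i) A)"
    using assms by (induction I rule: infinite_finite_induct) (auto simp: summable_on_add infsum_add)
  then show "(\<lambda>x. \<Sum>i\<in>I. f i x) summable_on A" "infsum (\<lambda>x. \<Sum>i\<in>I. f i x) A = (\<Sum>i\<in>I. infsum (f i) A)"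
    by auto
qed

section \<open>Sums over cosets of polynomials of bounded degree\<close>

definition coset_summable :: "nat \<Rightarrow> (int^2^2 \<Rightarrow> complex poly) \<Rightarrow> bool" where
  "coset_summable d F \<longleftrightarrow> (\<forall>i\<le>d. (\<lambda>C. coeff (F (coset_rep C)) i) summable_on cosets)"

definition coset_sum :: "nat \<Rightarrow> (int^2^2 \<Rightarrow> complex poly) \<Rightarrow> complex poly" where
  "coset_sum d F = (\<Sum>i\<le>d. Polynomial.monom (\<Sum>\<^sub>\<infinity>C\<in>cosets. coeff (F (coset_rep C)) i) i)"

lemma coeff_coset_sum:
  "coeff (coset_sum d F) i = (if i \<le> d then \<Sum>\<^sub>\<infinity>C\<in>cosets. coeff (F (coset_rep C)) i else 0)"
  by (simp add: coset_sum_def coeff_sum if_distrib sum.delta cong: if_cong)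

lemma degree_coset_sum: "degree (coset_sum d F) \<le> d"
  by (rule degree_le) (simp add: coeff_coset_sum)

text \<open>A linear functional on polynomials of degree at most d is a fixed finite combination of
  coefficients, so it commutes with the coefficientwise sum. Evaluation, substitution by \<gamma>
  and dual vectors are instances.\<close>

lemma
  assumes "coset_summable d F"
  shows coset_summable_functional: "(\<lambda>C. \<Sum>i\<le>d. coeff (F (coset_rep C)) i * a i) summable_on cosets"
    and coset_sum_functional: "(\<Sum>\<^sub>\<infinity>C\<in>cosets. \<Sum>i\<le>d. coeff (F (coset_rep C)) i * a i)
        = (\<Sum>i\<le>d. coeff (coset_sum d F) i * a i)"
proof -
  have s: "(\<lambda>C. coeff (F (coset_rep C)) i * a i) summable_on cosets" if "i \<le> d" for i
    using assms that by (intro summable_on_cmult_left) (simp add: coset_summable_def)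
  show "(\<lambda>C. \<Sum>i\<le>d. coeff (F (coset_rep C)) i * a i) summable_on cosets"
    using s by (intro summable_on_finite_sum) auto
  show "(\<Sum>\<^sub>\<infinity>C\<in>cosets. \<Sum>i\<le>d. coeff (F (coset_rep C)) i * a i) = (\<Sum>i\<le>d. coeff (coset_sum d F) i * a i)"
    using s by (subst infsum_finite_sum) (auto simp: coeff_coset_sum infsum_cmult_left')
qed

lemma coset_sum_cong:
  assumes "\<And>\<gamma>. \<gamma> \<in> carrier SL2Z \<Longrightarrow> F \<gamma> = G \<gamma>"
  shows "coset_sum d F = coset_sum d G"
  unfolding coset_sum_def using assms coset_rep(1)
  by (intro sum.cong refl arg_cong[where f = "\<lambda>z. Polynomial.monom z _"] infsum_cong) auto

lemma coeff_homog_subst: "coeff (homog_subst d \<gamma> p) k = (\<Sum>i\<le>d. coeff p i *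
    coeff ([:of_int (\<gamma>$1$2), of_int (\<gamma>$1$1):] ^ i * [:of_int (\<gamma>$2$2), of_int (\<gamma>$2$1):] ^ (d - i)) k)"
  by (simp add: homog_subst_def coeff_sum)

lemma
  assumes "coset_summable d F"
  shows coset_summable_homog_subst: "coset_summable d (\<lambda>\<delta>. homog_subst d \<gamma> (F \<delta>))"
    and coset_sum_homog_subst: "coset_sum d (\<lambda>\<delta>. homog_subst d \<gamma> (F \<delta>)) = homog_subst d \<gamma> (coset_sum d F)"
proof -
  show "coset_summable d (\<lambda>\<delta>. homog_subst d \<gamma> (F \<delta>))"
    unfolding coset_summable_def coeff_homog_subst
    by (intro allI impI) (rule coset_summable_functional[OF assms])
  show "coset_sum d (\<lambda>\<delta>. homog_subst d \<gamma> (F \<delta>)) = homog_subst d \<gamma> (coset_sum d F)"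
  proof (rule poly_eqI)
    fix k
    show "coeff (coset_sum d (\<lambda>\<delta>. homog_subst d \<gamma> (F \<delta>))) k = coeff (homog_subst d \<gamma> (coset_sum d F)) k"
    proof (cases "k \<le> d")
      case True
      then show ?thesis
        by (simp only: coeff_coset_sum[of d "\<lambda>\<delta>. homog_subst d \<gamma> (F \<delta>)"] coeff_homog_subst
            coset_sum_functional[OF assms] if_True)
    next
      case False
      then have "degree (homog_subst d \<gamma> (coset_sum d F)) < k"
        using degree_homog_subst[of d \<gamma> "coset_sum d F"] by linarith
      with False show ?thesis by (simp add: coeff_coset_sum coeff_eq_0)
    qed
  qed
qed

lemma
  assumes "coset_summable d F"
  shows coset_summable_smult: "coset_summable d (\<lambda>\<delta>. Polynomial.smult c (F \<delta>))"
    and coset_sum_smult: "coset_sum d (\<lambda>\<delta>. Polynomial.smult c (F \<delta>)) = Polynomial.smult c (coset_sum d F)"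
  using assms
  by (auto simp: coset_summable_def summable_on_cmult_right poly_eq_iff coeff_coset_sum infsum_cmult_right')

lemma coset_sum_add:
  assumes "coset_summable d F" "coset_summable d G"
  shows "coset_sum d (\<lambda>\<delta>. F \<delta> + G \<delta>) = coset_sum d F + coset_sum d G"
  using assms by (auto simp: coset_summable_def poly_eq_iff coeff_coset_sum infsum_add)

lemma
  assumes "(\<lambda>C. b (coset_rep C)) summable_on cosets" "degree p \<le> d"
  shows coset_summable_const: "coset_summable d (\<lambda>\<delta>. Polynomial.smult (b \<delta>) p)"
    and coset_sum_const: "coset_sum d (\<lambda>\<delta>. Polynomial.smult (b \<delta>) p)
        = Polynomial.smult (\<Sum>\<^sub>\<infinity>C\<in>cosets. b (coset_rep C)) p"
  using assms
  by (auto simp: coset_summable_def summable_on_cmult_left poly_eq_iff coeff_coset_sum infsum_cmult_left' coeff_eq_0)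

lemma coset_sum_translate:
  assumes "\<gamma> \<in> carrier SL2Z"
    and "\<And>t \<delta>. t \<in> Gamma_inf \<Longrightarrow> \<delta> \<in> carrier SL2Z \<Longrightarrow> F (t \<otimes>\<^bsub>SL2Z\<^esub> \<delta>) = F \<delta>"
  shows "coset_sum d (\<lambda>\<delta>. F (\<delta> \<otimes>\<^bsub>SL2Z\<^esub> \<gamma>)) = coset_sum d F"
  using infsum_cosets_translate[OF assms(1), of "\<lambda>\<delta>. coeff (F \<delta>) _"] assms(2)
  by (simp add: poly_eq_iff coeff_coset_sum)

text \<open>The coefficients of the vector-valued series, and the dual series, are finite
  combinations of scalar coset series whose coefficients are holomorphic in \<tau> and of polynomial
  growth. Convergence, holomorphy and growth follow here for all of them.\<close>

lemma
  fixes a :: "'i \<Rightarrow> int^2^2 \<Rightarrow> complex"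
  assumes a: "\<And>i. i \<in> I \<Longrightarrow> height_bounded M (a i)" and M: "M + 4 \<le> m"
    and b: "\<And>i. i \<in> I \<Longrightarrow> b i holomorphic_on upper_half_plane" "\<And>i. i \<in> I \<Longrightarrow> poly_growth (b i)"
    and f: "\<And>\<tau> \<gamma>. \<tau> \<in> upper_half_plane \<Longrightarrow> \<gamma> \<in> carrier SL2Z \<Longrightarrow>
      f \<tau> \<gamma> = (\<Sum>i\<in>I. b i \<tau> * (a i \<gamma> * aut_factor \<gamma> \<tau> powi (- int m)))"
  shows coset_combination_summable: "\<tau> \<in> upper_half_plane \<Longrightarrow> (\<lambda>C. f \<tau> (coset_rep C)) summable_on cosets"
    and coset_combination_holomorphic: "(\<lambda>\<tau>. \<Sum>\<^sub>\<infinity>C\<in>cosets. f \<tau> (coset_rep C)) holomorphic_on upper_half_plane"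
    and coset_combination_growth: "poly_growth (\<lambda>\<tau>. \<Sum>\<^sub>\<infinity>C\<in>cosets. f \<tau> (coset_rep C))"
proof -
  have s: "(\<lambda>C. b i \<tau> * (a i (coset_rep C) * aut_factor (coset_rep C) \<tau> powi (- int m))) summable_on cosets"
    if "i \<in> I" "\<tau> \<in> upper_half_plane" for i \<tau>
    by (rule summable_on_cmult_right[OF Infinite_Sum.abs_summable_summable])
       (rule coset_series_summable[OF a[OF that(1)] M that(2)])
  have eq: "(\<lambda>C. f \<tau> (coset_rep C)) summable_on cosets \<longleftrightarrow>
      (\<lambda>C. \<Sum>i\<in>I. b i \<tau> * (a i (coset_rep C) * aut_factor (coset_rep C) \<tau> powi (- int m))) summable_on cosets"
    if "\<tau> \<in> upper_half_plane" for \<tau>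
    by (rule summable_on_cong) (simp add: f that coset_rep(1))
  show "(\<lambda>C. f \<tau> (coset_rep C)) summable_on cosets" if "\<tau> \<in> upper_half_plane" for \<tau>
    unfolding eq[OF that] by (rule summable_on_finite_sum) (rule s[OF _ that])
  have sum: "(\<Sum>\<^sub>\<infinity>C\<in>cosets. f \<tau> (coset_rep C)) = (\<Sum>i\<in>I. b i \<tau> * coset_series m (a i) \<tau>)"
    if "\<tau> \<in> upper_half_plane" for \<tau>
  proof -
    have "(\<Sum>\<^sub>\<infinity>C\<in>cosets. f \<tau> (coset_rep C))
        = (\<Sum>\<^sub>\<infinity>C\<in>cosets. \<Sum>i\<in>I. b i \<tau> * (a i (coset_rep C) * aut_factor (coset_rep C) \<tau> powi (- int m)))"
      by (rule infsum_cong) (simp add: f that coset_rep(1))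
    also have "\<dots> = (\<Sum>i\<in>I. b i \<tau> * coset_series m (a i) \<tau>)"
      by (subst infsum_finite_sum) (use s that in \<open>auto simp: infsum_cmult_right' coset_series_def\<close>)
    finally show ?thesis .
  qed
  have "(\<lambda>\<tau>. \<Sum>i\<in>I. b i \<tau> * coset_series m (a i) \<tau>) holomorphic_on upper_half_plane"
    using coset_series_holomorphic[OF a M] b by (intro holomorphic_on_sum holomorphic_on_mult)
  then show "(\<lambda>\<tau>. \<Sum>\<^sub>\<infinity>C\<in>cosets. f \<tau> (coset_rep C)) holomorphic_on upper_half_plane"
    by (rule holomorphic_transform) (simp add: sum)
  have "poly_growth (\<lambda>\<tau>. \<Sum>i\<in>I. b i \<tau> * coset_series m (a i) \<tau>)"
    using poly_growth_coset_series[OF a M] b by (intro poly_growth_sum poly_growth_mult)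
  then show "poly_growth (\<lambda>\<tau>. \<Sum>\<^sub>\<infinity>C\<in>cosets. f \<tau> (coset_rep C))"
    by (simp add: poly_growth_def sum)
qed

section \<open>The trivial type and the symmetric powers\<close>

interpretation triv: arith_rep triv_rep
  by unfold_locales (rule arithmetic_type_triv)

interpretation sym: arith_rep "sym_rep d" for d
  by unfold_locales (rule arithmetic_type_sym)

interpretation sym_triv: arith_rep_pair "sym_rep d" triv_rep for d ..

interpretation triv_sym: arith_rep_pair triv_rep "sym_rep d" for d ..

lemma sym_rep_simps [simp]:
  "rep_space (sym_rep d) = {p. degree p \<le> d}" "rep_scale (sym_rep d) = Polynomial.smult"
  "\<gamma> \<in> carrier SL2Z \<Longrightarrow> rep_act (sym_rep d) (inv\<^bsub>SL2Z\<^esub> \<gamma>) = homog_subst d \<gamma>"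
  by (simp_all add: sym_rep_def)

lemma triv_rep_simps [simp]:
  "rep_space triv_rep = UNIV" "rep_scale triv_rep = (*)" "rep_act triv_rep \<gamma> z = z"
  by (simp_all add: triv_rep_def)

lemma rep_norm_triv: "rep_norm triv_rep N \<Longrightarrow> N z = norm z * N 1"
  using triv.rep_norm_scale[of N 1 z] by simp

lemma
  assumes "\<And>\<tau>. \<tau> \<notin> upper_half_plane \<Longrightarrow> f \<tau> = 0" "f holomorphic_on upper_half_plane"
  shows triv_functionI: "f \<in> vv_functions triv_rep"
    and triv_holomorphicI: "vv_holomorphic triv_rep f"
proof -
  show "f \<in> vv_functions triv_rep" using assms by (simp add: vv_functions_def)
  have "(\<lambda>\<tau>. l (f \<tau>)) holomorphic_on upper_half_plane" if "l \<in> rep_lin_maps triv_rep triv_rep" for l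
  proof -
    have "l (f \<tau>) = f \<tau> * l 1" for \<tau>
      using lin_maps_scale[OF that, of 1 "f \<tau>"] by simp
    then show ?thesis using assms(2) by (simp add: holomorphic_on_mult)
  qed
  then show "vv_holomorphic triv_rep f" by (simp add: vv_holomorphic_def triv.dual_rep_space)
qed

lemma triv_moderate_growthI:
  assumes "\<And>\<tau>. \<tau> \<notin> upper_half_plane \<Longrightarrow> f \<tau> = 0" "poly_growth f"
  shows "moderate_growth k triv_rep f"
proof -
  obtain K n where K: "\<And>\<tau> m. \<tau> \<in> upper_half_plane \<Longrightarrow> n \<le> m \<Longrightarrow> norm (f \<tau>) \<le> K * growth \<tau> ^ m"
    by (rule poly_growthE[OF assms(2)]) (rule that)
  show ?thesis
  proof (rule triv.moderate_growthI[where n = n])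
    show "f \<in> vv_functions triv_rep" using assms(1) by (simp add: vv_functions_def)
    fix N assume N: "rep_norm triv_rep N"
    then have N1: "N 1 \<ge> 0" by (simp add: rep_norm_def)
    have "N (f \<tau>) \<le> N 1 * K * growth \<tau> ^ n" if "\<tau> \<in> upper_half_plane" for \<tau>
      using mult_left_mono[OF K[OF that order_refl] N1] rep_norm_triv[OF N, of "f \<tau>"] by (simp add: mult_ac)
    then show "\<exists>K. \<forall>\<tau>\<in>upper_half_plane. N (f \<tau>) \<le> K * growth \<tau> ^ n" by blast
  qed
qed

text \<open>Moderate growth and boundedness at the cusp define the same space. A form in the latter
  sense is itself times the constant 1, and multiplication by a form preserves moderate growth.
  Conversely, a polynomial bound in one strip rules out a pole in q.\<close>

lemma vv_modular_forms_triv: "vv_modular_forms k triv_rep = modular_forms k"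
proof (intro equalityI subsetI)
  fix f assume f: "f \<in> modular_forms k"
  have one: "(indicator upper_half_plane :: complex \<Rightarrow> complex) \<in> vv_functions triv_rep"
    by (simp add: vv_functions_def)
  have "poly_growth (indicator upper_half_plane)"
    using poly_growth_const[of 1] by (simp add: poly_growth_def)
  then have "moderate_growth 0 triv_rep (indicator upper_half_plane)"
    by (intro triv_moderate_growthI) auto
  from triv.moderate_growth_mult[OF one this f]
  have "moderate_growth k triv_rep (\<lambda>\<tau>. f \<tau> * indicator upper_half_plane \<tau>)" by simp
  moreover have "(\<lambda>\<tau>. f \<tau> * indicator upper_half_plane \<tau>) = f"
    using modular_form_outside[OF f] by (auto simp: fun_eq_iff indicator_def)
  ultimately have "moderate_growth k triv_rep f" by simp
  moreover have "vv_slash k triv_rep f \<gamma> \<tau> = f \<tau>" if "\<gamma> \<in> carrier SL2Z" "\<tau> \<in> upper_half_plane" for \<gamma> \<tau>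
    using f that by (simp add: vv_slash_def modular_forms_def)
  ultimately show "f \<in> vv_modular_forms k triv_rep"
    using triv_functionI[of f] triv_holomorphicI[of f] modular_form_outside[OF f] modular_form_holomorphic[OF f]
    by (simp add: vv_modular_forms_def)
next
  fix f assume f: "f \<in> vv_modular_forms k triv_rep"
  then have mg: "moderate_growth k triv_rep f" by (simp add: vv_modular_forms_def)
  have "rep_norm triv_rep norm" by (auto simp: rep_norm_def norm_triangle_ineq norm_mult)
  from triv.moderate_growthD[OF mg this] obtain K Y n where
    bound: "\<And>\<tau>. Im \<tau> \<ge> Y \<Longrightarrow> \<bar>Re \<tau>\<bar> \<le> 1 \<Longrightarrow> norm (f \<tau>) \<le> K * Im \<tau> ^ n" by metis
  have id: "(\<lambda>z. z) \<in> rep_lin_maps triv_rep triv_rep" by (simp add: rep_lin_maps_def)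
  show "f \<in> modular_forms k"
  proof (rule modular_formI[OF _ _ _ bound])
    show "f \<tau> = 0" if "\<tau> \<notin> upper_half_plane" for \<tau>
      using f that by (simp add: vv_modular_forms_def vv_functions_def)
    have "vv_holomorphic triv_rep f" using f by (simp add: vv_modular_forms_def)
    then have "\<forall>l\<in>rep_lin_maps triv_rep triv_rep. (\<lambda>\<tau>. l (f \<tau>)) holomorphic_on upper_half_plane"
      by (simp add: vv_holomorphic_def triv.dual_rep_space)
    from bspec[OF this id] show "f holomorphic_on upper_half_plane" by simp
    show "invariant k f"
      unfolding invariant_def
    proof (intro ballI)
      fix \<gamma> \<tau> assume \<gamma>: "\<gamma> \<in> carrier SL2Z" "\<tau> \<in> upper_half_plane"
      then have "aut_factor \<gamma> \<tau> powi (- k) * f (moebius_act \<gamma> \<tau>) = f \<tau>"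
        using f by (simp add: vv_modular_forms_def vv_slash_def)
      then show "f (moebius_act \<gamma> \<tau>) = aut_factor \<gamma> \<tau> powi k * f \<tau>"
        using powi_cancel[OF aut_factor_nonzero[OF \<gamma>]] by blast
    qed
  qed
qed

text \<open>The triangle inequality bounds an arbitrary norm by a weighted sum of moduli of
  coefficients. It is therefore enough to control coefficients.\<close>

lemma
  assumes out: "\<And>\<tau>. \<tau> \<notin> upper_half_plane \<Longrightarrow> f \<tau> = 0"
    and deg: "\<And>\<tau>. \<tau> \<in> upper_half_plane \<Longrightarrow> degree (f \<tau>) \<le> d"
  shows sym_functionI: "f \<in> vv_functions (sym_rep d)"
    and sym_holomorphicI: "(\<And>i. i \<le> d \<Longrightarrow> (\<lambda>\<tau>. coeff (f \<tau>) i) holomorphic_on upper_half_plane)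
      \<Longrightarrow> vv_holomorphic (sym_rep d) f"
    and sym_moderate_growthI: "(\<And>i. i \<le> d \<Longrightarrow> poly_growth (\<lambda>\<tau>. coeff (f \<tau>) i))
      \<Longrightarrow> moderate_growth k (sym_rep d) f"
proof -
  show fn: "f \<in> vv_functions (sym_rep d)" using assms by (simp add: vv_functions_def)
  show "vv_holomorphic (sym_rep d) f"
    if hol: "\<And>i. i \<le> d \<Longrightarrow> (\<lambda>\<tau>. coeff (f \<tau>) i) holomorphic_on upper_half_plane"
    unfolding vv_holomorphic_def sym.dual_rep_space
  proof
    fix l assume l: "l \<in> rep_lin_maps (sym_rep d) triv_rep"
    have "(\<lambda>\<tau>. \<Sum>i\<le>d. coeff (f \<tau>) i * l (Polynomial.monom 1 i)) holomorphic_on upper_half_plane"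
      using hol by (intro holomorphic_intros) auto
    then show "(\<lambda>\<tau>. l (f \<tau>)) holomorphic_on upper_half_plane"
      by (rule holomorphic_transform) (simp add: dual_lin_coeffs[OF l deg])
  qed
  show "moderate_growth k (sym_rep d) f"
    if gr: "\<And>i. i \<le> d \<Longrightarrow> poly_growth (\<lambda>\<tau>. coeff (f \<tau>) i)"
  proof -
    have "\<forall>i\<in>{..d}. \<exists>K n. \<forall>\<tau> m. \<tau> \<in> upper_half_plane \<longrightarrow> n \<le> m \<longrightarrow> norm (coeff (f \<tau>) i) \<le> K * growth \<tau> ^ m"
      using poly_growthE[OF gr] by (metis atMost_iff)
    then obtain K n where K: "\<And>i \<tau> m. i \<le> d \<Longrightarrow> \<tau> \<in> upper_half_plane \<Longrightarrow> n i \<le> m \<Longrightarrow>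
        norm (coeff (f \<tau>) i) \<le> K i * growth \<tau> ^ m"
      by (metis atMost_iff)
    define m where "m = (\<Sum>i\<le>d. n i)"
    have m: "n i \<le> m" if "i \<le> d" for i
      unfolding m_def by (rule member_le_sum) (use that in auto)
    show ?thesis
    proof (rule sym.moderate_growthI[OF fn, where n = m])
      fix N assume N: "rep_norm (sym_rep d) N"
      have N0: "N (Polynomial.monom 1 i) \<ge> 0" if "i \<le> d" for i
        using N that by (simp add: rep_norm_def degree_monom_eq)
      have sum: "N (\<Sum>i\<in>I. p i) \<le> (\<Sum>i\<in>I. N (p i))" if "\<And>i. i \<in> I \<Longrightarrow> degree (p i) \<le> d"
        for I and p :: "nat \<Rightarrow> complex poly"
        using that
      proof (induction I rule: infinite_finite_induct)
        case (insert i I)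
        have "degree (\<Sum>i\<in>I. p i) \<le> d" using insert by (intro degree_sum_le) auto
        then have "N (p i + (\<Sum>i\<in>I. p i)) \<le> N (p i) + N (\<Sum>i\<in>I. p i)"
          using N insert.prems by (simp add: rep_norm_def)
        also have "\<dots> \<le> N (p i) + (\<Sum>i\<in>I. N (p i))" using insert by simp
        finally show ?case using insert by simp
      qed (use sym.rep_norm_zero[OF N] in auto)
      have "N (f \<tau>) \<le> (\<Sum>i\<le>d. K i * N (Polynomial.monom 1 i)) * growth \<tau> ^ m" if \<tau>: "\<tau> \<in> upper_half_plane" for \<tau>
      proof -
        have "f \<tau> = (\<Sum>i\<le>d. Polynomial.smult (coeff (f \<tau>) i) (Polynomial.monom 1 i))"
          using poly_as_sum_of_monoms'[OF deg[OF \<tau>]] by (simp add: smult_monom)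
        then have "N (f \<tau>) \<le> (\<Sum>i\<le>d. N (Polynomial.smult (coeff (f \<tau>) i) (Polynomial.monom 1 i)))"
          using sum[of "{..d}" "\<lambda>i. Polynomial.smult (coeff (f \<tau>) i) (Polynomial.monom 1 i)"]
          by (simp add: smult_monom order_trans[OF degree_monom_le])
        also have "\<dots> = (\<Sum>i\<le>d. norm (coeff (f \<tau>) i) * N (Polynomial.monom 1 i))"
          using sym.rep_norm_scale[OF N] by (intro sum.cong refl) (simp add: degree_monom_eq)
        also have "\<dots> \<le> (\<Sum>i\<le>d. K i * growth \<tau> ^ m * N (Polynomial.monom 1 i))"
          using K[OF _ \<tau> m] N0 by (intro sum_mono mult_right_mono) auto
        finally show ?thesis by (simp add: sum_distrib_left sum_distrib_right mult_ac)
      qed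
      then show "\<exists>K. \<forall>\<tau>\<in>upper_half_plane. N (f \<tau>) \<le> K * growth \<tau> ^ m" by blast
    qed
  qed
qed

lemma homog_subst_smult: "homog_subst d \<gamma> (Polynomial.smult c p) = Polynomial.smult c (homog_subst d \<gamma> p)"
  by (simp add: poly_eq_iff coeff_homog_subst sum_distrib_left mult.assoc)

lemma aut_factor_mult_power_int:
  assumes "\<delta> \<in> carrier SL2Z" "\<gamma> \<in> carrier SL2Z" "\<tau> \<in> upper_half_plane"
  shows "aut_factor (\<delta> \<otimes>\<^bsub>SL2Z\<^esub> \<gamma>) \<tau> powi k = aut_factor \<gamma> \<tau> powi k * aut_factor \<delta> (moebius_act \<gamma> \<tau>) powi k"
  using assms by (simp add: aut_factor_mult power_int_mult_distrib mult.commute)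

lemma aut_factor_coset_power_int:
  assumes "t \<in> Gamma_inf" "even k"
  shows "aut_factor (t \<otimes>\<^bsub>SL2Z\<^esub> \<gamma>) \<tau> powi k = aut_factor \<gamma> \<tau> powi k"
proof -
  obtain s :: complex where "s = 1 \<or> s = - 1" "\<And>\<tau>. aut_factor t \<tau> = s"
    "\<And>\<gamma> \<tau>. aut_factor (t \<otimes>\<^bsub>SL2Z\<^esub> \<gamma>) \<tau> = s * aut_factor \<gamma> \<tau>"
    by (rule aut_factor_Gamma_inf[OF assms(1)]) (rule that)
  then show ?thesis using power_int_minus_one_even[OF _ assms(2)] by simp
qed

subsection \<open>Eisenstein series of type \<open>(sym, 1)\<close>\<close>

definition sym_term :: "nat \<Rightarrow> (int^2^2 \<Rightarrow> complex poly) \<Rightarrow> complex \<Rightarrow> int^2^2 \<Rightarrow> complex poly" where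
  "sym_term m \<phi> \<tau> \<gamma> = Polynomial.smult (aut_factor \<gamma> \<tau> powi (- int m)) (\<phi> (inv\<^bsub>SL2Z\<^esub> \<gamma>))"

lemma eisenstein_sym_eq:
  "\<tau> \<in> upper_half_plane \<Longrightarrow> eisenstein_sym d (int m) \<phi> \<tau> = coset_sum d (sym_term m \<phi> \<tau>)"
  by (simp add: eisenstein_sym_def coset_sum_def sym_term_def)

context
  fixes d m :: nat and \<phi> :: "int^2^2 \<Rightarrow> complex poly"
  assumes \<phi>: "\<phi> \<in> parabolic_cocycles (sym_rep d)" and m: "d + 5 \<le> m" "even m"
begin

text \<open>The coefficients have exponent d + 1 in the height and the summation needs 4 more
  powers: this is the bound d + 5 on the weight.\<close>

lemma sym_term_summable: "\<tau> \<in> upper_half_plane \<Longrightarrow> coset_summable d (sym_term m \<phi> \<tau>)"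
  unfolding coset_summable_def
proof (intro allI impI)
  fix i assume \<tau>: "\<tau> \<in> upper_half_plane"
  have "(\<lambda>C. coeff (\<phi> (inv\<^bsub>SL2Z\<^esub> (coset_rep C))) i * aut_factor (coset_rep C) \<tau> powi (- int m)) summable_on cosets"
    by (rule Infinite_Sum.abs_summable_summable)
       (rule coset_series_summable[OF sym_cocycle_height_bounded[OF \<phi>]], use m \<tau> in auto)
  then show "(\<lambda>C. coeff (sym_term m \<phi> \<tau> (coset_rep C)) i) summable_on cosets"
    by (simp add: sym_term_def mult.commute)
qed

lemma coeff_eisenstein_sym:
  assumes "\<tau> \<in> upper_half_plane" "i \<le> d"
  shows "coeff (eisenstein_sym d (int m) \<phi> \<tau>) i = coset_series m (\<lambda>\<gamma>. coeff (\<phi> (inv\<^bsub>SL2Z\<^esub> \<gamma>)) i) \<tau>"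
  using assms by (simp add: eisenstein_sym_eq coeff_coset_sum sym_term_def coset_series_def mult.commute)

text \<open>Replacing \<delta> by \<delta>\<gamma> permutes the terms, while the cocycle relation
  splits each of them into the slashed term and a multiple of the fixed polynomial
  \<phi>(\<gamma>^-1). The multiples add up to the classical Eisenstein series at \<tau>.\<close>

lemma eisenstein_sym_slash:
  assumes \<gamma>: "\<gamma> \<in> carrier SL2Z" and \<tau>: "\<tau> \<in> upper_half_plane"
  shows "vv_slash (int m) (sym_rep d) (eisenstein_sym d (int m) \<phi>) \<gamma> \<tau> - eisenstein_sym d (int m) \<phi> \<tau>
    = Polynomial.smult (- eisenstein m \<tau>) (\<phi> (inv\<^bsub>SL2Z\<^esub> \<gamma>))"
proof -
  let ?\<tau> = "moebius_act \<gamma> \<tau>" and ?a = "aut_factor \<gamma> \<tau> powi (- int m)"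
  let ?b = "\<lambda>\<delta>. aut_factor (\<delta> \<otimes>\<^bsub>SL2Z\<^esub> \<gamma>) \<tau> powi (- int m)"
  let ?F = "\<lambda>\<delta>. Polynomial.smult ?a (homog_subst d \<gamma> (sym_term m \<phi> ?\<tau> \<delta>))"
  let ?G = "\<lambda>\<delta>. Polynomial.smult (?b \<delta>) (\<phi> (inv\<^bsub>SL2Z\<^esub> \<gamma>))"
  have \<tau>': "?\<tau> \<in> upper_half_plane" using \<gamma> \<tau> by (rule moebius_upper_half_plane)
  have deg: "degree (\<phi> (inv\<^bsub>SL2Z\<^esub> \<gamma>)) \<le> d" using sym_cocycle_degree[OF \<phi>] \<gamma> by simp
  have "(\<lambda>C. ?a * aut_factor (coset_rep C) ?\<tau> powi (- int m)) summable_on cosets"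
    by (rule summable_on_cmult_right[OF Infinite_Sum.abs_summable_summable])
       (rule eisenstein_summable, use m \<tau>' in auto)
  then have b: "(\<lambda>C. ?b (coset_rep C)) summable_on cosets"
    by (rule summable_on_cong[THEN iffD1, rotated]) (simp add: aut_factor_mult_power_int coset_rep(1) \<gamma> \<tau>)
  have step: "sym_term m \<phi> \<tau> (\<delta> \<otimes>\<^bsub>SL2Z\<^esub> \<gamma>) = ?F \<delta> + ?G \<delta>" if \<delta>: "\<delta> \<in> carrier SL2Z" for \<delta>
  proof -
    have "sym_term m \<phi> \<tau> (\<delta> \<otimes>\<^bsub>SL2Z\<^esub> \<gamma>)
        = Polynomial.smult (?b \<delta>) (homog_subst d \<gamma> (\<phi> (inv\<^bsub>SL2Z\<^esub> \<delta>)) + \<phi> (inv\<^bsub>SL2Z\<^esub> \<gamma>))"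
      by (simp only: sym_term_def sym_cocycle_mult[OF \<phi> \<delta> \<gamma>])
    also have "\<dots> = ?F \<delta> + ?G \<delta>"
      by (simp add: sym_term_def homog_subst_smult smult_add_right aut_factor_mult_power_int[OF \<delta> \<gamma> \<tau>])
    finally show ?thesis .
  qed
  have sF: "coset_summable d ?F"
    by (intro coset_summable_smult coset_summable_homog_subst sym_term_summable \<tau>')
  have sG: "coset_summable d ?G" by (rule coset_summable_const[OF b deg])
  have "coset_sum d (sym_term m \<phi> \<tau>) = coset_sum d (\<lambda>\<delta>. sym_term m \<phi> \<tau> (\<delta> \<otimes>\<^bsub>SL2Z\<^esub> \<gamma>))"
    using m by (intro coset_sum_translate[symmetric] \<gamma>)
      (simp add: sym_term_def sym_cocycle_coset[OF \<phi>] aut_factor_coset_power_int)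
  also have "\<dots> = coset_sum d (\<lambda>\<delta>. ?F \<delta> + ?G \<delta>)" by (rule coset_sum_cong) (rule step)
  also have "\<dots> = coset_sum d ?F + coset_sum d ?G" by (rule coset_sum_add[OF sF sG])
  also have "coset_sum d ?F = vv_slash (int m) (sym_rep d) (eisenstein_sym d (int m) \<phi>) \<gamma> \<tau>"
    using coset_sum_smult[OF coset_summable_homog_subst[OF sym_term_summable[OF \<tau>']]]
      coset_sum_homog_subst[OF sym_term_summable[OF \<tau>']]
    by (simp add: vv_slash_def \<gamma> eisenstein_sym_eq[OF \<tau>'])
  also have "coset_sum d ?G = Polynomial.smult (eisenstein m \<tau>) (\<phi> (inv\<^bsub>SL2Z\<^esub> \<gamma>))"
  proof -
    have "(\<Sum>\<^sub>\<infinity>C\<in>cosets. ?b (coset_rep C)) = eisenstein m \<tau>"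
      using infsum_cosets_translate[OF \<gamma>, of "\<lambda>\<delta>. aut_factor \<delta> \<tau> powi (- int m)"] m \<tau>
      by (simp add: aut_factor_coset_power_int eisenstein_def coset_series_def)
    then show ?thesis using coset_sum_const[OF b deg] by simp
  qed
  finally show ?thesis by (simp add: eisenstein_sym_eq[OF \<tau>])
qed

lemma eisenstein_sym_second_order:
  "eisenstein_sym d (int m) \<phi> \<in> second_order_forms (int m) (sym_rep d) triv_rep"
proof -
  let ?E = "eisenstein_sym d (int m) \<phi>"
  have bd: "height_bounded (d + 1) (\<lambda>\<gamma>. coeff (\<phi> (inv\<^bsub>SL2Z\<^esub> \<gamma>)) i)" for i
    by (rule sym_cocycle_height_bounded[OF \<phi>])
  have out: "?E \<tau> = 0" if "\<tau> \<notin> upper_half_plane" for \<tau> using that by (simp add: eisenstein_sym_def)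
  have deg: "degree (?E \<tau>) \<le> d" if "\<tau> \<in> upper_half_plane" for \<tau>
    by (simp add: eisenstein_sym_eq[OF that] degree_coset_sum)
  have hol: "(\<lambda>\<tau>. coeff (?E \<tau>) i) holomorphic_on upper_half_plane" if "i \<le> d" for i
    using coset_series_holomorphic[OF bd, of m] m
    by (rule_tac holomorphic_transform) (auto simp: coeff_eisenstein_sym that)
  have gr: "poly_growth (\<lambda>\<tau>. coeff (?E \<tau>) i)" if "i \<le> d" for i
    using poly_growth_coset_series[OF bd, of m i] m by (simp add: poly_growth_def coeff_eisenstein_sym that)
  \<comment> \<open>A cocycle with values in V becomes one with values in the linear maps from the
    complex numbers to V.\<close>
  let ?\<phi> = "\<lambda>\<gamma> z. Polynomial.smult z (\<phi> \<gamma>)"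
  have coc: "?\<phi> \<in> parabolic_cocycles (hom_rep triv_rep (sym_rep d))"
  proof -
    have scale: "rep_act (sym_rep d) \<gamma> (Polynomial.smult z (\<phi> \<delta>)) = Polynomial.smult z (rep_act (sym_rep d) \<gamma> (\<phi> \<delta>))"
      if "\<gamma> \<in> carrier SL2Z" "\<delta> \<in> carrier SL2Z" for \<gamma> \<delta> z
      using sym.act_scale[of \<gamma> "\<phi> \<delta>" d z] sym_cocycle_degree[OF \<phi> that(2)] that by simp
    have "?\<phi> \<gamma> \<in> rep_lin_maps triv_rep (sym_rep d)" if "\<gamma> \<in> carrier SL2Z" for \<gamma>
      using sym_cocycle_degree[OF \<phi> that] by (simp add: rep_lin_maps_def smult_add_left)
    then show ?thesis
      using \<phi> by (auto simp: parabolic_cocycles_def hom_rep_def fun_eq_iff scale smult_add_right)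
  qed
  show ?thesis
  proof (rule sym_triv.second_orderI[where A = "{?\<phi>}" and g = "\<lambda>_ \<tau>. (- 1) * eisenstein m \<tau>"])
    show "?E \<in> vv_functions (sym_rep d)" by (rule sym_functionI[OF out deg])
    show "vv_holomorphic (sym_rep d) ?E" by (rule sym_holomorphicI[OF out deg hol])
    show "moderate_growth (int m) (sym_rep d) ?E" by (rule sym_moderate_growthI[OF out deg gr])
    show "finite {?\<phi>}" by simp
    show "{?\<phi>} \<subseteq> parabolic_cocycles (hom_rep triv_rep (sym_rep d))" using coc by simp
    show "(\<lambda>\<tau>. (- 1) * eisenstein m \<tau>) \<in> vv_modular_forms (int m) triv_rep"
      unfolding vv_modular_forms_triv using m by (intro modular_forms_scale eisenstein_modular) auto
    show "vv_slash (int m) (sym_rep d) ?E \<gamma> \<tau> - ?E \<tau>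
        = (\<Sum>\<psi>\<in>{?\<phi>}. \<psi> (inv\<^bsub>SL2Z\<^esub> \<gamma>) ((- 1) * eisenstein m \<tau>))"
      if "\<gamma> \<in> carrier SL2Z" "\<tau> \<in> upper_half_plane" for \<gamma> \<tau>
      using eisenstein_sym_slash[OF that] by simp
  qed
qed

end

subsection \<open>Eisenstein series with values in the symmetric power\<close>

lemma height_bounded_add:
  assumes "height_bounded M a" "height_bounded M b"
  shows "height_bounded M (\<lambda>\<gamma>. a \<gamma> + b \<gamma>)"
proof -
  obtain K where K: "K \<ge> 0" "\<And>\<gamma>. \<gamma> \<in> carrier SL2Z \<Longrightarrow> norm (a \<gamma>) \<le> K * height \<gamma> ^ M"
    by (rule height_boundedE[OF assms(1)]) (rule that)
  obtain L where L: "L \<ge> 0" "\<And>\<gamma>. \<gamma> \<in> carrier SL2Z \<Longrightarrow> norm (b \<gamma>) \<le> L * height \<gamma> ^ M"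
    by (rule height_boundedE[OF assms(2)]) (rule that)
  have "norm (a \<gamma> + b \<gamma>) \<le> (K + L) * height \<gamma> ^ M" if "\<gamma> \<in> carrier SL2Z" for \<gamma>
    using K(2)[OF that] L(2)[OF that] norm_triangle_ineq[of "a \<gamma>" "b \<gamma>"] by (simp add: distrib_right)
  then show ?thesis unfolding height_bounded_def by blast
qed

lemma coeff_linear_mult:
  "coeff ([:a, b:] * p) i = a * coeff p i + b * (if i = 0 then 0 else coeff p (i - 1))"
  by (simp add: coeff_pCons split: nat.split)

lemma height_bounded_linear_power:
  "height_bounded n (\<lambda>\<gamma>. coeff ([:of_int (\<gamma>$2$2), of_int (\<gamma>$2$1):] ^ n) i)"
proof (induction n arbitrary: i)
  case 0
  show ?case by (simp add: height_bounded_const)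
next
  case (Suc n)
  have "norm (of_int (\<gamma>$2$i) :: complex) \<le> 1 * height \<gamma> ^ 1" for \<gamma> and i :: 2
    using exhaust_2[of i] by (auto simp: height_def)
  then have e: "height_bounded 1 (\<lambda>\<gamma>. of_int (\<gamma>$2$i))" for i :: 2
    unfolding height_bounded_def by blast
  have "height_bounded n (\<lambda>_. 0)"
    by (rule height_bounded_mono[OF height_bounded_const]) simp
  with Suc have "height_bounded n (\<lambda>\<gamma>. if i = 0 then 0 else coeff ([:of_int (\<gamma>$2$2), of_int (\<gamma>$2$1):] ^ n) (i - 1))"
    by (cases "i = 0") auto
  from height_bounded_add[OF height_bounded_mult[OF e Suc] height_bounded_mult[OF e this]]
  show ?case by (simp only: power_Suc coeff_linear_mult plus_1_eq_Suc)
qed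

text \<open>The scalar c = -1 serves the powers of X - \<tau>, and c = 1 those of X + \<tau> in the
  expansion around \<tau>.\<close>

lemma
  fixes c :: complex
  shows holomorphic_coeff_scaled_linear_power: "(\<lambda>\<tau>. coeff ([:c * \<tau>, 1:] ^ j) i) holomorphic_on A"
    and poly_growth_coeff_scaled_linear_power: "poly_growth (\<lambda>\<tau>. coeff ([:c * \<tau>, 1:] ^ j) i)"
proof -
  have "(\<lambda>\<tau>. coeff ([:c * \<tau>, 1:] ^ j) i) holomorphic_on A \<and> poly_growth (\<lambda>\<tau>. coeff ([:c * \<tau>, 1:] ^ j) i)"
  proof (induction j arbitrary: i)
    case 0
    show ?case by (simp add: poly_growth_const)
  next
    case (Suc j)
    have m: "poly_growth (\<lambda>\<tau>. c * \<tau>)" by (intro poly_growth_mult poly_growth_const poly_growth_ident)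
    have "poly_growth (\<lambda>\<tau>. if i = 0 then 0 else coeff ([:c * \<tau>, 1:] ^ j) (i - 1))"
      using Suc poly_growth_const[of 0] by (cases "i = 0") auto
    with Suc have "poly_growth (\<lambda>\<tau>. (c * \<tau>) * coeff ([:c * \<tau>, 1:] ^ j) i
        + (if i = 0 then 0 else coeff ([:c * \<tau>, 1:] ^ j) (i - 1)))"
      using poly_growth_add[OF poly_growth_mult[OF m]] by blast
    moreover have "(\<lambda>\<tau>. if i = 0 then 0 else coeff ([:c * \<tau>, 1:] ^ j) (i - 1)) holomorphic_on A"
      using Suc by (cases "i = 0") auto
    with Suc have "(\<lambda>\<tau>. (c * \<tau>) * coeff ([:c * \<tau>, 1:] ^ j) i
        + (if i = 0 then 0 else coeff ([:c * \<tau>, 1:] ^ j) (i - 1))) holomorphic_on A"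
      by (auto intro!: holomorphic_intros)
    ultimately show ?case by (simp only: power_Suc coeff_linear_mult mult_1)
  qed
  then show "(\<lambda>\<tau>. coeff ([:c * \<tau>, 1:] ^ j) i) holomorphic_on A" "poly_growth (\<lambda>\<tau>. coeff ([:c * \<tau>, 1:] ^ j) i)"
    by auto
qed

lemma
  shows holomorphic_coeff_linear_power: "(\<lambda>\<tau>. coeff ([:- \<tau>, 1:] ^ j) i) holomorphic_on A"
    and poly_growth_coeff_linear_power: "poly_growth (\<lambda>\<tau>. coeff ([:- \<tau>, 1:] ^ j) i)"
  using holomorphic_coeff_scaled_linear_power[of "- 1"] poly_growth_coeff_scaled_linear_power[of "- 1"] by simp_all

lemma degree_linear_power: "degree ([:a, b:] ^ n) \<le> n"
  by (rule order_trans[OF degree_power_le]) simp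

text \<open>This is \<open>(X - \<tau>)\<^sup>j|\<^sub>l\<gamma>\<close>.\<close>

definition sym_vector_term :: "nat \<Rightarrow> nat \<Rightarrow> nat \<Rightarrow> complex \<Rightarrow> int^2^2 \<Rightarrow> complex poly" where
  "sym_vector_term d l j \<tau> \<gamma> = Polynomial.smult (aut_factor \<gamma> \<tau> powi (- int (l + j)))
     ([:- \<tau>, 1:] ^ j * [:of_int (\<gamma>$2$2), of_int (\<gamma>$2$1):] ^ (d - j))"

definition sym_vector_eisenstein :: "nat \<Rightarrow> nat \<Rightarrow> nat \<Rightarrow> complex \<Rightarrow> complex poly" where
  "sym_vector_eisenstein d l j \<tau> = (if \<tau> \<in> upper_half_plane then coset_sum d (sym_vector_term d l j \<tau>) else 0)"

lemma degree_sym_vector_term: "j \<le> d \<Longrightarrow> degree (sym_vector_term d l j \<tau> \<gamma>) \<le> d"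
  unfolding sym_vector_term_def
  by (rule order_trans[OF degree_smult_le], rule order_trans[OF degree_mult_le],
      rule order_trans[OF add_mono[OF degree_linear_power degree_linear_power]]) simp

lemma coeff_sym_vector_term:
  "coeff (sym_vector_term d l j \<tau> \<gamma>) i = (\<Sum>s\<le>i. coeff ([:- \<tau>, 1:] ^ j) s *
     (coeff ([:of_int (\<gamma>$2$2), of_int (\<gamma>$2$1):] ^ (d - j)) (i - s) * aut_factor \<gamma> \<tau> powi (- int (l + j))))"
  by (simp add: sym_vector_term_def coeff_mult sum_distrib_left mult_ac)

context
  fixes d l j :: nat
  assumes j: "j \<le> d"
begin

lemma sym_vector_term_slash:
  assumes "\<gamma> \<in> carrier SL2Z" "\<tau> \<in> upper_half_plane"
  shows "vv_slash (int l) (sym_rep d) (\<lambda>z. [:- z, 1:] ^ j) \<gamma> \<tau> = sym_vector_term d l j \<tau> \<gamma>"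
proof -
  let ?a = "aut_factor \<gamma> \<tau>"
  have a: "?a \<noteq> 0" using assms by (rule aut_factor_nonzero)
  have "?a powi (- int l) = ?a powi (- int (l + j)) * ?a ^ j"
    using a by (simp flip: power_int_of_nat power_int_add)
  then have "vv_slash (int l) (sym_rep d) (\<lambda>z. [:- z, 1:] ^ j) \<gamma> \<tau>
      = Polynomial.smult (?a powi (- int (l + j))) (Polynomial.smult (?a ^ j) (homog_subst d \<gamma> ([:- moebius_act \<gamma> \<tau>, 1:] ^ j)))"
    using assms by (simp add: vv_slash_def)
  also have "\<dots> = sym_vector_term d l j \<tau> \<gamma>"
    by (simp only: homog_subst_linear_power[OF assms j] sym_vector_term_def)
  finally show ?thesis .
qed

text \<open>The terms are the slash images of (X - \<tau>)^j, and slashing is a right action. The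
  explicit formula hides this, so both sides are rewritten as slash images.\<close>

lemma sym_vector_term_mult:
  assumes \<gamma>: "\<gamma> \<in> carrier SL2Z" and \<delta>: "\<delta> \<in> carrier SL2Z" and \<tau>: "\<tau> \<in> upper_half_plane"
  shows "sym_vector_term d l j \<tau> (\<delta> \<otimes>\<^bsub>SL2Z\<^esub> \<gamma>)
    = Polynomial.smult (aut_factor \<gamma> \<tau> powi (- int l)) (homog_subst d \<gamma> (sym_vector_term d l j (moebius_act \<gamma> \<tau>) \<delta>))"
proof -
  have deg: "degree ([:- z, 1 :: complex:] ^ j) \<le> d" for z
    using degree_linear_power[of "- z" 1 j] j by linarith
  have \<tau>': "moebius_act \<gamma> \<tau> \<in> upper_half_plane" by (rule moebius_upper_half_plane[OF \<gamma> \<tau>])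
  have \<delta>\<gamma>: "\<delta> \<otimes>\<^bsub>SL2Z\<^esub> \<gamma> \<in> carrier SL2Z" using \<delta> \<gamma> by simp
  have eq: "sym_vector_term d l j z \<epsilon> = Polynomial.smult (aut_factor \<epsilon> z powi (- int l)) (homog_subst d \<epsilon> ([:- moebius_act \<epsilon> z, 1:] ^ j))"
    if "\<epsilon> \<in> carrier SL2Z" "z \<in> upper_half_plane" for \<epsilon> z
    using sym_vector_term_slash[OF that] that by (simp add: vv_slash_def)
  show ?thesis
    unfolding eq[OF \<delta>\<gamma> \<tau>] eq[OF \<delta> \<tau>'] homog_subst_smult smult_smult aut_factor_mult_power_int[OF \<delta> \<gamma> \<tau>]
      moebius_mult[OF \<delta> \<gamma> \<tau>] homog_subst_mult[OF \<delta> \<gamma> deg] ..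
qed

text \<open>For t with diagonal entries s = 1 or s = -1 the scalar is s^(-(l + j)) s^(d - j), which
  is 1 because l + d is even. So t and the identity have the same term, and slashing with \<delta>
  gives the claim.\<close>

lemma sym_vector_term_Gamma_inf:
  assumes t: "t \<in> Gamma_inf" and \<delta>: "\<delta> \<in> carrier SL2Z" and \<tau>: "\<tau> \<in> upper_half_plane" and even: "even (l + d)"
  shows "sym_vector_term d l j \<tau> (t \<otimes>\<^bsub>SL2Z\<^esub> \<delta>) = sym_vector_term d l j \<tau> \<delta>"
proof -
  have *: "sym_vector_term d l j z t = [:- z, 1:] ^ j" if t: "t \<in> Gamma_inf" for t z
  proof -
    obtain s :: complex where s: "s = 1 \<or> s = - 1" "\<And>\<tau>. aut_factor t \<tau> = s"
      "\<And>\<gamma> \<tau>. aut_factor (t \<otimes>\<^bsub>SL2Z\<^esub> \<gamma>) \<tau> = s * aut_factor \<gamma> \<tau>"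
      by (rule aut_factor_Gamma_inf[OF t]) (rule that)
    have row: "t$2$1 = 0" "of_int (t$2$2) = s"
      using t s(2)[of 0] by (simp_all add: Gamma_inf_iff_lower_left aut_factor_def)
    have "s powi (- int (l + j)) * s ^ (d - j) = 1"
    proof (cases "s = 1")
      case False
      with s have s: "s = - 1" by auto
      have "(- 1) powi (- int (l + j)) = ((- 1) ^ (l + j) :: complex)"
        by (simp only: power_int_minus power_int_of_nat power_inverse [symmetric]) simp
      moreover have "even (l + j + (d - j))" using even j by auto
      ultimately show ?thesis by (simp add: s flip: power_add)
    qed simp
    then show ?thesis
      by (simp add: sym_vector_term_def s(2) row poly_const_pow)
  qed
  have one: "\<one>\<^bsub>SL2Z\<^esub> \<in> Gamma_inf" by (rule subgroup.one_closed[OF subgroup_Gamma_inf])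
  show ?thesis
    using sym_vector_term_mult[OF \<delta> Gamma_inf_carrier[OF t] \<tau>] sym_vector_term_mult[OF \<delta> SL.one_closed \<tau>] \<delta>
    by (simp add: *[OF t] *[OF one])
qed

end

context
  fixes d l j :: nat
  assumes j: "j \<le> d" and l: "d + 4 \<le> l" "even (l + d)"
begin

text \<open>The power of c X + e brings d - j powers of the bottom row, against l + j in the
  denominator; 4 have to remain.\<close>

lemma
  assumes "i \<le> d"
  shows sym_vector_term_coeff_summable: "\<tau> \<in> upper_half_plane \<Longrightarrow>
      (\<lambda>C. coeff (sym_vector_term d l j \<tau> (coset_rep C)) i) summable_on cosets"
    and sym_vector_term_coeff_holomorphic: "(\<lambda>\<tau>. \<Sum>\<^sub>\<infinity>C\<in>cosets. coeff (sym_vector_term d l j \<tau> (coset_rep C)) i)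
      holomorphic_on upper_half_plane"
    and sym_vector_term_coeff_growth: "poly_growth (\<lambda>\<tau>. \<Sum>\<^sub>\<infinity>C\<in>cosets. coeff (sym_vector_term d l j \<tau> (coset_rep C)) i)"
proof -
  have M: "(d - j) + 4 \<le> l + j" using l by linarith
  note facts = height_bounded_linear_power M holomorphic_coeff_linear_power poly_growth_coeff_linear_power
    coeff_sym_vector_term
  show "(\<lambda>C. coeff (sym_vector_term d l j \<tau> (coset_rep C)) i) summable_on cosets" if "\<tau> \<in> upper_half_plane"
    by (rule coset_combination_summable[OF facts that])
  show "(\<lambda>\<tau>. \<Sum>\<^sub>\<infinity>C\<in>cosets. coeff (sym_vector_term d l j \<tau> (coset_rep C)) i) holomorphic_on upper_half_plane"
    by (rule coset_combination_holomorphic[OF facts])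
  show "poly_growth (\<lambda>\<tau>. \<Sum>\<^sub>\<infinity>C\<in>cosets. coeff (sym_vector_term d l j \<tau> (coset_rep C)) i)"
    by (rule coset_combination_growth[OF facts])
qed

lemma sym_vector_term_summable: "\<tau> \<in> upper_half_plane \<Longrightarrow> coset_summable d (sym_vector_term d l j \<tau>)"
  using sym_vector_term_coeff_summable by (simp add: coset_summable_def)

lemma sym_vector_eisenstein_modular: "sym_vector_eisenstein d l j \<in> vv_modular_forms (int l) (sym_rep d)"
proof -
  let ?E = "sym_vector_eisenstein d l j"
  have out: "?E \<tau> = 0" if "\<tau> \<notin> upper_half_plane" for \<tau> using that by (simp add: sym_vector_eisenstein_def)
  have deg: "degree (?E \<tau>) \<le> d" if "\<tau> \<in> upper_half_plane" for \<tau>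
    using that by (simp add: sym_vector_eisenstein_def degree_coset_sum)
  have c: "coeff (?E \<tau>) i = (\<Sum>\<^sub>\<infinity>C\<in>cosets. coeff (sym_vector_term d l j \<tau> (coset_rep C)) i)"
    if "\<tau> \<in> upper_half_plane" "i \<le> d" for \<tau> i
    using that by (simp add: sym_vector_eisenstein_def coeff_coset_sum)
  have hol: "(\<lambda>\<tau>. coeff (?E \<tau>) i) holomorphic_on upper_half_plane" if "i \<le> d" for i
    by (rule holomorphic_transform[OF sym_vector_term_coeff_holomorphic[OF that]]) (simp add: c that)
  have gr: "poly_growth (\<lambda>\<tau>. coeff (?E \<tau>) i)" if "i \<le> d" for i
    using sym_vector_term_coeff_growth[OF that] by (simp add: poly_growth_def c that)
  have inv: "vv_slash (int l) (sym_rep d) ?E \<gamma> \<tau> = ?E \<tau>" if \<gamma>: "\<gamma> \<in> carrier SL2Z" and \<tau>: "\<tau> \<in> upper_half_plane" for \<gamma> \<tau>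
  proof -
    let ?\<tau> = "moebius_act \<gamma> \<tau>"
    have \<tau>': "?\<tau> \<in> upper_half_plane" by (rule moebius_upper_half_plane[OF \<gamma> \<tau>])
    note s = sym_vector_term_summable[OF \<tau>']
    have "?E \<tau> = coset_sum d (\<lambda>\<delta>. sym_vector_term d l j \<tau> (\<delta> \<otimes>\<^bsub>SL2Z\<^esub> \<gamma>))"
      using coset_sum_translate[OF \<gamma> sym_vector_term_Gamma_inf[OF j _ _ \<tau> l(2)], of d] \<tau>
      by (simp add: sym_vector_eisenstein_def)
    also have "\<dots> = coset_sum d (\<lambda>\<delta>. Polynomial.smult (aut_factor \<gamma> \<tau> powi (- int l)) (homog_subst d \<gamma> (sym_vector_term d l j ?\<tau> \<delta>)))"
      by (rule coset_sum_cong) (rule sym_vector_term_mult[OF j \<gamma> _ \<tau>])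
    also have "\<dots> = vv_slash (int l) (sym_rep d) ?E \<gamma> \<tau>"
      using coset_sum_smult[OF coset_summable_homog_subst[OF s]] coset_sum_homog_subst[OF s] \<gamma> \<tau>'
      by (simp add: vv_slash_def sym_vector_eisenstein_def)
    finally show ?thesis ..
  qed
  show ?thesis
    using sym_functionI[OF out deg] sym_holomorphicI[OF out deg hol] sym_moderate_growthI[OF out deg gr] inv
    by (simp add: vv_modular_forms_def)
qed

end

lemma poly_coset_sum:
  assumes "coset_summable d F" "\<And>\<gamma>. \<gamma> \<in> carrier SL2Z \<Longrightarrow> degree (F \<gamma>) \<le> d"
  shows "poly (coset_sum d F) x = (\<Sum>\<^sub>\<infinity>C\<in>cosets. poly (F (coset_rep C)) x)"
proof -
  have p: "poly p x = (\<Sum>i\<le>d. coeff p i * x ^ i)" if "degree p \<le> d" for p :: "complex poly"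
    by (subst poly_as_sum_of_monoms'[OF that, symmetric]) (simp add: poly_sum poly_monom)
  show ?thesis
    unfolding p[OF degree_coset_sum] coset_sum_functional[OF assms(1), symmetric]
    by (intro infsum_cong p[symmetric] assms(2) coset_rep(1))
qed

text \<open>
  As \<open>cX + e = (c\<tau> + e) + c(X - \<tau>)\<close>, the expansion of the series in powers of \<open>X - \<tau>\<close> starts with
  a classical Eisenstein series times \<open>(X - \<tau>)\<^sup>j\<close>.
\<close>

lemma sym_vector_eisenstein_leading:
  assumes j: "j \<le> d" and l: "d + 4 \<le> l" "even (l + d)" and \<tau>: "\<tau> \<in> upper_half_plane"
  obtains r where "sym_vector_eisenstein d l j \<tau> = [:- \<tau>, 1:] ^ j * r" "poly r \<tau> = eisenstein (l + 2 * j - d) \<tau>"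
proof -
  \<comment> \<open>What is left of the term after (X - \<tau>)^j has been taken out; this power is
    the same for all cosets and leaves the sum.\<close>
  define F where "F = (\<lambda>\<gamma>::int^2^2. Polynomial.smult (aut_factor \<gamma> \<tau> powi (- int (l + j))) ([:of_int (\<gamma>$2$2), of_int (\<gamma>$2$1):] ^ (d - j)))"
  have degF: "degree (F \<gamma>) \<le> d - j" for \<gamma>
    unfolding F_def by (rule order_trans[OF degree_smult_le degree_linear_power])
  have sF: "coset_summable (d - j) F"
    unfolding coset_summable_def
  proof (intro allI impI)
    fix i
    have "(\<lambda>C. coeff ([:of_int (coset_rep C$2$2), of_int (coset_rep C$2$1):] ^ (d - j)) i
        * aut_factor (coset_rep C) \<tau> powi (- int (l + j))) summable_on cosets"
      by (rule Infinite_Sum.abs_summable_summable)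
         (rule coset_series_summable[OF height_bounded_linear_power], use l \<tau> in auto)
    then show "(\<lambda>C. coeff (F (coset_rep C)) i) summable_on cosets" by (simp add: F_def mult.commute)
  qed
  have V: "sym_vector_term d l j \<tau> \<gamma> = [:- \<tau>, 1:] ^ j * F \<gamma>" for \<gamma>
    by (simp add: sym_vector_term_def F_def)
  show ?thesis
  proof (rule that)
    show "sym_vector_eisenstein d l j \<tau> = [:- \<tau>, 1:] ^ j * coset_sum (d - j) F"
    proof (rule poly_eqI_upper_half_plane)
      fix x
      have "poly (sym_vector_eisenstein d l j \<tau>) x = (\<Sum>\<^sub>\<infinity>C\<in>cosets. (x - \<tau>) ^ j * poly (F (coset_rep C)) x)"
        using \<tau> poly_coset_sum[OF sym_vector_term_summable[OF j l \<tau>] degree_sym_vector_term[OF j]]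
        by (simp only: sym_vector_eisenstein_def if_True) (simp add: V)
      also have "\<dots> = (x - \<tau>) ^ j * poly (coset_sum (d - j) F) x"
        by (simp add: infsum_cmult_right' poly_coset_sum[OF sF degF])
      finally show "poly (sym_vector_eisenstein d l j \<tau>) x = poly ([:- \<tau>, 1:] ^ j * coset_sum (d - j) F) x"
        by simp
    qed
    \<comment> \<open>At X = \<tau> the d - j linear factors are automorphy factors themselves, so
      the exponent -(l + j) becomes -(l + 2 j - d).\<close>
    have "poly (F \<gamma>) \<tau> = aut_factor \<gamma> \<tau> powi (- int (l + 2 * j - d))" if "\<gamma> \<in> carrier SL2Z" for \<gamma>
    proof -
      have "aut_factor \<gamma> \<tau> \<noteq> 0" by (rule aut_factor_nonzero[OF that \<tau>])
      moreover have "- int (l + 2 * j - d) = - int (l + j) + int (d - j)" using j l by linarith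
      ultimately have "aut_factor \<gamma> \<tau> powi (- int (l + 2 * j - d)) = aut_factor \<gamma> \<tau> powi (- int (l + j)) * aut_factor \<gamma> \<tau> ^ (d - j)"
        by (simp only: power_int_add power_int_of_nat simp_thms)
      moreover have "of_int (\<gamma>$2$2) + \<tau> * of_int (\<gamma>$2$1) = aut_factor \<gamma> \<tau>" by (simp add: aut_factor_def mult.commute)
      ultimately show ?thesis by (simp add: F_def)
    qed
    then have "(\<Sum>\<^sub>\<infinity>C\<in>cosets. poly (F (coset_rep C)) \<tau>) = (\<Sum>\<^sub>\<infinity>C\<in>cosets. aut_factor (coset_rep C) \<tau> powi (- int (l + 2 * j - d)))"
      by (intro infsum_cong) (simp add: coset_rep(1))
    then show "poly (coset_sum (d - j) F) \<tau> = eisenstein (l + 2 * j - d) \<tau>"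
      using \<tau> by (simp add: poly_coset_sum[OF sF degF] eisenstein_def coset_series_def)
  qed
qed

subsection \<open>Eisenstein series of type \<open>(1, sym)\<close>\<close>

context
  fixes d l j :: nat and \<phi> :: "int^2^2 \<Rightarrow> complex poly \<Rightarrow> complex"
  assumes \<phi>: "\<phi> \<in> parabolic_cocycles (dual_rep (sym_rep d))"
    and j: "j \<le> d" and l: "2 * d + 5 \<le> l" "even (l + d)"
begin

lemma eisenstein_sym_dual_eq:
  "\<tau> \<in> upper_half_plane \<Longrightarrow> eisenstein_sym_dual d (int l) \<phi> j \<tau>
    = (\<Sum>\<^sub>\<infinity>C\<in>cosets. \<phi> (inv\<^bsub>SL2Z\<^esub> (coset_rep C)) (sym_vector_term d l j \<tau> (coset_rep C)))"
  by (auto simp: eisenstein_sym_dual_def sym_vector_term_slash[OF j] coset_rep(1) intro!: infsum_cong)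

lemma dual_cocycle_inv_lin: "\<gamma> \<in> carrier SL2Z \<Longrightarrow> \<phi> (inv\<^bsub>SL2Z\<^esub> \<gamma>) \<in> rep_lin_maps (sym_rep d) triv_rep"
  using dual_cocycle_lin[OF \<phi>] by simp

text \<open>Expanded in coefficients of (X - \<tau>)^j and of (c X + e)^(d - j), the terms have
  exponent (d - j) + (d + 1) in the height. With 4 more for summation, and l + j in the denominator,
  the bound 2 d + 5 on l suffices for every j.\<close>

lemma
  shows dual_term_summable: "\<tau> \<in> upper_half_plane \<Longrightarrow>
      (\<lambda>C. \<phi> (inv\<^bsub>SL2Z\<^esub> (coset_rep C)) (sym_vector_term d l j \<tau> (coset_rep C))) summable_on cosets"
    and eisenstein_sym_dual_holomorphic: "eisenstein_sym_dual d (int l) \<phi> j holomorphic_on upper_half_plane"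
    and eisenstein_sym_dual_growth: "poly_growth (eisenstein_sym_dual d (int l) \<phi> j)"
proof -
  let ?I = "Sigma {..d} (\<lambda>i. {..i})"
  let ?b = "\<lambda>(i, s) \<tau>. coeff ([:- \<tau>, 1:] ^ j) s"
  let ?a = "\<lambda>(i, s) \<gamma>::int^2^2. coeff ([:of_int (\<gamma>$2$2), of_int (\<gamma>$2$1):] ^ (d - j)) (i - s) * \<phi> (inv\<^bsub>SL2Z\<^esub> \<gamma>) (Polynomial.monom 1 i)"
  have a: "height_bounded ((d - j) + (d + 1)) (?a x)" if I: "x \<in> ?I" for x
  proof -
    obtain i s where x: "x = (i, s)" "i \<le> d" using I by auto
    show ?thesis
      unfolding x case_prod_conv
      by (rule height_bounded_mult[OF height_bounded_linear_power dual_cocycle_height_bounded[OF \<phi> x(2)]])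
  qed
  have M: "(d - j) + (d + 1) + 4 \<le> l + j" using l by linarith
  have b: "?b x holomorphic_on upper_half_plane" "poly_growth (?b x)" for x :: "nat \<times> nat"
    by (auto simp: case_prod_beta intro: holomorphic_coeff_linear_power poly_growth_coeff_linear_power)
  have f: "\<phi> (inv\<^bsub>SL2Z\<^esub> \<gamma>) (sym_vector_term d l j \<tau> \<gamma>) = (\<Sum>x\<in>?I. ?b x \<tau> * (?a x \<gamma> * aut_factor \<gamma> \<tau> powi (- int (l + j))))"
    if "\<gamma> \<in> carrier SL2Z" for \<tau> \<gamma>
  proof -
    have "\<phi> (inv\<^bsub>SL2Z\<^esub> \<gamma>) (sym_vector_term d l j \<tau> \<gamma>)
        = (\<Sum>i\<le>d. coeff (sym_vector_term d l j \<tau> \<gamma>) i * \<phi> (inv\<^bsub>SL2Z\<^esub> \<gamma>) (Polynomial.monom 1 i))"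
      by (rule dual_lin_coeffs[OF dual_cocycle_inv_lin[OF that] degree_sym_vector_term[OF j]])
    also have "\<dots> = (\<Sum>i\<le>d. \<Sum>s\<le>i. ?b (i, s) \<tau> * (?a (i, s) \<gamma> * aut_factor \<gamma> \<tau> powi (- int (l + j))))"
      unfolding coeff_sym_vector_term sum_distrib_right by (intro sum.cong refl) (simp add: mult_ac)
    also have "\<dots> = (\<Sum>x\<in>?I. ?b x \<tau> * (?a x \<gamma> * aut_factor \<gamma> \<tau> powi (- int (l + j))))"
      by (subst sum.Sigma) (auto simp: case_prod_beta)
    finally show ?thesis .
  qed
  note facts = a M b f
  show "(\<lambda>C. \<phi> (inv\<^bsub>SL2Z\<^esub> (coset_rep C)) (sym_vector_term d l j \<tau> (coset_rep C))) summable_on cosets"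
    if "\<tau> \<in> upper_half_plane"
    by (rule coset_combination_summable[OF facts that])
  have "(\<lambda>\<tau>. \<Sum>\<^sub>\<infinity>C\<in>cosets. \<phi> (inv\<^bsub>SL2Z\<^esub> (coset_rep C)) (sym_vector_term d l j \<tau> (coset_rep C))) holomorphic_on upper_half_plane"
    by (rule coset_combination_holomorphic[OF facts])
  then show "eisenstein_sym_dual d (int l) \<phi> j holomorphic_on upper_half_plane"
    by (rule holomorphic_transform) (simp add: eisenstein_sym_dual_eq)
  have "poly_growth (\<lambda>\<tau>. \<Sum>\<^sub>\<infinity>C\<in>cosets. \<phi> (inv\<^bsub>SL2Z\<^esub> (coset_rep C)) (sym_vector_term d l j \<tau> (coset_rep C)))"
    by (rule coset_combination_growth[OF facts])
  then show "poly_growth (eisenstein_sym_dual d (int l) \<phi> j)"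
    by (simp add: poly_growth_def eisenstein_sym_dual_eq)
qed

text \<open>The inverse of \<delta>\<gamma> is \<gamma>^-1 \<delta>^-1, so the cocycle relation
  evaluates \<phi>(\<delta>^-1) at the polynomial substituted by \<gamma>^-1. This undoes the
  substitution by \<gamma> contained in the term of \<delta>\<gamma>.\<close>

lemma dual_term_translate:
  assumes \<gamma>: "\<gamma> \<in> carrier SL2Z" and \<delta>: "\<delta> \<in> carrier SL2Z" and \<tau>: "\<tau> \<in> upper_half_plane"
  shows "\<phi> (inv\<^bsub>SL2Z\<^esub> (\<delta> \<otimes>\<^bsub>SL2Z\<^esub> \<gamma>)) (sym_vector_term d l j \<tau> (\<delta> \<otimes>\<^bsub>SL2Z\<^esub> \<gamma>))
    = aut_factor \<gamma> \<tau> powi (- int l) * \<phi> (inv\<^bsub>SL2Z\<^esub> \<delta>) (sym_vector_term d l j (moebius_act \<gamma> \<tau>) \<delta>)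
      + \<phi> (inv\<^bsub>SL2Z\<^esub> \<gamma>) (sym_vector_term d l j \<tau> (\<delta> \<otimes>\<^bsub>SL2Z\<^esub> \<gamma>))"
proof -
  let ?p = "sym_vector_term d l j \<tau> (\<delta> \<otimes>\<^bsub>SL2Z\<^esub> \<gamma>)" and ?q = "sym_vector_term d l j (moebius_act \<gamma> \<tau>) \<delta>"
  have \<gamma>i: "inv\<^bsub>SL2Z\<^esub> \<gamma> \<in> carrier SL2Z" and \<delta>i: "inv\<^bsub>SL2Z\<^esub> \<delta> \<in> carrier SL2Z" using \<gamma> \<delta> by auto
  have degq: "degree ?q \<le> d" and degp: "degree ?p \<le> d" by (rule degree_sym_vector_term[OF j])+
  have one: "homog_subst d \<one>\<^bsub>SL2Z\<^esub> ?q = ?q"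
    using sym.arith[of d] degq by (simp add: arithmetic_type_def sym_rep_def)
  have "homog_subst d (inv\<^bsub>SL2Z\<^esub> \<gamma>) ?p = Polynomial.smult (aut_factor \<gamma> \<tau> powi (- int l)) ?q"
    unfolding sym_vector_term_mult[OF j \<gamma> \<delta> \<tau>] homog_subst_smult homog_subst_mult[OF \<gamma> \<gamma>i degq, symmetric]
    using \<gamma> one by simp
  moreover have "\<phi> (inv\<^bsub>SL2Z\<^esub> (\<delta> \<otimes>\<^bsub>SL2Z\<^esub> \<gamma>)) ?p
      = \<phi> (inv\<^bsub>SL2Z\<^esub> \<delta>) (homog_subst d (inv\<^bsub>SL2Z\<^esub> \<gamma>) ?p) + \<phi> (inv\<^bsub>SL2Z\<^esub> \<gamma>) ?p"
    unfolding SL.inv_mult_group[OF \<delta> \<gamma>] by (rule dual_cocycle_mult[OF \<phi> \<gamma>i \<delta>i degp])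
  ultimately show ?thesis
    by (simp add: dual_lin_smult[OF dual_cocycle_inv_lin[OF \<delta>] degq])
qed

text \<open>In the second summand of \<open>dual_term_translate\<close> the functional
  \<phi>(\<gamma>^-1) is the same for all cosets. It passes through the sum and is applied to the
  vector-valued Eisenstein series.\<close>

lemma eisenstein_sym_dual_slash:
  assumes \<gamma>: "\<gamma> \<in> carrier SL2Z" and \<tau>: "\<tau> \<in> upper_half_plane"
  shows "vv_slash (int l) triv_rep (eisenstein_sym_dual d (int l) \<phi> j) \<gamma> \<tau> - eisenstein_sym_dual d (int l) \<phi> j \<tau>
    = - \<phi> (inv\<^bsub>SL2Z\<^esub> \<gamma>) (sym_vector_eisenstein d l j \<tau>)"
proof -
  let ?\<tau> = "moebius_act \<gamma> \<tau>" and ?a = "aut_factor \<gamma> \<tau> powi (- int l)"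
  let ?V = "sym_vector_term d l j"
  let ?f = "\<lambda>\<delta>. ?a * \<phi> (inv\<^bsub>SL2Z\<^esub> \<delta>) (?V ?\<tau> \<delta>)"
  let ?F = "\<lambda>\<delta>. Polynomial.smult ?a (homog_subst d \<gamma> (?V ?\<tau> \<delta>))"
  let ?h = "\<phi> (inv\<^bsub>SL2Z\<^esub> \<gamma>)"
  let ?g = "\<lambda>\<delta>. \<Sum>i\<le>d. coeff (?F \<delta>) i * ?h (Polynomial.monom 1 i)"
  note h = dual_cocycle_inv_lin[OF \<gamma>]
  have \<tau>': "?\<tau> \<in> upper_half_plane" by (rule moebius_upper_half_plane[OF \<gamma> \<tau>])
  have l4: "d + 4 \<le> l" using l by simp
  have g: "?h (?V \<tau> (\<delta> \<otimes>\<^bsub>SL2Z\<^esub> \<gamma>)) = ?g \<delta>" if "\<delta> \<in> carrier SL2Z" for \<delta>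
    using dual_lin_coeffs[OF h degree_sym_vector_term[OF j], of l \<tau> "\<delta> \<otimes>\<^bsub>SL2Z\<^esub> \<gamma>"]
    by (simp only: sym_vector_term_mult[OF j \<gamma> that \<tau>])
  have sF: "coset_summable d ?F"
    by (intro coset_summable_smult coset_summable_homog_subst sym_vector_term_summable[OF j l4 l(2)] \<tau>')
  have F: "coset_sum d ?F = sym_vector_eisenstein d l j \<tau>"
  proof -
    have "coset_sum d ?F = coset_sum d (\<lambda>\<delta>. ?V \<tau> (\<delta> \<otimes>\<^bsub>SL2Z\<^esub> \<gamma>))"
      by (rule coset_sum_cong) (rule sym_vector_term_mult[OF j \<gamma> _ \<tau>, symmetric])
    also have "\<dots> = sym_vector_eisenstein d l j \<tau>"
      using coset_sum_translate[OF \<gamma> sym_vector_term_Gamma_inf[OF j _ _ \<tau> l(2)], of d] \<tau>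
      by (simp add: sym_vector_eisenstein_def)
    finally show ?thesis .
  qed
  have "eisenstein_sym_dual d (int l) \<phi> j \<tau> = (\<Sum>\<^sub>\<infinity>C\<in>cosets. \<phi> (inv\<^bsub>SL2Z\<^esub> (coset_rep C \<otimes>\<^bsub>SL2Z\<^esub> \<gamma>)) (?V \<tau> (coset_rep C \<otimes>\<^bsub>SL2Z\<^esub> \<gamma>)))"
    unfolding eisenstein_sym_dual_eq[OF \<tau>]
  proof (rule infsum_cosets_translate[OF \<gamma>, symmetric])
    fix t \<delta> assume t: "t \<in> Gamma_inf" and \<delta>: "\<delta> \<in> carrier SL2Z"
    have ti: "inv\<^bsub>SL2Z\<^esub> t \<in> Gamma_inf" by (rule subgroup.m_inv_closed[OF subgroup_Gamma_inf t])
    have "\<phi> (inv\<^bsub>SL2Z\<^esub> (t \<otimes>\<^bsub>SL2Z\<^esub> \<delta>)) (?V \<tau> \<delta>) = \<phi> (inv\<^bsub>SL2Z\<^esub> \<delta>) (?V \<tau> \<delta>)"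
      unfolding SL.inv_mult_group[OF Gamma_inf_carrier[OF t] \<delta>]
      by (subst dual_cocycle_mult[OF \<phi> SL.inv_closed[OF \<delta>] SL.inv_closed[OF Gamma_inf_carrier[OF t]] degree_sym_vector_term[OF j]])
         (simp add: dual_cocycle_Gamma_inf[OF \<phi> ti])
    then show "\<phi> (inv\<^bsub>SL2Z\<^esub> (t \<otimes>\<^bsub>SL2Z\<^esub> \<delta>)) (?V \<tau> (t \<otimes>\<^bsub>SL2Z\<^esub> \<delta>)) = \<phi> (inv\<^bsub>SL2Z\<^esub> \<delta>) (?V \<tau> \<delta>)"
      by (simp only: sym_vector_term_Gamma_inf[OF j t \<delta> \<tau> l(2)])
  qed
  also have "\<dots> = (\<Sum>\<^sub>\<infinity>C\<in>cosets. ?f (coset_rep C) + ?g (coset_rep C))"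
    by (rule infsum_cong) (simp only: dual_term_translate[OF \<gamma> coset_rep(1) \<tau>] g[OF coset_rep(1)])
  also have "\<dots> = (\<Sum>\<^sub>\<infinity>C\<in>cosets. ?f (coset_rep C)) + (\<Sum>\<^sub>\<infinity>C\<in>cosets. ?g (coset_rep C))"
    by (rule infsum_add[OF summable_on_cmult_right[OF dual_term_summable[OF \<tau>']] coset_summable_functional[OF sF]])
  also have "(\<Sum>\<^sub>\<infinity>C\<in>cosets. ?f (coset_rep C)) = vv_slash (int l) triv_rep (eisenstein_sym_dual d (int l) \<phi> j) \<gamma> \<tau>"
    by (simp add: vv_slash_def eisenstein_sym_dual_eq[OF \<tau>'] infsum_cmult_right')
  also have "(\<Sum>\<^sub>\<infinity>C\<in>cosets. ?g (coset_rep C)) = ?h (sym_vector_eisenstein d l j \<tau>)"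
    using dual_lin_coeffs[OF h degree_coset_sum, of ?F] by (simp only: coset_sum_functional[OF sF] F)
  finally show ?thesis by simp
qed

lemma eisenstein_sym_dual_second_order:
  "eisenstein_sym_dual d (int l) \<phi> j \<in> second_order_forms (int l) triv_rep (sym_rep d)"
proof -
  let ?E = "eisenstein_sym_dual d (int l) \<phi> j"
  have out: "?E \<tau> = 0" if "\<tau> \<notin> upper_half_plane" for \<tau> using that by (simp add: eisenstein_sym_dual_def)
  have l4: "d + 4 \<le> l" using l by simp
  show ?thesis
  \<comment> \<open>The sign is written as multiplication by the form -1 of weight 0, so that
    closure under multiplication by modular forms applies.\<close>
  proof (rule triv_sym.second_orderI[where A = "{\<phi>}"
        and g = "\<lambda>_ \<tau>. rep_scale (sym_rep d) (- indicator upper_half_plane \<tau>) (sym_vector_eisenstein d l j \<tau>)"])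
    show "?E \<in> vv_functions triv_rep" "vv_holomorphic triv_rep ?E"
      by (rule triv_functionI triv_holomorphicI; simp add: out eisenstein_sym_dual_holomorphic)+
    show "moderate_growth (int l) triv_rep ?E"
      by (rule triv_moderate_growthI[OF out eisenstein_sym_dual_growth])
    show "finite {\<phi>}" by simp
    show "{\<phi>} \<subseteq> parabolic_cocycles (hom_rep (sym_rep d) triv_rep)" using \<phi> by (simp add: dual_rep_def)
    have "(\<lambda>\<tau>. - 1 * indicator upper_half_plane \<tau>) \<in> modular_forms 0"
      by (rule modular_forms_scale[OF modular_forms_one])
    from sym.vv_modular_forms_mult[OF this sym_vector_eisenstein_modular[OF j l4 l(2)]]
    show "(\<lambda>\<tau>. rep_scale (sym_rep d) (- indicator upper_half_plane \<tau>) (sym_vector_eisenstein d l j \<tau>)) \<in> vv_modular_forms (int l) (sym_rep d)"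
      by simp
    show "vv_slash (int l) triv_rep ?E \<gamma> \<tau> - ?E \<tau> = (\<Sum>\<psi>\<in>{\<phi>}. \<psi> (inv\<^bsub>SL2Z\<^esub> \<gamma>)
        (rep_scale (sym_rep d) (- indicator upper_half_plane \<tau>) (sym_vector_eisenstein d l j \<tau>)))"
      if "\<gamma> \<in> carrier SL2Z" "\<tau> \<in> upper_half_plane" for \<gamma> \<tau>
      using eisenstein_sym_dual_slash[OF that] dual_lin_smult[OF dual_cocycle_inv_lin[OF that(1)], of "sym_vector_eisenstein d l j \<tau>" "- 1"] that
      by (simp add: sym_vector_eisenstein_def degree_coset_sum)
  qed
qed

end

section \<open>Saturation at the discriminant\<close>

subsection \<open>Expansion of symmetric power valued forms in powers of \<open>X - \<tau>\<close>\<close>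

text \<open>The coefficient of (X - \<tau>)^j in the expansion of p around \<tau>.\<close>

definition taylor_coeff :: "nat \<Rightarrow> complex poly \<Rightarrow> complex \<Rightarrow> complex" where
  "taylor_coeff j p \<tau> = coeff (pcompose p [:\<tau>, 1:]) j"

lemma taylor_coeff_simps:
  "taylor_coeff j (p + q) \<tau> = taylor_coeff j p \<tau> + taylor_coeff j q \<tau>"
  "taylor_coeff j (Polynomial.smult c p) \<tau> = c * taylor_coeff j p \<tau>"
  "taylor_coeff j 0 \<tau> = 0"
  by (simp_all add: taylor_coeff_def pcompose_add pcompose_smult)

lemma taylor_coeff_diff: "taylor_coeff j (p - q) \<tau> = taylor_coeff j p \<tau> - taylor_coeff j q \<tau>"
  by (simp add: taylor_coeff_def pcompose_diff)

lemma taylor_coeff_sum: "taylor_coeff j (\<Sum>i\<in>I. p i) \<tau> = (\<Sum>i\<in>I. taylor_coeff j (p i) \<tau>)"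
  by (induction I rule: infinite_finite_induct) (simp_all add: taylor_coeff_simps)

lemma taylor_coeff_mult: "taylor_coeff j ([:- \<tau>, 1:] ^ j * r) \<tau> = poly r \<tau>"
proof -
  have 1: "pcompose [:- \<tau>, 1:] [:\<tau>, 1:] = [:0, 1:]" by (simp add: pcompose_pCons)
  have "pcompose ([:- \<tau>, 1:] ^ j) [:\<tau>, 1:] = [:0, 1:] ^ j"
    by (induction j) (simp_all only: power_0 pcompose_1 power_Suc pcompose_mult 1)
  then have "pcompose ([:- \<tau>, 1:] ^ j) [:\<tau>, 1:] = Polynomial.monom 1 j"
    by (simp add: monom_altdef)
  then show ?thesis
    by (simp add: taylor_coeff_def pcompose_mult coeff_monom_mult poly_pcompose flip: poly_0_coeff_0)
qed

lemma taylor_coeff_eq: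
  assumes "degree p \<le> d"
  shows "taylor_coeff j p \<tau> = (\<Sum>i\<le>d. coeff p i * coeff ([:\<tau>, 1:] ^ i) j)"
proof -
  have monom: "taylor_coeff j (Polynomial.monom 1 i) \<tau> = coeff ([:\<tau>, 1:] ^ i) j" for i
  proof -
    have "pcompose (Polynomial.monom 1 i) [:\<tau>, 1:] = [:\<tau>, 1:] ^ i"
      by (induction i) (simp_all add: monom_Suc pcompose_pCons monom_0)
    then show ?thesis by (simp add: taylor_coeff_def)
  qed
  have "taylor_coeff j p \<tau> = taylor_coeff j (\<Sum>i\<le>d. Polynomial.smult (coeff p i) (Polynomial.monom 1 i)) \<tau>"
    using poly_as_sum_of_monoms'[OF assms] by (simp add: smult_monom)
  also have "\<dots> = (\<Sum>i\<le>d. coeff p i * taylor_coeff j (Polynomial.monom 1 i) \<tau>)"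
    by (simp only: taylor_coeff_sum taylor_coeff_simps)
  also have "\<dots> = (\<Sum>i\<le>d. coeff p i * coeff ([:\<tau>, 1:] ^ i) j)" by (simp only: monom)
  finally show ?thesis .
qed

lemma dvd_if_taylor_coeff_zero:
  assumes "[:- \<tau>, 1:] ^ j dvd p" "taylor_coeff j p \<tau> = 0"
  shows "[:- \<tau>, 1:] ^ Suc j dvd p"
proof -
  obtain r where r: "p = [:- \<tau>, 1:] ^ j * r" using assms(1) by (elim dvdE)
  then have "poly r \<tau> = 0" using assms(2) taylor_coeff_mult by simp
  then have "[:- \<tau>, 1:] dvd r" by (simp add: poly_eq_0_iff_dvd)
  then have "[:- \<tau>, 1:] ^ j * [:- \<tau>, 1:] dvd p" unfolding r by (rule mult_dvd_mono[OF dvd_refl])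
  then show ?thesis by (simp only: power_Suc2)
qed

lemma homog_subst_times:
  assumes "degree p \<le> m" "degree q \<le> n" "\<gamma> \<in> carrier SL2Z"
  shows "homog_subst (m + n) \<gamma> (p * q) = homog_subst m \<gamma> p * homog_subst n \<gamma> q"
proof (rule poly_eqI_upper_half_plane)
  fix x assume "x \<in> upper_half_plane"
  moreover have "degree (p * q) \<le> m + n" using assms degree_mult_le[of p q] by linarith
  ultimately show "poly (homog_subst (m + n) \<gamma> (p * q)) x = poly (homog_subst m \<gamma> p * homog_subst n \<gamma> q) x"
    using assms by (simp add: poly_homog_subst aut_factor_nonzero power_add)
qed

lemma growth_le_Im:
  assumes "Im \<tau> \<ge> 1" "\<bar>Re \<tau>\<bar> \<le> 1"
  shows "growth \<tau> \<le> 6 * Im \<tau>"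
proof -
  have "1 + norm \<tau> \<le> 3 * Im \<tau>" "1 + 1 / Im \<tau> \<le> 2"
    using cmod_le[of \<tau>] assms by auto
  then have "growth \<tau> \<le> (3 * Im \<tau>) * 2"
    unfolding growth_def using assms by (intro mult_mono) auto
  then show ?thesis by simp
qed

text \<open>Taking a coefficient is a functional in the dual, once it is extended by zero beyond
  degree d.\<close>

lemma sym_modular_coeff_holomorphic:
  assumes "g \<in> vv_modular_forms k (sym_rep d)"
  shows "(\<lambda>\<tau>. coeff (g \<tau>) i) holomorphic_on upper_half_plane"
proof -
  have g: "degree (g \<tau>) \<le> d" if "\<tau> \<in> upper_half_plane" for \<tau>
    using assms that by (simp add: vv_modular_forms_def vv_functions_def)
  have "(\<lambda>p. if degree p \<le> d then coeff p i else 0) \<in> rep_lin_maps (sym_rep d) triv_rep"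
    using order_trans[OF degree_smult_le] by (auto simp: rep_lin_maps_def degree_add_le)
  moreover have "vv_holomorphic (sym_rep d) g" using assms by (simp add: vv_modular_forms_def)
  ultimately have "(\<lambda>\<tau>. if degree (g \<tau>) \<le> d then coeff (g \<tau>) i else 0) holomorphic_on upper_half_plane"
    unfolding vv_holomorphic_def sym.dual_rep_space by (rule bspec[rotated])
  then show ?thesis by (rule holomorphic_transform) (simp add: g)
qed

text \<open>Write g = (X - \<tau>)^j r with r of degree at most d - j. Slashing reproduces (X -
  \<tau>)^j up to the j-th power of the automorphy factor, so the cofactors can be compared at X =
  \<tau>, where the substitution of degree d - j gives another power. Hence the weight k + j - (d -
  j).\<close>

lemma taylor_coeff_modular:
  assumes g: "g \<in> vv_modular_forms k (sym_rep d)" and j: "j \<le> d"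
    and dvd: "\<And>\<tau>. \<tau> \<in> upper_half_plane \<Longrightarrow> [:- \<tau>, 1:] ^ j dvd g \<tau>"
  shows "(\<lambda>\<tau>. taylor_coeff j (g \<tau>) \<tau>) \<in> modular_forms (k + 2 * int j - int d)"
proof -
  have deg: "degree (g \<tau>) \<le> d" if "\<tau> \<in> upper_half_plane" for \<tau>
    using g that by (simp add: vv_modular_forms_def vv_functions_def)
  have out: "g \<tau> = 0" if "\<tau> \<notin> upper_half_plane" for \<tau>
    using g that by (simp add: vv_modular_forms_def vv_functions_def)
  let ?a = "\<lambda>i \<tau>. coeff ([:\<tau>, 1:] ^ i) j"
  have eq: "taylor_coeff j (g \<tau>) \<tau> = (\<Sum>i\<le>d. coeff (g \<tau>) i * ?a i \<tau>)" if "\<tau> \<in> upper_half_plane" for \<tau>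
    by (rule taylor_coeff_eq[OF deg[OF that]])
  \<comment> \<open>A concrete norm, so that moderate growth of g bounds all its coefficients
    simultaneously.\<close>
  let ?N = "\<lambda>p. \<Sum>i\<le>d. norm (coeff p i)"
  have N: "rep_norm (sym_rep d) ?N"
    unfolding rep_norm_def sym_rep_simps
  proof (intro conjI ballI allI)
    fix v w :: "complex poly" and c assume v: "v \<in> {p. degree p \<le> d}"
    show "0 \<le> ?N v" by (rule sum_nonneg) simp
    have "?N v = 0 \<longleftrightarrow> (\<forall>i\<le>d. coeff v i = 0)" by (subst sum_nonneg_eq_0_iff) auto
    also have "\<dots> \<longleftrightarrow> v = 0"
      using v by (metis coeff_0 leading_coeff_0_iff mem_Collect_eq)
    finally show "?N v = 0 \<longleftrightarrow> v = 0" .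
    show "?N (v + w) \<le> ?N v + ?N w"
      by (simp add: sum_mono norm_triangle_ineq flip: sum.distrib)
    show "?N (Polynomial.smult c v) = norm c * ?N v" by (simp add: norm_mult sum_distrib_left)
  qed
  have "moderate_growth k (sym_rep d) g" using g by (simp add: vv_modular_forms_def)
  then obtain K Y n where Y: "Y \<ge> 1" and K: "\<And>\<tau>. Im \<tau> \<ge> Y \<Longrightarrow> \<bar>Re \<tau>\<bar> \<le> 1 \<Longrightarrow> ?N (g \<tau>) \<le> K * Im \<tau> ^ n"
    by (rule sym.moderate_growthD[OF _ N]) (rule that)
  have a: "poly_growth (?a i)" "?a i holomorphic_on A" for i A
    using poly_growth_coeff_scaled_linear_power[of 1] holomorphic_coeff_scaled_linear_power[of 1] by simp_all
  have gr: "poly_growth (\<lambda>\<tau>. \<Sum>i\<le>d. of_real (norm (?a i \<tau>)))"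
    using a(1) by (intro poly_growth_sum) (simp add: poly_growth_def)
  obtain L m where L: "L \<ge> 0" "\<And>\<tau> m'. \<tau> \<in> upper_half_plane \<Longrightarrow> m \<le> m' \<Longrightarrow>
      norm (\<Sum>i\<le>d. complex_of_real (norm (?a i \<tau>))) \<le> L * growth \<tau> ^ m'"
    by (rule poly_growthE[OF gr]) (rule that)
  show ?thesis
  proof (rule modular_formI)
    show "taylor_coeff j (g \<tau>) \<tau> = 0" if "\<tau> \<notin> upper_half_plane" for \<tau>
      by (simp add: out[OF that] taylor_coeff_simps)
    have "(\<lambda>\<tau>. \<Sum>i\<le>d. coeff (g \<tau>) i * ?a i \<tau>) holomorphic_on upper_half_plane"
      by (intro holomorphic_on_sum holomorphic_on_mult sym_modular_coeff_holomorphic[OF g] a(2))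
    then show "(\<lambda>\<tau>. taylor_coeff j (g \<tau>) \<tau>) holomorphic_on upper_half_plane"
      by (rule holomorphic_transform) (simp add: eq)
    show "norm (taylor_coeff j (g \<tau>) \<tau>) \<le> (K * (L * 6 ^ m)) * Im \<tau> ^ (n + m)" if \<tau>: "Im \<tau> \<ge> Y" "\<bar>Re \<tau>\<bar> \<le> 1" for \<tau>
    proof -
      have \<tau>': "\<tau> \<in> upper_half_plane" using \<tau> Y by (simp add: upper_half_plane_def)
      have S: "(\<Sum>i\<le>d. norm (?a i \<tau>)) \<le> L * 6 ^ m * Im \<tau> ^ m"
      proof -
        have "norm (\<Sum>i\<le>d. complex_of_real (norm (?a i \<tau>))) = (\<Sum>i\<le>d. norm (?a i \<tau>))"
          by (simp add: sum_nonneg flip: of_real_sum)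
        then have "(\<Sum>i\<le>d. norm (?a i \<tau>)) \<le> L * growth \<tau> ^ m" using L(2)[OF \<tau>' order_refl] by simp
        also have "\<dots> \<le> L * (6 * Im \<tau>) ^ m"
          using growth_le_Im[of \<tau>] growth_ge_1[OF \<tau>'] \<tau> Y L(1) by (intro mult_left_mono power_mono) auto
        finally show ?thesis by (simp add: power_mult_distrib mult.assoc)
      qed
      have "norm (taylor_coeff j (g \<tau>) \<tau>) \<le> (\<Sum>i\<le>d. norm (coeff (g \<tau>) i) * norm (?a i \<tau>))"
        unfolding eq[OF \<tau>'] by (rule order_trans[OF norm_sum]) (simp add: norm_mult)
      also have "\<dots> \<le> (\<Sum>i\<le>d. norm (coeff (g \<tau>) i) * (\<Sum>i\<le>d. norm (?a i \<tau>)))"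
        by (intro sum_mono mult_left_mono member_le_sum) auto
      also have "\<dots> = ?N (g \<tau>) * (\<Sum>i\<le>d. norm (?a i \<tau>))" by (simp add: sum_distrib_right)
      also have "\<dots> \<le> (K * Im \<tau> ^ n) * (L * 6 ^ m * Im \<tau> ^ m)"
        using K[OF \<tau>] by (intro mult_mono S K[OF \<tau>]) (auto intro!: sum_nonneg order_trans[OF sum_nonneg K[OF \<tau>]])
      finally show ?thesis by (simp add: power_add mult_ac)
    qed
    show "invariant (k + 2 * int j - int d) (\<lambda>\<tau>. taylor_coeff j (g \<tau>) \<tau>)"
      unfolding invariant_def
    proof (intro ballI)
      fix \<gamma> \<tau> assume \<gamma>: "\<gamma> \<in> carrier SL2Z" and \<tau>: "\<tau> \<in> upper_half_plane"
      let ?\<tau> = "moebius_act \<gamma> \<tau>" and ?c = "aut_factor \<gamma> \<tau>"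
      have \<tau>': "?\<tau> \<in> upper_half_plane" by (rule moebius_upper_half_plane[OF \<gamma> \<tau>])
      have c: "?c \<noteq> 0" by (rule aut_factor_nonzero[OF \<gamma> \<tau>])
      obtain r where r: "g \<tau> = [:- \<tau>, 1:] ^ j * r" using dvd[OF \<tau>] by (elim dvdE)
      obtain r' where r': "g ?\<tau> = [:- ?\<tau>, 1:] ^ j * r'" using dvd[OF \<tau>'] by (elim dvdE)
      have degr': "degree r' \<le> d - j"
      proof (cases "r' = 0")
        case False
        then have "degree (g ?\<tau>) = j + degree r'" unfolding r' by (subst degree_mult_eq) (auto simp: degree_power_eq)
        then show ?thesis using deg[OF \<tau>'] by simp
      qed simp
      have "homog_subst d \<gamma> (g ?\<tau>) = homog_subst j \<gamma> ([:- ?\<tau>, 1:] ^ j) * homog_subst (d - j) \<gamma> r'"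
        using homog_subst_times[OF degree_linear_power[of "- ?\<tau>" 1 j] degr' \<gamma>] j by (simp add: r')
      then have "Polynomial.smult (?c ^ j) (homog_subst d \<gamma> (g ?\<tau>)) = [:- \<tau>, 1:] ^ j * homog_subst (d - j) \<gamma> r'"
        using homog_subst_linear_power[OF \<gamma> \<tau>, of j j] by (simp flip: mult_smult_left)
      moreover have "Polynomial.smult (?c powi (- k)) (homog_subst d \<gamma> (g ?\<tau>)) = g \<tau>"
        using g \<gamma> \<tau> by (simp add: vv_modular_forms_def vv_slash_def)
      \<comment> \<open>Both sides carry (X - \<tau>)^j; it is cancelled as a polynomial before X =
        \<tau> is inserted, where it would vanish for j > 0.\<close>
      ultimately have "[:- \<tau>, 1:] ^ j * Polynomial.smult (?c powi (- k)) (homog_subst (d - j) \<gamma> r')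
          = [:- \<tau>, 1:] ^ j * Polynomial.smult (?c ^ j) r"
        unfolding r mult_smult_right by (metis mult.commute smult_smult)
      then have "Polynomial.smult (?c powi (- k)) (homog_subst (d - j) \<gamma> r') = Polynomial.smult (?c ^ j) r"
        by (subst (asm) mult_left_cancel) auto
      then have "poly (Polynomial.smult (?c powi (- k)) (homog_subst (d - j) \<gamma> r')) \<tau> = poly (Polynomial.smult (?c ^ j) r) \<tau>"
        by simp
      then have "?c powi (- k) * ?c ^ (d - j) * poly r' ?\<tau> = ?c ^ j * poly r \<tau>"
        by (simp add: poly_homog_subst[OF degr' c] mult.assoc)
      moreover have "?c powi (- k) * ?c ^ (d - j) = ?c powi (int d - int j - k)"
        using c j by (simp add: of_nat_diff flip: power_int_of_nat power_int_add)
      moreover have "?c ^ j = ?c powi (int d - int j - k) * ?c powi (k + 2 * int j - int d)"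
        using c by (simp flip: power_int_of_nat power_int_add)
      ultimately have "?c powi (int d - int j - k) * poly r' ?\<tau>
          = ?c powi (int d - int j - k) * (?c powi (k + 2 * int j - int d) * poly r \<tau>)"
        by (simp only: mult.assoc)
      then have "poly r' ?\<tau> = ?c powi (k + 2 * int j - int d) * poly r \<tau>"
        using c by (simp only: mult_cancel_left power_int_eq_0_iff) simp
      then show "taylor_coeff j (g ?\<tau>) ?\<tau> = ?c powi (k + 2 * int j - int d) * taylor_coeff j (g \<tau>) \<tau>"
        by (simp only: r r' taylor_coeff_mult)
    qed
  qed
qed

lemma smult_sum_right: "Polynomial.smult c (\<Sum>i\<in>I. p i) = (\<Sum>i\<in>I. Polynomial.smult c (p i))"
  by (induction I rule: infinite_finite_induct) (simp_all add: smult_add_right)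

lemma vv_modular_forms_degree: "g \<in> vv_modular_forms k (sym_rep d) \<Longrightarrow> \<tau> \<in> upper_half_plane \<Longrightarrow> degree (g \<tau>) \<le> d"
  by (simp add: vv_modular_forms_def vv_functions_def)

text \<open>
  If \<open>(X - \<tau>)\<^sup>j\<close> divides \<open>g\<close>, its leading coefficient is a modular form, and subtracting multiples of
  vector-valued Eisenstein series from \<open>\<Delta>\<^sup>N g\<close> yields a form divisible by \<open>(X - \<tau>)\<^sup>j\<^sup>+\<^sup>1\<close>.
\<close>

lemma delta_power_sym_form:
  assumes n0: "2 * d + 4 \<le> 12 * n0"
  shows "\<exists>N m. \<forall>k. \<forall>g\<in>vv_modular_forms k (sym_rep d).
    \<exists>u. (\<forall>j\<le>d. \<forall>n<m. u j n \<in> modular_forms (k + 12 * int N - int (12 * (n0 + n) + d - 2 * j))) \<and>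
        (\<forall>\<tau>\<in>upper_half_plane. Polynomial.smult (ramanujan_delta \<tau> ^ N) (g \<tau>)
           = (\<Sum>j\<le>d. \<Sum>n<m. Polynomial.smult (u j n \<tau>) (sym_vector_eisenstein d (12 * (n0 + n) + d - 2 * j) j \<tau>)))"
proof -
  obtain N m H where H: "\<And>n. n < m \<Longrightarrow> H n \<in> modular_forms (12 * int N - 12 * int (n0 + n))"
    and HE: "\<And>\<tau>. \<tau> \<in> upper_half_plane \<Longrightarrow>
      ramanujan_delta \<tau> ^ N = (\<Sum>n<m. H n \<tau> * eisenstein (12 * (n0 + n)) \<tau>)"
    by (rule delta_power_eisenstein[of n0]) (rule that)
  \<comment> \<open>Chosen such that w + 2 j - d = 12 (n0 + n), the weight of the leading
    coefficient. The assumption on n0 gives w \<ge> d + 4 for all j up to d, as convergence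
    requires.\<close>
  define w where "w = (\<lambda>j n. 12 * (n0 + n) + d - 2 * j)"
  define V where "V = (\<lambda>j n. sym_vector_eisenstein d (w j n) j)"
  have w: "d + 4 \<le> w j n" "even (w j n + d)" "w j n + 2 * j - d = 12 * (n0 + n)"
    "int (w j n) + 2 * int j = 12 * int (n0 + n) + int d" if "j \<le> d" for j n
    using n0 that by (auto simp: w_def)
  have V: "V j n \<in> vv_modular_forms (int (w j n)) (sym_rep d)" if "j \<le> d" for j n
    unfolding V_def by (rule sym_vector_eisenstein_modular[OF that w(1,2)[OF that]])
  \<comment> \<open>Induction on the number i of remaining steps of the filtration. For i = 0
    divisibility by (X - \<tau>)^(d + 1) forces g to vanish, and each step costs one more factor
    \<Delta>^N.\<close>
  have "\<exists>u. (\<forall>j\<le>d. \<forall>n<m. u j n \<in> modular_forms (k + 12 * int (N * i) - int (w j n))) \<and>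
      (\<forall>\<tau>\<in>upper_half_plane. Polynomial.smult (ramanujan_delta \<tau> ^ (N * i)) (g \<tau>)
         = (\<Sum>j\<le>d. \<Sum>n<m. Polynomial.smult (u j n \<tau>) (V j n \<tau>)))"
    if "g \<in> vv_modular_forms k (sym_rep d)" "i \<le> d + 1" "\<forall>\<tau>\<in>upper_half_plane. [:- \<tau>, 1:] ^ (d + 1 - i) dvd g \<tau>"
    for i k g
    using that
  proof (induction i arbitrary: k g)
    case 0
    have "g \<tau> = 0" if "\<tau> \<in> upper_half_plane" for \<tau>
    proof (rule ccontr)
      assume "g \<tau> \<noteq> 0"
      moreover have "[:- \<tau>, 1:] ^ (d + 1) dvd g \<tau>" using 0 that by simp
      ultimately have "degree ([:- \<tau>, 1:] ^ (d + 1)) \<le> degree (g \<tau>)" by (intro dvd_imp_degree_le)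
      moreover have "degree ([:- \<tau>, 1:] ^ (d + 1)) = d + 1" by (subst degree_power_eq) auto
      ultimately show False using vv_modular_forms_degree[OF 0(1) that] by simp
    qed
    then show ?case
      by (intro exI[of _ "\<lambda>_ _ _. 0"]) (simp add: modular_forms_0)
  next
    case (Suc i)
    define j where "j = d - i"
    have j: "j \<le> d" "d + 1 - Suc i = j" "d + 1 - i = Suc j" using Suc.prems(2) by (auto simp: j_def)
    define c where "c = (\<lambda>\<tau>. taylor_coeff j (g \<tau>) \<tau>)"
    have dvd: "[:- \<tau>, 1:] ^ j dvd g \<tau>" if "\<tau> \<in> upper_half_plane" for \<tau>
      using Suc.prems(3) that j(2) by simp
    have c: "c \<in> modular_forms (k + 2 * int j - int d)"
      unfolding c_def by (rule taylor_coeff_modular[OF Suc.prems(1) j(1) dvd])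
    define b where "b = (\<lambda>n \<tau>. c \<tau> * H n \<tau>)"
    have b: "b n \<in> modular_forms (k + 12 * int N - int (w j n))" if "n < m" for n
    proof -
      have "k + 2 * int j - int d + (12 * int N - 12 * int (n0 + n)) = k + 12 * int N - int (w j n)"
        using w(4)[OF j(1), of n] by linarith
      then show ?thesis using modular_forms_mult[OF c H[OF that]] by (simp only: b_def)
    qed
    \<comment> \<open>The subtracted series have leading coefficients c H_n times the classical
      Eisenstein series, which sum up to \<Delta>^N c. So the coefficient of (X - \<tau>)^j
      cancels.\<close>
    define g' where "g' = (\<lambda>\<tau>. Polynomial.smult (mf_pow ramanujan_delta N \<tau>) (g \<tau>)
      + (\<Sum>n<m. Polynomial.smult (- 1 * b n \<tau>) (V j n \<tau>)))"
    have "(\<lambda>\<tau>. Polynomial.smult (- 1 * b n \<tau>) (V j n \<tau>)) \<in> vv_modular_forms (k + 12 * int N) (sym_rep d)" if "n < m" for n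
      using sym.vv_modular_forms_mult[OF modular_forms_scale[OF b[OF that], of "- 1"] V[OF j(1)], of n] by simp
    then have "(\<lambda>\<tau>. \<Sum>n<m. Polynomial.smult (- 1 * b n \<tau>) (V j n \<tau>)) \<in> vv_modular_forms (k + 12 * int N) (sym_rep d)"
      by (intro sym.vv_modular_forms_sum) auto
    moreover have "(\<lambda>\<tau>. Polynomial.smult (mf_pow ramanujan_delta N \<tau>) (g \<tau>)) \<in> vv_modular_forms (k + 12 * int N) (sym_rep d)"
      using sym.vv_modular_forms_mult[OF delta_pow Suc.prems(1), of N] by (simp add: add.commute)
    ultimately have g': "g' \<in> vv_modular_forms (k + 12 * int N) (sym_rep d)"
      unfolding g'_def by (intro sym.vv_modular_forms_add)
    have "[:- \<tau>, 1:] ^ Suc j dvd g' \<tau>" if \<tau>: "\<tau> \<in> upper_half_plane" for \<tau>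
    proof (rule dvd_if_taylor_coeff_zero)
      have lead: "[:- \<tau>, 1:] ^ j dvd V j n \<tau> \<and> taylor_coeff j (V j n \<tau>) \<tau> = eisenstein (12 * (n0 + n)) \<tau>" for n
      proof -
        obtain r where "V j n \<tau> = [:- \<tau>, 1:] ^ j * r" "poly r \<tau> = eisenstein (12 * (n0 + n)) \<tau>"
          using sym_vector_eisenstein_leading[OF j(1) w(1,2)[OF j(1)] \<tau>] unfolding V_def w(3)[OF j(1)] by blast
        then show ?thesis by (simp add: taylor_coeff_mult)
      qed
      show "[:- \<tau>, 1:] ^ j dvd g' \<tau>"
        unfolding g'_def using lead dvd[OF \<tau>] by (intro dvd_add dvd_sum dvd_smult) auto
      have "taylor_coeff j (g' \<tau>) \<tau> = ramanujan_delta \<tau> ^ N * c \<tau> - (\<Sum>n<m. b n \<tau> * eisenstein (12 * (n0 + n)) \<tau>)"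
        using lead \<tau> by (simp add: g'_def taylor_coeff_simps taylor_coeff_diff taylor_coeff_sum c_def mf_pow_def sum_negf)
      also have "\<dots> = 0"
        by (simp add: HE[OF \<tau>] b_def sum_distrib_left sum_distrib_right mult_ac)
      finally show "taylor_coeff j (g' \<tau>) \<tau> = 0" .
    qed
    then have "\<forall>\<tau>\<in>upper_half_plane. [:- \<tau>, 1:] ^ (d + 1 - i) dvd g' \<tau>" using j(3) by simp
    from Suc.IH[OF g' _ this] Suc.prems(2) obtain u
      where u: "\<forall>j\<le>d. \<forall>n<m. u j n \<in> modular_forms (k + 12 * int N + 12 * int (N * i) - int (w j n))"
        and ug: "\<forall>\<tau>\<in>upper_half_plane. Polynomial.smult (ramanujan_delta \<tau> ^ (N * i)) (g' \<tau>)
          = (\<Sum>j\<le>d. \<Sum>n<m. Polynomial.smult (u j n \<tau>) (V j n \<tau>))"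
      by auto
    \<comment> \<open>The hypothesis treats \<Delta>^(N i) g', so what was subtracted in this step
      has to be put back with the same power of \<Delta>.\<close>
    define u' where "u' = (\<lambda>j' n \<tau>. u j' n \<tau> + (if j' = j then mf_pow ramanujan_delta (N * i) \<tau> * b n \<tau> else 0))"
    have "u' j' n \<in> modular_forms (k + 12 * int (N * Suc i) - int (w j' n))" if "j' \<le> d" "n < m" for j' n
    proof -
      have wt: "k + 12 * int (N * Suc i) - int (w j' n) = k + 12 * int N + 12 * int (N * i) - int (w j' n)"
        by (simp add: algebra_simps)
      have "(\<lambda>\<tau>. if j' = j then mf_pow ramanujan_delta (N * i) \<tau> * b n \<tau> else 0)
          \<in> modular_forms (k + 12 * int N + 12 * int (N * i) - int (w j' n))"
        using modular_forms_mult[OF delta_pow[of "N * i"] b[OF that(2)]]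
        by (cases "j' = j") (simp_all add: modular_forms_0 algebra_simps)
      with u that show ?thesis unfolding wt u'_def by (intro modular_forms_add) auto
    qed
    moreover have "Polynomial.smult (ramanujan_delta \<tau> ^ (N * Suc i)) (g \<tau>)
        = (\<Sum>j\<le>d. \<Sum>n<m. Polynomial.smult (u' j n \<tau>) (V j n \<tau>))" if \<tau>: "\<tau> \<in> upper_half_plane" for \<tau>
    proof -
      let ?D = "ramanujan_delta \<tau> ^ (N * i)"
      have "(\<Sum>j'\<le>d. \<Sum>n<m. Polynomial.smult (u' j' n \<tau>) (V j' n \<tau>))
          = (\<Sum>j'\<le>d. \<Sum>n<m. Polynomial.smult (u j' n \<tau>) (V j' n \<tau>))
            + (\<Sum>j'\<le>d. if j' = j then \<Sum>n<m. Polynomial.smult (?D * b n \<tau>) (V j' n \<tau>) else 0)"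
        unfolding sum.distrib[symmetric] using \<tau>
        by (intro sum.cong refl) (auto simp: u'_def mf_pow_def smult_add_left sum.distrib)
      also have "\<dots> = Polynomial.smult ?D (g' \<tau>) + (\<Sum>n<m. Polynomial.smult (?D * b n \<tau>) (V j n \<tau>))"
        using j(1) ug \<tau> by (simp add: sum.delta)
      also have "\<dots> = Polynomial.smult (ramanujan_delta \<tau> ^ (N * Suc i)) (g \<tau>)"
        using \<tau> by (simp add: g'_def mf_pow_def smult_diff_right smult_sum_right sum_negf power_add mult.commute)
      finally show ?thesis ..
    qed
    ultimately show ?case by blast
  qed
  from this[where i = "d + 1"] show ?thesis
    unfolding w_def V_def by (intro exI[of _ "N * (d + 1)"] exI[of _ m] allI ballI) simp
qed

subsection \<open>Cancelling the cocycle\<close>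

context arith_rep_pair
begin

lemma second_order_functions: "f \<in> second_order_forms k \<rho> \<sigma> \<Longrightarrow> f \<in> vv_functions \<rho>"
  by (simp add: second_order_forms_def)

lemma vv_slash_sum:
  assumes "\<gamma> \<in> carrier SL2Z" "\<tau> \<in> upper_half_plane" "\<And>i. i \<in> I \<Longrightarrow> p i \<in> second_order_forms k \<rho> \<sigma>"
  shows "vv_slash k \<rho> (\<lambda>\<tau>. \<Sum>i\<in>I. p i \<tau>) \<gamma> \<tau> = (\<Sum>i\<in>I. vv_slash k \<rho> (p i) \<gamma> \<tau>)"
proof -
  have zero: "vv_slash k \<rho> (\<lambda>_. 0) \<gamma> \<tau> = 0"
    using \<rho>.vv_modular_forms_zero[of k] assms by (simp add: vv_modular_forms_def)
  show ?thesis
    using assms(3)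
  proof (induction I rule: infinite_finite_induct)
    case (insert i I)
    have "(\<lambda>\<tau>. \<Sum>i\<in>I. p i \<tau>) \<in> second_order_forms k \<rho> \<sigma>"
      using insert.prems by (intro second_order_sum) auto
    then have "vv_slash k \<rho> (\<lambda>\<tau>. p i \<tau> + (\<Sum>i\<in>I. p i \<tau>)) \<gamma> \<tau>
        = vv_slash k \<rho> (p i) \<gamma> \<tau> + vv_slash k \<rho> (\<lambda>\<tau>. \<Sum>i\<in>I. p i \<tau>) \<gamma> \<tau>"
      using insert.prems by (intro \<rho>.vv_slash_add assms second_order_functions) auto
    then show ?case using insert by simp
  qed (simp_all add: zero)
qed

text \<open>The defects of F and of the combination of the u_i e_i cancel, so their sum is
  invariant, and it inherits holomorphy and growth as a second order form. The defects D_i stay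
  abstract in order to cover both types.\<close>

lemma second_order_reduction:
  assumes S: "S \<subseteq> carrier M" and F: "F \<in> second_order_forms k \<rho> \<sigma>"
    and e: "\<And>i. i \<in> I \<Longrightarrow> e i \<in> second_order_forms (l i) \<rho> \<sigma>"
      "\<And>i. i \<in> I \<Longrightarrow> homogeneous (l i) (e i) \<in> S"
    and u: "\<And>i. i \<in> I \<Longrightarrow> u i \<in> modular_forms (k - l i)"
    and slash_e: "\<And>i \<gamma> \<tau>. i \<in> I \<Longrightarrow> \<gamma> \<in> carrier SL2Z \<Longrightarrow> \<tau> \<in> upper_half_plane \<Longrightarrow>
      vv_slash (l i) \<rho> (e i) \<gamma> \<tau> - e i \<tau> = - D i \<gamma> \<tau>"
    and slash_F: "\<And>\<gamma> \<tau>. \<gamma> \<in> carrier SL2Z \<Longrightarrow> \<tau> \<in> upper_half_plane \<Longrightarrow>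
      vv_slash k \<rho> F \<gamma> \<tau> - F \<tau> = (\<Sum>i\<in>I. rep_scale \<rho> (u i \<tau>) (D i \<gamma> \<tau>))"
  shows "\<exists>G\<in>module_span modular_ring M S. \<exists>h\<in>vv_modular_forms k \<rho>. homogeneous k F = G + homogeneous k h"
proof -
  let ?P = "\<lambda>i \<tau>. rep_scale \<rho> (u i \<tau>) (e i \<tau>)"
  let ?h = "\<lambda>\<tau>. F \<tau> + (\<Sum>i\<in>I. ?P i \<tau>)"
  let ?G = "\<Sum>i\<in>I. homogeneous k (\<lambda>\<tau>. rep_scale \<rho> (- 1 * u i \<tau>) (e i \<tau>))"
  have P: "?P i \<in> second_order_forms k \<rho> \<sigma>" if "i \<in> I" for i
    using second_order_mult[OF u[OF that] e(1)[OF that]] by simp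
  have sumP: "(\<lambda>\<tau>. \<Sum>i\<in>I. ?P i \<tau>) \<in> second_order_forms k \<rho> \<sigma>" by (rule second_order_sum) (rule P)
  have inv: "vv_slash k \<rho> ?h \<gamma> \<tau> = ?h \<tau>" if \<gamma>: "\<gamma> \<in> carrier SL2Z" and \<tau>: "\<tau> \<in> upper_half_plane" for \<gamma> \<tau>
  proof -
    have slash_P: "vv_slash k \<rho> (?P i) \<gamma> \<tau> = ?P i \<tau> - rep_scale \<rho> (u i \<tau>) (D i \<gamma> \<tau>)" if "i \<in> I" for i
    proof -
      have "vv_slash k \<rho> (?P i) \<gamma> \<tau> = rep_scale \<rho> (u i \<tau>) (vv_slash (l i) \<rho> (e i) \<gamma> \<tau>)"
        using \<rho>.vv_slash_mult[OF \<gamma> \<tau> second_order_functions[OF e(1)[OF that]] modular_form_invariant[OF u[OF that] \<gamma> \<tau>], of "l i"]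
        by simp
      also have "vv_slash (l i) \<rho> (e i) \<gamma> \<tau> = e i \<tau> - D i \<gamma> \<tau>"
        using slash_e[OF that \<gamma> \<tau>] by (simp add: algebra_simps)
      finally show ?thesis by (simp add: \<rho>.V.scale_right_diff_distrib)
    qed
    have "vv_slash k \<rho> ?h \<gamma> \<tau> = vv_slash k \<rho> F \<gamma> \<tau> + (\<Sum>i\<in>I. vv_slash k \<rho> (?P i) \<gamma> \<tau>)"
      using \<rho>.vv_slash_add[OF \<gamma> \<tau> second_order_functions[OF F] second_order_functions[OF sumP]] vv_slash_sum[OF \<gamma> \<tau> P]
      by simp
    also have "(\<Sum>i\<in>I. vv_slash k \<rho> (?P i) \<gamma> \<tau>) = (\<Sum>i\<in>I. ?P i \<tau>) - (vv_slash k \<rho> F \<gamma> \<tau> - F \<tau>)"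
      by (simp add: slash_P sum_subtractf slash_F[OF \<gamma> \<tau>])
    finally show ?thesis by simp
  qed
  have "?h \<in> second_order_forms k \<rho> \<sigma>" by (rule second_order_add[OF F sumP])
  then have h: "?h \<in> vv_modular_forms k \<rho>"
    using inv by (simp add: second_order_forms_def vv_modular_forms_def)
  have "homogeneous k (\<lambda>\<tau>. rep_scale \<rho> (- 1 * u i \<tau>) (e i \<tau>)) \<in> module_span modular_ring M S" if "i \<in> I" for i
    using module_span_generator[OF S e(2)[OF that] modular_forms_scale[OF u[OF that], of "- 1"]] by simp
  then have "?G \<in> module_span modular_ring M S"
    by (induction I rule: infinite_finite_induct) (simp_all add: module_span_zero[OF S] module_span_add[OF S])
  moreover have "homogeneous k F = ?G + homogeneous k ?h"
  proof (intro ext)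
    fix l \<tau>
    have "?G l \<tau> = (if l = k then \<Sum>i\<in>I. - ?P i \<tau> else 0)"
      by (induction I rule: infinite_finite_induct) (simp_all add: homogeneous_def)
    then show "homogeneous k F l \<tau> = (?G + homogeneous k ?h) l \<tau>"
      by (simp add: homogeneous_def sum_negf)
  qed
  ultimately show ?thesis using h by blast
qed

lemma delta_pow_slash:
  assumes "f \<in> second_order_forms k \<rho> \<sigma>" "\<gamma> \<in> carrier SL2Z" "\<tau> \<in> upper_half_plane"
  shows "vv_slash (k + 12 * int N) \<rho> (\<lambda>\<tau>. rep_scale \<rho> (mf_pow ramanujan_delta N \<tau>) (f \<tau>)) \<gamma> \<tau>
      - rep_scale \<rho> (mf_pow ramanujan_delta N \<tau>) (f \<tau>)
    = rep_scale \<rho> (ramanujan_delta \<tau> ^ N) (vv_slash k \<rho> f \<gamma> \<tau> - f \<tau>)"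
  using \<rho>.vv_slash_mult[OF assms(2,3) second_order_functions[OF assms(1)] modular_form_invariant[OF delta_pow[of N] assms(2,3)], of k] assms(3)
  by (simp add: mf_pow_def \<rho>.V.scale_right_diff_distrib add.commute)

lemma homogeneous_carrier:
  assumes "f \<in> second_order_forms k \<rho> \<sigma>"
  shows "homogeneous k f \<in> carrier M"
  unfolding carrier_M graded_sum_def
  using assms second_order_zero finite_subset[OF homogeneous_support[of k f]]
  by (auto simp: homogeneous_def zero_fun_def)

end

text \<open>A linear map on the one-dimensional space is determined by its value at 1, which
  identifies the linear maps to V with V.\<close>

lemma hom_triv_cocycle:
  assumes \<phi>: "\<phi> \<in> parabolic_cocycles (hom_rep triv_rep (sym_rep d))"
  shows "(\<lambda>\<gamma>. \<phi> \<gamma> 1) \<in> parabolic_cocycles (sym_rep d)"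
    and "\<gamma> \<in> carrier SL2Z \<Longrightarrow> \<phi> \<gamma> z = Polynomial.smult z (\<phi> \<gamma> 1)"
proof -
  show "(\<lambda>\<gamma>. \<phi> \<gamma> 1) \<in> parabolic_cocycles (sym_rep d)"
    using \<phi> lin_maps_mem[OF sym_triv.cocycle_lin[OF \<phi>], of _ 1]
    by (auto simp: parabolic_cocycles_def hom_rep_def)
  show "\<phi> \<gamma> z = Polynomial.smult z (\<phi> \<gamma> 1)" if "\<gamma> \<in> carrier SL2Z"
    using lin_maps_scale[OF sym_triv.cocycle_lin[OF \<phi> that], of 1 z] by simp
qed

lemma saturation_eisenstein_sym:
  fixes d :: nat and k0 :: int
  shows "saturation modular_ring (second_order_module (sym_rep d) triv_rep)
      (pure_eisenstein_sym d k0 <+>\<^bsub>second_order_module (sym_rep d) triv_rep\<^esub>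
        graded_sum (\<lambda>k. vv_modular_forms k (sym_rep d)))
      (homogeneous 12 ramanujan_delta)
    = carrier (second_order_module (sym_rep d) triv_rep)"
proof -
  \<comment> \<open>The summand \<open>nat k0\<close> lifts the weights 12 n above k0, and d + 5
    brings them into the range of convergence.\<close>
  define n0 where "n0 = nat k0 + d + 5"
  define w where "w = (\<lambda>n. 12 * (n0 + n))"
  have w: "d + 5 \<le> w n" "even (w n)" "k0 \<le> int (w n)" for n
    by (auto simp: w_def n0_def)
  obtain N m H where H: "\<And>n. n < m \<Longrightarrow> H n \<in> modular_forms (12 * int N - 12 * int (n0 + n))"
    and HE: "\<And>\<tau>. \<tau> \<in> upper_half_plane \<Longrightarrow> ramanujan_delta \<tau> ^ N = (\<Sum>n<m. H n \<tau> * eisenstein (12 * (n0 + n)) \<tau>)"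
    by (rule delta_power_eisenstein[of n0]) (rule that)
  let ?E = "\<lambda>n. eisenstein_sym d (int (w n))"
  define S where "S = {homogeneous (int (w n)) (?E n \<phi>) | n \<phi>. \<phi> \<in> parabolic_cocycles (sym_rep d)}"
  have S: "S \<subseteq> carrier (sym_triv.M d)"
    using sym_triv.homogeneous_carrier[OF eisenstein_sym_second_order[OF _ w(1,2)]] by (auto simp: S_def)
  show ?thesis
    unfolding pure_eisenstein_sym_def sym_triv.M_def[symmetric]
  proof (rule sym_triv.saturation_eq_carrier[OF S, where N = N])
    show "S \<subseteq> {homogeneous k (eisenstein_sym d k \<phi>) |k \<phi>. k0 \<le> k \<and> even k \<and> \<phi> \<in> parabolic_cocycles (sym_rep d)}"
      using w unfolding S_def by fastforce
    show "(\<lambda>\<tau>. f \<tau> + g \<tau>) \<in> vv_modular_forms k (sym_rep d)"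
      if "f \<in> vv_modular_forms k (sym_rep d)" "g \<in> vv_modular_forms k (sym_rep d)" for k f g
      using that by (rule sym.vv_modular_forms_add)
    show "(\<lambda>_. 0) \<in> vv_modular_forms k (sym_rep d)" for k by (rule sym.vv_modular_forms_zero)
  next
    fix k f assume f: "f \<in> second_order_forms k (sym_rep d) triv_rep"
    then obtain A g where A: "A \<subseteq> parabolic_cocycles (hom_rep triv_rep (sym_rep d))"
      and g: "\<forall>\<phi>\<in>A. g \<phi> \<in> vv_modular_forms k triv_rep"
      and slash: "\<forall>\<gamma>\<in>carrier SL2Z. \<forall>\<tau>\<in>upper_half_plane.
        vv_slash k (sym_rep d) f \<gamma> \<tau> - f \<tau> = (\<Sum>\<phi>\<in>A. \<phi> (inv\<^bsub>SL2Z\<^esub> \<gamma>) (g \<phi> \<tau>))"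
      by (rule sym_triv.second_orderE) (rule that)
    let ?\<phi> = "\<lambda>\<phi> \<gamma>. \<phi> \<gamma> 1"
    let ?F = "\<lambda>\<tau>. rep_scale (sym_rep d) (mf_pow ramanujan_delta N \<tau>) (f \<tau>)"
    have coc: "?\<phi> \<phi> \<in> parabolic_cocycles (sym_rep d)" if "\<phi> \<in> A" for \<phi>
      using hom_triv_cocycle(1) A that by blast
    show "\<exists>G\<in>module_span modular_ring (sym_triv.M d) S. \<exists>h\<in>vv_modular_forms (k + 12 * int N) (sym_rep d).
        homogeneous (k + 12 * int N) ?F = G + homogeneous (k + 12 * int N) h"
    proof (rule sym_triv.second_order_reduction[OF S, where I = "A \<times> {..<m}" and l = "\<lambda>x. int (w (snd x))"
          and e = "\<lambda>x. ?E (snd x) (?\<phi> (fst x))" and u = "\<lambda>x \<tau>. g (fst x) \<tau> * H (snd x) \<tau>"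
          and D = "\<lambda>x \<gamma> \<tau>. Polynomial.smult (eisenstein (w (snd x)) \<tau>) (?\<phi> (fst x) (inv\<^bsub>SL2Z\<^esub> \<gamma>))"])
      show "?F \<in> second_order_forms (k + 12 * int N) (sym_rep d) triv_rep"
        using sym_triv.second_order_mult[OF delta_pow f, of N] by (simp only: add.commute)
    next
      fix x assume "x \<in> A \<times> {..<m}"
      then have x: "fst x \<in> A" "snd x < m" by auto
      show "?E (snd x) (?\<phi> (fst x)) \<in> second_order_forms (int (w (snd x))) (sym_rep d) triv_rep"
        by (rule eisenstein_sym_second_order[OF coc[OF x(1)] w(1,2)])
      show "homogeneous (int (w (snd x))) (?E (snd x) (?\<phi> (fst x))) \<in> S"
        unfolding S_def using coc[OF x(1)] by blast
      have "g (fst x) \<in> modular_forms k" using g x(1) by (simp add: vv_modular_forms_triv)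
      from modular_forms_mult[OF this H[OF x(2)]]
      show "(\<lambda>\<tau>. g (fst x) \<tau> * H (snd x) \<tau>) \<in> modular_forms (k + 12 * int N - int (w (snd x)))"
        by (simp add: w_def algebra_simps)
      show "vv_slash (int (w (snd x))) (sym_rep d) (?E (snd x) (?\<phi> (fst x))) \<gamma> \<tau> - ?E (snd x) (?\<phi> (fst x)) \<tau>
          = - Polynomial.smult (eisenstein (w (snd x)) \<tau>) (?\<phi> (fst x) (inv\<^bsub>SL2Z\<^esub> \<gamma>))"
        if "\<gamma> \<in> carrier SL2Z" "\<tau> \<in> upper_half_plane" for \<gamma> \<tau>
        using eisenstein_sym_slash[OF coc[OF x(1)] w(1,2) that] by simp
    next
      fix \<gamma> \<tau> assume \<gamma>: "\<gamma> \<in> carrier SL2Z" and \<tau>: "\<tau> \<in> upper_half_plane"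
      let ?v = "\<lambda>\<phi>. ?\<phi> \<phi> (inv\<^bsub>SL2Z\<^esub> \<gamma>)"
      have "vv_slash (k + 12 * int N) (sym_rep d) ?F \<gamma> \<tau> - ?F \<tau>
          = Polynomial.smult (ramanujan_delta \<tau> ^ N) (\<Sum>\<phi>\<in>A. \<phi> (inv\<^bsub>SL2Z\<^esub> \<gamma>) (g \<phi> \<tau>))"
        using sym_triv.delta_pow_slash[OF f \<gamma> \<tau>] slash \<gamma> \<tau> by simp
      also have "\<dots> = (\<Sum>\<phi>\<in>A. Polynomial.smult (g \<phi> \<tau> * ramanujan_delta \<tau> ^ N) (?v \<phi>))"
        unfolding smult_sum_right
      proof (rule sum.cong[OF refl])
        fix \<phi> assume "\<phi> \<in> A"
        with A hom_triv_cocycle(2)[of \<phi> d "inv\<^bsub>SL2Z\<^esub> \<gamma>" "g \<phi> \<tau>"] \<gamma>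
        have "\<phi> (inv\<^bsub>SL2Z\<^esub> \<gamma>) (g \<phi> \<tau>) = Polynomial.smult (g \<phi> \<tau>) (?v \<phi>)" by auto
        then show "Polynomial.smult (ramanujan_delta \<tau> ^ N) (\<phi> (inv\<^bsub>SL2Z\<^esub> \<gamma>) (g \<phi> \<tau>))
            = Polynomial.smult (g \<phi> \<tau> * ramanujan_delta \<tau> ^ N) (?v \<phi>)"
          by (simp only: smult_smult mult.commute)
      qed
      also have "\<dots> = (\<Sum>\<phi>\<in>A. \<Sum>n<m. Polynomial.smult (g \<phi> \<tau> * H n \<tau>) (Polynomial.smult (eisenstein (w n) \<tau>) (?v \<phi>)))"
        by (simp add: HE[OF \<tau>] w_def sum_distrib_left smult_sum mult.assoc)
      also have "\<dots> = (\<Sum>x\<in>A \<times> {..<m}. rep_scale (sym_rep d) (g (fst x) \<tau> * H (snd x) \<tau>)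
          (Polynomial.smult (eisenstein (w (snd x)) \<tau>) (?v (fst x))))"
        by (simp add: sum.cartesian_product case_prod_beta)
      finally show "vv_slash (k + 12 * int N) (sym_rep d) ?F \<gamma> \<tau> - ?F \<tau> = \<dots>" .
    qed
  qed
qed

lemma saturation_eisenstein_sym_dual:
  fixes d :: nat and k0 :: int
  shows "saturation modular_ring (second_order_module triv_rep (sym_rep d))
      (pure_eisenstein_sym_dual d k0 <+>\<^bsub>second_order_module triv_rep (sym_rep d)\<^esub> graded_sum modular_forms)
      (homogeneous 12 ramanujan_delta)
    = carrier (second_order_module triv_rep (sym_rep d))"
proof -
  \<comment> \<open>Since 2 j is at most 2 d, this keeps 12 (n0 + n) + d - 2 j above both k0 and 2 d
    + 5.\<close>
  define n0 where "n0 = nat k0 + 2 * d + 5"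
  define w where "w = (\<lambda>j n. 12 * (n0 + n) + d - 2 * j)"
  have w: "2 * d + 5 \<le> w j n" "even (w j n + d)" "k0 \<le> int (w j n)" "even (int (w j n) - int d)" "d + 4 \<le> w j n"
    if "j \<le> d" for j n
    using that by (auto simp: w_def n0_def)
  have w_eq: "w j n = 12 * (n0 + n) + d - 2 * j" for j n by (simp add: w_def)
  have "2 * d + 4 \<le> 12 * n0" by (simp add: n0_def)
  \<comment> \<open>N and m do not depend on the form. So one power of \<Delta> and one index set
    serve all cocycles of f, and only the coefficients u vary with the cocycle.\<close>
  from delta_power_sym_form[OF this, folded w_eq] obtain N m where gen: "\<forall>k. \<forall>g\<in>vv_modular_forms k (sym_rep d).
    \<exists>u. (\<forall>j\<le>d. \<forall>n<m. u j n \<in> modular_forms (k + 12 * int N - int (w j n))) \<and>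
        (\<forall>\<tau>\<in>upper_half_plane. Polynomial.smult (ramanujan_delta \<tau> ^ N) (g \<tau>)
           = (\<Sum>j\<le>d. \<Sum>n<m. Polynomial.smult (u j n \<tau>) (sym_vector_eisenstein d (w j n) j \<tau>)))"
    by (elim exE) (rule that)
  let ?E = "\<lambda>j n \<phi>. eisenstein_sym_dual d (int (w j n)) \<phi> j"
  let ?V = "\<lambda>j n. sym_vector_eisenstein d (w j n) j"
  define S where "S = {homogeneous (int (w j n)) (?E j n \<phi>) | j n \<phi>. j \<le> d \<and> \<phi> \<in> parabolic_cocycles (dual_rep (sym_rep d))}"
  have S: "S \<subseteq> carrier (triv_sym.M d)"
    using triv_sym.homogeneous_carrier[OF eisenstein_sym_dual_second_order[OF _ _ w(1,2)]] by (auto simp: S_def)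
  show ?thesis
    unfolding pure_eisenstein_sym_dual_def triv_sym.M_def[symmetric]
  proof (rule triv_sym.saturation_eq_carrier[OF S, where N = N])
    show "S \<subseteq> {homogeneous k (eisenstein_sym_dual d k \<phi> j) |k \<phi> j.
        k0 \<le> k \<and> even (k - int d) \<and> j \<le> d \<and> \<phi> \<in> parabolic_cocycles (dual_rep (sym_rep d))}"
    proof
      fix x assume "x \<in> S"
      then obtain j n \<phi> where "x = homogeneous (int (w j n)) (?E j n \<phi>)" "j \<le> d"
        "\<phi> \<in> parabolic_cocycles (dual_rep (sym_rep d))"
        unfolding S_def by blast
      with w(3,4)[of j n] show "x \<in> {homogeneous k (eisenstein_sym_dual d k \<phi> j) |k \<phi> j.
          k0 \<le> k \<and> even (k - int d) \<and> j \<le> d \<and> \<phi> \<in> parabolic_cocycles (dual_rep (sym_rep d))}"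
        by blast
    qed
    show "(\<lambda>\<tau>. f \<tau> + g \<tau>) \<in> modular_forms k" if "f \<in> modular_forms k" "g \<in> modular_forms k" for k f g
      using that by (rule modular_forms_add)
    show "(\<lambda>_. 0) \<in> modular_forms k" for k by (rule modular_forms_0)
  next
    fix k f assume f: "f \<in> second_order_forms k triv_rep (sym_rep d)"
    then obtain A g where A: "A \<subseteq> parabolic_cocycles (hom_rep (sym_rep d) triv_rep)"
      and g: "\<forall>\<phi>\<in>A. g \<phi> \<in> vv_modular_forms k (sym_rep d)"
      and slash: "\<forall>\<gamma>\<in>carrier SL2Z. \<forall>\<tau>\<in>upper_half_plane.
        vv_slash k triv_rep f \<gamma> \<tau> - f \<tau> = (\<Sum>\<phi>\<in>A. \<phi> (inv\<^bsub>SL2Z\<^esub> \<gamma>) (g \<phi> \<tau>))"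
      by (rule triv_sym.second_orderE) (rule that)
    let ?F = "\<lambda>\<tau>. rep_scale triv_rep (mf_pow ramanujan_delta N \<tau>) (f \<tau>)"
    have coc: "\<phi> \<in> parabolic_cocycles (dual_rep (sym_rep d))" if "\<phi> \<in> A" for \<phi>
      using A that by (auto simp: dual_rep_def)
    have "\<forall>\<phi>\<in>A. \<exists>u. (\<forall>j\<le>d. \<forall>n<m. u j n \<in> modular_forms (k + 12 * int N - int (w j n))) \<and>
        (\<forall>\<tau>\<in>upper_half_plane. Polynomial.smult (ramanujan_delta \<tau> ^ N) (g \<phi> \<tau>)
           = (\<Sum>j\<le>d. \<Sum>n<m. Polynomial.smult (u j n \<tau>) (?V j n \<tau>)))"
    proof
      fix \<phi> assume "\<phi> \<in> A"
      with g have "g \<phi> \<in> vv_modular_forms k (sym_rep d)" by simp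
      from bspec[OF spec[OF gen] this]
      show "\<exists>u. (\<forall>j\<le>d. \<forall>n<m. u j n \<in> modular_forms (k + 12 * int N - int (w j n))) \<and>
        (\<forall>\<tau>\<in>upper_half_plane. Polynomial.smult (ramanujan_delta \<tau> ^ N) (g \<phi> \<tau>)
           = (\<Sum>j\<le>d. \<Sum>n<m. Polynomial.smult (u j n \<tau>) (?V j n \<tau>)))" .
    qed
    from bchoice[OF this] obtain u where
      u: "\<forall>\<phi>\<in>A. (\<forall>j\<le>d. \<forall>n<m. u \<phi> j n \<in> modular_forms (k + 12 * int N - int (w j n))) \<and>
        (\<forall>\<tau>\<in>upper_half_plane. Polynomial.smult (ramanujan_delta \<tau> ^ N) (g \<phi> \<tau>)
           = (\<Sum>j\<le>d. \<Sum>n<m. Polynomial.smult (u \<phi> j n \<tau>) (?V j n \<tau>)))" ..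
    let ?j = "\<lambda>x. fst (snd x)" and ?n = "\<lambda>x. snd (snd x)"
    have "\<exists>G\<in>module_span modular_ring (triv_sym.M d) S. \<exists>h\<in>vv_modular_forms (k + 12 * int N) triv_rep.
        homogeneous (k + 12 * int N) ?F = G + homogeneous (k + 12 * int N) h"
    proof (rule triv_sym.second_order_reduction[OF S, where I = "A \<times> {..d} \<times> {..<m}"
          and l = "\<lambda>x. int (w (?j x) (?n x))" and e = "\<lambda>x. ?E (?j x) (?n x) (fst x)"
          and u = "\<lambda>x. u (fst x) (?j x) (?n x)"
          and D = "\<lambda>x \<gamma> \<tau>. fst x (inv\<^bsub>SL2Z\<^esub> \<gamma>) (?V (?j x) (?n x) \<tau>)"])
      show "?F \<in> second_order_forms (k + 12 * int N) triv_rep (sym_rep d)"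
        using triv_sym.second_order_mult[OF delta_pow f, of N] by (simp only: add.commute)
    next
      fix x assume "x \<in> A \<times> {..d} \<times> {..<m}"
      then have x: "fst x \<in> A" "?j x \<le> d" "?n x < m" by auto
      show "?E (?j x) (?n x) (fst x) \<in> second_order_forms (int (w (?j x) (?n x))) triv_rep (sym_rep d)"
        by (rule eisenstein_sym_dual_second_order[OF coc[OF x(1)] x(2) w(1,2)[OF x(2)]])
      show "homogeneous (int (w (?j x) (?n x))) (?E (?j x) (?n x) (fst x)) \<in> S"
        unfolding S_def using coc[OF x(1)] x(2) by blast
      show "u (fst x) (?j x) (?n x) \<in> modular_forms (k + 12 * int N - int (w (?j x) (?n x)))"
        using u x by simp
      show "vv_slash (int (w (?j x) (?n x))) triv_rep (?E (?j x) (?n x) (fst x)) \<gamma> \<tau> - ?E (?j x) (?n x) (fst x) \<tau>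
          = - fst x (inv\<^bsub>SL2Z\<^esub> \<gamma>) (?V (?j x) (?n x) \<tau>)"
        if "\<gamma> \<in> carrier SL2Z" "\<tau> \<in> upper_half_plane" for \<gamma> \<tau>
        by (rule eisenstein_sym_dual_slash[OF coc[OF x(1)] x(2) w(1,2)[OF x(2)] that])
    next
      fix \<gamma> \<tau> assume \<gamma>: "\<gamma> \<in> carrier SL2Z" and \<tau>: "\<tau> \<in> upper_half_plane"
      let ?D = "ramanujan_delta \<tau> ^ N"
      have degV: "degree (?V j n \<tau>) \<le> d" for j n
        using \<tau> by (simp add: sym_vector_eisenstein_def degree_coset_sum)
      have step: "?D * \<phi> (inv\<^bsub>SL2Z\<^esub> \<gamma>) (g \<phi> \<tau>) = (\<Sum>j\<le>d. \<Sum>n<m. u \<phi> j n \<tau> * \<phi> (inv\<^bsub>SL2Z\<^esub> \<gamma>) (?V j n \<tau>))"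
        if \<phi>: "\<phi> \<in> A" for \<phi>
      proof -
        have h: "\<phi> (inv\<^bsub>SL2Z\<^esub> \<gamma>) \<in> rep_lin_maps (sym_rep d) triv_rep"
          using dual_cocycle_lin[OF coc[OF \<phi>]] \<gamma> by simp
        have hsum: "\<phi> (inv\<^bsub>SL2Z\<^esub> \<gamma>) (\<Sum>i\<in>I. p i) = (\<Sum>i\<in>I. \<phi> (inv\<^bsub>SL2Z\<^esub> \<gamma>) (p i))"
          if "\<And>i. degree (p i) \<le> d" for I and p :: "nat \<Rightarrow> complex poly"
        proof (induction I rule: infinite_finite_induct)
          case (insert i I)
          have "degree (\<Sum>i\<in>I. p i) \<le> d" using insert(1) that by (intro degree_sum_le) auto
          then show ?case using insert that by (simp add: dual_lin_add[OF h])
        qed (simp_all add: triv_sym.hom_zero[OF h])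
        have deg: "degree (Polynomial.smult c (?V j n \<tau>)) \<le> d" for c j n
          by (rule order_trans[OF degree_smult_le degV])
        have "?D * \<phi> (inv\<^bsub>SL2Z\<^esub> \<gamma>) (g \<phi> \<tau>) = \<phi> (inv\<^bsub>SL2Z\<^esub> \<gamma>) (Polynomial.smult ?D (g \<phi> \<tau>))"
          using dual_lin_smult[OF h vv_modular_forms_degree[OF bspec[OF g \<phi>] \<tau>]] by simp
        also have "Polynomial.smult ?D (g \<phi> \<tau>) = (\<Sum>j\<le>d. \<Sum>n<m. Polynomial.smult (u \<phi> j n \<tau>) (?V j n \<tau>))"
          using u \<phi> \<tau> by blast
        also have "\<phi> (inv\<^bsub>SL2Z\<^esub> \<gamma>) \<dots> = (\<Sum>j\<le>d. \<phi> (inv\<^bsub>SL2Z\<^esub> \<gamma>) (\<Sum>n<m. Polynomial.smult (u \<phi> j n \<tau>) (?V j n \<tau>)))"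
          by (rule hsum) (rule degree_sum_le[OF finite_lessThan deg])
        also have "\<dots> = (\<Sum>j\<le>d. \<Sum>n<m. u \<phi> j n \<tau> * \<phi> (inv\<^bsub>SL2Z\<^esub> \<gamma>) (?V j n \<tau>))"
          by (subst hsum[OF deg]) (simp add: dual_lin_smult[OF h degV])
        finally show ?thesis .
      qed
      have "vv_slash (k + 12 * int N) triv_rep ?F \<gamma> \<tau> - ?F \<tau> = ?D * (\<Sum>\<phi>\<in>A. \<phi> (inv\<^bsub>SL2Z\<^esub> \<gamma>) (g \<phi> \<tau>))"
        using triv_sym.delta_pow_slash[OF f \<gamma> \<tau>, of N] slash \<gamma> \<tau> by simp
      also have "\<dots> = (\<Sum>\<phi>\<in>A. \<Sum>j\<le>d. \<Sum>n<m. u \<phi> j n \<tau> * \<phi> (inv\<^bsub>SL2Z\<^esub> \<gamma>) (?V j n \<tau>))"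
        unfolding sum_distrib_left by (rule sum.cong[OF refl]) (rule step)
      also have "\<dots> = (\<Sum>x\<in>A \<times> {..d} \<times> {..<m}. rep_scale triv_rep (u (fst x) (?j x) (?n x) \<tau>)
          (fst x (inv\<^bsub>SL2Z\<^esub> \<gamma>) (?V (?j x) (?n x) \<tau>)))"
        by (simp add: sum.cartesian_product case_prod_beta)
      finally show "vv_slash (k + 12 * int N) triv_rep ?F \<gamma> \<tau> - ?F \<tau> = \<dots>" .
    qed
    then show "\<exists>G\<in>module_span modular_ring (triv_sym.M d) S. \<exists>h\<in>modular_forms (k + 12 * int N).
        homogeneous (k + 12 * int N) ?F = G + homogeneous (k + 12 * int N) h"
      by (simp only: vv_modular_forms_triv)
  qed
qed

theorem theoremB:
  fixes d :: nat and k0 :: int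
  assumes "k0 \<ge> 5 + int d"
  shows "saturation modular_ring (second_order_module (sym_rep d) triv_rep)
           (pure_eisenstein_sym d k0
              <+>\<^bsub>second_order_module (sym_rep d) triv_rep\<^esub>
            graded_sum (\<lambda>k. vv_modular_forms k (sym_rep d)))
           (homogeneous 12 ramanujan_delta)
         = carrier (second_order_module (sym_rep d) triv_rep)
       \<and> saturation modular_ring (second_order_module triv_rep (sym_rep d))
           (pure_eisenstein_sym_dual d k0
              <+>\<^bsub>second_order_module triv_rep (sym_rep d)\<^esub>
            graded_sum modular_forms)
           (homogeneous 12 ramanujan_delta)
         = carrier (second_order_module triv_rep (sym_rep d))"
  using saturation_eisenstein_sym saturation_eisenstein_sym_dual by blast

end
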